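(* Let $\omega\subset\mathbb{R}^2$ be a bounded and connected open set with Lipschitz-continuous boundary. Then the Kirchhoff-Love energy functional $J$ (defined in the context) has a minimizer in the set $V(\omega)=V_H(\omega)\times V_3(\omega)$, where $V_H(\omega)$ is any closed subspace of the space $$\{(u_\alpha)\in H^1(\omega)\times H^1(\omega);\ u_\alpha=0\text{ on }\partial\omega \text{ for all }\alpha\in\{1,2\}\}$$ and $V_3(\omega)$ is any closed subspace of the space $H^2(\omega)$ whose intersection with the space of affine functions over $\omega$ reduces to $\{0\}$.
   Context: Greek indices range in $\{1,2\}$, Latin indices in $\{1,2,3\}$, and summation over repeated indices is understood. $\partial_\alpha=\partial/\partial y_\alpha$, $\partial_{\alpha\beta}=\partial^2/\partial y_\alpha\partial y_\beta$ (distributional derivatives); $\mathbb{S}^2$ is the space of symmetric $2\times2$ real matrices. Boundary values are understood in the sense of traces. Fix constants $\varepsilon>0$, $\lambda\ge 0$, $\mu>0$. Let $\Omega^\varepsilon=\omega\times(-\varepsilon,\varepsilon)$ and $\Gamma^\varepsilon_\pm=\omega\times\{-\varepsilon,\varepsilon\}$, and let arbitrary force densities $(f_i^\varepsilon)\in L^2(\Omega^\varepsilon;\mathbb{R}^3)$ and $(g_i^\varepsilon)\in L^2(\Gamma^\varepsilon_\pm;\mathbb{R}^3)$ be given. Define $p_i^\varepsilon,q_\alpha^\varepsilon\in L^2(\omega)$ by $$p_i^\varepsilon=\int_{-\varepsilon}^{\varepsilon}f_i^\varepsilon(\cdot,x_3)\,dx_3+g_i^\varepsilon(\cdot,+\varepsilon)+g_i^\varepsilon(\cdot,-\varepsilon),\qquad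 q_\alpha^\varepsilon=\int_{-\varepsilon}^{\varepsilon}x_3f_\alpha^\varepsilon(\cdot,x_3)\,dx_3+\varepsilon\big(g_\alpha^\varepsilon(\cdot,+\varepsilon)-g_\alpha^\varepsilon(\cdot,-\varepsilon)\big).$$ For $\boldsymbol{u}=(u_i)\in H^1(\omega)\times H^1(\omega)\times H^2(\omega)$ define $\boldsymbol{E}(\boldsymbol{u})=(E_{\alpha\beta}(\boldsymbol{u}))$ and $\boldsymbol{F}(\boldsymbol{u})=(F_{\alpha\beta}(\boldsymbol{u}))$ in $L^2(\omega;\mathbb{S}^2)$ by $$E_{\alpha\beta}(\boldsymbol{u})=\tfrac12(\partial_\alpha u_\beta+\partial_\beta u_\alpha+\partial_\alpha u_3\,\partial_\beta u_3),\qquad F_{\alpha\beta}(\boldsymbol{u})=\partial_{\alpha\beta}u_3.$$ For $(s_{\alpha\beta})\in L^2(\omega;\mathbb{S}^2)$ let $\|(s_{\alpha\beta})\|_{\lambda,\mu}^2=\int_\omega a^{\alpha\beta\sigma\tau}s_{\sigma\tau}(y)s_{\alpha\beta}(y)\,dy$, where $a^{\alpha\beta\sigma\tau}=\frac{4\lambda\mu}{\lambda+2\mu}\delta_{\sigma\tau}\delta_{\alpha\beta}+2\mu(\delta_{\alpha\sigma}\delta_{\beta\tau}+\delta_{\alpha\tau}\delta_{\beta\sigma})$. The functional $J:H^1(\omega)\times H^1(\omega)\times H^2(\omega)\to\mathbb{R}$ is $$J(\boldsymbol{u})=\frac{\varepsilon}{2}\|\boldsymbol{E}(\boldsymbol{u})\|_{\lambda,\mu}^2+\frac{\varepsilon^3}{6}\|\boldsymbol{F}(\boldsymbol{u})\|_{\lambda,\mu}^2-L(\boldsymbol{u}),\qquad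 L(\boldsymbol{u})=\int_\omega\big(p_i^\varepsilon u_i-q_\alpha^\varepsilon\partial_\alpha u_3\big)\,dy.$$ A minimizer of $J$ in $V(\omega)$ is an element $\boldsymbol{u}\in V(\omega)$ with $J(\boldsymbol{u})=\inf_{\boldsymbol{w}\in V(\omega)}J(\boldsymbol{w})$. *)

theory Defs
  imports "HOL-Analysis.Analysis"
begin

text \<open>
  Elements of Lebesgue and Sobolev spaces over a set \<open>\<omega>\<close> in the plane are represented by functions
  on the whole plane; only their values almost everywhere on \<open>\<omega>\<close> matter, so the norms below are
  seminorms on representatives.
\<close>

subsection \<open>Lebesgue spaces and smooth functions\<close>

definition L2 :: "'a measure \<Rightarrow> ('a \<Rightarrow> real) set" where
  "L2 M = {f \<in> borel_measurable M. integrable M (\<lambda>x. (f x)\<^sup>2)}"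

definition partial_deriv :: "2 \<Rightarrow> (real^2 \<Rightarrow> real) \<Rightarrow> real^2 \<Rightarrow> real" where
  "partial_deriv \<alpha> f x = frechet_derivative f (at x) (axis \<alpha> 1)"

primrec C_k :: "nat \<Rightarrow> (real^2 \<Rightarrow> real) \<Rightarrow> bool" where
  "C_k 0 f \<longleftrightarrow> continuous_on UNIV f"
| "C_k (Suc k) f \<longleftrightarrow> (\<forall>x. f differentiable (at x)) \<and> (\<forall>\<alpha>. C_k k (partial_deriv \<alpha> f))"

definition smooth :: "(real^2 \<Rightarrow> real) \<Rightarrow> bool" where
  "smooth f \<longleftrightarrow> (\<forall>k. C_k k f)"

definition test_functions :: "(real^2) set \<Rightarrow> (real^2 \<Rightarrow> real) set" where
  "test_functions \<omega> =
    {\<phi>. smooth \<phi> \<and> compact (closure {x. \<phi> x \<noteq> 0}) \<and> closure {x. \<phi> x \<noteq> 0} \<subseteq> \<omega>}"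

subsection \<open>Distributional derivatives and Sobolev spaces\<close>

definition has_weak_partial ::
    "(real^2) set \<Rightarrow> 2 \<Rightarrow> (real^2 \<Rightarrow> real) \<Rightarrow> (real^2 \<Rightarrow> real) \<Rightarrow> bool" where
  "has_weak_partial \<omega> \<alpha> u v \<longleftrightarrow>
    (\<forall>\<phi>\<in>test_functions \<omega>.
       (LINT x|lebesgue_on \<omega>. u x * partial_deriv \<alpha> \<phi> x) = - (LINT x|lebesgue_on \<omega>. v x * \<phi> x))"

text \<open>The choice only selects a representative: for open \<open>\<omega>\<close> the derivative is unique a.e.\<close>

definition weak_partial :: "(real^2) set \<Rightarrow> 2 \<Rightarrow> (real^2 \<Rightarrow> real) \<Rightarrow> real^2 \<Rightarrow> real" where
  "weak_partial \<omega> \<alpha> u = (SOME v. v \<in> L2 (lebesgue_on \<omega>) \<and> has_weak_partial \<omega> \<alpha> u v)"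

definition H1 :: "(real^2) set \<Rightarrow> (real^2 \<Rightarrow> real) set" where
  "H1 \<omega> = {u \<in> L2 (lebesgue_on \<omega>). \<forall>\<alpha>. \<exists>v \<in> L2 (lebesgue_on \<omega>). has_weak_partial \<omega> \<alpha> u v}"

definition H2 :: "(real^2) set \<Rightarrow> (real^2 \<Rightarrow> real) set" where
  "H2 \<omega> = {u \<in> H1 \<omega>. \<forall>\<alpha>. weak_partial \<omega> \<alpha> u \<in> H1 \<omega>}"

definition norm_H1 :: "(real^2) set \<Rightarrow> (real^2 \<Rightarrow> real) \<Rightarrow> real" where
  "norm_H1 \<omega> u = sqrt ((LINT x|lebesgue_on \<omega>. (u x)\<^sup>2)
      + (\<Sum>\<alpha>\<in>UNIV. LINT x|lebesgue_on \<omega>. (weak_partial \<omega> \<alpha> u x)\<^sup>2))"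

definition norm_H2 :: "(real^2) set \<Rightarrow> (real^2 \<Rightarrow> real) \<Rightarrow> real" where
  "norm_H2 \<omega> u = sqrt ((LINT x|lebesgue_on \<omega>. (u x)\<^sup>2)
      + (\<Sum>\<alpha>\<in>UNIV. LINT x|lebesgue_on \<omega>. (weak_partial \<omega> \<alpha> u x)\<^sup>2)
      + (\<Sum>\<alpha>\<in>UNIV. \<Sum>\<beta>\<in>UNIV.
          LINT x|lebesgue_on \<omega>. (weak_partial \<omega> \<alpha> (weak_partial \<omega> \<beta> u) x)\<^sup>2))"

definition norm_H1_pair :: "(real^2) set \<Rightarrow> (real^2 \<Rightarrow> real^2) \<Rightarrow> real" where
  "norm_H1_pair \<omega> u = sqrt (\<Sum>\<alpha>\<in>UNIV. (norm_H1 \<omega> (\<lambda>y. u y $ \<alpha>))\<^sup>2)"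

text \<open>
  Closed linear subspaces of the space \<open>X\<close> with (semi)norm \<open>N\<close>. Closedness makes \<open>V\<close> saturated
  with respect to equality almost everywhere, since functions that agree a.e. have \<open>N\<close>-distance 0.
\<close>

definition closed_subspace_of ::
    "(('a \<Rightarrow> 'b::real_vector) \<Rightarrow> real) \<Rightarrow> ('a \<Rightarrow> 'b) set \<Rightarrow> ('a \<Rightarrow> 'b) set \<Rightarrow> bool" where
  "closed_subspace_of N X V \<longleftrightarrow>
     V \<subseteq> X \<and> (\<lambda>_. 0) \<in> V \<and>
     (\<forall>u\<in>V. \<forall>v\<in>V. (\<lambda>y. u y + v y) \<in> V) \<and>
     (\<forall>c. \<forall>u\<in>V. (\<lambda>y. c *\<^sub>R u y) \<in> V) \<and>
     (\<forall>s. \<forall>u\<in>X. (\<forall>n. s n \<in> V) \<and> (\<lambda>n. N (\<lambda>y. s n y - u y)) \<longlonglongrightarrow> 0 \<longrightarrow> u \<in> V)"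

subsection \<open>Lipschitz boundaries and traces\<close>

definition lipschitz_boundary :: "(real^2) set \<Rightarrow> bool" where
  "lipschitz_boundary \<omega> \<longleftrightarrow>
     (\<forall>x\<in>frontier \<omega>. \<exists>r>0. \<exists>e \<nu> :: real^2. \<exists>(\<gamma> :: real \<Rightarrow> real) C.
        norm e = 1 \<and> norm \<nu> = 1 \<and> e \<bullet> \<nu> = 0 \<and> C-lipschitz_on UNIV \<gamma> \<and>
        \<omega> \<inter> ball x r = {y \<in> ball x r. \<gamma> (y \<bullet> e) < y \<bullet> \<nu>})"

text \<open>One-dimensional Hausdorff measure, which is the arc length measure on \<open>frontier \<omega>\<close>.\<close>

definition hausdorff1_outer :: "(real^2) set \<Rightarrow> ennreal" where
  "hausdorff1_outer A =
     (SUP \<delta>\<in>{0<..}.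
        INF C\<in>{C :: nat \<Rightarrow> (real^2) set.
                 A \<subseteq> (\<Union>n. C n) \<and> (\<forall>n. bounded (C n) \<and> diameter (C n) \<le> \<delta>)}.
          \<Sum>n. ennreal (diameter (C n)))"

definition hausdorff1 :: "(real^2) measure" where
  "hausdorff1 = measure_of UNIV (sets borel) hausdorff1_outer"

definition boundary_measure :: "(real^2) set \<Rightarrow> (real^2) measure" where
  "boundary_measure \<omega> = restrict_space hausdorff1 (frontier \<omega>)"

text \<open>
  The trace operator is the continuous extension to \<open>H1 \<omega>\<close> of the map that restricts functions
  smooth up to the boundary to \<open>frontier \<omega>\<close>, with values in \<open>L2 (boundary_measure \<omega>)\<close>;
  \<open>has_trace \<omega>\<close> is its graph.
\<close>

definition has_trace :: "(real^2) set \<Rightarrow> (real^2 \<Rightarrow> real) \<Rightarrow> (real^2 \<Rightarrow> real) \<Rightarrow> bool" where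
  "has_trace \<omega> u g \<longleftrightarrow>
     u \<in> H1 \<omega> \<and> g \<in> L2 (boundary_measure \<omega>) \<and>
     (\<exists>\<phi> :: nat \<Rightarrow> real^2 \<Rightarrow> real.
        (\<forall>n. smooth (\<phi> n)) \<and>
        (\<lambda>n. norm_H1 \<omega> (\<lambda>y. \<phi> n y - u y)) \<longlonglongrightarrow> 0 \<and>
        (\<lambda>n. \<integral>\<^sup>+y. ennreal ((\<phi> n y - g y)\<^sup>2) \<partial>boundary_measure \<omega>) \<longlonglongrightarrow> 0)"

definition H1_pair_zero_trace :: "(real^2) set \<Rightarrow> (real^2 \<Rightarrow> real^2) set" where
  "H1_pair_zero_trace \<omega> =
     {u. \<forall>\<alpha>. (\<lambda>y. u y $ \<alpha>) \<in> H1 \<omega> \<and> has_trace \<omega> (\<lambda>y. u y $ \<alpha>) (\<lambda>_. 0)}"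

definition affine_on :: "(real^2) set \<Rightarrow> (real^2 \<Rightarrow> real) \<Rightarrow> bool" where
  "affine_on \<omega> u \<longleftrightarrow> (\<exists>a b. AE y in lebesgue_on \<omega>. u y = a + b \<bullet> y)"

subsection \<open>The Kirchhoff--Love energy\<close>

text \<open>
  A displacement \<open>(u\<^sub>1, u\<^sub>2, u\<^sub>3)\<close> is the pair of its tangential part \<open>(u\<^sub>1, u\<^sub>2)\<close> and of \<open>u\<^sub>3\<close>.
\<close>

type_synonym displacement = "(real^2 \<Rightarrow> real^2) \<times> (real^2 \<Rightarrow> real)"

definition component :: "displacement \<Rightarrow> 3 \<Rightarrow> real^2 \<Rightarrow> real" where
  "component u i y = (if i = 1 then fst u y $ 1 else if i = 2 then fst u y $ 2 else snd u y)"

definition latin :: "2 \<Rightarrow> 3" where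
  "latin \<alpha> = (if \<alpha> = 1 then 1 else 2)"

definition strain_E :: "(real^2) set \<Rightarrow> displacement \<Rightarrow> real^2 \<Rightarrow> real^2^2" where
  "strain_E \<omega> u y = (\<chi> \<alpha> \<beta>. 1/2 *
      (weak_partial \<omega> \<alpha> (\<lambda>z. fst u z $ \<beta>) y + weak_partial \<omega> \<beta> (\<lambda>z. fst u z $ \<alpha>) y
       + weak_partial \<omega> \<alpha> (snd u) y * weak_partial \<omega> \<beta> (snd u) y))"

definition strain_F :: "(real^2) set \<Rightarrow> displacement \<Rightarrow> real^2 \<Rightarrow> real^2^2" where
  "strain_F \<omega> u y = (\<chi> \<alpha> \<beta>. weak_partial \<omega> \<alpha> (weak_partial \<omega> \<beta> (snd u)) y)"

definition kronecker :: "2 \<Rightarrow> 2 \<Rightarrow> real" where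
  "kronecker \<alpha> \<beta> = (if \<alpha> = \<beta> then 1 else 0)"

definition elasticity :: "real \<Rightarrow> real \<Rightarrow> 2 \<Rightarrow> 2 \<Rightarrow> 2 \<Rightarrow> 2 \<Rightarrow> real" where
  "elasticity lam \<mu> \<alpha> \<beta> \<sigma> \<tau> =
     4 * lam * \<mu> / (lam + 2 * \<mu>) * kronecker \<sigma> \<tau> * kronecker \<alpha> \<beta>
     + 2 * \<mu> * (kronecker \<alpha> \<sigma> * kronecker \<beta> \<tau> + kronecker \<alpha> \<tau> * kronecker \<beta> \<sigma>)"

definition elastic_norm_sq :: "(real^2) set \<Rightarrow> real \<Rightarrow> real \<Rightarrow> (real^2 \<Rightarrow> real^2^2) \<Rightarrow> real" where
  "elastic_norm_sq \<omega> lam \<mu> s = (LINT y|lebesgue_on \<omega>.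
      (\<Sum>\<alpha>\<in>UNIV. \<Sum>\<beta>\<in>UNIV. \<Sum>\<sigma>\<in>UNIV. \<Sum>\<tau>\<in>UNIV.
        elasticity lam \<mu> \<alpha> \<beta> \<sigma> \<tau> * s y $ \<sigma> $ \<tau> * s y $ \<alpha> $ \<beta>))"

text \<open>
  Volume and surface forces; on the flat faces \<open>\<omega> \<times> {-\<epsilon>, \<epsilon>}\<close> the surface measure is the product of
  the planar Lebesgue measure and the counting measure.
\<close>

definition volume_forces :: "(real^2) set \<Rightarrow> real \<Rightarrow> ((real^2) \<times> real \<Rightarrow> real^3) set" where
  "volume_forces \<omega> \<epsilon> = {f. \<forall>i. (\<lambda>x. f x $ i) \<in> L2 (lebesgue_on (\<omega> \<times> {-\<epsilon><..<\<epsilon>}))}"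

definition surface_forces :: "(real^2) set \<Rightarrow> real \<Rightarrow> ((real^2) \<times> real \<Rightarrow> real^3) set" where
  "surface_forces \<omega> \<epsilon> =
     {g. \<forall>i. (\<lambda>x. g x $ i) \<in> L2 (lebesgue_on \<omega> \<Otimes>\<^sub>M count_space {-\<epsilon>, \<epsilon>})}"

definition resultant_p ::
    "real \<Rightarrow> ((real^2) \<times> real \<Rightarrow> real^3) \<Rightarrow> ((real^2) \<times> real \<Rightarrow> real^3) \<Rightarrow> 3 \<Rightarrow> real^2 \<Rightarrow> real" where
  "resultant_p \<epsilon> f g i y =
     (LINT x3|lebesgue_on {-\<epsilon><..<\<epsilon>}. f (y, x3) $ i) + g (y, \<epsilon>) $ i + g (y, -\<epsilon>) $ i"

definition resultant_q ::
    "real \<Rightarrow> ((real^2) \<times> real \<Rightarrow> real^3) \<Rightarrow> ((real^2) \<times> real \<Rightarrow> real^3) \<Rightarrow> 2 \<Rightarrow> real^2 \<Rightarrow> real" where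
  "resultant_q \<epsilon> f g \<alpha> y =
     (LINT x3|lebesgue_on {-\<epsilon><..<\<epsilon>}. x3 * f (y, x3) $ latin \<alpha>)
     + \<epsilon> * (g (y, \<epsilon>) $ latin \<alpha> - g (y, -\<epsilon>) $ latin \<alpha>)"

definition load ::
    "(real^2) set \<Rightarrow> real \<Rightarrow> ((real^2) \<times> real \<Rightarrow> real^3) \<Rightarrow> ((real^2) \<times> real \<Rightarrow> real^3)
      \<Rightarrow> displacement \<Rightarrow> real" where
  "load \<omega> \<epsilon> f g u = (LINT y|lebesgue_on \<omega>.
      (\<Sum>i\<in>UNIV. resultant_p \<epsilon> f g i y * component u i y)
      - (\<Sum>\<alpha>\<in>UNIV. resultant_q \<epsilon> f g \<alpha> y * weak_partial \<omega> \<alpha> (snd u) y))"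

definition kirchhoff_love_energy ::
    "(real^2) set \<Rightarrow> real \<Rightarrow> real \<Rightarrow> real \<Rightarrow> ((real^2) \<times> real \<Rightarrow> real^3)
      \<Rightarrow> ((real^2) \<times> real \<Rightarrow> real^3) \<Rightarrow> displacement \<Rightarrow> real" where
  "kirchhoff_love_energy \<omega> \<epsilon> lam \<mu> f g u =
     \<epsilon> / 2 * elastic_norm_sq \<omega> lam \<mu> (strain_E \<omega> u)
     + \<epsilon> ^ 3 / 6 * elastic_norm_sq \<omega> lam \<mu> (strain_F \<omega> u)
     - load \<omega> \<epsilon> f g u"

text \<open>The infimum is taken in the extended reals, where it is \<open>-\<infinity>\<close> for unbounded functionals.\<close>

definition is_minimizer :: "('a \<Rightarrow> real) \<Rightarrow> 'a set \<Rightarrow> 'a \<Rightarrow> bool" where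
  "is_minimizer J V u \<longleftrightarrow> u \<in> V \<and> ereal (J u) = (INF w\<in>V. ereal (J w))"

end

theory Submission
 imports Defs "HOL-Computational_Algebra.Polynomial" "HOL-Library.Diagonal_Subsequence"
begin

text \<open>
The energy is not convex, because the slopes \<open>\<partial>\<^sub>\<alpha>u\<^sub>3\<close> enter the membrane strain quadratically, but it is
uniformly convex up to products of slopes. A horizontal displacement with zero trace has a
divergence of integral zero, so the trace of the strain bounds the slopes in \<open>L\<^sup>2\<close>; together with the
Korn inequality, the Ladyzhenskaya inequality and the Poincare inequality this gives coercivity. By Rellich's
theorem some minimizing sequence has slopes that converge in \<open>L\<^sup>2\<close>, and by the Ladyzhenskaya inequality
the products of slope differences then tend to zero in \<open>L\<^sup>2\<close>. Comparing the energy of a midpoint of two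
members of the sequence with the infimum shows, as in the Hilbert space projection theorem, that
the sequence is a Cauchy sequence, and its limit is a minimizer.

Instead of the divergence theorem only the bound of \<open>\<integral>\<partial>\<^sub>i\<Phi>\<close> over \<open>\<omega>\<close> by a multiple of the integral of \<open>\<bar>\<Phi>\<bar>\<close>
with respect to the boundary measure is needed. It follows from cutting off \<open>\<Phi>\<close> near the balls of an
almost optimal cover of the boundary.
\<close>

text \<open>The balance behind coercivity: let X be the norm of the membrane strain, Y that of the
  Hessian and G that of the slopes. The energy dominates X^2 + Y^2, the horizontal displacement is
  bounded by X + G Y, and G^2 \<le> D X. So the load grows at most like X + X^(1/2) Y + Y, below
  quadratic order, and forces of any size are absorbed.

  The Ladyzhenskaya inequality carries the slope norm as a factor. Compactness makes this factor
  small while the Hessian is merely bounded, so the convexity defect vanishes in the limit.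

  The estimates stay inside the domain. At a boundary point the graph condition leaves two
  independent directions in which short segments remain in \<omega>, and mollifications can be
  integrated along them. The resulting bound on fourth powers also makes squares uniformly small on
  a thin strip along the boundary, which extends interior compactness to the whole domain.

  A zero trace is known only through smooth functions whose boundary values tend to zero, so
  boundary estimates are made for smooth functions with a uniform constant.\<close>

abbreviation pd where "pd \<equiv> partial_deriv"

section \<open>Square integrable functions\<close>

definition l2norm :: "'a measure \<Rightarrow> ('a \<Rightarrow> real) \<Rightarrow> real" where
 "l2norm M f = sqrt (LINT x|M. (f x)^2)"

lemma L2_measurable: "f \<in> L2 M \<Longrightarrow> f \<in> borel_measurable M"
 by (simp add: L2_def)

lemma L2_square_integrable: "f \<in> L2 M \<Longrightarrow> integrable M (\<lambda>x. (f x)^2)"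
 by (simp add: L2_def)

lemma L2_mult_integrable:
 assumes "f \<in> L2 M" "g \<in> L2 M"
 shows "integrable M (\<lambda>x. f x * g x)"
proof (rule Bochner_Integration.integrable_bound)
 show "integrable M (\<lambda>x. (f x)^2 + (g x)^2)"
  using assms by (simp add: L2_def)
 show "(\<lambda>x. f x * g x) \<in> borel_measurable M"
  using assms by (intro borel_measurable_times) (auto simp: L2_def)
 have "\<bar>a * b\<bar> \<le> \<bar>a^2 + b^2\<bar>" for a b :: real
 proof -
  have "0 \<le> (\<bar>a\<bar> - \<bar>b\<bar>)^2" by simp
  hence "2 * (\<bar>a\<bar> * \<bar>b\<bar>) \<le> a^2 + b^2" by (simp add: power2_diff)
  moreover have "0 \<le> \<bar>a\<bar> * \<bar>b\<bar>" by simp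
  ultimately have "\<bar>a\<bar> * \<bar>b\<bar> \<le> a^2 + b^2" by linarith
  thus ?thesis by (simp add: abs_mult)
 qed
 thus "AE x in M. norm (f x * g x) \<le> norm ((f x)^2 + (g x)^2)"
  by (simp add: real_norm_def)
qed

lemma L2_bound:
 assumes "g \<in> L2 M" "f \<in> borel_measurable M" "AE x in M. \<bar>f x\<bar> \<le> \<bar>g x\<bar>"
 shows "f \<in> L2 M"
proof -
 have "integrable M (\<lambda>x. (f x)^2)"
 proof (rule Bochner_Integration.integrable_bound[OF L2_square_integrable[OF assms(1)]])
  show "(\<lambda>x. (f x)^2) \<in> borel_measurable M" using assms(2) by simp
  show "AE x in M. norm ((f x)^2) \<le> norm ((g x)^2)"
   using assms(3) by eventually_elim (simp add: abs_le_square_iff)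
 qed
 thus ?thesis using assms(2) by (simp add: L2_def)
qed

lemma L2_add: "f \<in> L2 M \<Longrightarrow> g \<in> L2 M \<Longrightarrow> (\<lambda>x. f x + g x) \<in> L2 M"
 using L2_mult_integrable[of f M g] by (auto simp: L2_def power2_sum mult.assoc intro!: borel_measurable_add)

lemma L2_scale: "f \<in> L2 M \<Longrightarrow> (\<lambda>x. c * f x) \<in> L2 M"
 by (auto simp: L2_def power_mult_distrib intro!: borel_measurable_times)

lemma L2_diff: "f \<in> L2 M \<Longrightarrow> g \<in> L2 M \<Longrightarrow> (\<lambda>x. f x - g x) \<in> L2 M"
 using L2_add[of f M "\<lambda>x. (-1) * g x"] L2_scale[of g M "-1"] by simp

lemma L2_zero: "(\<lambda>x. 0) \<in> L2 M"
 by (simp add: L2_def)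

lemma L2_sum: "(\<And>i. i \<in> I \<Longrightarrow> f i \<in> L2 M) \<Longrightarrow> (\<lambda>x. \<Sum>i\<in>I. f i x) \<in> L2 M"
 by (induction I rule: infinite_finite_induct) (simp_all add: L2_zero L2_add)

lemma L2_const: "finite_measure M \<Longrightarrow> (\<lambda>x. c) \<in> L2 M"
 by (simp add: L2_def finite_measure.integrable_const)

lemma L2_integrable:
 assumes "finite_measure M" "f \<in> L2 M"
 shows "integrable M f"
 using L2_mult_integrable[OF assms(2) L2_const[OF assms(1), of 1]] by simp

lemma L2_AE_cong:
 assumes "f \<in> L2 M" "g \<in> borel_measurable M" "AE x in M. f x = g x"
 shows "g \<in> L2 M"
 by (rule L2_bound[OF assms(1,2)]) (use assms(3) in auto)

lemma l2norm_nonneg [simp]: "0 \<le> l2norm M f"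
 by (simp add: l2norm_def)

lemma l2norm_power2: "(l2norm M f)^2 = (LINT x|M. (f x)^2)"
 by (simp add: l2norm_def)

lemma l2norm_zero [simp]: "l2norm M (\<lambda>x. 0) = 0"
 by (simp add: l2norm_def)

lemma l2norm_cong_AE:
 assumes "f \<in> borel_measurable M" "g \<in> borel_measurable M" "AE x in M. f x = g x"
 shows "l2norm M f = l2norm M g"
 unfolding l2norm_def
 by (rule arg_cong[where f=sqrt], rule integral_cong_AE) (use assms in auto)

lemma l2norm_mono:
 assumes "g \<in> L2 M" "f \<in> borel_measurable M" "AE x in M. \<bar>f x\<bar> \<le> \<bar>g x\<bar>"
 shows "l2norm M f \<le> l2norm M g"
proof -
 have "f \<in> L2 M" using L2_bound assms by blast
 hence "(LINT x|M. (f x)^2) \<le> (LINT x|M. (g x)^2)"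
  using assms by (intro integral_mono_AE) (auto simp: L2_def abs_le_square_iff)
 thus ?thesis by (simp add: l2norm_def)
qed

lemma l2norm_eq_0:
 assumes "f \<in> L2 M" "l2norm M f = 0"
 shows "AE x in M. f x = 0"
 using assms integral_nonneg_eq_0_iff_AE[of M "\<lambda>x. (f x)^2"] by (auto simp: l2norm_def L2_def)

lemma l2norm_scale: "l2norm M (\<lambda>x. c * f x) = \<bar>c\<bar> * l2norm M f"
 by (simp add: l2norm_def power_mult_distrib real_sqrt_mult)

lemma l2norm_minus_commute: "l2norm M (\<lambda>x. f x - g x) = l2norm M (\<lambda>x. g x - f x)"
 by (simp add: l2norm_def power2_commute)

lemma L2_Cauchy_Schwarz:
 assumes "f \<in> L2 M" "g \<in> L2 M"
 shows "\<bar>LINT x|M. f x * g x\<bar> \<le> l2norm M f * l2norm M g"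
proof -
 define a b c where "a = (LINT x|M. (f x)^2)" and "b = (LINT x|M. f x * g x)"
  and "c = (LINT x|M. (g x)^2)"
 have i: "integrable M (\<lambda>x. (f x)^2)" "integrable M (\<lambda>x. (g x)^2)" "integrable M (\<lambda>x. f x * g x)"
  using assms L2_mult_integrable by (auto simp: L2_def)
 have a0: "0 \<le> a" and c0: "0 \<le> c" by (auto simp: a_def c_def)
 have "b^2 \<le> a * c"
 proof (cases "c = 0")
  case True
  hence "AE x in M. g x = 0" using l2norm_eq_0[OF assms(2)] by (simp add: l2norm_def c_def)
  hence "b = (LINT x|M. 0)" unfolding b_def
   using assms by (intro integral_cong_AE) (auto simp: L2_def)
  thus ?thesis using True by simp
 next
  case False
  \<comment> \<open>The discriminant argument in a form without division: expanded, this integral is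
    \<open>c\<close> times \<open>a * c - b^2\<close>.\<close>
  have "0 \<le> (LINT x|M. (c * f x - b * g x)^2)" by simp
  also have "\<dots> = (LINT x|M. c^2 * (f x)^2 - 2 * b * c * (f x * g x) + b^2 * (g x)^2)"
   by (simp add: power2_diff power_mult_distrib algebra_simps)
  also have "\<dots> = c^2 * a - 2 * b * c * b + b^2 * c"
   using i by (simp add: a_def b_def c_def)
  also have "\<dots> = c * (a * c - b^2)" by (simp add: power2_eq_square algebra_simps)
  finally have "0 \<le> a * c - b^2" using False c0 by (simp add: zero_le_mult_iff)
  thus ?thesis by simp
 qed
 hence "\<bar>b\<bar> \<le> sqrt (a * c)" by (metis real_sqrt_abs real_sqrt_le_mono)
 thus ?thesis by (simp add: a_def b_def c_def l2norm_def real_sqrt_mult)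
qed

lemma l2norm_triangle:
 assumes "f \<in> L2 M" "g \<in> L2 M"
 shows "l2norm M (\<lambda>x. f x + g x) \<le> l2norm M f + l2norm M g"
proof -
 have i: "integrable M (\<lambda>x. (f x)^2)" "integrable M (\<lambda>x. (g x)^2)" "integrable M (\<lambda>x. f x * g x)"
  using assms L2_mult_integrable by (auto simp: L2_def)
 have "(l2norm M (\<lambda>x. f x + g x))^2 = (l2norm M f)^2 + (l2norm M g)^2 + 2 * (LINT x|M. f x * g x)"
  using i by (simp add: l2norm_power2 power2_sum mult.assoc)
 also have "\<dots> \<le> (l2norm M f + l2norm M g)^2"
  using L2_Cauchy_Schwarz[OF assms] by (simp add: power2_sum)
 finally show ?thesis by (rule power2_le_imp_le) simp
qed

lemma l2norm_triangle_diff: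
 assumes "f \<in> L2 M" "g \<in> L2 M" "h \<in> L2 M"
 shows "l2norm M (\<lambda>x. f x - h x) \<le> l2norm M (\<lambda>x. f x - g x) + l2norm M (\<lambda>x. g x - h x)"
 using l2norm_triangle[OF L2_diff[OF assms(1,2)] L2_diff[OF assms(2,3)]] by simp

lemma l2norm_diff_le:
 assumes "f \<in> L2 M" "g \<in> L2 M"
 shows "l2norm M (\<lambda>x. f x - g x) \<le> l2norm M f + l2norm M g"
 using l2norm_triangle_diff[OF assms(1) L2_zero assms(2)]
 by (simp add: l2norm_def)

lemma l2norm_abs_diff_le:
 assumes "f \<in> L2 M" "g \<in> L2 M"
 shows "\<bar>l2norm M f - l2norm M g\<bar> \<le> l2norm M (\<lambda>x. f x - g x)"
 using l2norm_triangle[OF L2_diff[OF assms] assms(2)] l2norm_triangle[OF L2_diff[OF assms(2,1)] assms(1)]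
  l2norm_minus_commute[of M f g] by simp

lemma l2norm_sum_le:
 assumes "\<And>i. i \<in> I \<Longrightarrow> f i \<in> L2 M"
 shows "l2norm M (\<lambda>x. \<Sum>i\<in>I. f i x) \<le> (\<Sum>i\<in>I. l2norm M (f i))"
 using assms
proof (induction I rule: infinite_finite_induct)
 case (insert i I)
 have "l2norm M (\<lambda>x. f i x + (\<Sum>i\<in>I. f i x)) \<le> l2norm M (f i) + l2norm M (\<lambda>x. \<Sum>i\<in>I. f i x)"
  using insert by (intro l2norm_triangle L2_sum) auto
 with insert show ?case by fastforce
qed auto

lemma L1_le_l2norm:
 assumes "finite_measure M" "f \<in> L2 M"
 shows "(LINT x|M. \<bar>f x\<bar>) \<le> sqrt (measure M (space M)) * l2norm M f"
proof -
 have "(\<lambda>x. \<bar>f x\<bar>) \<in> L2 M" using assms by (auto simp: L2_def)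
 from L2_Cauchy_Schwarz[OF this L2_const[OF assms(1), of 1]]
 show ?thesis by (simp add: l2norm_def mult.commute)
qed

lemma l2norm_tendsto:
 assumes "\<And>n. f n \<in> L2 M" "g \<in> L2 M" "(\<lambda>n. l2norm M (\<lambda>x. f n x - g x)) \<longlonglongrightarrow> 0"
 shows "(\<lambda>n. l2norm M (f n)) \<longlonglongrightarrow> l2norm M g"
proof -
 have "(\<lambda>n. l2norm M (f n) - l2norm M g) \<longlonglongrightarrow> 0"
  by (rule Lim_null_comparison[OF _ assms(3)]) (use l2norm_abs_diff_le[OF assms(1,2)] in auto)
 thus ?thesis using LIM_zero_iff by blast
qed

lemma L2_inner_tendsto:
 assumes "\<And>n. f n \<in> L2 M" "g \<in> L2 M" "h \<in> L2 M" "(\<lambda>n. l2norm M (\<lambda>x. f n x - g x)) \<longlonglongrightarrow> 0"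
 shows "(\<lambda>n. LINT x|M. f n x * h x) \<longlonglongrightarrow> (LINT x|M. g x * h x)"
proof -
 have *: "\<bar>(LINT x|M. f n x * h x) - (LINT x|M. g x * h x)\<bar>
   \<le> l2norm M (\<lambda>x. f n x - g x) * l2norm M h" for n
  using L2_Cauchy_Schwarz[OF L2_diff[OF assms(1) assms(2)] assms(3), of n]
   L2_mult_integrable[OF assms(1) assms(3)] L2_mult_integrable[OF assms(2) assms(3)]
  by (simp add: left_diff_distrib)
 have "(\<lambda>n. l2norm M (\<lambda>x. f n x - g x) * l2norm M h) \<longlonglongrightarrow> 0"
  using tendsto_mult_left_zero[OF assms(4)] .
 from Lim_null_comparison[OF _ this, of "\<lambda>n. (LINT x|M. f n x * h x) - (LINT x|M. g x * h x)"] *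
 show ?thesis by (auto simp: LIM_zero_iff)
qed

text \<open>Bounds proved for mollifications pass to their almost everywhere limits in this form of
  Fatou's lemma.\<close>

lemma nn_integral_Fatou_le:
 fixes f :: "nat \<Rightarrow> 'a \<Rightarrow> ennreal"
 assumes m: "\<And>k. f k \<in> borel_measurable N" and lim: "AE x in N. (\<lambda>k. f k x) \<longlonglongrightarrow> g x"
  and B: "\<forall>\<^sub>F k in sequentially. (\<integral>\<^sup>+x. f k x \<partial>N) \<le> B"
 shows "(\<integral>\<^sup>+x. g x \<partial>N) \<le> B"
proof -
 have "(\<integral>\<^sup>+x. g x \<partial>N) = (\<integral>\<^sup>+x. liminf (\<lambda>k. f k x) \<partial>N)"
  by (rule nn_integral_cong_AE, use lim in eventually_elim) (rule lim_imp_Liminf[OF trivial_limit_sequentially, symmetric])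
 also have "\<dots> \<le> liminf (\<lambda>k. \<integral>\<^sup>+x. f k x \<partial>N)" by (rule nn_integral_liminf[OF m])
 also have "\<dots> \<le> limsup (\<lambda>k. \<integral>\<^sup>+x. f k x \<partial>N)" by (simp add: Liminf_le_Limsup)
 also have "\<dots> \<le> B" by (rule Limsup_bounded[OF B])
 finally show ?thesis .
qed

lemma L2_Fatou:
 assumes f: "\<And>n. f n \<in> L2 M" and g: "g \<in> borel_measurable M"
  and lim: "AE x in M. (\<lambda>n. f n x) \<longlonglongrightarrow> g x"
  and bd: "\<forall>\<^sub>F n in sequentially. l2norm M (f n) \<le> C"
 shows "g \<in> L2 M \<and> l2norm M g \<le> C"
proof -
 have [measurable]: "f n \<in> borel_measurable M" for n using f by (simp add: L2_def)
 note g[measurable]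
 have C: "0 \<le> C" using eventually_happens'[OF sequentially_bot bd] l2norm_nonneg order_trans by blast
 have le: "(\<integral>\<^sup>+x. ennreal ((g x)^2) \<partial>M) \<le> ennreal (C^2)"
 proof (rule nn_integral_Fatou_le[where f="\<lambda>n x. ennreal ((f n x)^2)"])
  show "AE x in M. (\<lambda>n. ennreal ((f n x)^2)) \<longlonglongrightarrow> ennreal ((g x)^2)"
   using lim by eventually_elim (intro tendsto_intros)
  show "\<forall>\<^sub>F n in sequentially. (\<integral>\<^sup>+x. ennreal ((f n x)^2) \<partial>M) \<le> ennreal (C^2)"
   using bd
  proof eventually_elim
   case (elim n)
   have "(\<integral>\<^sup>+x. ennreal ((f n x)^2) \<partial>M) = ennreal ((l2norm M (f n))^2)"
    unfolding l2norm_power2 by (rule nn_integral_eq_integral) (use L2_square_integrable[OF f] in auto)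
   thus ?case using elim by (simp add: ennreal_leI power_mono)
  qed
 qed simp
 have int: "integrable M (\<lambda>x. (g x)^2)"
  by (rule integrableI_bounded) (use le in \<open>auto simp: top.not_eq_extremum[symmetric] top_unique\<close>)
 hence "ennreal (LINT x|M. (g x)^2) \<le> ennreal (C^2)"
  using le nn_integral_eq_integral[OF int] by simp
 hence "(LINT x|M. (g x)^2) \<le> C^2" by (simp add: ennreal_le_iff)
 hence "l2norm M g \<le> C" unfolding l2norm_def using C real_le_lsqrt by (simp add: real_le_lsqrt)
 thus ?thesis using int by (simp add: L2_def)
qed

text \<open>Riesz-Fischer. A finite measure bounds the L1 norm by the L2 norm, so the increments of
  a fast subsequence are summable in L1 and the subsequence converges almost everywhere. Fatou turns
  the Cauchy property into norm convergence of the whole sequence.\<close>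

lemma L2_complete:
 assumes M: "finite_measure M" and f: "\<And>n::nat. f n \<in> L2 M"
  and C: "\<And>e. e > 0 \<Longrightarrow> \<exists>N. \<forall>m\<ge>N. \<forall>n\<ge>N. l2norm M (\<lambda>x. f m x - f n x) < e"
 obtains g r where "g \<in> L2 M" "(\<lambda>n. l2norm M (\<lambda>x. f n x - g x)) \<longlonglongrightarrow> 0"
  "strict_mono (r::nat\<Rightarrow>nat)" "AE x in M. (\<lambda>n. f (r n) x) \<longlonglongrightarrow> g x"
proof -
 have [measurable]: "f n \<in> borel_measurable M" for n using f by (simp add: L2_def)
 have "\<forall>k. \<exists>N. \<forall>m\<ge>N. \<forall>n\<ge>N. l2norm M (\<lambda>x. f m x - f n x) < (1/2)^k"
  using C by auto
 then obtain N where N: "\<And>k m n. m \<ge> N k \<Longrightarrow> n \<ge> N k \<Longrightarrow> l2norm M (\<lambda>x. f m x - f n x) < (1/2)^k"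
  by metis
 \<comment> \<open>Each index passes both its predecessor and the threshold for the next accuracy,
   so consecutive members differ by less than \<open>(1/2)^k\<close>.\<close>
 define r where "r = rec_nat (N 0) (\<lambda>k rk. Suc (max rk (N (Suc k))))"
 have r_Suc: "r (Suc k) = Suc (max (r k) (N (Suc k)))" for k by (simp add: r_def)
 have rm: "strict_mono r" by (rule strict_monoI_Suc) (simp add: r_Suc)
 have rN: "r k \<ge> N k" for k by (cases k) (simp_all add: r_Suc, simp add: r_def)
 define d where "d k x = \<bar>f (r (Suc k)) x - f (r k) x\<bar>" for k x
 have [measurable]: "d k \<in> borel_measurable M" for k unfolding d_def by measurable
 have d2: "d k \<in> L2 M" for k
  using L2_diff[OF f f, of "r (Suc k)" "r k"] by (simp add: L2_def d_def)
 have dk: "(\<integral>\<^sup>+x. ennreal (d k x) \<partial>M) \<le> ennreal (sqrt (measure M (space M)) * (1/2)^k)" for k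
 proof -
  have "(\<integral>\<^sup>+x. ennreal (d k x) \<partial>M) = ennreal (LINT x|M. d k x)"
   by (rule nn_integral_eq_integral) (use L2_integrable[OF M d2] in simp, simp add: d_def)
  moreover have "(LINT x|M. d k x) \<le> sqrt (measure M (space M)) * (1/2)^k"
  proof -
   have "r k \<le> r (Suc k)" by (simp add: r_Suc)
   hence "l2norm M (\<lambda>x. f (r (Suc k)) x - f (r k) x) \<le> (1/2)^k"
    using N[of k "r (Suc k)" "r k"] rN[of k] by force
   with L1_le_l2norm[OF M L2_diff[OF f f], of "r (Suc k)" "r k"]
   show ?thesis unfolding d_def
    by (smt (verit) mult_left_mono real_sqrt_ge_zero measure_nonneg)
  qed
  ultimately show ?thesis by (simp add: ennreal_leI)
 qed
 have "(\<integral>\<^sup>+x. (\<Sum>k. ennreal (d k x)) \<partial>M) = (\<Sum>k. \<integral>\<^sup>+x. ennreal (d k x) \<partial>M)"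
  by (rule nn_integral_suminf) simp
 also have "\<dots> \<le> (\<Sum>k. ennreal (sqrt (measure M (space M)) * (1/2)^k))"
  by (intro suminf_le dk) auto
 also have "\<dots> < \<infinity>"
  by (subst suminf_ennreal_eq[OF _ summable_sums]) (auto intro!: summable_mult)
 finally have "AE x in M. (\<Sum>k. ennreal (d k x)) \<noteq> \<infinity>"
  by (intro nn_integral_noteq_infinite) auto
 hence conv: "AE x in M. convergent (\<lambda>n. f (r n) x)"
 proof eventually_elim
  fix x assume "(\<Sum>k. ennreal (d k x)) \<noteq> \<infinity>"
  hence "summable (\<lambda>k. d k x)" by (intro summable_suminf_not_top) (auto simp: d_def)
  hence "summable (\<lambda>k. f (r (Suc k)) x - f (r k) x)"
   unfolding d_def by (rule summable_rabs_cancel)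
  thus "convergent (\<lambda>n. f (r n) x)" using sum_lessThan_telescope[of "\<lambda>i. f (r i) x"]
   by (simp add: summable_iff_convergent convergent_diff_const_right_iff)
 qed
 define g where "g x = lim (\<lambda>n. f (r n) x)" for x
 have [measurable]: "g \<in> borel_measurable M" unfolding g_def by measurable
 have lim: "AE x in M. (\<lambda>n. f (r n) x) \<longlonglongrightarrow> g x"
  using conv by eventually_elim (simp add: g_def convergent_LIMSEQ_iff)
 \<comment> \<open>With \<open>n\<close> fixed, Fatou is applied to the differences from the
   subsequence, whose members eventually lie beyond \<open>N k\<close>.\<close>
 have key: "(\<lambda>x. f n x - g x) \<in> L2 M \<and> l2norm M (\<lambda>x. f n x - g x) \<le> (1/2)^k" if "n \<ge> N k" for n k
 proof (rule L2_Fatou[where f="\<lambda>m x. f n x - f (r m) x"])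
  show "(\<lambda>x. f n x - f (r m) x) \<in> L2 M" for m using L2_diff f by blast
  show "AE x in M. (\<lambda>m. f n x - f (r m) x) \<longlonglongrightarrow> f n x - g x"
   using lim by eventually_elim (intro tendsto_intros)
  show "\<forall>\<^sub>F m in sequentially. l2norm M (\<lambda>x. f n x - f (r m) x) \<le> (1/2)^k"
  proof (rule eventually_sequentiallyI[of "N k"])
   fix m assume "m \<ge> N k"
   hence "r m \<ge> N k" using seq_suble[OF rm, of m] by simp
   thus "l2norm M (\<lambda>x. f n x - f (r m) x) \<le> (1/2)^k" using N[OF that] by (simp add: less_imp_le)
  qed
 qed simp
 have "(\<lambda>x. f (N 0) x - (f (N 0) x - g x)) \<in> L2 M"
  using key[of 0 "N 0"] L2_diff f by blast
 hence g2: "g \<in> L2 M" by simp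
 have "(\<lambda>n. l2norm M (\<lambda>x. f n x - g x)) \<longlonglongrightarrow> 0"
 proof (rule LIMSEQ_I)
  fix e :: real assume "e > 0"
  then obtain k where k: "(1/2)^k < e" using real_arch_pow_inv[of e "1/2"] by auto
  have "norm (l2norm M (\<lambda>x. f n x - g x) - 0) < e" if "n \<ge> N k" for n
   using key[OF that] k by simp
  thus "\<exists>no. \<forall>n\<ge>no. norm (l2norm M (\<lambda>x. f n x - g x) - 0) < e" by blast
 qed
 thus thesis by (rule that[OF g2 _ rm lim])
qed

section \<open>Smooth functions and mollification\<close>

lemma partial_deriv_eq:
 assumes "(f has_derivative f') (at x)"
 shows "pd i f x = f' (axis i 1)"
 using frechet_derivative_at[OF assms] by (simp add: partial_deriv_def)

lemma has_derivative_partial: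
 assumes "f differentiable (at x)"
 shows "(f has_derivative (\<lambda>v. \<Sum>i\<in>UNIV. v $ i * pd i f x)) (at x)"
proof -
 have d: "(f has_derivative frechet_derivative f (at x)) (at x)"
  using assms frechet_derivative_works by blast
 interpret linear "frechet_derivative f (at x)"
  using d has_derivative_linear by blast
 have "frechet_derivative f (at x) v = (\<Sum>i\<in>UNIV. v $ i * pd i f x)" for v
 proof -
  have "v = (\<Sum>i\<in>UNIV. v $ i *\<^sub>R axis i 1)"
   using basis_expansion[of v] by (simp add: scalar_mult_eq_scaleR)
  hence "frechet_derivative f (at x) v = (\<Sum>i\<in>UNIV. frechet_derivative f (at x) (v $ i *\<^sub>R axis i 1))"
   using sum by metis
  thus ?thesis by (simp add: scale partial_deriv_def)
 qed
 thus ?thesis using d by (metis (no_types, lifting) ext)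
qed

lemma line_deriv:
 fixes a x :: "real^2"
 assumes "f differentiable (at (x + t *\<^sub>R a))"
 shows "((\<lambda>t. f (x + t *\<^sub>R a)) has_real_derivative
      (\<Sum>i\<in>UNIV. a $ i * pd i f (x + t *\<^sub>R a))) (at t)"
proof -
 have "((\<lambda>t. x + t *\<^sub>R a) has_derivative (\<lambda>s. s *\<^sub>R a)) (at t)"
  by (auto intro!: derivative_eq_intros)
 from has_derivative_compose[OF this has_derivative_partial[OF assms]]
 show ?thesis
  unfolding has_field_derivative_def
  by (rule has_derivative_eq_rhs) (simp add: fun_eq_iff sum_distrib_left mult_ac)
qed

lemma C_k_Suc_imp: "C_k (Suc k) f \<Longrightarrow> C_k k f"
proof (induction k arbitrary: f)
 case 0
 thus ?case by (simp add: differentiable_imp_continuous_on differentiable_on_def differentiable_at_withinI)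
next
 case (Suc k)
 have "f differentiable (at x)" for x using Suc.prems by simp
 moreover have "C_k k (pd i f)" for i
  using Suc.prems by (intro Suc.IH) simp
 ultimately show ?case by simp
qed

lemma C_k_const: "C_k k (\<lambda>x. c)"
proof (induction k arbitrary: c)
 case (Suc k)
 have "pd i (\<lambda>x. c) = (\<lambda>x. 0)" for i
  by (rule ext, subst partial_deriv_eq) (auto intro: derivative_intros)
 thus ?case using Suc by simp
qed simp

lemma partial_deriv_add:
 assumes "f differentiable (at x)" "g differentiable (at x)"
 shows "pd i (\<lambda>x. f x + g x) x = pd i f x + pd i g x"
 by (rule trans[OF partial_deriv_eq[OF has_derivative_add]])
   (use assms frechet_derivative_works in \<open>auto simp: partial_deriv_def\<close>)

lemma partial_deriv_mult:
 assumes "f differentiable (at x)" "g differentiable (at x)"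
 shows "pd i (\<lambda>x. f x * g x) x = f x * pd i g x + pd i f x * g x"
 by (rule trans[OF partial_deriv_eq[OF has_derivative_mult]])
   (use assms frechet_derivative_works in \<open>auto simp: partial_deriv_def\<close>)

lemma C_k_add: "C_k k f \<Longrightarrow> C_k k g \<Longrightarrow> C_k k (\<lambda>x. f x + g x)"
proof (induction k arbitrary: f g)
 case (Suc k)
 have "pd i (\<lambda>x. f x + g x) = (\<lambda>x. pd i f x + pd i g x)" for i
  using Suc.prems by (intro ext partial_deriv_add) auto
 thus ?case using Suc by simp
qed (simp add: continuous_on_add)

lemma C_k_mult: "C_k k f \<Longrightarrow> C_k k g \<Longrightarrow> C_k k (\<lambda>x. f x * g x)"
proof (induction k arbitrary: f g)
 case (Suc k)
 have "pd i (\<lambda>x. f x * g x) =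
   (\<lambda>x. f x * pd i g x + pd i f x * g x)" for i
  using Suc.prems by (intro ext partial_deriv_mult) auto
 thus ?case using Suc C_k_Suc_imp[OF Suc.prems(1)] C_k_Suc_imp[OF Suc.prems(2)]
  by (simp add: C_k_add)
qed (simp add: continuous_on_mult)

lemma partial_deriv_inner: "pd i (\<lambda>x. x \<bullet> a) = (\<lambda>x. a $ i)"
proof
 fix x
 have "((\<lambda>x. x \<bullet> a) has_derivative (\<lambda>v. v \<bullet> a)) (at x)" by (auto intro!: derivative_eq_intros)
 from partial_deriv_eq[OF this] show "pd i (\<lambda>x. x \<bullet> a) x = a $ i"
  by (simp add: inner_axis')
qed

lemma C_k_inner: "C_k k (\<lambda>x. x \<bullet> a)"
 by (cases k) (auto simp: partial_deriv_inner C_k_const intro!: continuous_intros)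

text \<open>\<open>D\<close> lists all derivatives of a function of one variable, so
  \<open>n\<close> stays arbitrary in the induction: differentiating \<open>D n (r x)\<close> gives
  \<open>D (Suc n) (r x)\<close> times a partial derivative of \<open>r\<close>, and closure under
  products finishes the step.\<close>

lemma C_k_compose:
 assumes D: "\<And>n t. (D n has_real_derivative D (Suc n) t) (at t)" and r: "smooth r"
 shows "C_k k (\<lambda>x. D n (r x))"
proof (induction k arbitrary: n)
 case 0
 have "continuous_on UNIV (D n)" using D
  by (intro continuous_at_imp_continuous_on ballI DERIV_isCont) blast
 moreover have "continuous_on UNIV r" using r unfolding smooth_def by (metis C_k.simps(1))
 ultimately show ?case by (auto intro: continuous_on_compose2)
next
 case (Suc k)
 have rd: "r differentiable (at x)" for x using r unfolding smooth_def by (metis C_k.simps(2))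
 have pd: "((\<lambda>x. D n (r x)) has_derivative (\<lambda>v. D (Suc n) (r x) * frechet_derivative r (at x) v)) (at x)" for x
  using has_derivative_compose[OF frechet_derivative_works[THEN iffD1, OF rd]
    D[of n "r x", unfolded has_field_derivative_def]] .
 have "pd i (\<lambda>x. D n (r x)) = (\<lambda>x. D (Suc n) (r x) * pd i r x)" for i
  by (rule ext, subst partial_deriv_eq[OF pd]) (simp add: partial_deriv_def)
 moreover have "C_k k (pd i r)" for i using r unfolding smooth_def by (metis C_k.simps(2))
 moreover have "(\<lambda>x. D n (r x)) differentiable (at x)" for x using pd by (rule differentiableI)
 ultimately show ?case using Suc by (simp add: C_k_mult)
qed

lemma smooth_const: "smooth (\<lambda>x. c)" by (simp add: smooth_def C_k_const)
lemma smooth_add: "smooth f \<Longrightarrow> smooth g \<Longrightarrow> smooth (\<lambda>x. f x + g x)" by (simp add: smooth_def C_k_add)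
lemma smooth_mult: "smooth f \<Longrightarrow> smooth g \<Longrightarrow> smooth (\<lambda>x. f x * g x)" by (simp add: smooth_def C_k_mult)
lemma smooth_inner: "smooth (\<lambda>x. x \<bullet> a)" by (simp add: smooth_def C_k_inner)
lemma smooth_diff: "smooth f \<Longrightarrow> smooth g \<Longrightarrow> smooth (\<lambda>x. f x - g x)"
 using smooth_add[of f "\<lambda>x. (-1) * g x"] smooth_mult[OF smooth_const[of "-1"], of g] by simp

lemma smooth_sum: "(\<And>i. i \<in> I \<Longrightarrow> smooth (f i)) \<Longrightarrow> smooth (\<lambda>x. \<Sum>i\<in>I. f i x)"
 by (induction I rule: infinite_finite_induct) (simp_all add: smooth_const smooth_add)

lemma smooth_partial_deriv: "smooth f \<Longrightarrow> smooth (pd i f)"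
 unfolding smooth_def by (metis C_k.simps(2))

lemma smooth_differentiable: "smooth f \<Longrightarrow> f differentiable (at x)"
 unfolding smooth_def by (metis C_k.simps(2))

lemma smooth_continuous: "smooth f \<Longrightarrow> continuous_on S f"
 unfolding smooth_def by (metis C_k.simps(1) continuous_on_subset subset_UNIV)

lemma smooth_measurable [measurable_dest]: "smooth f \<Longrightarrow> f \<in> borel_measurable borel"
 using smooth_continuous[of f UNIV] by (rule borel_measurable_continuous_onI)

lemma smooth_coord: "smooth (\<lambda>x. x $ i)"
 using smooth_inner[of "axis i 1"] by (simp add: inner_axis)

lemma partial_deriv_coord: "pd i (\<lambda>x. x $ j) = (\<lambda>x. if i = j then 1 else 0)"
proof -
 have "(\<lambda>x::real^2. x \<bullet> axis j 1) = (\<lambda>x. x $ j)" by (simp add: inner_axis fun_eq_iff)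
 with partial_deriv_inner[of i "axis j 1"] show ?thesis by (auto simp: axis_def fun_eq_iff)
qed

lemma smooth_norm_sq: "smooth (\<lambda>x. (norm (x - z))^2)"
proof -
 have "(\<lambda>x::real^2. (norm (x - z))^2) = (\<lambda>x. (\<Sum>i\<in>UNIV. (x $ i - z $ i) * (x $ i - z $ i)))"
  by (simp add: power2_norm_eq_inner inner_vec_def fun_eq_iff)
 thus ?thesis
  by (simp, intro smooth_sum smooth_mult smooth_diff smooth_coord smooth_const)
qed

section \<open>Symmetry of second derivatives\<close>

lemma second_difference:
 fixes a b x :: "real^2" and h :: real
 assumes f: "smooth f" and h: "h > 0"
 shows "\<exists>s t. 0 \<le> s \<and> s \<le> h \<and> 0 \<le> t \<and> t \<le> h \<and>
  f (x + h *\<^sub>R axis i 1 + h *\<^sub>R axis j 1) - f (x + h *\<^sub>R axis i 1) - f (x + h *\<^sub>R axis j 1) + f x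
   = h^2 * pd j (pd i f) (x + s *\<^sub>R axis i 1 + t *\<^sub>R axis j 1)"
proof -
 have ax: "(\<Sum>\<gamma>\<in>UNIV. axis i 1 $ \<gamma> * c \<gamma>) = c i" for i :: 2 and c :: "2 \<Rightarrow> real"
  by (simp add: axis_def if_distrib[of "\<lambda>x. x * _"] cong: if_cong)
 \<comment> \<open>The increment in direction \<open>j\<close> as a function of the displacement in
   direction \<open>i\<close>. The mean value theorem is applied once to it and once to its
   derivative as a function of the displacement in direction \<open>j\<close>.\<close>
 define g where "g s = f ((x + h *\<^sub>R axis j 1) + s *\<^sub>R axis i 1) - f (x + s *\<^sub>R axis i 1)" for s
 define g' where "g' s = pd i f ((x + h *\<^sub>R axis j 1) + s *\<^sub>R axis i 1)
   - pd i f (x + s *\<^sub>R axis i 1)" for s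
 have "(g has_real_derivative g' s) (at s)" for s
  unfolding g_def g'_def using line_deriv[OF smooth_differentiable[OF f], where a = "axis i 1"]
  by (intro DERIV_diff) (simp_all only: ax)
 then obtain s where s: "0 < s" "s < h" "g h - g 0 = (h - 0) * g' s"
  using MVT2[OF h, of g g'] by blast
 define k where "k t = pd i f ((x + s *\<^sub>R axis i 1) + t *\<^sub>R axis j 1)" for t
 have "(k has_real_derivative pd j (pd i f) ((x + s *\<^sub>R axis i 1) + t *\<^sub>R axis j 1)) (at t)" for t
  unfolding k_def
  using line_deriv[OF smooth_differentiable[OF smooth_partial_deriv[OF f]], where a = "axis j 1"]
  by (simp only: ax)
 then obtain t where t: "0 < t" "t < h"
  "k h - k 0 = (h - 0) * pd j (pd i f) ((x + s *\<^sub>R axis i 1) + t *\<^sub>R axis j 1)"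
  using MVT2[OF h, of k "\<lambda>t. pd j (pd i f) ((x + s *\<^sub>R axis i 1) + t *\<^sub>R axis j 1)"] by blast
 have "k h - k 0 = g' s" by (simp add: k_def g'_def algebra_simps)
 hence "g h - g 0 = h^2 * pd j (pd i f) (x + s *\<^sub>R axis i 1 + t *\<^sub>R axis j 1)"
  using s t by (simp add: power2_eq_square)
 moreover have "g h - g 0 = f (x + h *\<^sub>R axis i 1 + h *\<^sub>R axis j 1) - f (x + h *\<^sub>R axis i 1) - f (x + h *\<^sub>R axis j 1) + f x"
  by (simp add: g_def algebra_simps)
 ultimately show ?thesis using s t by (intro exI[of _ s] exI[of _ t]) auto
qed

text \<open>Both orders of differentiation are limits of one second difference quotient, which is
  symmetric in \<open>i\<close> and \<open>j\<close>.\<close>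

lemma partial_deriv_commute:
 assumes f: "smooth f"
 shows "pd i (pd j f) x = pd j (pd i f) x"
proof -
 define h :: "nat \<Rightarrow> real" where "h n = 1 / Suc n" for n
 have h0: "h n > 0" for n by (simp add: h_def)
 have hlim: "h \<longlonglongrightarrow> 0" unfolding h_def using LIMSEQ_Suc[OF lim_1_over_n] by simp
 define Q where "Q n = (f (x + h n *\<^sub>R axis i 1 + h n *\<^sub>R axis j 1) - f (x + h n *\<^sub>R axis i 1)
  - f (x + h n *\<^sub>R axis j 1) + f x) / (h n)^2" for n
 have *: "Q' \<longlonglongrightarrow> pd d (pd c f) x"
  if Q': "\<And>n. Q' n = (f (x + h n *\<^sub>R axis c 1 + h n *\<^sub>R axis d 1) - f (x + h n *\<^sub>R axis c 1)
  - f (x + h n *\<^sub>R axis d 1) + f x) / (h n)^2" for Q' c d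
 proof -
  have "\<forall>n. \<exists>s t. 0 \<le> s \<and> s \<le> h n \<and> 0 \<le> t \<and> t \<le> h n \<and>
    Q' n = pd d (pd c f) (x + s *\<^sub>R axis c 1 + t *\<^sub>R axis d 1)"
   using second_difference[OF f h0, where x=x and i=c and j=d] unfolding Q'
   by (smt (verit) h0 nonzero_mult_div_cancel_left zero_less_power)
  then obtain s t where st: "\<And>n. 0 \<le> s n" "\<And>n. s n \<le> h n" "\<And>n. 0 \<le> t n" "\<And>n. t n \<le> h n"
    "\<And>n. Q' n = pd d (pd c f) (x + s n *\<^sub>R axis c 1 + t n *\<^sub>R axis d 1)"
   by metis
  have "s \<longlonglongrightarrow> 0" "t \<longlonglongrightarrow> 0"
   by (rule tendsto_sandwich[OF _ _ tendsto_const hlim]; use st in simp)+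
  hence "(\<lambda>n. x + s n *\<^sub>R axis c 1 + t n *\<^sub>R axis d 1) \<longlonglongrightarrow> x + 0 *\<^sub>R axis c 1 + 0 *\<^sub>R axis d 1"
   by (intro tendsto_intros)
  moreover have "isCont (pd d (pd c f)) x"
   using smooth_differentiable[OF smooth_partial_deriv[OF smooth_partial_deriv[OF f]]]
   by (rule differentiable_imp_continuous_within)
  ultimately show ?thesis unfolding st(5)
   by (intro isCont_tendsto_compose[where g="pd d (pd c f)"]) auto
 qed
 have "Q \<longlonglongrightarrow> pd j (pd i f) x" by (rule *) (simp add: Q_def)
 moreover have "Q \<longlonglongrightarrow> pd i (pd j f) x"
  by (rule *) (simp add: Q_def algebra_simps)
 ultimately show ?thesis using LIMSEQ_unique by blast
qed

text \<open>The derivatives of \<open>exp (- 1 / t)\<close> are of the form \<open>p (1 / t) * exp (- 1 / t)\<close>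
 with \<open>p\<close> a polynomial.\<close>

definition flat_term :: "real poly \<Rightarrow> real \<Rightarrow> real" where
 "flat_term p t = (if t > 0 then poly p (1 / t) * exp (- (1 / t)) else 0)"

text \<open>With \<open>s = 1 / t\<close> this says that the exponential beats every
  polynomial.\<close>

lemma flat_term_tendsto: "(flat_term p \<longlongrightarrow> 0) (at_right 0)"
proof -
 have "((\<lambda>s. \<Sum>i\<le>degree p. coeff p i * (s ^ i / exp s)) \<longlongrightarrow> (\<Sum>i\<le>degree p. coeff p i * 0)) at_top"
  by (intro tendsto_intros tendsto_power_div_exp_0)
 hence "((\<lambda>s. poly p s / exp s) \<longlongrightarrow> 0) at_top"
  by (simp add: poly_altdef sum_divide_distrib)
 moreover have "LIM t at_right 0. 1 / (t::real) :> at_top"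
  using filterlim_inverse_at_top_right by (simp add: inverse_eq_divide)
 ultimately have "((\<lambda>t. poly p (1 / t) / exp (1 / t)) \<longlongrightarrow> 0) (at_right 0)"
  by (rule filterlim_compose)
 moreover have "\<forall>\<^sub>F t in at_right 0. poly p (1 / t) / exp (1 / t) = flat_term p t"
  by (simp add: eventually_at_right_less[of 0, THEN eventually_mono] flat_term_def exp_minus divide_inverse)
 ultimately show ?thesis by (rule Lim_transform_eventually)
qed

text \<open>For positive \<open>t\<close> the chain rule yields a factor \<open>1 / t^2\<close>,
  which is multiplication of the polynomial in \<open>1 / t\<close> by the square
  \<open>[:0, 0, 1:]\<close> of its variable. The class of these functions is therefore closed under
  differentiation.\<close>

lemma flat_term_DERIV:
 "(flat_term p has_real_derivative flat_term ([:0, 0, 1:] * (p - pderiv p)) t) (at t)"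
proof -
 consider "t < 0" | "t = 0" | "t > 0" by linarith
 thus ?thesis
 proof cases
  case 1
  have "((\<lambda>_. 0) has_real_derivative 0) (at t)" by simp
  moreover have "\<forall>\<^sub>F s in nhds t. flat_term p s = 0"
   using 1 eventually_nhds_in_open[of "{..<0}" t] by (auto elim!: eventually_mono simp: flat_term_def)
  ultimately show ?thesis using 1 DERIV_cong_ev[OF refl _ refl, where f="flat_term p" and g="\<lambda>_. 0"]
   by (simp add: flat_term_def)
 next
  case 2
  have "((\<lambda>s. flat_term p s / s) \<longlongrightarrow> 0) (at_left 0)"
   by (rule tendsto_eventually) (auto simp: eventually_at_left_field flat_term_def intro: exI[of _ "-1"])
  \<comment> \<open>Dividing by \<open>s\<close> multiplies the polynomial by its variable, so the
    difference quotient at 0 is again of this form.\<close>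
  moreover have "((\<lambda>s. flat_term p s / s) \<longlongrightarrow> 0) (at_right 0)"
   using flat_term_tendsto[of "[:0, 1:] * p"]
   by (rule Lim_transform_eventually)
    (simp add: eventually_at_right_less[of 0, THEN eventually_mono] flat_term_def)
  ultimately have "((\<lambda>s. flat_term p s / s) \<longlongrightarrow> 0) (at 0)"
   by (simp add: filterlim_split_at)
  thus ?thesis using 2 by (simp add: has_field_derivative_iff flat_term_def)
 next
  case 3
  have "((\<lambda>s. poly p (1 / s) * exp (- (1 / s))) has_real_derivative
    poly p (1/t) * (exp (- (1/t)) * (1 / t^2)) + poly (pderiv p) (1/t) * (- 1 / t^2) * exp (- (1/t))) (at t)"
   using 3 by (auto intro!: derivative_eq_intros DERIV_chain2[OF poly_DERIV] simp: power2_eq_square field_simps)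
  moreover have "\<forall>\<^sub>F s in nhds t. flat_term p s = poly p (1 / s) * exp (- (1 / s))"
   using 3 eventually_nhds_in_open[of "{0<..}" t] by (auto elim!: eventually_mono simp: flat_term_def)
  ultimately have "(flat_term p has_real_derivative
    poly p (1/t) * (exp (- (1/t)) * (1 / t^2)) + poly (pderiv p) (1/t) * (- 1 / t^2) * exp (- (1/t))) (at t)"
   using DERIV_cong_ev[OF refl _ refl, where f="flat_term p" and g="\<lambda>s. poly p (1 / s) * exp (- (1 / s))"] by simp
  moreover have "poly p (1/t) * (exp (- (1/t)) * (1 / t^2)) + poly (pderiv p) (1/t) * (- 1 / t^2) * exp (- (1/t))
    = flat_term ([:0, 0, 1:] * (p - pderiv p)) t"
   using 3 by (simp add: flat_term_def power2_eq_square field_simps)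
  ultimately show ?thesis by simp
 qed
qed

section \<open>The bump kernel and mollification\<close>

definition bump :: "real \<Rightarrow> real^2 \<Rightarrow> real^2 \<Rightarrow> real" where
 "bump d x y = flat_term 1 (d^2 - (norm (y - x))^2)"

lemma smooth_bump: "smooth (bump d x)"
proof -
 \<comment> \<open>Iterating the polynomial rule gives a sequence that starts with
   \<open>flat_term 1\<close> and in which each function is the derivative of its
   predecessor.\<close>
 define D where "D n = flat_term (((\<lambda>p. [:0, 0, 1:] * (p - pderiv p)) ^^ n) 1)" for n
 have "smooth (\<lambda>y. D 0 (d^2 - (norm (y - x))^2))"
  unfolding smooth_def
 proof (rule allI, rule C_k_compose[where D=D and n=0])
  show "(D n has_real_derivative D (Suc n) t) (at t)" for n t
   using flat_term_DERIV[of "((\<lambda>p. [:0, 0, 1:] * (p - pderiv p)) ^^ n) 1" t] by (simp add: D_def)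
  show "smooth (\<lambda>y. d^2 - (norm (y - x))^2)"
   by (intro smooth_diff smooth_const smooth_norm_sq)
 qed
 thus ?thesis by (simp add: D_def bump_def[abs_def])
qed

lemma bump_nonneg: "0 \<le> bump d x y"
 by (simp add: bump_def flat_term_def)

lemma bump_commute: "bump d x y = bump d y x"
 by (simp add: bump_def norm_minus_commute)

lemma bump_pos_iff: "d > 0 \<Longrightarrow> 0 < bump d x y \<longleftrightarrow> dist x y < d"
 using abs_square_less_1 power2_strict_mono
 by (auto simp: bump_def flat_term_def dist_norm norm_minus_commute intro: power2_less_imp_less power_strict_mono)

lemma bump_eq_0: "d > 0 \<Longrightarrow> d \<le> dist x y \<Longrightarrow> bump d x y = 0"
 using bump_pos_iff[of d x y] bump_nonneg[of d x y] by linarith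

lemma bump_support: "d > 0 \<Longrightarrow> closure {y. bump d x y \<noteq> 0} \<subseteq> cball x d"
 using bump_eq_0[of d x] by (intro closure_minimal) (auto, meson nle_le)

lemma bump_test_function: "d > 0 \<Longrightarrow> cball x d \<subseteq> \<omega> \<Longrightarrow> bump d x \<in> test_functions \<omega>"
 using bump_support[of d x] smooth_bump bounded_subset[OF bounded_cball]
 unfolding test_functions_def by (auto simp: compact_eq_bounded_closed)

text \<open>Borel representatives on the whole plane that vanish off \<open>\<omega>\<close>:
  translations, Tonelli's theorem and integrals over \<open>lborel\<close> apply to them
  directly.\<close>

definition L20 :: "(real^2) set \<Rightarrow> (real^2 \<Rightarrow> real) set" where
 "L20 \<omega> = {u \<in> L2 lborel. \<forall>x. x \<notin> \<omega> \<longrightarrow> u x = 0}"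

definition bump_mass :: "real \<Rightarrow> real" where
 "bump_mass d = (LINT y|lborel. bump d 0 y)"

definition moll :: "real \<Rightarrow> (real^2 \<Rightarrow> real) \<Rightarrow> real^2 \<Rightarrow> real" where
 "moll d u x = (LINT y|lborel. u y * (bump d x y / bump_mass d))"

lemma bump_le_1: "bump d x y \<le> 1"
 by (simp add: bump_def flat_term_def)

lemma bump_shift: "bump d x y = bump d 0 (y - x)"
 by (simp add: bump_def)

lemma measurable_bump [measurable]: "bump d x \<in> borel_measurable borel"
 using smooth_measurable[OF smooth_bump] .

lemma measurable_bump2 [measurable]:
 "(\<lambda>(x, y). bump d x y) \<in> borel_measurable (borel \<Otimes>\<^sub>M borel)"
 by (subst bump_shift) measurable

lemma integrable_bump:
 assumes "d > 0" shows "integrable lborel (bump d x)"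
proof (rule Bochner_Integration.integrable_bound)
 show "integrable lborel (indicator (cball x d) :: real^2 \<Rightarrow> real)"
  using emeasure_lborel_cbox_finite emeasure_bounded_finite[OF bounded_cball[of x d]]
  by (simp add: integrable_indicator_iff)
 show "AE y in lborel. norm (bump d x y) \<le> norm (indicator (cball x d) y :: real)"
  using bump_eq_0[OF assms, of x] bump_le_1[of d x] bump_nonneg[of d x]
  by (auto simp: indicator_def)
qed measurable

lemma bump_mass_eq: "(LINT y|lborel. bump d x y) = bump_mass d"
proof -
 have "(LINT y|lborel. bump d x y) = (LINT y|distr lborel borel ((+) x). bump d x y)"
  by (simp add: lborel_distr_plus)
 also have "\<dots> = bump_mass d"
  by (subst integral_distr) (auto simp: bump_mass_def bump_shift[of d x])
 finally show ?thesis .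
qed

lemma bump_mass_pos: assumes "d > 0" shows "bump_mass d > 0"
proof -
 have "bump_mass d \<noteq> 0"
 proof
  assume "bump_mass d = 0"
  hence "AE y in lborel. bump d 0 y = 0"
   using integral_nonneg_eq_0_iff_AE[OF integrable_bump[OF assms, of 0]] bump_nonneg
   by (simp add: bump_mass_def)
  hence "AE y::real^2 in lborel. y \<notin> ball 0 d"
  proof eventually_elim
   fix y :: "real^2" assume "bump d 0 y = 0"
   thus "y \<notin> ball 0 d" using bump_pos_iff[OF assms, of 0 y] by force
  qed
  hence "emeasure lborel (ball (0::real^2) d) = 0"
   using AE_iff_measurable[of "ball (0::real^2) d" lborel "\<lambda>y. y \<notin> ball 0 d"]
   by (simp del: mem_ball mem_ball_0)
  hence "negligible (ball (0::real^2) d)"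
   by (simp add: negligible_iff_null_sets null_sets_completionI null_setsI)
  thus False using assms open_not_negligible[of "ball (0::real^2) d"] by simp
 qed
 moreover have "bump_mass d \<ge> 0" by (simp add: bump_mass_def bump_nonneg)
 ultimately show ?thesis by simp
qed

lemma kernel_mass:
 assumes "d > 0"
 shows "(\<integral>\<^sup>+y. ennreal (bump d x y / bump_mass d) \<partial>lborel) = 1"
proof -
 have "(\<integral>\<^sup>+y. ennreal (bump d x y / bump_mass d) \<partial>lborel) = ennreal (LINT y|lborel. bump d x y / bump_mass d)"
  using integrable_bump[OF assms, of x] bump_nonneg bump_mass_pos[OF assms]
  by (intro nn_integral_eq_integral) auto
 thus ?thesis using bump_mass_eq[of d x] bump_mass_pos[OF assms] by simp
qed

lemma L20_integrable:
 assumes "bounded \<omega>" "open \<omega>" "u \<in> L20 \<omega>" shows "integrable lborel u"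
proof -
 have "(indicator \<omega> :: real^2 \<Rightarrow> real) \<in> L2 lborel"
 proof -
  have "(indicator \<omega> x :: real)^2 = indicator \<omega> x" for x by (simp add: indicator_def)
  moreover have "integrable lborel (indicator \<omega> :: real^2 \<Rightarrow> real)"
   using emeasure_bounded_finite[OF assms(1)] assms(2) by (simp add: integrable_indicator_iff)
  moreover have "(indicator \<omega> :: real^2 \<Rightarrow> real) \<in> borel_measurable lborel"
   using assms(2) by (intro borel_measurable_indicator) auto
  ultimately show ?thesis by (simp add: L2_def)
 qed
 hence "integrable lborel (\<lambda>x. u x * indicator \<omega> x)"
  using assms(3) by (intro L2_mult_integrable) (auto simp: L20_def)
 also have "(\<lambda>x. u x * indicator \<omega> x) = u"
  using assms(3) by (auto simp: L20_def indicator_def fun_eq_iff)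
 finally show ?thesis .
qed

lemma moll_kernel_integrable:
 assumes "d > 0" "u \<in> borel_measurable borel" "integrable lborel u \<or> u \<in> L2 lborel"
 shows "integrable lborel (\<lambda>y. u y * (bump d x y / bump_mass d))"
proof -
 note assms(2)[measurable]
 have "integrable lborel (\<lambda>y. u y * bump d x y)"
  using assms(3)
 proof
  assume "integrable lborel u"
  thus ?thesis
  proof (rule Bochner_Integration.integrable_bound)
   show "AE y in lborel. norm (u y * bump d x y) \<le> norm (u y)"
    using bump_le_1[of d x] bump_nonneg[of d x] by (auto simp: abs_mult mult_left_le)
  qed measurable
 next
  assume "u \<in> L2 lborel"
  moreover have "bump d x \<in> L2 lborel"
  proof -
   have "integrable lborel (\<lambda>y. (bump d x y)^2)"
   proof (rule Bochner_Integration.integrable_bound[OF integrable_bump[OF assms(1)]])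
    show "AE y in lborel. norm ((bump d x y)^2) \<le> norm (bump d x y)"
     using bump_le_1[of d x] bump_nonneg[of d x] by (auto simp: power2_eq_square mult_left_le)
   qed measurable
   thus ?thesis by (simp add: L2_def)
  qed
  ultimately show ?thesis by (rule L2_mult_integrable)
 qed
 from integrable_divide[OF this, of "bump_mass d"] show ?thesis by simp
qed

lemma moll_measurable [measurable]:
 assumes [measurable]: "u \<in> borel_measurable borel"
 shows "moll d u \<in> borel_measurable borel"
 unfolding moll_def[abs_def] by measurable

lemma moll_add:
 assumes "d > 0" "u \<in> L2 lborel" "v \<in> L2 lborel"
 shows "moll d (\<lambda>x. u x + v x) x = moll d u x + moll d v x"
 unfolding moll_def distrib_right
 using moll_kernel_integrable[OF assms(1), of u x] moll_kernel_integrable[OF assms(1), of v x] assms(2,3)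
 by (intro Bochner_Integration.integral_add) (auto simp: L2_def)

lemma moll_scale: "moll d (\<lambda>x. c * u x) x = c * moll d u x"
 unfolding moll_def mult.assoc by simp

lemma moll_diff:
 assumes "d > 0" "u \<in> L2 lborel" "v \<in> L2 lborel"
 shows "moll d (\<lambda>x. u x - v x) x = moll d u x - moll d v x"
 using moll_add[OF assms(1,2) L2_scale[OF assms(3), of "-1"], of x] moll_scale[of d "-1" v x]
 by simp

text \<open>The kernel is a probability density, and Cauchy-Schwarz is applied to the factors
  \<open>u y * k y\<close> and \<open>k y\<close>, with \<open>k\<close> the square root of the
  kernel. An infinite right-hand side leaves nothing to prove.\<close>

lemma moll_Jensen:
 assumes d: "d > 0" and u: "u \<in> borel_measurable borel"
 shows "ennreal ((LINT y|lborel. u y * (bump d x y / bump_mass d))^2)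
  \<le> (\<integral>\<^sup>+y. ennreal ((u y)^2 * (bump d x y / bump_mass d)) \<partial>lborel)"
proof (cases "integrable lborel (\<lambda>y. (u y)^2 * (bump d x y / bump_mass d))")
 case True
 note u[measurable]
 define k where "k y = sqrt (bump d x y / bump_mass d)" for y
 have k2: "k y * k y = bump d x y / bump_mass d" for y
  using bump_nonneg bump_mass_pos[OF d] by (simp add: k_def less_imp_le)
 hence k2': "(k y)^2 = bump d x y / bump_mass d" for y by (simp add: power2_eq_square)
 have [measurable]: "k \<in> borel_measurable borel" unfolding k_def by measurable
 have 1: "(\<lambda>y. u y * k y) \<in> L2 lborel"
  using True by (simp add: L2_def power_mult_distrib k2')
 have 2: "k \<in> L2 lborel"
  using integrable_bump[OF d, of x] by (simp add: L2_def k2')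
 have "(l2norm lborel k)^2 = 1"
  using bump_mass_eq[of d x] bump_mass_pos[OF d]
  by (simp add: l2norm_power2 k2')
 hence "l2norm lborel k = 1" using l2norm_nonneg[of lborel k] by (simp add: power2_eq_1_iff)
 hence "\<bar>LINT y|lborel. (u y * k y) * k y\<bar> \<le> l2norm lborel (\<lambda>y. u y * k y)"
  using L2_Cauchy_Schwarz[OF 1 2] by simp
 from power_mono[OF this abs_ge_zero, of 2]
 have "(LINT y|lborel. (u y * k y) * k y)^2 \<le> (l2norm lborel (\<lambda>y. u y * k y))^2" by simp
 also have "\<dots> = (LINT y|lborel. (u y)^2 * (bump d x y / bump_mass d))"
  by (simp add: l2norm_power2 power_mult_distrib k2')
 finally have "(LINT y|lborel. u y * (bump d x y / bump_mass d))^2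
   \<le> (LINT y|lborel. (u y)^2 * (bump d x y / bump_mass d))"
  by (simp only: mult.assoc k2)
 thus ?thesis
  using True bump_nonneg bump_mass_pos[OF d]
  by (subst nn_integral_eq_integral) (auto intro!: ennreal_leI)
next
 case False
 note u[measurable]
 have "(\<integral>\<^sup>+y. ennreal ((u y)^2 * (bump d x y / bump_mass d)) \<partial>lborel) = \<infinity>"
 proof (rule ccontr)
  assume "\<not> ?thesis"
  hence "integrable lborel (\<lambda>y. (u y)^2 * (bump d x y / bump_mass d))"
   using bump_nonneg bump_mass_pos[OF d]
   by (intro integrableI_nonneg) (auto simp: less_top)
  with False show False by simp
 qed
 thus ?thesis by simp
qed

text \<open>Jensen's inequality at each point is integrated by Tonelli's theorem; the kernel is
  symmetric, so its mass in the other variable is 1 as well.\<close>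

lemma moll_nn_integral_le:
 assumes d: "d > 0" and u: "u \<in> borel_measurable borel"
 shows "(\<integral>\<^sup>+x. ennreal ((moll d u x)^2) \<partial>lborel) \<le> (\<integral>\<^sup>+y. ennreal ((u y)^2) \<partial>lborel)"
proof -
 note u[measurable]
 have "(\<integral>\<^sup>+x. ennreal ((moll d u x)^2) \<partial>lborel)
   \<le> (\<integral>\<^sup>+x. \<integral>\<^sup>+y. ennreal ((u y)^2 * (bump d x y / bump_mass d)) \<partial>lborel \<partial>lborel)"
  unfolding moll_def by (intro nn_integral_mono moll_Jensen[OF d u])
 also have "\<dots> = (\<integral>\<^sup>+y. \<integral>\<^sup>+x. ennreal ((u y)^2 * (bump d x y / bump_mass d)) \<partial>lborel \<partial>lborel)"
  by (rule lborel_pair.Fubini') measurable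
 also have "\<dots> = (\<integral>\<^sup>+y. ennreal ((u y)^2) * (\<integral>\<^sup>+x. ennreal (bump d y x / bump_mass d) \<partial>lborel) \<partial>lborel)"
 proof (rule nn_integral_cong)
  fix y
  have "(\<integral>\<^sup>+x. ennreal ((u y)^2 * (bump d x y / bump_mass d)) \<partial>lborel)
   = (\<integral>\<^sup>+x. ennreal ((u y)^2) * ennreal (bump d y x / bump_mass d) \<partial>lborel)"
   by (intro nn_integral_cong) (subst ennreal_mult'[symmetric], auto simp: bump_commute)
  thus "(\<integral>\<^sup>+x. ennreal ((u y)^2 * (bump d x y / bump_mass d)) \<partial>lborel)
   = ennreal ((u y)^2) * (\<integral>\<^sup>+x. ennreal (bump d y x / bump_mass d) \<partial>lborel)"
   by (simp add: nn_integral_cmult)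
 qed
 finally show ?thesis by (simp add: kernel_mass[OF d])
qed

lemma moll_L2:
 assumes d: "d > 0" and u: "u \<in> L2 lborel"
 shows "moll d u \<in> L2 lborel" "l2norm lborel (moll d u) \<le> l2norm lborel u"
proof -
 have [measurable]: "u \<in> borel_measurable borel" using u by (simp add: L2_def)
 have le: "(\<integral>\<^sup>+x. ennreal ((moll d u x)^2) \<partial>lborel) \<le> ennreal (LINT x|lborel. (u x)^2)"
  using moll_nn_integral_le[OF d, of u] nn_integral_eq_integral[OF L2_square_integrable[OF u]] by simp
 have i: "integrable lborel (\<lambda>x. (moll d u x)^2)"
  by (rule integrableI_bounded) (use le in \<open>auto simp: top.not_eq_extremum[symmetric] top_unique\<close>)
 thus "moll d u \<in> L2 lborel" by (simp add: L2_def)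
 have "ennreal (LINT x|lborel. (moll d u x)^2) \<le> ennreal (LINT x|lborel. (u x)^2)"
  using le nn_integral_eq_integral[OF i] by simp
 thus "l2norm lborel (moll d u) \<le> l2norm lborel u" by (simp add: l2norm_def ennreal_le_iff)
qed

section \<open>Approximation by mollification\<close>

lemma L2_dominated_convergence:
 assumes f: "\<And>n. f n \<in> borel_measurable M" and h: "h \<in> L2 M"
  and bd: "\<And>n. AE x in M. \<bar>f n x\<bar> \<le> h x" and lim: "AE x in M. (\<lambda>n. f n x) \<longlonglongrightarrow> 0"
 shows "(\<lambda>n. l2norm M (f n)) \<longlonglongrightarrow> 0"
proof -
 have "(\<lambda>n. LINT x|M. (f n x)^2) \<longlonglongrightarrow> (LINT x|M. 0)"
 proof (rule integral_dominated_convergence)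
  show "integrable M (\<lambda>x. (h x)^2)" using h by (rule L2_square_integrable)
  show "AE x in M. (\<lambda>n. (f n x)^2) \<longlonglongrightarrow> 0"
   using lim by eventually_elim (auto intro: tendsto_eq_intros)
  show "AE x in M. norm ((f n x)^2) \<le> (h x)^2" for n
   using bd[of n] by eventually_elim (auto intro: power2_le_iff_abs_le[THEN iffD2] simp: power2_le_iff_abs_le)
  show "(\<lambda>x. (f n x)^2) \<in> borel_measurable M" for n using f by simp
 qed simp
 hence "(\<lambda>n. sqrt (LINT x|M. (f n x)^2)) \<longlonglongrightarrow> sqrt 0"
  by (intro tendsto_real_sqrt) simp
 thus ?thesis by (simp add: l2norm_def)
qed

lemma L2_indicator:
 assumes "bounded \<omega>" "\<omega> \<in> sets borel"
 shows "(\<lambda>x::real^2. c * indicator \<omega> x) \<in> L2 lborel"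
proof -
 have "(indicator \<omega> x :: real)^2 = indicator \<omega> x" for x :: "real^2" by (simp add: indicator_def)
 moreover have "integrable lborel (indicator \<omega> :: real^2 \<Rightarrow> real)"
  using emeasure_bounded_finite[OF assms(1)] assms(2) by (simp add: integrable_indicator_iff)
 moreover have "(indicator \<omega> :: real^2 \<Rightarrow> real) \<in> borel_measurable lborel"
  using assms(2) by (intro borel_measurable_indicator) auto
 ultimately show ?thesis by (intro L2_scale) (simp add: L2_def)
qed

lemma L2_lborel_measurable: "u \<in> L2 lborel \<Longrightarrow> u \<in> borel_measurable borel"
 by (simp add: L2_def)

text \<open>Truncation makes \<open>u\<close> bounded. A measurable function is an almost everywhere
  limit of continuous ones, and truncating these at the same level allows dominated convergence on
  the bounded set.\<close>

lemma continuous_dense_L2: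
 assumes \<omega>: "open \<omega>" "bounded \<omega>" and u: "u \<in> L20 \<omega>" and e: "e > 0"
 obtains g where "continuous_on UNIV g" "(\<lambda>x. g x * indicator \<omega> x) \<in> L2 lborel"
  "l2norm lborel (\<lambda>x. u x - g x * indicator \<omega> x) < e"
proof -
 have u2: "u \<in> L2 lborel" and uz: "\<And>x. x \<notin> \<omega> \<Longrightarrow> u x = 0" using u by (auto simp: L20_def)
 note [measurable] = L2_lborel_measurable[OF u2]
 have [measurable]: "\<omega> \<in> sets borel" using \<omega> by simp
 define cl where "cl k t = max (- k) (min k t)" for k t :: real
 have clc: "isCont (cl k) t" for k t unfolding cl_def[abs_def] by (intro continuous_intros)
 have clm [measurable]: "cl k \<in> borel_measurable borel" for k
  using clc by (intro borel_measurable_continuous_onI continuous_at_imp_continuous_on) auto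
 have "(\<lambda>n. l2norm lborel (\<lambda>x. u x - cl (real n) (u x))) \<longlonglongrightarrow> 0"
 proof (rule L2_dominated_convergence[where h="\<lambda>x. \<bar>u x\<bar>"])
  show "(\<lambda>x. \<bar>u x\<bar>) \<in> L2 lborel" using u2 by (auto simp: L2_def)
  show "AE x in lborel. \<bar>u x - cl (real n) (u x)\<bar> \<le> \<bar>u x\<bar>" for n by (auto simp: cl_def)
  show "AE x in lborel. (\<lambda>n. u x - cl (real n) (u x)) \<longlonglongrightarrow> 0"
  proof (rule AE_I2)
   fix x
   obtain N where "\<bar>u x\<bar> \<le> real N" using real_arch_simple by blast
   hence "\<forall>\<^sub>F n in sequentially. u x - cl (real n) (u x) = 0"
    by (intro eventually_sequentiallyI[of N]) (auto simp: cl_def)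
   thus "(\<lambda>n. u x - cl (real n) (u x)) \<longlonglongrightarrow> 0" by (rule tendsto_eventually)
  qed
 qed measurable
 then obtain k :: nat where k: "l2norm lborel (\<lambda>x. u x - cl (real k) (u x)) < e/2"
  using e LIMSEQ_D[of _ 0 "e/2"] by fastforce
 have "u measurable_on \<omega>"
  using \<omega> by (intro lebesgue_measurable_imp_measurable_on_real) (auto intro: measurable_completion)
 then obtain N g where N: "negligible N" and g: "\<And>n. continuous_on UNIV (g n)"
  and lim: "\<And>x. x \<notin> N \<Longrightarrow> (\<lambda>n. g n x) \<longlonglongrightarrow> (if x \<in> \<omega> then u x else 0)"
  by (auto simp: measurable_on_def)
 have gm [measurable]: "g n \<in> borel_measurable borel" for n using g by (rule borel_measurable_continuous_onI)
 have AEN: "AE x in lborel. x \<notin> N"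
 proof -
  have "AE x in lebesgue. x \<notin> N" using N by (simp add: negligible_iff_null_sets AE_not_in)
  thus ?thesis by (simp add: AE_completion_iff)
 qed
 have lim2: "(\<lambda>n. l2norm lborel (\<lambda>x. cl k (u x) - cl k (g n x) * indicator \<omega> x)) \<longlonglongrightarrow> 0"
 proof (rule L2_dominated_convergence[OF _ L2_indicator[OF \<omega>(2), of "2 * real k"]])
  show "AE x in lborel. \<bar>cl k (u x) - cl k (g n x) * indicator \<omega> x\<bar> \<le> 2 * real k * indicator \<omega> x" for n
   using uz by (auto simp: cl_def indicator_def)
  show "AE x in lborel. (\<lambda>n. cl k (u x) - cl k (g n x) * indicator \<omega> x) \<longlonglongrightarrow> 0"
   using AEN
  proof eventually_elim
   fix x assume "x \<notin> N"
   note l = lim[OF this]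
   show "(\<lambda>n. cl k (u x) - cl k (g n x) * indicator \<omega> x) \<longlonglongrightarrow> 0"
   proof (cases "x \<in> \<omega>")
    case True
    hence "(\<lambda>n. cl k (g n x)) \<longlonglongrightarrow> cl k (u x)" using l isCont_tendsto_compose[OF clc] by simp
    from tendsto_diff[OF tendsto_const[of "cl k (u x)"] this] show ?thesis using True by simp
   next
    case False
    thus ?thesis using uz by (simp add: cl_def)
   qed
  qed
 qed simp_all
 then obtain n where n: "l2norm lborel (\<lambda>x. cl k (u x) - cl k (g n x) * indicator \<omega> x) < e/2"
  using e LIMSEQ_D[of _ 0 "e/2"] by fastforce
 have 1: "(\<lambda>x. cl k (g n x) * indicator \<omega> x) \<in> L2 lborel"
  by (rule L2_bound[OF L2_indicator[OF \<omega>(2), of "real k"]]) (auto simp: cl_def indicator_def)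
 have 2: "(\<lambda>x. cl k (u x)) \<in> L2 lborel"
  by (rule L2_bound[OF u2]) (auto simp: cl_def)
 show thesis
 proof (rule that)
  show "continuous_on UNIV (\<lambda>x. cl k (g n x))"
   unfolding cl_def using g by (intro continuous_intros) 
  show "(\<lambda>x. cl k (g n x) * indicator \<omega> x) \<in> L2 lborel" by (rule 1)
  show "l2norm lborel (\<lambda>x. u x - cl k (g n x) * indicator \<omega> x) < e"
   using l2norm_triangle_diff[OF u2 2 1] n k by simp
 qed
qed

lemma kernel_integral: "d > 0 \<Longrightarrow> (LINT y|lborel. bump d x y / bump_mass d) = 1"
 using bump_mass_eq[of d x] bump_mass_pos[of d] by simp

text \<open>The kernel has mass 1 and vanishes outside the ball, so \<open>moll d u x - c\<close> is
  an average of \<open>u y - c\<close> over nearby points.\<close>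

lemma moll_near:
 assumes d: "d > 0" and u: "u \<in> borel_measurable borel" "integrable lborel u \<or> u \<in> L2 lborel"
  and near: "\<And>y. dist x y < d \<Longrightarrow> \<bar>u y - c\<bar> \<le> h"
 shows "\<bar>moll d u x - c\<bar> \<le> h"
proof -
 define k where "k y = bump d x y / bump_mass d" for y
 have k0: "0 \<le> k y" for y unfolding k_def using bump_nonneg bump_mass_pos[OF d] by (simp add: less_imp_le)
 have ki: "integrable lborel k" unfolding k_def[abs_def] using integrable_bump[OF d] by (rule integrable_divide)
 have k1: "(LINT y|lborel. k y) = 1" unfolding k_def by (rule kernel_integral[OF d])
 have ui: "integrable lborel (\<lambda>y. u y * k y)" unfolding k_def using moll_kernel_integrable[OF d u] .
 have "moll d u x - c = (LINT y|lborel. u y * k y) - (LINT y|lborel. c * k y)"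
  unfolding moll_def k_def[symmetric] Bochner_Integration.integral_mult_right_zero k1 by simp
 also have "\<dots> = (LINT y|lborel. (u y - c) * k y)"
  unfolding left_diff_distrib
  by (rule Bochner_Integration.integral_diff[symmetric, OF ui integrable_mult_right[OF ki]])
 finally have eq: "moll d u x - c = (LINT y|lborel. (u y - c) * k y)" .
 have "\<bar>LINT y|lborel. (u y - c) * k y\<bar> \<le> (LINT y|lborel. \<bar>(u y - c) * k y\<bar>)"
    by (rule integral_abs_bound)
 also have "\<dots> \<le> (LINT y|lborel. h * k y)"
 proof (rule integral_mono)
    show "integrable lborel (\<lambda>y. \<bar>(u y - c) * k y\<bar>)"
     unfolding left_diff_distrib using ui ki by (intro integrable_abs Bochner_Integration.integrable_diff integrable_mult_right)
    show "integrable lborel (\<lambda>y. h * k y)" by (rule integrable_mult_right[OF ki])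
    show "\<bar>(u y - c) * k y\<bar> \<le> h * k y" for y
    proof (cases "dist x y < d")
     case True
     from mult_right_mono[OF near[OF True] k0[of y]] show ?thesis using k0[of y] by (simp add: abs_mult)
    next
     case False thus ?thesis using bump_eq_0[OF d, of x y] by (simp add: k_def)
    qed
   qed
 finally show ?thesis unfolding eq Bochner_Integration.integral_mult_right_zero k1 by simp
qed

text \<open>Convergence is claimed on \<open>K\<close> only, away from the boundary: the
  approximation \<open>G\<close> of \<open>u\<close> may jump at the boundary of
  \<open>\<omega>\<close>, and its mollification is uniformly close to it only where the kernel
  stays inside.\<close>

lemma moll_tendsto:
 fixes h :: "nat \<Rightarrow> real"
 assumes \<omega>: "open \<omega>" "bounded \<omega>" and u: "u \<in> L20 \<omega>"
  and K: "K \<in> sets borel" and d: "d > 0" and Kd: "\<And>x. x \<in> K \<Longrightarrow> cball x d \<subseteq> \<omega>"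
  and h0: "\<And>n. h n > 0" and h: "h \<longlonglongrightarrow> 0"
 shows "(\<lambda>n. l2norm lborel (\<lambda>x. indicator K x * (moll (h n) u x - u x))) \<longlonglongrightarrow> 0"
proof (rule LIMSEQ_I)
 fix e :: real assume e: "e > 0"
 have u2: "u \<in> L2 lborel" using u by (auto simp: L20_def)
 note [measurable] = L2_lborel_measurable[OF u2] K
 have K\<omega>: "K \<subseteq> \<omega>" using Kd d by (meson centre_in_cball less_imp_le subsetD subsetI)
 obtain g where gc: "continuous_on UNIV g" and G2: "(\<lambda>x. g x * indicator \<omega> x) \<in> L2 lborel"
  and ug: "l2norm lborel (\<lambda>x. u x - g x * indicator \<omega> x) < e/3"
  using continuous_dense_L2[OF \<omega> u, of "e/3"] e by auto
 define G where "G x = g x * indicator \<omega> x" for x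
 have G2: "G \<in> L2 lborel" using G2 by (simp add: G_def[abs_def])
 note [measurable] = L2_lborel_measurable[OF G2]
 define m where "m = l2norm lborel (\<lambda>x::real^2. 1 * indicator \<omega> x)"
 have m0: "0 \<le> m" by (simp add: m_def)
 \<comment> \<open>A uniform error \<open>c\<close> costs \<open>c * m\<close> in L2, with
   \<open>m\<close> the norm of the indicator of \<open>\<omega>\<close>; the \<open>+ 1\<close>
   covers \<open>m = 0\<close>.\<close>
 define c where "c = e / (3 * (m + 1))"
 have c0: "c > 0" using e m0 by (simp add: c_def)
 have cm: "c * m < e / 3" using e m0 by (simp add: c_def field_simps)
 have "uniformly_continuous_on (closure \<omega>) g"
  using gc \<omega>(2) by (intro compact_uniformly_continuous) (auto intro: continuous_on_subset)
 then obtain r where r: "r > 0" "\<And>x y. x \<in> closure \<omega> \<Longrightarrow> y \<in> closure \<omega> \<Longrightarrow> dist y x < r \<Longrightarrow> dist (g y) (g x) < c"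
  using c0 unfolding uniformly_continuous_on_def by metis
 obtain N where N: "\<And>n. n \<ge> N \<Longrightarrow> h n < min r d"
  using order_tendstoD(2)[OF h, of "min r d"] r(1) d by (auto simp: eventually_sequentially)
 have "norm (l2norm lborel (\<lambda>x. indicator K x * (moll (h n) u x - u x)) - 0) < e" if n: "n \<ge> N" for n
 proof -
  let ?d = "h n"
  let ?g = "\<lambda>x. indicator K x * (moll ?d G x - G x)" and ?v = "\<lambda>x. moll ?d (\<lambda>x. u x - G x) x - (u x - G x)"
  let ?w = "\<lambda>x. indicator K x * ?v x"
  have 1: "(\<lambda>x. moll ?d (\<lambda>x. u x - G x) x) \<in> L2 lborel"
   "l2norm lborel (\<lambda>x. moll ?d (\<lambda>x. u x - G x) x) < e/3"
   using moll_L2[OF h0[of n] L2_diff[OF u2 G2]] ug by (auto simp: G_def)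
  have ib: "\<bar>indicator K x * (moll ?d G x - G x)\<bar> \<le> \<bar>c * indicator \<omega> x\<bar>" for x
  proof (cases "x \<in> K")
   case True
   hence "x \<in> \<omega>" using K\<omega> by auto
   have "\<bar>moll ?d G x - g x\<bar> \<le> c"
   proof (rule moll_near[OF h0])
    fix y assume "dist x y < ?d"
    hence dd: "dist x y < r" "dist x y < d" using N[OF n] by auto
    hence "y \<in> \<omega>" using Kd[OF True] by auto
    moreover from this \<open>x \<in> \<omega>\<close> have "x \<in> closure \<omega>" "y \<in> closure \<omega>"
     using closure_subset by blast+
    ultimately show "\<bar>G y - g x\<bar> \<le> c" using r(2)[of x y] dd
     by (simp add: G_def dist_real_def dist_commute)
   qed (use G2 in auto)
   thus ?thesis using True \<open>x \<in> \<omega>\<close> c0 by (simp add: G_def)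
  qed (simp add: c0)
  have 2: "?g \<in> L2 lborel"
   "l2norm lborel ?g \<le> c * m"
  proof -
   have e2: "(\<lambda>x::real^2. c * indicator \<omega> x) \<in> L2 lborel"
    by (rule L2_indicator[OF \<omega>(2)]) (use \<omega>(1) in simp)
   show "?g \<in> L2 lborel"
    by (rule L2_bound[OF e2 _ AE_I2[OF ib]]) simp
   have "l2norm lborel ?g \<le> l2norm lborel (\<lambda>x::real^2. c * indicator \<omega> x)"
    by (rule l2norm_mono[OF e2 _ AE_I2[OF ib]]) simp
   thus "l2norm lborel ?g \<le> c * m"
    using c0 by (simp add: l2norm_scale m_def)
  qed
  have 3: "?v \<in> L2 lborel"
   "l2norm lborel ?v < 2 * e / 3"
   using L2_diff[OF 1(1) L2_diff[OF u2 G2]] l2norm_diff_le[OF 1(1) L2_diff[OF u2 G2]] 1(2) ug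
   by (auto simp: G_def)
  have 4: "l2norm lborel ?w < 2 * e / 3"
   by (rule le_less_trans[OF l2norm_mono[OF 3(1)] 3(2)]) (auto simp: indicator_def)
  have 5: "?w \<in> L2 lborel"
   by (rule L2_bound[OF 3(1)]) (auto simp: indicator_def)
  have "(\<lambda>x. indicator K x * (moll ?d u x - u x)) =
   (\<lambda>x. indicator K x * (moll ?d (\<lambda>x. u x - G x) x - (u x - G x)) + indicator K x * (moll ?d G x - G x))"
   unfolding moll_diff[OF h0[of n] u2 G2] by (simp add: algebra_simps)
  hence "l2norm lborel (\<lambda>x. indicator K x * (moll ?d u x - u x)) < 2 * e / 3 + e / 3"
   using l2norm_triangle[OF 5 2(1)] 4 2(2) cm by simp
  thus ?thesis by simp
 qed
 thus "\<exists>no. \<forall>n\<ge>no. norm (l2norm lborel (\<lambda>x. indicator K x * (moll (h n) u x - u x)) - 0) < e" by blast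
qed

section \<open>Derivatives of mollifications\<close>

lemma DERIV_integral:
 fixes k k' :: "real \<Rightarrow> 'a \<Rightarrow> real"
 assumes u: "integrable M u"
  and km: "\<And>t. k t \<in> borel_measurable M" and k'm: "k' t0 \<in> borel_measurable M"
  and ki: "\<And>t. integrable M (\<lambda>y. u y * k t y)"
  and d: "\<And>t y. ((\<lambda>t. k t y) has_real_derivative k' t y) (at t)"
  and bd: "\<And>t y. \<bar>k' t y\<bar> \<le> C"
 shows "((\<lambda>t. LINT y|M. u y * k t y) has_real_derivative (LINT y|M. u y * k' t0 y)) (at t0)"
proof -
 note [measurable] = borel_measurable_integrable[OF u] km k'm
 have "(\<lambda>n. ((LINT y|M. u y * k (X n) y) - (LINT y|M. u y * k t0 y)) / (X n - t0)) \<longlonglongrightarrow> (LINT y|M. u y * k' t0 y)"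
  if X: "\<forall>n. X n \<noteq> t0" "X \<longlonglongrightarrow> t0" for X
 proof -
  have eq: "((LINT y|M. u y * k (X n) y) - (LINT y|M. u y * k t0 y)) / (X n - t0)
   = (LINT y|M. u y * ((k (X n) y - k t0 y) / (X n - t0)))" for n
   using Bochner_Integration.integral_diff[OF ki[of "X n"] ki[of t0]]
   by (simp add: right_diff_distrib[symmetric] )
  have "(\<lambda>n. LINT y|M. u y * ((k (X n) y - k t0 y) / (X n - t0))) \<longlonglongrightarrow> (LINT y|M. u y * k' t0 y)"
  proof (rule integral_dominated_convergence)
   show "integrable M (\<lambda>y. C * \<bar>u y\<bar>)" using u by simp
   show "AE y in M. (\<lambda>n. u y * ((k (X n) y - k t0 y) / (X n - t0))) \<longlonglongrightarrow> u y * k' t0 y"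
   proof (rule AE_I2)
    fix y
    have "((\<lambda>t. (k t y - k t0 y) / (t - t0)) \<longlongrightarrow> k' t0 y) (at t0)"
     using d[of y t0] by (simp add: has_field_derivative_iff)
    hence "(\<lambda>n. (k (X n) y - k t0 y) / (X n - t0)) \<longlonglongrightarrow> k' t0 y"
     using X by (auto simp: tendsto_at_iff_sequentially o_def)
    thus "(\<lambda>n. u y * ((k (X n) y - k t0 y) / (X n - t0))) \<longlonglongrightarrow> u y * k' t0 y"
     by (intro tendsto_intros)
   qed
   show "AE y in M. norm (u y * ((k (X n) y - k t0 y) / (X n - t0))) \<le> C * \<bar>u y\<bar>" for n
   proof (rule AE_I2)
    fix y
    \<comment> \<open>By the mean value inequality every difference quotient of the kernel is at
      most \<open>C\<close>, which gives the dominating function.\<close>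
    have "norm (k (X n) y - k t0 y) \<le> C * norm (X n - t0)"
     by (rule field_differentiable_bound[where S=UNIV and f'="\<lambda>t. k' t y"]) (use d bd in auto)
    hence "\<bar>(k (X n) y - k t0 y) / (X n - t0)\<bar> \<le> C"
     using X(1) by (simp add: abs_divide divide_le_eq)
    from mult_right_mono[OF this abs_ge_zero[of "u y"]]
    show "norm (u y * ((k (X n) y - k t0 y) / (X n - t0))) \<le> C * \<bar>u y\<bar>"
     by (metis abs_mult mult.commute real_norm_def)
   qed
  qed measurable
  thus ?thesis by (simp add: eq)
 qed
 thus ?thesis by (auto simp: has_field_derivative_iff tendsto_at_iff_sequentially o_def)
qed

lemma partial_bump_bounded:
 assumes "d > 0"
 obtains C where "\<And>z. \<bar>pd i (bump d 0) z\<bar> \<le> C"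
proof -
 have "continuous_on (cball 0 d) (pd i (bump d 0))"
  by (intro smooth_continuous smooth_partial_deriv smooth_bump)
 hence "bounded (pd i (bump d 0) ` cball 0 d)"
  by (intro compact_imp_bounded compact_continuous_image compact_cball)
 then obtain C where C: "\<And>z. z \<in> cball 0 d \<Longrightarrow> \<bar>pd i (bump d 0) z\<bar> \<le> C"
  unfolding bounded_iff by (auto simp del: mem_cball mem_cball_0)
 have "pd i (bump d 0) z = 0" if "z \<notin> cball 0 d" for z
 proof -
  have "((\<lambda>_. 0) has_derivative (\<lambda>_. 0)) (at z)" by simp
  moreover have "open (- cball (0::real^2) d)" by (simp add: open_Compl)
  ultimately have "(bump d 0 has_derivative (\<lambda>_. 0)) (at z)"
   by (rule has_derivative_transform_within_open) (use that assms bump_eq_0 in auto)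
  from partial_deriv_eq[OF this] show ?thesis .
 qed
 hence "\<bar>pd i (bump d 0) z\<bar> \<le> max C 0" for z using C[of z] by (cases "z \<in> cball 0 d") auto
 thus thesis by (rule that)
qed

text \<open>The kernel depends only on the difference of its arguments, so changing the variable of
  differentiation changes the sign. This sign cancels the one in the definition of a weak
  derivative.\<close>

lemma partial_deriv_bump: "pd a (bump d z) y = - pd a (bump d 0) (z - y)"
proof -
 have e: "bump d z = (\<lambda>y. bump d 0 (z - y))"
  by (simp add: bump_def fun_eq_iff norm_minus_commute)
 have i: "((\<lambda>y. z - y) has_derivative (\<lambda>v. - v)) (at y)" by (auto intro!: derivative_eq_intros)
 have "(bump d z has_derivative (\<lambda>v. \<Sum>j\<in>UNIV. (- v) $ j * pd j (bump d 0) (z - y))) (at y)"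
  unfolding e by (rule has_derivative_compose[OF i has_derivative_partial[OF smooth_differentiable[OF smooth_bump]]])
 from partial_deriv_eq[OF this, of a] show ?thesis
  by (simp add: axis_def if_distrib[of "\<lambda>x. x * _"] if_distrib[of uminus] sum.delta' cong: if_cong)
qed

definition weak_partial0 :: "(real^2) set \<Rightarrow> 2 \<Rightarrow> (real^2 \<Rightarrow> real) \<Rightarrow> (real^2 \<Rightarrow> real) \<Rightarrow> bool" where
 "weak_partial0 \<omega> i u v \<longleftrightarrow> (\<forall>f\<in>test_functions \<omega>.
    (LINT x|lborel. u x * pd i f x) = - (LINT x|lborel. v x * f x))"

text \<open>Differentiation under the integral puts the derivative on the kernel. When the closed
  \<open>d\<close>-ball around the point lies in \<open>\<omega>\<close>, the kernel centred there
  is a test function and the derivative passes to \<open>u\<close>. All later estimates use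
  derivatives of mollifications along lines.\<close>

lemma moll_line_deriv:
 assumes \<omega>: "open \<omega>" "bounded \<omega>" and u: "u \<in> L20 \<omega>"
  and v: "\<And>p. weak_partial0 \<omega> p u (v p)"
  and d: "d > 0" and sub: "cball (x + t *\<^sub>R a) d \<subseteq> \<omega>"
 shows "((\<lambda>t. moll d u (x + t *\<^sub>R a)) has_real_derivative
   (\<Sum>p\<in>UNIV. a $ p * moll d (v p) (x + t *\<^sub>R a))) (at t)"
proof -
 let ?P = "\<lambda>p. pd p (bump d 0)"
 let ?c = "bump_mass d"
 have ui: "integrable lborel u" using L20_integrable \<omega> u by blast
 note [measurable] = borel_measurable_integrable[OF ui]
 have "\<forall>p. \<exists>C. \<forall>z. \<bar>?P p z\<bar> \<le> C"
  using partial_bump_bounded[OF d] by meson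
 then obtain C where C: "\<And>p z. \<bar>?P p z\<bar> \<le> C p" by metis
 define k where "k s y = bump d (x + s *\<^sub>R a) y / ?c" for s y
 define k' where "k' s y = (\<Sum>p\<in>UNIV. a $ p * ?P p (x + s *\<^sub>R a - y)) / ?c" for s y
 have Pm [measurable]: "?P p \<in> borel_measurable borel" for p
  by (intro smooth_measurable smooth_partial_deriv smooth_bump)
 have "((\<lambda>t. LINT y|lborel. u y * k t y) has_real_derivative (LINT y|lborel. u y * k' t y)) (at t)"
 proof (rule DERIV_integral[OF ui, where C="(\<Sum>p\<in>UNIV. \<bar>a $ p\<bar> * C p) / ?c"])
  show "k s \<in> borel_measurable lborel" for s unfolding k_def by measurable
  show "k' t \<in> borel_measurable lborel" unfolding k'_def by measurable
  show "integrable lborel (\<lambda>y. u y * k s y)" for s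
   unfolding k_def using moll_kernel_integrable[OF d] ui by auto
  show "((\<lambda>t. k t y) has_real_derivative k' s y) (at s)" for s y
  proof -
   have "((\<lambda>t. bump d 0 ((x - y) + t *\<^sub>R a)) has_real_derivative
     (\<Sum>p\<in>UNIV. a $ p * ?P p ((x - y) + s *\<^sub>R a))) (at s)"
    by (rule line_deriv[OF smooth_differentiable[OF smooth_bump]])
   moreover have "bump d 0 ((x - y) + t *\<^sub>R a) = bump d (x + t *\<^sub>R a) y" for t
    by (subst bump_commute[of _ "x + t *\<^sub>R a"], subst (2) bump_shift) (simp add: algebra_simps)
   ultimately have "((\<lambda>t. bump d (x + t *\<^sub>R a) y) has_real_derivative
     (\<Sum>p\<in>UNIV. a $ p * ?P p (x + s *\<^sub>R a - y))) (at s)"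
    by (simp add: algebra_simps)
   from DERIV_cdivide[OF this, of ?c] show ?thesis by (simp add: k_def k'_def)
  qed
  show "\<bar>k' s y\<bar> \<le> (\<Sum>p\<in>UNIV. \<bar>a $ p\<bar> * C p) / ?c" for s y
  proof -
   have "\<bar>\<Sum>p\<in>UNIV. a $ p * ?P p (x + s *\<^sub>R a - y)\<bar> \<le> (\<Sum>p\<in>UNIV. \<bar>a $ p\<bar> * C p)"
    using C by (intro order_trans[OF sum_abs] sum_mono) (auto simp: abs_mult intro!: mult_left_mono)
   thus ?thesis using bump_mass_pos[OF d] by (simp add: k'_def divide_right_mono)
  qed
 qed
 moreover have "(LINT y|lborel. u y * k' t y) = (\<Sum>p\<in>UNIV. a $ p * moll d (v p) (x + t *\<^sub>R a))"
 proof -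
  let ?z = "x + t *\<^sub>R a"
  have i: "integrable lborel (\<lambda>y. u y * ?P p (?z - y))" for p
  proof (rule Bochner_Integration.integrable_bound)
   show "integrable lborel (\<lambda>y. C p * u y)" using ui by simp
   have "0 \<le> C p" using C[of p 0] by simp
   thus "AE y in lborel. norm (u y * ?P p (?z - y)) \<le> norm (C p * u y)"
    using C[of p] by (intro AE_I2) (simp add: abs_mult mult.commute[of "C p"] mult_left_mono)
  qed measurable
  have e: "(LINT y|lborel. u y * ?P p (?z - y)) = ?c * moll d (v p) ?z" for p
  proof -
   have "(LINT y|lborel. u y * ?P p (?z - y)) = - (LINT y|lborel. u y * pd p (bump d ?z) y)"
    unfolding partial_deriv_bump[of p d ?z] by simp
   also have "\<dots> = (LINT y|lborel. v p y * bump d ?z y)"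
    using v[of p] bump_test_function[OF d sub] by (simp add: weak_partial0_def)
   finally show ?thesis using bump_mass_pos[OF d] by (simp add: moll_def)
  qed
  have "(LINT y|lborel. u y * k' t y) = (LINT y|lborel. (\<Sum>p\<in>UNIV. (a $ p / ?c) * (u y * ?P p (?z - y))))"
   by (simp add: k'_def sum_divide_distrib sum_distrib_left mult_ac)
  also have "\<dots> = (\<Sum>p\<in>UNIV. (a $ p / ?c) * (LINT y|lborel. u y * ?P p (?z - y)))"
   using i by (subst Bochner_Integration.integral_sum) auto
  finally show ?thesis using bump_mass_pos[OF d] by (simp add: e)
 qed
 ultimately show ?thesis by (simp add: moll_def[abs_def] k_def)
qed

lemma moll_continuous:
 assumes ui: "integrable lborel u" and d: "d > 0"
 shows "continuous_on UNIV (moll d u)"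
proof (rule continuous_at_imp_continuous_on, rule ballI)
 fix x
 note [measurable] = borel_measurable_integrable[OF ui]
 show "isCont (moll d u) x"
 proof (rule continuous_at_sequentiallyI)
  fix X assume X: "X \<longlonglongrightarrow> x"
  show "(\<lambda>n. moll d u (X n)) \<longlonglongrightarrow> moll d u x"
   unfolding moll_def
  proof (rule integral_dominated_convergence)
   show "integrable lborel (\<lambda>y. \<bar>u y\<bar> * (1 / bump_mass d))" using ui by simp
   show "AE y in lborel. (\<lambda>n. u y * (bump d (X n) y / bump_mass d)) \<longlonglongrightarrow> u y * (bump d x y / bump_mass d)"
   proof (rule AE_I2)
    fix y
    have "isCont (bump d y) x"
     using smooth_differentiable[OF smooth_bump] by (rule differentiable_imp_continuous_within)
    hence "(\<lambda>n. bump d y (X n)) \<longlonglongrightarrow> bump d y x" using X by (rule isCont_tendsto_compose)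
    thus "(\<lambda>n. u y * (bump d (X n) y / bump_mass d)) \<longlonglongrightarrow> u y * (bump d x y / bump_mass d)"
     using bump_mass_pos[OF d] by (intro tendsto_intros) (auto simp: bump_commute)
   qed
   show "AE y in lborel. norm (u y * (bump d (X n) y / bump_mass d)) \<le> \<bar>u y\<bar> * (1 / bump_mass d)" for n
    using bump_mass_pos[OF d] bump_le_1 bump_nonneg
    by (intro AE_I2) (auto simp: abs_mult divide_right_mono mult_left_le)
  qed measurable
 qed
qed

section \<open>Weak derivatives\<close>

locale planar_domain =
 fixes \<omega> :: "(real^2) set"
 assumes open_dom: "open \<omega>" and bounded_dom: "bounded \<omega>"
begin

abbreviation M where "M \<equiv> lebesgue_on \<omega>"
abbreviation wd where "wd \<equiv> weak_partial \<omega>"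
abbreviation has_wd where "has_wd \<equiv> has_weak_partial \<omega>"
abbreviation nm where "nm \<equiv> l2norm M"

lemma dom_borel [measurable]: "\<omega> \<in> sets borel"
 using open_dom by simp

lemma dom_lebesgue [measurable]: "\<omega> \<in> sets lebesgue"
 using dom_borel by auto

lemma finite_dom: "emeasure lebesgue \<omega> < \<infinity>"
 using emeasure_bounded_finite[OF bounded_dom] dom_borel by simp

lemma finite_measure_dom: "finite_measure M"
 using finite_dom by (intro finite_measureI) (simp add: emeasure_restrict_space)

text \<open>Points at distance more than \<open>d\<close> from the complement; mollification with
  radius at most \<open>d\<close> sees only \<open>\<omega>\<close> there.\<close>

definition inset :: "real \<Rightarrow> (real^2) set" where
 "inset d = {x. d < infdist x (- \<omega>)}"

lemma open_inset: "open (inset d)"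
 unfolding inset_def by (intro open_Collect_less continuous_intros)

lemma inset_borel [measurable]: "inset d \<in> sets borel"
 using open_inset by simp

lemma compl_dom_nonempty: "- \<omega> \<noteq> {}"
 using bounded_dom not_bounded_UNIV[where ?'a = "real^2"] by (metis Compl_empty_eq double_complement)

lemma inset_cball: "x \<in> inset d \<Longrightarrow> cball x d \<subseteq> \<omega>"
 using infdist_le[of _ "- \<omega>" x] by (fastforce simp: inset_def)

lemma cball_inset: "cball x d' \<subseteq> \<omega> \<Longrightarrow> d < d' \<Longrightarrow> x \<in> inset d"
proof -
 assume a: "cball x d' \<subseteq> \<omega>" "d < d'"
 have "d' \<le> infdist x (- \<omega>)"
  unfolding infdist_notempty[OF compl_dom_nonempty]
  by (rule cINF_greatest[OF compl_dom_nonempty]) (use a in force)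
 thus ?thesis using a by (simp add: inset_def)
qed

lemma inset_subset: "0 \<le> d \<Longrightarrow> inset d \<subseteq> \<omega>"
 using inset_cball by (meson centre_in_cball subset_iff)

lemma inset_mono: "d \<le> d' \<Longrightarrow> inset d' \<subseteq> inset d"
 by (auto simp: inset_def)

lemma inset_shift: "x \<in> inset d \<Longrightarrow> dist x y \<le> r \<Longrightarrow> y \<in> inset (d - r)"
 using infdist_triangle[of x "- \<omega>" y] by (auto simp: inset_def)

lemma Union_inset: "(\<Union>n. inset (1 / Suc n)) = \<omega>"
proof
 show "(\<Union>n. inset (1 / Suc n)) \<subseteq> \<omega>" by (intro UN_least inset_subset) simp
 show "\<omega> \<subseteq> (\<Union>n. inset (1 / Suc n))"
 proof
  fix x assume "x \<in> \<omega>"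
  hence "infdist x (- \<omega>) > 0"
   using infdist_pos_not_in_closed[of "- \<omega>" x] open_dom compl_dom_nonempty by auto
  then obtain n where "1 / Suc n < infdist x (- \<omega>)" using nat_approx_posE by metis
  thus "x \<in> (\<Union>n. inset (1 / Suc n))" by (auto simp: inset_def)
 qed
qed

section \<open>Borel representatives\<close>

lemma lborel_measurable_dom:
 "v \<in> borel_measurable borel \<Longrightarrow> v \<in> borel_measurable M" for v :: "real^2 \<Rightarrow> real"
 by (intro measurable_restrict_space1 measurable_completion) simp

text \<open>The extension by zero is Lebesgue measurable and agrees almost everywhere with a Borel
  function, which is cut off once more because it may be nonzero on a null set outside
  \<open>\<omega>\<close>.\<close>

lemma borel_representative:
 fixes u :: "real^2 \<Rightarrow> real"
 assumes "u \<in> borel_measurable M"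
 obtains v where "v \<in> borel_measurable borel" "\<forall>x. x \<notin> \<omega> \<longrightarrow> v x = 0" "AE x in M. u x = v x"
proof -
 have "(\<lambda>x. if x \<in> \<omega> then u x else 0) \<in> borel_measurable lebesgue"
  using assms dom_lebesgue by (rule borel_measurable_if_I)
 from completion_ex_borel_measurable_real[OF this]
 obtain g where g: "g \<in> borel_measurable lborel" "AE x in lborel. (if x \<in> \<omega> then u x else 0) = g x" by auto
 show thesis
 proof (rule that)
  show "(\<lambda>x. g x * indicator \<omega> x) \<in> borel_measurable borel"
   using g(1) by (intro borel_measurable_times borel_measurable_indicator) auto
  have "AE x in lebesgue. x \<in> \<omega> \<longrightarrow> u x = g x * indicator \<omega> x"
   using AE_completion[OF g(2)] by eventually_elim auto
  thus "AE x in M. u x = g x * indicator \<omega> x"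
   by (subst AE_restrict_space_iff) auto
 qed auto
qed

text \<open>The bridge between two settings: the Sobolev spaces use Lebesgue measurable functions on
  \<open>\<omega>\<close>, mollification uses Borel functions on the plane.\<close>

lemma integral_dom_eq:
 fixes v w :: "real^2 \<Rightarrow> real"
 assumes v: "v \<in> borel_measurable borel" "\<And>x. x \<notin> \<omega> \<Longrightarrow> v x = 0"
  and w: "w \<in> borel_measurable M" "AE x in M. w x = v x"
 shows "(LINT x|M. w x) = (LINT x|lborel. v x)"
  "integrable M w \<longleftrightarrow> integrable lborel v"
proof -
 have i: "indicator \<omega> x * v x = v x" for x using v(2)[of x] by (cases "x \<in> \<omega>") auto
 have vm: "v \<in> borel_measurable M" using lborel_measurable_dom[OF v(1)] .
 have "(LINT x|M. w x) = (LINT x|M. v x)"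
  by (rule integral_cong_AE[OF w(1) vm w(2)])
 also have "\<dots> = (LINT x|lebesgue. v x)"
  by (subst integral_restrict_space) (auto simp: i)
 also have "\<dots> = (LINT x|lborel. v x)"
  using v(1) by (intro integral_completion) simp
 finally show "(LINT x|M. w x) = (LINT x|lborel. v x)" .
 have "integrable M w \<longleftrightarrow> integrable M v"
  by (rule integrable_cong_AE[OF w(1) vm w(2)])
 also have "\<dots> \<longleftrightarrow> integrable lebesgue v"
  by (subst integrable_restrict_space) (auto simp: i)
 also have "\<dots> \<longleftrightarrow> integrable lborel v"
  using v(1) by (intro integrable_completion) simp
 finally show "integrable M w \<longleftrightarrow> integrable lborel v" .
qed

lemma L2_representative:
 assumes "u \<in> L2 M"
 obtains v where "v \<in> L20 \<omega>" "AE x in M. u x = v x"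
proof -
 obtain v where v: "v \<in> borel_measurable borel" "\<forall>x. x \<notin> \<omega> \<longrightarrow> v x = 0" "AE x in M. u x = v x"
  by (rule borel_representative[OF L2_measurable[OF assms]])
 have "integrable M (\<lambda>x. (u x)^2) \<longleftrightarrow> integrable lborel (\<lambda>x. (v x)^2)"
 proof (rule integral_dom_eq(2))
  show "AE x in M. (u x)^2 = (v x)^2" using v(3) by eventually_elim simp
 qed (use v(1,2) L2_measurable[OF assms] in auto)
 hence "v \<in> L20 \<omega>" using v L2_square_integrable[OF assms] by (auto simp: L20_def L2_def)
 with v(3) that show thesis by blast
qed

lemma L20_imp_L2:
 assumes "v \<in> L20 \<omega>"
 shows "v \<in> L2 M"
proof -
 have v: "v \<in> borel_measurable borel" "integrable lborel (\<lambda>x. (v x)^2)" "\<And>x. x \<notin> \<omega> \<Longrightarrow> v x = 0"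
  using assms by (auto simp: L20_def L2_def)
 note m = lborel_measurable_dom[OF v(1)]
 have "integrable M (\<lambda>x. (v x)^2) \<longleftrightarrow> integrable lborel (\<lambda>x. (v x)^2)"
  by (rule integral_dom_eq(2)) (use v m in auto)
 with v(2) m show ?thesis by (simp add: L2_def)
qed

lemma l2norm_dom_eq:
 assumes "u \<in> borel_measurable M" "v \<in> borel_measurable borel" "\<And>x. x \<notin> \<omega> \<Longrightarrow> v x = 0"
  "AE x in M. u x = v x"
 shows "nm u = l2norm lborel v"
 unfolding l2norm_def
proof (rule arg_cong[where f=sqrt], rule integral_dom_eq(1))
 show "AE x in M. (u x)^2 = (v x)^2" using assms(4) by eventually_elim simp
qed (use assms(1-3) in auto)

lemma AE_dom_iff:
 "(AE x in lborel. x \<in> \<omega> \<longrightarrow> P x) \<Longrightarrow> (AE x in M. P x)"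
 by (subst AE_restrict_space_iff) (auto dest: AE_completion)

lemma continuous_L2:
 fixes h :: "real^2 \<Rightarrow> real"
 assumes "continuous_on UNIV h"
 shows "h \<in> L2 M"
proof -
 have "compact (closure \<omega>)" using bounded_dom by simp
 hence "bounded (h ` closure \<omega>)"
  using assms by (intro compact_imp_bounded compact_continuous_image) (auto intro: continuous_on_subset)
 then obtain C where C: "\<And>x. x \<in> closure \<omega> \<Longrightarrow> \<bar>h x\<bar> \<le> C" by (auto simp: bounded_iff)
 show ?thesis
 proof (rule L2_bound[OF L2_const[OF finite_measure_dom, of C]])
  show "h \<in> borel_measurable M"
   using borel_measurable_continuous_onI[OF assms] by (rule lborel_measurable_dom)
  show "AE x in M. \<bar>h x\<bar> \<le> \<bar>C\<bar>"
  proof (rule AE_I2)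
   fix x assume "x \<in> space M"
   hence "x \<in> closure \<omega>" using closure_subset by auto
   thus "\<bar>h x\<bar> \<le> \<bar>C\<bar>" using C[of x] by linarith
  qed
 qed
qed

lemma smooth_L2: "smooth h \<Longrightarrow> h \<in> L2 M"
 using continuous_L2 smooth_continuous by blast

lemma test_function_smooth: "f \<in> test_functions \<omega> \<Longrightarrow> smooth f"
 by (simp add: test_functions_def)

lemma test_function_L2:
 assumes "f \<in> test_functions \<omega>"
 shows "f \<in> L2 M" "pd i f \<in> L2 M"
 using smooth_L2[OF test_function_smooth[OF assms]]
  smooth_L2[OF smooth_partial_deriv[OF test_function_smooth[OF assms]]] by auto

lemma test_function_partial:
 assumes f: "f \<in> test_functions \<omega>"
 shows "pd i f \<in> test_functions \<omega>"
proof -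
 have "pd i f x = 0" if x: "x \<notin> closure {x. f x \<noteq> 0}" for x
 proof -
  have "((\<lambda>_. 0) has_derivative (\<lambda>_. 0)) (at x)" by simp
  moreover have "open (- closure {x. f x \<noteq> 0})" by (simp add: open_Compl)
  ultimately have "(f has_derivative (\<lambda>_. 0)) (at x)"
  proof (rule has_derivative_transform_within_open)
   show "x \<in> - closure {x. f x \<noteq> 0}" using x by simp
   fix y assume "y \<in> - closure {x. f x \<noteq> 0}"
   thus "0 = f y" using closure_subset[of "{x. f x \<noteq> 0}"] by auto
  qed
  from partial_deriv_eq[OF this] show ?thesis .
 qed
 hence "closure {x. pd i f x \<noteq> 0} \<subseteq> closure {x. f x \<noteq> 0}"
  by (intro closure_minimal) auto
 moreover from this f have "compact (closure {x. pd i f x \<noteq> 0})"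
  unfolding test_functions_def compact_eq_bounded_closed by (auto intro: bounded_subset)
 ultimately show ?thesis using f by (auto simp: test_functions_def smooth_partial_deriv)
qed

lemma weak_partial0_iff:
 assumes "u \<in> borel_measurable M" "u0 \<in> L20 \<omega>" "AE x in M. u x = u0 x"
  and "v \<in> borel_measurable M" "v0 \<in> L20 \<omega>" "AE x in M. v x = v0 x"
 shows "has_wd i u v \<longleftrightarrow> weak_partial0 \<omega> i u0 v0"
proof -
 have *: "(LINT x|M. u x * h x) = (LINT x|lborel. u0 x * h x)"
  if "smooth h" "u \<in> borel_measurable M" "u0 \<in> L20 \<omega>" "AE x in M. u x = u0 x"
  for h u u0
 proof (rule integral_dom_eq(1))
  show "(\<lambda>x. u0 x * h x) \<in> borel_measurable borel"
   using that smooth_measurable[OF that(1)] by (auto simp: L20_def L2_def)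
  show "(\<lambda>x. u x * h x) \<in> borel_measurable M"
   using that lborel_measurable_dom[OF smooth_measurable[OF that(1)]] by simp
  show "AE x in M. u x * h x = u0 x * h x" using that(4) by eventually_elim simp
 qed (use that in \<open>auto simp: L20_def\<close>)
 show ?thesis unfolding has_weak_partial_def weak_partial0_def
  by (rule ball_cong[OF refl])
   (simp only: *[OF smooth_partial_deriv[OF test_function_smooth] assms(1-3)] *[OF test_function_smooth assms(4-6)])
qed

text \<open>The fundamental lemma of the calculus of variations. On \<open>inset d\<close> the
  kernels of radius at most \<open>d\<close> are test functions, so the mollifications of
  \<open>w\<close> vanish there, and they converge to \<open>w\<close>.\<close>

lemma L20_zero_if_test:
 assumes w: "w \<in> L20 \<omega>" and z: "\<And>f. f \<in> test_functions \<omega> \<Longrightarrow> (LINT x|lborel. w x * f x) = 0"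
 shows "AE x in lborel. w x = 0"
proof -
 have w2: "w \<in> L2 lborel" and wz: "\<And>x. x \<notin> \<omega> \<Longrightarrow> w x = 0" using w by (auto simp: L20_def)
 have [measurable]: "w \<in> borel_measurable borel" using L2_lborel_measurable[OF w2] .
 have "AE x in lborel. x \<in> inset d \<longrightarrow> w x = 0" if d: "d > 0" for d
 proof -
  define h where "h n = d / Suc n" for n
  have h0: "h n > 0" "h n \<le> d" for n using d by (auto simp: h_def field_simps)
  have "h \<longlonglongrightarrow> 0"
   unfolding h_def using tendsto_mult_right_zero[OF LIMSEQ_Suc[OF lim_1_over_n], of d] by simp
  from moll_tendsto[OF open_dom bounded_dom w inset_borel d inset_cball h0(1) this]
  have l: "(\<lambda>n. l2norm lborel (\<lambda>x. indicator (inset d) x * (moll (h n) w x - w x))) \<longlonglongrightarrow> 0" .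
  have "moll (h n) w x = 0" if x: "x \<in> inset d" for n x
  proof -
   have "bump (h n) x \<in> test_functions \<omega>"
    using h0(1) order_trans[OF subset_cball[OF h0(2)] inset_cball[OF x]] by (rule bump_test_function)
   from z[OF this] show ?thesis by (simp add: moll_def)
  qed
  \<comment> \<open>The sequence of differences is constant, equal to minus \<open>w\<close> on the
    inset, and its norms tend to zero.\<close>
  hence e: "(\<lambda>x. indicator (inset d) x * (moll (h n) w x - w x)) = (\<lambda>x. - 1 * (indicator (inset d) x * w x))" for n
   by (auto simp: indicator_def fun_eq_iff)
  have "l2norm lborel (\<lambda>x. indicator (inset d) x * w x) = 0"
   using l unfolding e l2norm_scale by (simp add: LIMSEQ_const_iff)
  moreover have "(\<lambda>x. indicator (inset d) x * w x) \<in> L2 lborel"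
   by (rule L2_bound[OF w2]) (auto simp: indicator_def)
  ultimately have "AE x in lborel. indicator (inset d) x * w x = 0" using l2norm_eq_0 by blast
  thus ?thesis by eventually_elim auto
 qed
 hence "AE x in lborel. \<forall>n::nat. x \<in> inset (1 / Suc n) \<longrightarrow> w x = 0"
  by (subst AE_all_countable) auto
 thus ?thesis
 proof eventually_elim
  fix x assume "\<forall>n::nat. x \<in> inset (1 / Suc n) \<longrightarrow> w x = 0"
  thus "w x = 0" using wz[of x] Union_inset by (cases "x \<in> \<omega>") auto
 qed
qed

text \<open>Besides uniqueness of weak derivatives this yields the symmetry of second weak
  derivatives, which is why the hypothesis compares integrals against test functions and mentions no
  derivative.\<close>

lemma has_weak_partial_unique:
 assumes v: "v \<in> L2 M" and v': "v' \<in> L2 M"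
  and eq: "\<And>f. f \<in> test_functions \<omega> \<Longrightarrow> (LINT x|M. v x * f x) = (LINT x|M. v' x * f x)"
 shows "AE x in M. v x = v' x"
proof -
 have d: "(\<lambda>x. v x - v' x) \<in> L2 M" using v v' by (rule L2_diff)
 obtain w where w: "w \<in> L20 \<omega>" "AE x in M. v x - v' x = w x" by (rule L2_representative[OF d])
 have "AE x in lborel. w x = 0"
 proof (rule L20_zero_if_test[OF w(1)])
  fix f assume f: "f \<in> test_functions \<omega>"
  have p2: "f \<in> L2 M" using test_function_L2 f by blast
  have pm: "f \<in> borel_measurable borel" using smooth_measurable test_function_smooth[OF f] by blast
  have "(LINT x|lborel. w x * f x) = (LINT x|M. (v x - v' x) * f x)"
  proof (rule integral_dom_eq(1)[symmetric])
   show "(\<lambda>x. w x * f x) \<in> borel_measurable borel"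
    using w(1) pm by (auto simp: L20_def L2_def)
   show "(\<lambda>x. (v x - v' x) * f x) \<in> borel_measurable M"
    using L2_measurable[OF d] L2_measurable[OF p2] by simp
   show "AE x in M. (v x - v' x) * f x = w x * f x"
    using w(2) by eventually_elim simp
  qed (use w in \<open>auto simp: L20_def\<close>)
  also have "\<dots> = 0"
   using eq[OF f] L2_mult_integrable[OF v p2] L2_mult_integrable[OF v' p2] by (simp add: left_diff_distrib)
  finally show "(LINT x|lborel. w x * f x) = 0" .
 qed
 hence "AE x in M. w x = 0" by (intro AE_dom_iff) auto
 with w(2) show ?thesis by eventually_elim simp
qed

lemma has_weak_partial_AE_cong:
 assumes "u \<in> borel_measurable M" "u' \<in> borel_measurable M"
  "AE x in M. u x = u' x" "has_wd i u v"
 shows "has_wd i u' v"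
 unfolding has_weak_partial_def
proof
 fix f assume f: "f \<in> test_functions \<omega>"
 have "(LINT x|M. u' x * pd i f x) = (LINT x|M. u x * pd i f x)"
  using assms L2_measurable[OF test_function_L2(2)[OF f, of i]]
  by (intro integral_cong_AE) (auto elim!: eventually_mono)
 thus "(LINT x|M. u' x * pd i f x) = - (LINT x|M. v x * f x)"
  using assms(4) f by (simp add: has_weak_partial_def)
qed

section \<open>Weak derivatives of sums, representatives and limits\<close>

lemma H1_L2: "u \<in> H1 \<omega> \<Longrightarrow> u \<in> L2 M"
 by (simp add: H1_def)

lemma weak_partial_works:
 assumes "u \<in> H1 \<omega>"
 shows "wd i u \<in> L2 M" "has_wd i u (wd i u)"
proof -
 have "\<exists>v. v \<in> L2 M \<and> has_wd i u v" using assms by (auto simp: H1_def)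
 from someI_ex[OF this] show "wd i u \<in> L2 M" "has_wd i u (wd i u)"
  by (auto simp: weak_partial_def)
qed

lemma weak_partial_AE_eq:
 assumes "v \<in> L2 M" "has_wd i u v"
 shows "AE x in M. wd i u x = v x"
proof -
 have "\<exists>v. v \<in> L2 M \<and> has_wd i u v" using assms by auto
 from someI_ex[OF this] have "wd i u \<in> L2 M" "has_wd i u (wd i u)"
  by (auto simp: weak_partial_def)
 with assms show ?thesis by (intro has_weak_partial_unique) (auto simp: has_weak_partial_def)
qed

lemma H1_I:
 assumes "u \<in> L2 M" "\<And>i. v i \<in> L2 M" "\<And>i. has_wd i u (v i)"
 shows "u \<in> H1 \<omega>"
 using assms by (auto simp: H1_def)

lemma has_weak_partial_sum:
 assumes "\<And>k. k \<in> K \<Longrightarrow> u k \<in> L2 M" "\<And>k. k \<in> K \<Longrightarrow> v k \<in> L2 M"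
  "\<And>k. k \<in> K \<Longrightarrow> has_wd i (u k) (v k)"
 shows "has_wd i (\<lambda>x. \<Sum>k\<in>K. c k * u k x) (\<lambda>x. \<Sum>k\<in>K. c k * v k x)"
 unfolding has_weak_partial_def
proof
 fix f assume f: "f \<in> test_functions \<omega>"
 have "(LINT x|M. (\<Sum>k\<in>K. c k * u k x) * pd i f x)
   = (\<Sum>k\<in>K. c k * (LINT x|M. u k x * pd i f x))"
  unfolding sum_distrib_right mult.assoc
  using L2_mult_integrable[OF assms(1) test_function_L2(2)[OF f]]
  by (subst Bochner_Integration.integral_sum) auto
 moreover have "(LINT x|M. (\<Sum>k\<in>K. c k * v k x) * f x)
   = (\<Sum>k\<in>K. c k * (LINT x|M. v k x * f x))"
  unfolding sum_distrib_right mult.assoc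
  using L2_mult_integrable[OF assms(2) test_function_L2(1)[OF f]]
  by (subst Bochner_Integration.integral_sum) auto
 ultimately show "(LINT x|M. (\<Sum>k\<in>K. c k * u k x) * pd i f x)
   = - (LINT x|M. (\<Sum>k\<in>K. c k * v k x) * f x)"
  using assms(3) f by (simp add: has_weak_partial_def sum_negf)
qed

lemma H1_sum:
 assumes "\<And>k. k \<in> K \<Longrightarrow> u k \<in> H1 \<omega>"
 shows "(\<lambda>x. \<Sum>k\<in>K. c k * u k x) \<in> H1 \<omega>"
  "AE x in M. wd i (\<lambda>x. \<Sum>k\<in>K. c k * u k x) x = (\<Sum>k\<in>K. c k * wd i (u k) x)"
proof -
 let ?s = "\<lambda>x. \<Sum>k\<in>K. c k * u k x"
 have w: "has_wd i ?s (\<lambda>x. \<Sum>k\<in>K. c k * wd i (u k) x)" for i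
  using assms by (intro has_weak_partial_sum) (auto simp: weak_partial_works H1_L2)
 have l: "(\<lambda>x. \<Sum>k\<in>K. c k * wd i (u k) x) \<in> L2 M" for i
  using assms by (intro L2_sum L2_scale) (auto simp: weak_partial_works)
 show "?s \<in> H1 \<omega>"
  by (rule H1_I[OF _ l w]) (intro L2_sum L2_scale H1_L2 assms)
 show "AE x in M. wd i ?s x = (\<Sum>k\<in>K. c k * wd i (u k) x)"
  by (rule weak_partial_AE_eq[OF l w])
qed

lemma H1_combination:
 assumes "u \<in> H1 \<omega>" "v \<in> H1 \<omega>"
 shows "(\<lambda>x. a * u x + b * v x) \<in> H1 \<omega>"
  "AE x in M. wd i (\<lambda>x. a * u x + b * v x) x = a * wd i u x + b * wd i v x"
proof -
 \<comment> \<open>Indexing the two summands by \<open>bool\<close> makes this an instance of the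
   finite sum.\<close>
 have "\<And>k. k \<in> UNIV \<Longrightarrow> (if k then u else v) \<in> H1 \<omega>" using assms by simp
 note s = H1_sum[of UNIV "\<lambda>k. if k then u else v", OF this, where c = "\<lambda>k. if k then a else b"]
 show "(\<lambda>x. a * u x + b * v x) \<in> H1 \<omega>" using s(1) by (simp add: UNIV_bool add.commute)
 show "AE x in M. wd i (\<lambda>x. a * u x + b * v x) x = a * wd i u x + b * wd i v x"
  using s(2)[where i=i] by (simp add: UNIV_bool add.commute)
qed

lemma H1_diff:
 assumes "u \<in> H1 \<omega>" "v \<in> H1 \<omega>"
 shows "(\<lambda>x. u x - v x) \<in> H1 \<omega>"
  "AE x in M. wd i (\<lambda>x. u x - v x) x = wd i u x - wd i v x"
 using H1_combination(1)[OF assms, of 1 "-1"] H1_combination(2)[OF assms, where a=1 and b="-1" and i=i] by simp_all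

lemma H1_AE_cong:
 assumes "u \<in> H1 \<omega>" "u' \<in> borel_measurable M" "AE x in M. u x = u' x"
 shows "u' \<in> H1 \<omega>" "AE x in M. wd i u' x = wd i u x"
proof -
 have w: "has_wd i u' (wd i u)" for i
  using has_weak_partial_AE_cong[OF L2_measurable[OF H1_L2[OF assms(1)]] assms(2,3)] weak_partial_works(2)[OF assms(1)] .
 show "u' \<in> H1 \<omega>"
  by (rule H1_I[OF _ _ w]) (use weak_partial_works[OF assms(1)] L2_AE_cong[OF H1_L2[OF assms(1)] assms(2,3)] in auto)
 show "AE x in M. wd i u' x = wd i u x"
  by (rule weak_partial_AE_eq[OF weak_partial_works(1)[OF assms(1)] w])
qed

lemma H2_H1: "u \<in> H2 \<omega> \<Longrightarrow> u \<in> H1 \<omega>" "u \<in> H2 \<omega> \<Longrightarrow> wd i u \<in> H1 \<omega>"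
 by (auto simp: H2_def)

text \<open>\<open>wd\<close> is a chosen representative and \<open>H2 \<omega>\<close> speaks of
  the chosen first derivatives; any other candidates \<open>v\<close> agree with them almost
  everywhere.\<close>

lemma H2_I:
 assumes u: "u \<in> L2 M" and v: "\<And>i. v i \<in> H1 \<omega>" and w: "\<And>i. has_wd i u (v i)"
 shows "u \<in> H2 \<omega>"
  "AE x in M. wd i (wd j u) x = wd i (v j) x"
proof -
 have u1: "u \<in> H1 \<omega>" using H1_I[OF u H1_L2[OF v] w] .
 have e: "AE x in M. v i x = wd i u x" for i
  using weak_partial_AE_eq[OF H1_L2[OF v] w, of i] by eventually_elim simp
 note m = L2_measurable[OF weak_partial_works(1)[OF u1]]
 show "u \<in> H2 \<omega>" using u1 H1_AE_cong(1)[OF v m e] by (simp add: H2_def)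
 show "AE x in M. wd i (wd j u) x = wd i (v j) x"
  using H1_AE_cong(2)[OF v m e] .
qed

lemma H2_sum:
 assumes "\<And>k. k \<in> K \<Longrightarrow> u k \<in> H2 \<omega>"
 shows "(\<lambda>x. \<Sum>k\<in>K. c k * u k x) \<in> H2 \<omega>"
  "AE x in M. wd i (wd j (\<lambda>x. \<Sum>k\<in>K. c k * u k x)) x
   = (\<Sum>k\<in>K. c k * wd i (wd j (u k)) x)"
proof -
 let ?s = "\<lambda>x. \<Sum>k\<in>K. c k * u k x"
 have v: "(\<lambda>x. \<Sum>k\<in>K. c k * wd i (u k) x) \<in> H1 \<omega>" for i
  using assms by (intro H1_sum) (auto simp: H2_H1)
 have w: "has_wd i ?s (\<lambda>x. \<Sum>k\<in>K. c k * wd i (u k) x)" for i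
  using assms by (intro has_weak_partial_sum) (auto simp: weak_partial_works H1_L2 H2_H1)
 have l: "?s \<in> L2 M"
  using assms by (intro L2_sum L2_scale H1_L2 H2_H1)
 show "?s \<in> H2 \<omega>" by (rule H2_I(1)[OF l v w])
 have "AE x in M. wd i (\<lambda>x. \<Sum>k\<in>K. c k * wd j (u k) x) x
   = (\<Sum>k\<in>K. c k * wd i (wd j (u k)) x)"
  using assms by (intro H1_sum(2)) (auto simp: H2_H1)
 with H2_I(2)[OF l v w, of i j]
 show "AE x in M. wd i (wd j ?s) x
   = (\<Sum>k\<in>K. c k * wd i (wd j (u k)) x)"
  by eventually_elim simp
qed

lemma H2_combination:
 assumes "u \<in> H2 \<omega>" "v \<in> H2 \<omega>"
 shows "(\<lambda>x. a * u x + b * v x) \<in> H2 \<omega>"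
  "AE x in M. wd i (wd j (\<lambda>x. a * u x + b * v x)) x
  = a * wd i (wd j u) x + b * wd i (wd j v) x"
proof -
 have "\<And>k. k \<in> UNIV \<Longrightarrow> (if k then u else v) \<in> H2 \<omega>" using assms by simp
 note s = H2_sum[of UNIV "\<lambda>k. if k then u else v", OF this, where c = "\<lambda>k. if k then a else b"]
 show "(\<lambda>x. a * u x + b * v x) \<in> H2 \<omega>" using s(1) by (simp add: UNIV_bool add.commute)
 show "AE x in M. wd i (wd j (\<lambda>x. a * u x + b * v x)) x = a * wd i (wd j u) x + b * wd i (wd j v) x"
  using s(2)[where i=i and j=j] by (simp add: UNIV_bool add.commute)
qed

lemma H2_diff:
 assumes "u \<in> H2 \<omega>" "v \<in> H2 \<omega>"
 shows "(\<lambda>x. u x - v x) \<in> H2 \<omega>"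
  "AE x in M. wd i (wd j (\<lambda>x. u x - v x)) x
   = wd i (wd j u) x - wd i (wd j v) x"
 using H2_combination(1)[OF assms, of 1 "-1"] H2_combination(2)[OF assms, where a=1 and b="-1" and i=i and j=j] by simp_all

text \<open>For a fixed test function both sides of the defining identity are continuous in
  L2.\<close>

lemma has_weak_partial_limit:
 assumes "\<And>n. u n \<in> L2 M" "u' \<in> L2 M"
  "\<And>n. v n \<in> L2 M" "v' \<in> L2 M"
  "\<And>n. has_wd i (u n) (v n)"
  "(\<lambda>n. nm (\<lambda>x. u n x - u' x)) \<longlonglongrightarrow> 0"
  "(\<lambda>n. nm (\<lambda>x. v n x - v' x)) \<longlonglongrightarrow> 0"
 shows "has_wd i u' v'"
 unfolding has_weak_partial_def
proof
 fix f assume f: "f \<in> test_functions \<omega>"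
 have "(\<lambda>n. LINT x|M. u n x * pd i f x) \<longlonglongrightarrow> (LINT x|M. u' x * pd i f x)"
  using assms test_function_L2[OF f] by (intro L2_inner_tendsto) auto
 moreover have "(\<lambda>n. - (LINT x|M. v n x * f x)) \<longlonglongrightarrow> - (LINT x|M. v' x * f x)"
  using assms test_function_L2[OF f] by (intro tendsto_minus L2_inner_tendsto) auto
 moreover have "(LINT x|M. u n x * pd i f x) = - (LINT x|M. v n x * f x)" for n
  using assms(5) f by (simp add: has_weak_partial_def)
 ultimately show "(LINT x|M. u' x * pd i f x) = - (LINT x|M. v' x * f x)"
  using LIMSEQ_unique by simp
qed

text \<open>Both derivatives are moved to the test function, where they commute.\<close>

lemma weak_partial_commute:
 assumes u: "u \<in> H2 \<omega>"
 shows "AE x in M. wd i (wd j u) x = wd j (wd i u) x"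
proof (rule has_weak_partial_unique)
 have *: "(LINT x|M. wd i (wd j u) x * f x)
   = (LINT x|M. u x * pd j (pd i f) x)"
  if f: "f \<in> test_functions \<omega>" for i j f
  using weak_partial_works(2)[OF H2_H1(2)[OF u], of i j] weak_partial_works(2)[OF H2_H1(1)[OF u], of j]
   f test_function_partial[OF f, of i] by (simp add: has_weak_partial_def)
 fix f assume f: "f \<in> test_functions \<omega>"
 show "(LINT x|M. wd i (wd j u) x * f x)
   = (LINT x|M. wd j (wd i u) x * f x)"
  unfolding *[OF f] partial_deriv_commute[OF test_function_smooth[OF f], of i j] ..
qed (use weak_partial_works H2_H1[OF u] in auto)

end

section \<open>The Ladyzhenskaya inequality on a Lipschitz domain\<close>

definition det2 :: "real^2 \<Rightarrow> real^2 \<Rightarrow> real" where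
 "det2 a b = a $ 1 * b $ 2 - b $ 1 * a $ 2"

lemma measurable_plane:
 "(\<lambda>(s::real, t::real). (\<chi> i. if i = 1 then s else t) :: real^2) \<in> borel_measurable (lborel \<Otimes>\<^sub>M lborel)"
proof -
 have "continuous_on UNIV (\<lambda>p::real \<times> real. if i = 1 then fst p else snd p)" for i :: 2
  by (cases "i = 1") (simp_all add: continuous_on_fst continuous_on_snd)
 hence "continuous_on UNIV (\<lambda>p. (\<chi> i. if i = 1 then fst p else snd p) :: real^2)"
  by (rule continuous_on_vec_lambda)
 from borel_measurable_continuous_onI[OF this] show ?thesis
  by (simp add: lborel_prod case_prod_beta')
qed

text \<open>Identifies the measure on vectors with a product measure, so that Tonelli's theorem can
  slice the plane into lines; agreement on boxes decides equality.\<close>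

lemma lborel_plane:
 "(lborel :: (real^2) measure) = distr (lborel \<Otimes>\<^sub>M lborel) borel (\<lambda>(s, t). \<chi> i. if i = 1 then s else t)"
proof (rule lborel_eqI)
 let ?f = "\<lambda>(s::real, t::real). (\<chi> i. if i = 1 then s else t) :: real^2"
 note fm [measurable] = measurable_plane
 fix l u :: "real^2" assume le: "\<And>b. b \<in> Basis \<Longrightarrow> l \<bullet> b \<le> u \<bullet> b"
 have lu: "l $ i \<le> u $ i" for i using le[of "axis i 1"] by (simp add: inner_axis axis_in_Basis_iff)
 have "emeasure (distr (lborel \<Otimes>\<^sub>M lborel) borel ?f) (box l u)
   = emeasure (lborel \<Otimes>\<^sub>M lborel) (?f -` box l u \<inter> space (lborel \<Otimes>\<^sub>M lborel))"
  by (rule emeasure_distr[OF fm]) simp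
 also have "?f -` box l u \<inter> space (lborel \<Otimes>\<^sub>M lborel) = {l $ 1<..<u $ 1} \<times> {l $ 2<..<u $ 2}"
  by (auto simp: mem_box_cart forall_2 space_pair_measure)
 also have "emeasure (lborel \<Otimes>\<^sub>M lborel) \<dots> = ennreal (u $ 1 - l $ 1) * ennreal (u $ 2 - l $ 2)"
  using lu by (subst lborel.emeasure_pair_measure_Times) auto
 also have "\<dots> = ennreal (\<Prod>i\<in>UNIV. u $ i - l $ i)"
  using lu by (simp add: UNIV_2 ennreal_mult)
 also have "(\<Prod>i\<in>UNIV. u $ i - l $ i) = (\<Prod>b\<in>Basis. (u - l) \<bullet> b)"
 proof -
  have B: "(Basis :: (real^2) set) = (\<lambda>i. axis i 1) ` UNIV"
   by (auto simp: Basis_vec_def)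
  show ?thesis unfolding B
   by (subst prod.reindex) (auto simp: inj_on_def axis_eq_axis inner_axis)
 qed
 finally show "emeasure (distr (lborel \<Otimes>\<^sub>M lborel) borel ?f) (box l u) = (\<Prod>b\<in>Basis. (u - l) \<bullet> b)" .
qed simp

lemma nn_integral_plane:
 fixes G :: "real^2 \<Rightarrow> ennreal"
 assumes [measurable]: "G \<in> borel_measurable borel"
 shows "(\<integral>\<^sup>+x. G x \<partial>lborel) = (\<integral>\<^sup>+t. \<integral>\<^sup>+s. G (\<chi> i. if i = 1 then s else t) \<partial>lborel \<partial>lborel)"
proof -
 let ?f = "\<lambda>(s::real, t::real). (\<chi> i. if i = 1 then s else t) :: real^2"
 note measurable_plane [measurable]
 have "(\<integral>\<^sup>+x. G x \<partial>lborel) = (\<integral>\<^sup>+p. G (?f p) \<partial>(lborel \<Otimes>\<^sub>M lborel))"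
  by (subst lborel_plane, subst nn_integral_distr) auto
 also have "\<dots> = (\<integral>\<^sup>+t. \<integral>\<^sup>+s. G (?f (s, t)) \<partial>lborel \<partial>lborel)"
  by (rule lborel_pair.nn_integral_snd[symmetric]) measurable
 finally show ?thesis by simp
qed

text \<open>On a box this is the determinant formula for the measure of a linear image, applied to
  the preimage of the box.\<close>

lemma lborel_linear:
 fixes a b :: "real^2"
 assumes d: "det2 a b \<noteq> 0"
 shows "lborel = density (distr lborel borel (\<lambda>x::real^2. x $ 1 *\<^sub>R a + x $ 2 *\<^sub>R b)) (\<lambda>_. ennreal \<bar>det2 a b\<bar>)"
proof (rule lborel_eqI)
 define A where "A x = x $ 1 *\<^sub>R a + x $ 2 *\<^sub>R b" for x :: "real^2"
 have lin: "linear A" by (rule linearI) (simp_all add: A_def algebra_simps)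
 have detA: "det (matrix A) = det2 a b"
  by (simp add: det_2 matrix_def A_def axis_def det2_def)
 have "inj A" using det_nz_iff_inj[OF lin] d detA by simp
 then obtain B where B: "linear B" "\<And>x. B (A x) = x" "\<And>x. A (B x) = x"
  using linear_injective_isomorphism[OF lin] by auto
 have Am [measurable]: "A \<in> borel_measurable lborel"
  using borel_measurable_continuous_onI[OF linear_continuous_on[OF linear_conv_bounded_linear[THEN iffD1, OF lin]]]
  by simp
 fix l u :: "real^2" assume le: "\<And>b. b \<in> Basis \<Longrightarrow> l \<bullet> b \<le> u \<bullet> b"
 have pre: "A -` box l u = B ` box l u" using B by (auto simp: image_iff) metis
 have lm: "B ` box l u \<in> lmeasurable" using B(1) by (intro measurable_linear_image) auto
 have im: "A ` (B ` box l u) = box l u" using B(3) by (auto simp: image_image)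
 have meas: "measure lebesgue (box l u) = \<bar>det2 a b\<bar> * measure lebesgue (B ` box l u)"
  using measure_linear_image[OF lin lm] im detA by simp
 have Am': "A -` box l u \<in> sets borel" using measurable_sets[OF Am, of "box l u"] by simp
 have "emeasure (density (distr lborel borel A) (\<lambda>_. ennreal \<bar>det2 a b\<bar>)) (box l u)
   = ennreal \<bar>det2 a b\<bar> * emeasure (distr lborel borel A) (box l u)"
  by (simp add: emeasure_density_const)
 also have "emeasure (distr lborel borel A) (box l u) = emeasure lborel (A -` box l u)"
  by (subst emeasure_distr) auto
 also have "\<dots> = emeasure lebesgue (B ` box l u)"
  using Am' pre by simp
 also have "\<dots> = ennreal (measure lebesgue (B ` box l u))"
  using lm by (rule emeasure_eq_measure2)
 also have "ennreal \<bar>det2 a b\<bar> * \<dots> = ennreal (measure lebesgue (box l u))"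
  by (simp add: meas ennreal_mult)
 also have "\<dots> = (\<Prod>b\<in>Basis. (u - l) \<bullet> b)"
  using le by (simp add: measure_def)
 finally show "emeasure (density (distr lborel borel (\<lambda>x::real^2. x $ 1 *\<^sub>R a + x $ 2 *\<^sub>R b)) (\<lambda>_. ennreal \<bar>det2 a b\<bar>)) (box l u) = (\<Prod>b\<in>Basis. (u - l) \<bullet> b)"
  by (simp add: A_def[abs_def])
qed simp

lemma nn_integral_linear:
 fixes a b :: "real^2" and G :: "real^2 \<Rightarrow> ennreal"
 assumes d: "det2 a b \<noteq> 0" and G [measurable]: "G \<in> borel_measurable borel"
 shows "(\<integral>\<^sup>+x. G x \<partial>lborel) = ennreal \<bar>det2 a b\<bar> * (\<integral>\<^sup>+t. \<integral>\<^sup>+s. G (s *\<^sub>R a + t *\<^sub>R b) \<partial>lborel \<partial>lborel)"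
proof -
 have "(\<integral>\<^sup>+x. G x \<partial>lborel) = (\<integral>\<^sup>+(x::real^2). ennreal \<bar>det2 a b\<bar> * G (x $ 1 *\<^sub>R a + x $ 2 *\<^sub>R b) \<partial>lborel)"
  by (subst lborel_linear[OF d]) (simp add: nn_integral_density nn_integral_distr)
 also have "\<dots> = ennreal \<bar>det2 a b\<bar> * (\<integral>\<^sup>+(x::real^2). G (x $ 1 *\<^sub>R a + x $ 2 *\<^sub>R b) \<partial>lborel)"
  by (rule nn_integral_cmult) measurable
 also have "(\<integral>\<^sup>+(x::real^2). G (x $ 1 *\<^sub>R a + x $ 2 *\<^sub>R b) \<partial>lborel) = (\<integral>\<^sup>+t. \<integral>\<^sup>+s. G (s *\<^sub>R a + t *\<^sub>R b) \<partial>lborel \<partial>lborel)"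
  by (subst nn_integral_plane) simp_all
 finally show ?thesis .
qed

text \<open>The line integrals of \<open>G\<close> in direction \<open>a\<close> and of \<open>H\<close> in direction \<open>b\<close> depend on one
 oblique coordinate each, so the integral of their product factorizes.\<close>

lemma nn_integral_line_product:
 fixes a b :: "real^2" and G H :: "real^2 \<Rightarrow> ennreal"
 assumes d: "det2 a b \<noteq> 0" and [measurable]: "G \<in> borel_measurable borel" "H \<in> borel_measurable borel"
 shows "ennreal \<bar>det2 a b\<bar> * (\<integral>\<^sup>+x. (\<integral>\<^sup>+s. G (x + s *\<^sub>R a) \<partial>lborel) * (\<integral>\<^sup>+s. H (x + s *\<^sub>R b) \<partial>lborel) \<partial>lborel)
  = (\<integral>\<^sup>+x. G x \<partial>lborel) * (\<integral>\<^sup>+x. H x \<partial>lborel)"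
proof -
 let ?I = "\<integral>\<^sup>+x. (\<integral>\<^sup>+s. G (x + s *\<^sub>R a) \<partial>lborel) * (\<integral>\<^sup>+s. H (x + s *\<^sub>R b) \<partial>lborel) \<partial>lborel" and ?e = "ennreal \<bar>det2 a b\<bar>"
 define P where "P t = (\<integral>\<^sup>+s. G (s *\<^sub>R a + t *\<^sub>R b) \<partial>lborel)" for t
 define Q where "Q s = (\<integral>\<^sup>+t. H (s *\<^sub>R a + t *\<^sub>R b) \<partial>lborel)" for s
 have [measurable]: "P \<in> borel_measurable borel" "Q \<in> borel_measurable borel"
  unfolding P_def[abs_def] Q_def[abs_def] by measurable
 \<comment> \<open>Moving the base point along \<open>a\<close> only shifts the integration
   variable, so the line integral depends on the coordinate \<open>t'\<close> alone.\<close>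
 have P: "(\<integral>\<^sup>+s. G ((s' *\<^sub>R a + t' *\<^sub>R b) + s *\<^sub>R a) \<partial>lborel) = P t'" for s' t'
  unfolding P_def
  by (subst (2) nn_integral_real_affine[where c=1 and t=s']) (auto simp: algebra_simps)
 have Q: "(\<integral>\<^sup>+s. H ((s' *\<^sub>R a + t' *\<^sub>R b) + s *\<^sub>R b) \<partial>lborel) = Q s'" for s' t'
  unfolding Q_def
  by (subst (2) nn_integral_real_affine[where c=1 and t=t']) (auto simp: algebra_simps)
 have "?I
   = ?e * (\<integral>\<^sup>+t. \<integral>\<^sup>+s. P t * Q s \<partial>lborel \<partial>lborel)"
  by (subst nn_integral_linear[OF d]) (simp_all add: P Q)
 also have "(\<integral>\<^sup>+t. \<integral>\<^sup>+s. P t * Q s \<partial>lborel \<partial>lborel) = (\<integral>\<^sup>+t. P t \<partial>lborel) * (\<integral>\<^sup>+s. Q s \<partial>lborel)"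
  by (simp add: nn_integral_cmult nn_integral_multc)
 finally have 1: "?I
   = ?e * ((\<integral>\<^sup>+t. P t \<partial>lborel) * (\<integral>\<^sup>+s. Q s \<partial>lborel))" .
 have 2: "(\<integral>\<^sup>+x. G x \<partial>lborel) = ?e * (\<integral>\<^sup>+t. P t \<partial>lborel)"
  unfolding P_def by (rule nn_integral_linear[OF d]) simp
 have "(\<integral>\<^sup>+x. H x \<partial>lborel) = ?e * (\<integral>\<^sup>+t. \<integral>\<^sup>+s. H (s *\<^sub>R a + t *\<^sub>R b) \<partial>lborel \<partial>lborel)"
  by (rule nn_integral_linear[OF d]) simp
 also have "(\<integral>\<^sup>+t. \<integral>\<^sup>+s. H (s *\<^sub>R a + t *\<^sub>R b) \<partial>lborel \<partial>lborel) = (\<integral>\<^sup>+s. Q s \<partial>lborel)"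
  unfolding Q_def by (rule lborel_pair.Fubini') measurable
 finally have 3: "(\<integral>\<^sup>+x. H x \<partial>lborel) = ?e * (\<integral>\<^sup>+s. Q s \<partial>lborel)" .
 show ?thesis unfolding 1 2 3 by (simp add: mult_ac)
qed

text \<open>For each \<open>s\<close> in the interval, \<open>(f 0)^2\<close> exceeds
  \<open>(f s)^2\<close> by at most the integral of \<open>2 * \<bar>f * f'\<bar>\<close>; averaging
  over \<open>s\<close> produces the factor \<open>1 / h\<close>.\<close>

lemma square_le_line_integral:
 fixes f f' :: "real \<Rightarrow> real"
 assumes h: "h > 0" and c: "continuous_on UNIV f" "continuous_on UNIV f'"
  and d: "\<And>s. 0 \<le> s \<Longrightarrow> s \<le> h \<Longrightarrow> (f has_real_derivative f' s) (at s)"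
 shows "ennreal ((f 0)^2) \<le> (\<integral>\<^sup>+s. ennreal (indicator {0..h} s * ((f s)^2 / h + 2 * \<bar>f s * f' s\<bar>)) \<partial>lborel)"
proof -
 have [continuous_intros]: "continuous_on S f" "continuous_on S f'" for S using c continuous_on_subset by blast+
 have [measurable]: "f \<in> borel_measurable borel" "f' \<in> borel_measurable borel"
  using c by (auto intro: borel_measurable_continuous_onI)
 define I where "I = (LINT s|lborel. indicator {0..h} s * (2 * \<bar>f s * f' s\<bar>))"
 have int: "integrable lborel (\<lambda>s. indicator {r..t} s * g s)" if "continuous_on {r..t} g" for r t and g :: "real \<Rightarrow> real"
  using borel_integrable_atLeastAtMost'[OF that] by (simp add: set_integrable_def)
 have *: "(f 0)^2 \<le> (f s)^2 + I" if s: "0 \<le> s" "s \<le> h" for s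
 proof -
  have "(LINT t|lborel. (2 * f t * f' t) * indicator {0..s} t) = (f s)^2 - (f 0)^2"
  proof (rule integral_FTC_Icc_real[OF s(1)])
   fix x assume x: "0 \<le> x" "x \<le> s"
   show "((\<lambda>s. (f s)^2) has_real_derivative 2 * f x * f' x) (at x)"
    using d[of x] x s by (auto intro!: derivative_eq_intros)
   have "continuous_on UNIV (\<lambda>x. 2 * f x * f' x)" by (intro continuous_intros)
   thus "isCont (\<lambda>x. 2 * f x * f' x) x" by (simp add: continuous_on_eq_continuous_at)
  qed
  hence "(f 0)^2 = (f s)^2 + (LINT t|lborel. - ((2 * f t * f' t) * indicator {0..s} t))" by simp
  also have "(LINT t|lborel. - ((2 * f t * f' t) * indicator {0..s} t)) \<le> I"
   unfolding I_def
  proof (rule integral_mono)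
   show "integrable lborel (\<lambda>t. - ((2 * f t * f' t) * indicator {0..s} t))"
   proof -
    have "continuous_on {0..s} (\<lambda>t. - (2 * f t * f' t))" by (intro continuous_intros)
    from int[OF this] show ?thesis by (simp add: mult_ac)
   qed
   show "integrable lborel (\<lambda>s. indicator {0..h} s * (2 * \<bar>f s * f' s\<bar>))"
    by (intro int continuous_intros)
   show "- ((2 * f t * f' t) * indicator {0..s} t) \<le> indicator {0..h} t * (2 * \<bar>f t * f' t\<bar>)" for t
   proof (cases "t \<in> {0..s}")
    case True
    hence "t \<in> {0..h}" using s by simp
    thus ?thesis using True abs_ge_minus_self[of "f t * f' t"] by simp
   next
    case False
    hence "indicator {0..s} t = (0::real)" by (rule indicator_simps(2))
    thus ?thesis by simp
   qed
  qed
  finally show ?thesis by simp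
 qed
 have "(LINT s|lborel. indicator {0..h} s * (f 0)^2) \<le> (LINT s|lborel. indicator {0..h} s * ((f s)^2 + I))"
 proof (intro integral_mono int continuous_intros)
  fix s show "indicator {0..h} s * (f 0)^2 \<le> indicator {0..h} s * ((f s)^2 + I)"
   using *[of s] by (cases "s \<in> {0..h}") simp_all
 qed
 also have "\<dots> = (LINT s|lborel. indicator {0..h} s * (f s)^2) + (LINT s|lborel. indicator {0..h} s * I)"
  unfolding distrib_left by (intro Bochner_Integration.integral_add int continuous_intros)
 finally have "h * (f 0)^2 \<le> (LINT s|lborel. indicator {0..h} s * (f s)^2) + h * I"
  using h by simp
 hence "(f 0)^2 \<le> (LINT s|lborel. indicator {0..h} s * (f s)^2) / h + I"
  using h by (simp add: field_simps)
 also have "\<dots> = (LINT s|lborel. indicator {0..h} s * ((f s)^2 / h)) + I" by simp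
 also have "\<dots> = (LINT s|lborel. indicator {0..h} s * ((f s)^2 / h + 2 * \<bar>f s * f' s\<bar>))"
  unfolding I_def distrib_left
  using h by (intro Bochner_Integration.integral_add[symmetric] int continuous_intros) auto
 finally have "ennreal ((f 0)^2) \<le> ennreal \<dots>" by (rule ennreal_leI)
 also have "\<dots> = (\<integral>\<^sup>+s. ennreal (indicator {0..h} s * ((f s)^2 / h + 2 * \<bar>f s * f' s\<bar>)) \<partial>lborel)"
  using h by (intro nn_integral_eq_integral[symmetric] int continuous_intros AE_I2 mult_nonneg_nonneg add_nonneg_nonneg) simp_all
 finally show ?thesis .
qed

text \<open>Near a boundary point \<open>n\<close> points into the domain, and so does
  \<open>n\<close> tilted by \<open>\<kappa>\<close> along the graph, because the graph rises by at
  most \<open>C * \<kappa>\<close>, less than 1, per unit of motion. These directions replace the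
  coordinate axes, which serve at interior points.\<close>

lemma lipschitz_directions:
 assumes op: "open \<omega>" and lip: "lipschitz_boundary \<omega>" and x0: "x0 \<in> closure \<omega>"
 shows "\<exists>q>0. \<exists>h>0. \<exists>a b. det2 a b \<noteq> 0 \<and>
  (\<forall>y\<in>\<omega> \<inter> ball x0 q. \<forall>t. 0 \<le> t \<and> t \<le> h \<longrightarrow> y + t *\<^sub>R a \<in> \<omega> \<and> y + t *\<^sub>R b \<in> \<omega>)"
proof (cases "x0 \<in> \<omega>")
 case True
 then obtain r where r: "r > 0" "ball x0 r \<subseteq> \<omega>" using op openE by blast
 have "det2 (axis 1 1) (axis 2 1) \<noteq> 0" by (simp add: det2_def axis_def)
 moreover have "y + t *\<^sub>R axis i 1 \<in> \<omega>" if "y \<in> ball x0 (r/2)" "0 \<le> t" "t \<le> r/4" for y t and i :: 2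
 proof -
  have "dist x0 (y + t *\<^sub>R axis i 1) \<le> dist x0 y + dist y (y + t *\<^sub>R axis i 1)" by (rule dist_triangle)
  also have "\<dots> < r" using that r(1) by (simp add: dist_norm)
  finally show ?thesis using r(2) by auto
 qed
 ultimately show ?thesis using r(1)
  by (intro exI[of _ "r/2"] conjI exI[of _ "r/4"] exI[of _ "axis 1 1"] exI[of _ "axis 2 1"]) auto
next
 case False
 hence "x0 \<in> frontier \<omega>" using x0 op by (simp add: frontier_def interior_open)
 then obtain r e n c C where r: "r > 0" and e: "norm e = 1" "norm n = 1" "e \<bullet> n = 0"
  and c: "C-lipschitz_on UNIV c" and g: "\<omega> \<inter> ball x0 r = {y \<in> ball x0 r. c (y \<bullet> e) < y \<bullet> n}"
  using lip unfolding lipschitz_boundary_def by blast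
 have C0: "0 \<le> C" using c by (rule lipschitz_on_nonneg)
 define \<kappa> where "\<kappa> = 1 / (C + 1)"
 have \<kappa>: "\<kappa> > 0" "C * \<kappa> < 1" "\<kappa> \<le> 1" using C0 by (auto simp: \<kappa>_def field_simps)
 have ee: "e \<bullet> e = 1" "n \<bullet> n = 1" using e by (simp_all add: norm_eq_1)
 \<comment> \<open>Lagrange's identity: an orthonormal pair has a determinant of modulus 1.\<close>
 have "(n $ 1 * e $ 2 - e $ 1 * n $ 2)^2 = (n \<bullet> n) * (e \<bullet> e) - (e \<bullet> n)^2"
  by (simp add: inner_vec_def sum_2 power2_eq_square algebra_simps)
 hence "det2 n e \<noteq> 0" using ee e(3) by (auto simp: det2_def)
 moreover have "det2 n (n + \<kappa> *\<^sub>R e) = \<kappa> * det2 n e" by (simp add: det2_def algebra_simps)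
 ultimately have det: "det2 n (n + \<kappa> *\<^sub>R e) \<noteq> 0" using \<kappa> by simp
 \<comment> \<open>The directions have norm at most 2, so a step of length parameter
   \<open>r/8\<close> from \<open>ball x0 (r/2)\<close> moves by at most \<open>r/4\<close> and
   stays where the graph describes \<open>\<omega>\<close>.\<close>
 have mem: "y + t *\<^sub>R (n + k *\<^sub>R e) \<in> \<omega>"
  if y: "y \<in> \<omega> \<inter> ball x0 (r/2)" and t: "0 \<le> t" "t \<le> r/8" and k: "0 \<le> k" "k \<le> \<kappa>" for y t k
 proof -
  let ?z = "y + t *\<^sub>R (n + k *\<^sub>R e)"
  have "norm (n + k *\<^sub>R e) \<le> norm n + norm (k *\<^sub>R e)" by (rule norm_triangle_ineq)
  also have "\<dots> \<le> 2" using e k \<kappa> by simp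
  finally have n2: "norm (n + k *\<^sub>R e) \<le> 2" .
  have "dist x0 ?z \<le> dist x0 y + dist y ?z" by (rule dist_triangle)
  also have "dist y ?z = t * norm (n + k *\<^sub>R e)" using t by (simp add: dist_norm)
  also have "\<dots> \<le> r/8 * 2" using t n2 by (intro mult_mono) auto
  finally have zb: "?z \<in> ball x0 r" using y r by simp
  have yb: "y \<in> \<omega> \<inter> ball x0 r" using y r by simp
  hence yg: "c (y \<bullet> e) < y \<bullet> n" unfolding g by simp
  have ze: "?z \<bullet> e = y \<bullet> e + t * k" using ee e(3) inner_commute[of n e] by (simp add: inner_add_left)
  have zn: "?z \<bullet> n = y \<bullet> n + t" using ee e(3) by (simp add: inner_add_left)
  have "\<bar>c (y \<bullet> e + t * k) - c (y \<bullet> e)\<bar> \<le> C * \<bar>t * k\<bar>"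
   using lipschitz_onD[OF c, of "y \<bullet> e + t * k" "y \<bullet> e"] by (simp add: dist_real_def)
  also have "\<dots> = t * (C * k)" using t k by simp
  also have "\<dots> \<le> t * (C * \<kappa>)" using t k C0 by (intro mult_left_mono) auto
  also have "\<dots> \<le> t * 1" using t \<kappa> by (intro mult_left_mono) auto
  finally have "c (?z \<bullet> e) < ?z \<bullet> n" using yg unfolding ze zn by linarith
  hence "?z \<in> \<omega> \<inter> ball x0 r" using zb unfolding g by simp
  thus ?thesis by simp
 qed
 have "y + t *\<^sub>R n \<in> \<omega> \<and> y + t *\<^sub>R (n + \<kappa> *\<^sub>R e) \<in> \<omega>"
  if "y \<in> \<omega> \<inter> ball x0 (r/2)" "0 \<le> t \<and> t \<le> r/8" for y t
  using mem[of y t 0] mem[of y t \<kappa>] that \<kappa> by simp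
 with det r show ?thesis
  by (intro exI[of _ "r/2"] conjI exI[of _ "r/8"] exI[of _ n] exI[of _ "n + \<kappa> *\<^sub>R e"]) auto
qed

section \<open>Fourth powers near a point of the closure\<close>

context planar_domain
begin

text \<open>The squared mollification is bounded by a line integral in direction \<open>a\<close>
  and by one in direction \<open>b\<close>. Their product bounds the fourth power, and its integral
  factorizes into two integrals over the plane, each controlled by Cauchy-Schwarz. The factor
  \<open>l2norm lborel u\<close> in \<open>N\<close> is what later makes products of slopes
  small.\<close>

lemma ladyzhenskaya_moll:
 assumes u: "u \<in> L20 \<omega>" and v: "\<And>q. v q \<in> L20 \<omega>" and w: "\<And>q. weak_partial0 \<omega> q u (v q)"
  and h: "h > 0" and det: "det2 a b \<noteq> 0"
  and dir: "\<And>y t. y \<in> \<omega> \<Longrightarrow> y \<in> ball x0 r \<Longrightarrow> 0 \<le> t \<Longrightarrow> t \<le> h \<Longrightarrow> y + t *\<^sub>R a \<in> \<omega> \<and> y + t *\<^sub>R b \<in> \<omega>"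
  and d: "0 < d" "d < d'" and A: "\<And>x. x \<in> A \<Longrightarrow> cball x d' \<subseteq> \<omega> \<inter> ball x0 r"
 defines "N \<equiv> l2norm lborel u * (l2norm lborel u + (\<Sum>q\<in>UNIV. l2norm lborel (v q)))"
 defines "C \<equiv> \<lambda>c :: real^2. 1 / h + 2 * (\<Sum>q\<in>UNIV. \<bar>c $ q\<bar>)"
 shows "ennreal \<bar>det2 a b\<bar> * (\<integral>\<^sup>+x. ennreal (indicator A x * (moll d u x) ^ 4) \<partial>lborel)
  \<le> ennreal (C a * N * (C b * N))"
proof -
 define W where "W = moll d u"
 define p where "p q = moll d (v q)" for q
 define D where "D c y = (\<Sum>q\<in>UNIV. c $ q * p q y)" for c :: "real^2" and y
 have u2: "u \<in> L2 lborel" and v2: "v q \<in> L2 lborel" for q using u v by (auto simp: L20_def)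
 have ui: "integrable lborel u" and vi: "integrable lborel (v q)" for q
  using L20_integrable[OF bounded_dom open_dom] u v by auto
 have W2: "W \<in> L2 lborel" "l2norm lborel W \<le> l2norm lborel u"
  unfolding W_def using moll_L2[OF d(1) u2] by auto
 have p2: "p q \<in> L2 lborel" "l2norm lborel (p q) \<le> l2norm lborel (v q)" for q
  unfolding p_def using moll_L2[OF d(1) v2] by auto
 have Wc: "continuous_on UNIV W" and pc: "continuous_on UNIV (p q)" for q
  unfolding W_def p_def using moll_continuous d(1) ui vi by auto
 have Dc: "continuous_on UNIV (D c)" for c unfolding D_def[abs_def] using pc by (intro continuous_intros)
 have [measurable]: "W \<in> borel_measurable borel" "p q \<in> borel_measurable borel" "D c \<in> borel_measurable borel" for q c
  using Wc pc Dc by (auto intro: borel_measurable_continuous_onI)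
 define G where "G c y = ennreal (indicator (inset d) y * ((W y)^2 / h + 2 * \<bar>W y * D c y\<bar>))" for c y
 have [measurable]: "G c \<in> borel_measurable borel" for c unfolding G_def[abs_def] by measurable
 have line: "ennreal ((W x)^2) \<le> (\<integral>\<^sup>+s. G c (x + s *\<^sub>R c) \<partial>lborel)"
  if x: "x \<in> A" and c: "c = a \<or> c = b" for x c
 proof -
  \<comment> \<open>The larger ball of radius \<open>d'\<close> travels along: every point of it
    starts in \<open>\<omega>\<close> inside \<open>ball x0 r\<close> and is carried into
    \<open>\<omega>\<close>, so the segment runs in \<open>inset d\<close>.\<close>
  have cb: "cball (x + s *\<^sub>R c) d' \<subseteq> \<omega>" if s: "0 \<le> s" "s \<le> h" for s
  proof
   fix z assume "z \<in> cball (x + s *\<^sub>R c) d'"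
   hence "z - s *\<^sub>R c \<in> cball x d'" by (simp add: dist_norm algebra_simps)
   hence "z - s *\<^sub>R c \<in> \<omega>" "z - s *\<^sub>R c \<in> ball x0 r" using A[OF x] by blast+
   from dir[OF this s] c show "z \<in> \<omega>" by auto
  qed
  let ?j = "\<lambda>s. W (x + s *\<^sub>R c)" and ?j' = "\<lambda>s. D c (x + s *\<^sub>R c)"
  have cont: "continuous_on UNIV (\<lambda>s. x + s *\<^sub>R c)" by (intro continuous_intros)
  have "ennreal ((?j 0)^2) \<le> (\<integral>\<^sup>+s. ennreal (indicator {0..h} s * ((?j s)^2 / h + 2 * \<bar>?j s * ?j' s\<bar>)) \<partial>lborel)"
  proof (rule square_le_line_integral[OF h])
   show "continuous_on UNIV ?j" "continuous_on UNIV ?j'"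
    using continuous_on_compose2[OF Wc cont] continuous_on_compose2[OF Dc cont] by auto
   fix s assume s: "0 \<le> s" "s \<le> h"
   have "cball (x + s *\<^sub>R c) d \<subseteq> \<omega>" using order_trans[OF subset_cball cb[OF s]] d(2) by simp
   from moll_line_deriv[OF open_dom bounded_dom u w d(1) this]
   show "(?j has_real_derivative ?j' s) (at s)" by (simp add: W_def D_def p_def)
  qed
  also have "\<dots> \<le> (\<integral>\<^sup>+s. G c (x + s *\<^sub>R c) \<partial>lborel)"
  proof (rule nn_integral_mono)
   fix s
   show "ennreal (indicator {0..h} s * ((?j s)^2 / h + 2 * \<bar>?j s * ?j' s\<bar>)) \<le> G c (x + s *\<^sub>R c)"
   proof (cases "s \<in> {0..h}")
    case True
    hence "x + s *\<^sub>R c \<in> inset d" using cb[of s] cball_inset[OF _ d(2)] by simp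
    thus ?thesis using True by (simp add: G_def)
   next
    case False
    hence "indicator {0..h} s = (0::real)" by (rule indicator_simps(2))
    thus ?thesis by simp
   qed
  qed
  finally show ?thesis by simp
 qed
 let ?l = "\<lambda>c x. \<integral>\<^sup>+s. G c (x + s *\<^sub>R c) \<partial>lborel" and ?I = "\<integral>\<^sup>+x. ennreal (indicator A x * (moll d u x) ^ 4) \<partial>lborel"
 have Gint: "(\<integral>\<^sup>+y. G c y \<partial>lborel) \<le> ennreal (C c * N)" for c
 proof -
  have a2: "(\<lambda>x. \<bar>f x\<bar>) \<in> L2 lborel" if "f \<in> L2 lborel" for f :: "real^2 \<Rightarrow> real" using that by (auto simp: L2_def)
  have i: "integrable lborel (\<lambda>y. \<bar>W y\<bar> * \<bar>p q y\<bar>)" for q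
   by (rule L2_mult_integrable[OF a2[OF W2(1)] a2[OF p2(1)]])
  have iv: "(LINT y|lborel. \<bar>W y\<bar> * \<bar>p q y\<bar>) \<le> l2norm lborel u * l2norm lborel (v q)" for q
  proof -
   have "(LINT y|lborel. \<bar>W y\<bar> * \<bar>p q y\<bar>) \<le> l2norm lborel (\<lambda>y. \<bar>W y\<bar>) * l2norm lborel (\<lambda>y. \<bar>p q y\<bar>)"
    using L2_Cauchy_Schwarz[OF a2[OF W2(1)] a2[OF p2(1)], of q] by linarith
   also have "\<dots> = l2norm lborel W * l2norm lborel (p q)" by (simp add: l2norm_def)
   also have "\<dots> \<le> l2norm lborel u * l2norm lborel (v q)" using W2 p2 by (intro mult_mono) auto
   finally show ?thesis .
  qed
  have iW: "integrable lborel (\<lambda>y. (W y)^2)" using W2 by (simp add: L2_def)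
  define g where "g y = (1 / h) * (W y)^2 + (\<Sum>q\<in>UNIV. 2 * \<bar>c $ q\<bar> * (\<bar>W y\<bar> * \<bar>p q y\<bar>))" for y
  have gi: "integrable lborel g" unfolding g_def[abs_def] using i iW by auto
  have g0: "0 \<le> g y" for y unfolding g_def using h by (intro add_nonneg_nonneg sum_nonneg) auto
  have "(\<integral>\<^sup>+y. G c y \<partial>lborel) \<le> (\<integral>\<^sup>+y. ennreal (g y) \<partial>lborel)"
  proof (rule nn_integral_mono)
   fix y
   have "\<bar>D c y\<bar> \<le> (\<Sum>q\<in>UNIV. \<bar>c $ q\<bar> * \<bar>p q y\<bar>)"
    unfolding D_def by (rule order_trans[OF sum_abs]) (simp add: abs_mult)
   hence "\<bar>W y\<bar> * \<bar>D c y\<bar> \<le> \<bar>W y\<bar> * (\<Sum>q\<in>UNIV. \<bar>c $ q\<bar> * \<bar>p q y\<bar>)" by (rule mult_left_mono) simp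
   hence "2 * (\<bar>W y\<bar> * \<bar>D c y\<bar>) \<le> 2 * (\<bar>W y\<bar> * (\<Sum>q\<in>UNIV. \<bar>c $ q\<bar> * \<bar>p q y\<bar>))" by simp
   also have "\<dots> = (\<Sum>q\<in>UNIV. 2 * \<bar>c $ q\<bar> * (\<bar>W y\<bar> * \<bar>p q y\<bar>))"
    by (simp add: sum_distrib_left mult_ac)
   finally have "(W y)^2 / h + 2 * \<bar>W y * D c y\<bar> \<le> g y"
    by (simp add: g_def abs_mult)
   moreover have "indicator (inset d) y * ((W y)^2 / h + 2 * \<bar>W y * D c y\<bar>) \<le> (W y)^2 / h + 2 * \<bar>W y * D c y\<bar>"
    using h by (intro mult_left_le_one_le) (auto simp: indicator_def)
   ultimately show "G c y \<le> ennreal (g y)" unfolding G_def by (intro ennreal_leI) linarith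
  qed
  also have "\<dots> = ennreal (LINT y|lborel. g y)" using gi g0 by (intro nn_integral_eq_integral) auto
  also have "(LINT y|lborel. g y) = (1 / h) * (l2norm lborel W)^2 + (\<Sum>q\<in>UNIV. 2 * \<bar>c $ q\<bar> * (LINT y|lborel. \<bar>W y\<bar> * \<bar>p q y\<bar>))"
   unfolding g_def using i iW
   by (subst Bochner_Integration.integral_add) (auto simp: l2norm_power2 Bochner_Integration.integral_sum)
  also have "\<dots> \<le> (1 / h) * N + (\<Sum>q\<in>UNIV. 2 * \<bar>c $ q\<bar> * N)"
  proof (intro add_mono mult_left_mono sum_mono)
   have "(l2norm lborel W)^2 \<le> (l2norm lborel u)^2" using W2 by (intro power_mono) auto
   also have "\<dots> \<le> N" unfolding N_def power2_eq_square by (intro mult_left_mono) (auto intro: sum_nonneg)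
   finally show "(l2norm lborel W)^2 \<le> N" .
   fix q :: 2
   have "l2norm lborel (v q) \<le> (\<Sum>q\<in>UNIV. l2norm lborel (v q))" by (rule member_le_sum) auto
   hence "l2norm lborel u * l2norm lborel (v q) \<le> N"
    unfolding N_def by (intro mult_left_mono) (auto simp: add_increasing)
   with iv[of q] show "(LINT y|lborel. \<bar>W y\<bar> * \<bar>p q y\<bar>) \<le> N" by linarith
  qed (use h in auto)
  also have "\<dots> = C c * N" by (simp add: C_def distrib_right sum_distrib_left sum_distrib_right)
  finally show ?thesis by (simp add: ennreal_leI)
 qed
 have "?I
  \<le> (\<integral>\<^sup>+x. ?l a x * ?l b x \<partial>lborel)"
 proof (rule nn_integral_mono)
  fix x
  show "ennreal (indicator A x * (moll d u x) ^ 4) \<le> ?l a x * ?l b x"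
  proof (cases "x \<in> A")
   case True
   have "ennreal (indicator A x * (moll d u x) ^ 4) = ennreal ((W x)^2) * ennreal ((W x)^2)"
    using True by (simp add: W_def ennreal_mult[symmetric] power2_eq_square power4_eq_xxxx mult.assoc)
   also have "\<dots> \<le> ?l a x * ?l b x"
    using line[OF True, of a] line[OF True, of b] by (intro mult_mono) auto
   finally show ?thesis .
  qed simp
 qed
 hence "ennreal \<bar>det2 a b\<bar> * ?I
  \<le> ennreal \<bar>det2 a b\<bar> * (\<integral>\<^sup>+x. ?l a x * ?l b x \<partial>lborel)"
  by (rule mult_left_mono) simp
 also have "\<dots> = (\<integral>\<^sup>+x. G a x \<partial>lborel) * (\<integral>\<^sup>+x. G b x \<partial>lborel)"
  by (rule nn_integral_line_product[OF det]) measurable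
 also have "\<dots> \<le> ennreal (C a * N) * ennreal (C b * N)"
  by (intro mult_mono Gint) auto
 also have "\<dots> = ennreal (C a * N * (C b * N))"
 proof -
  have "0 \<le> N" unfolding N_def by (intro mult_nonneg_nonneg add_nonneg_nonneg sum_nonneg) auto
  moreover have "0 \<le> C c" for c unfolding C_def using h by (intro add_nonneg_nonneg mult_nonneg_nonneg sum_nonneg) auto
  ultimately show ?thesis by (simp add: ennreal_mult)
 qed
 finally show ?thesis .
qed

text \<open>The squared errors tend to zero in L1, which gives an almost everywhere convergent
  subsequence.\<close>

lemma moll_AE_subseq:
 assumes u: "u \<in> L20 \<omega>" and d: "d > 0" and h: "\<And>n::nat. h n > 0" "h \<longlonglongrightarrow> 0"
 obtains r where "strict_mono (r :: nat \<Rightarrow> nat)"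
  "AE x in lborel. x \<in> inset d \<longrightarrow> (\<lambda>n. moll (h (r n)) u x) \<longlonglongrightarrow> u x"
proof -
 have u2: "u \<in> L2 lborel" using u by (simp add: L20_def)
 let ?f = "\<lambda>n x. indicator (inset d) x * (moll (h n) u x - u x)"
 have f2: "?f n \<in> L2 lborel" for n
 proof (rule L2_bound[OF L2_diff[OF moll_L2(1)[OF h(1) u2] u2]])
  show "?f n \<in> borel_measurable lborel" using L2_lborel_measurable[OF u2] by simp
 qed (auto simp: indicator_def)
 have "(\<lambda>n. l2norm lborel (?f n)) \<longlonglongrightarrow> 0"
  by (rule moll_tendsto[OF open_dom bounded_dom u inset_borel d inset_cball h])
 from tendsto_power[OF this, of 2] have "(\<lambda>n. LINT x|lborel. norm ((?f n x)^2)) \<longlonglongrightarrow> 0"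
  by (simp add: l2norm_power2)
 from tendsto_L1_AE_subseq[OF L2_square_integrable[OF f2] this]
 obtain r where r: "strict_mono r" "AE x in lborel. (\<lambda>n. (?f (r n) x)^2) \<longlonglongrightarrow> 0" by auto
 show thesis
 proof (rule that[OF r(1)])
  show "AE x in lborel. x \<in> inset d \<longrightarrow> (\<lambda>n. moll (h (r n)) u x) \<longlonglongrightarrow> u x"
   using r(2)
  proof eventually_elim
   fix x assume "(\<lambda>n. (?f (r n) x)^2) \<longlonglongrightarrow> 0"
   hence "(\<lambda>n. sqrt ((?f (r n) x)^2)) \<longlonglongrightarrow> sqrt 0" by (rule tendsto_real_sqrt)
   hence *: "(\<lambda>n. ?f (r n) x) \<longlonglongrightarrow> 0" by (simp add: tendsto_rabs_zero_iff)
   show "x \<in> inset d \<longrightarrow> (\<lambda>n. moll (h (r n)) u x) \<longlonglongrightarrow> u x"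
   proof
    assume "x \<in> inset d"
    with * have "(\<lambda>n. moll (h (r n)) u x - u x) \<longlonglongrightarrow> 0" by simp
    thus "(\<lambda>n. moll (h (r n)) u x) \<longlonglongrightarrow> u x" by (simp add: LIM_zero_iff)
   qed
  qed
 qed
qed

text \<open>Two limits by Fatou: the mollification radius tends to zero on a fixed inset, and the
  insets exhaust \<open>\<omega>\<close>.\<close>

lemma ladyzhenskaya_piece:
 assumes u: "u \<in> L20 \<omega>" and v: "\<And>i. v i \<in> L20 \<omega>" and w: "\<And>i. weak_partial0 \<omega> i u (v i)"
  and h: "h > 0" and q: "q > 0" and det: "det2 a b \<noteq> 0"
  and dir: "\<And>y t. y \<in> \<omega> \<Longrightarrow> y \<in> ball x0 q \<Longrightarrow> 0 \<le> t \<Longrightarrow> t \<le> h \<Longrightarrow> y + t *\<^sub>R a \<in> \<omega> \<and> y + t *\<^sub>R b \<in> \<omega>"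
 defines "N \<equiv> l2norm lborel u * (l2norm lborel u + (\<Sum>i\<in>UNIV. l2norm lborel (v i)))"
 defines "C \<equiv> \<lambda>c :: real^2. 1 / h + 2 * (\<Sum>i\<in>UNIV. \<bar>c $ i\<bar>)"
 shows "(\<integral>\<^sup>+x. ennreal (indicator (ball x0 (q/2)) x * (u x) ^ 4) \<partial>lborel) \<le> ennreal (C a * C b / \<bar>det2 a b\<bar> * N^2)"
proof -
 have u2: "u \<in> L2 lborel" and uz: "\<And>x. x \<notin> \<omega> \<Longrightarrow> u x = 0" using u by (auto simp: L20_def)
 note [measurable] = L2_lborel_measurable[OF u2]
 let ?B = "ennreal (C a * C b / \<bar>det2 a b\<bar> * N^2)"
 define A where "A n = inset (1 / Suc n) \<inter> ball x0 (q/2)" for n :: nat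
 have [measurable]: "A n \<in> sets borel" for n by (simp add: A_def)
 have An: "(\<integral>\<^sup>+x. ennreal (indicator (A n) x * (u x) ^ 4) \<partial>lborel) \<le> ?B" for n
 proof -
  \<comment> \<open>This radius keeps balls around points of \<open>A n\<close> inside both
    \<open>\<omega>\<close> and \<open>ball x0 q\<close>. The radii \<open>s k\<close> have to be
    strictly smaller, hence denominators from 2 on.\<close>
  define d where "d = min (1 / Suc n) (q/4)"
  have d: "d > 0" using q by (simp add: d_def)
  define s where "s k = d / (Suc (Suc k))" for k :: nat
  have s0: "s k > 0" "s k < d" for k
  proof -
   show "s k > 0" using d by (simp add: s_def)
   have "d * 1 < d * real (Suc (Suc k))" using d by (intro mult_strict_left_mono) auto
   thus "s k < d" by (simp add: s_def divide_less_eq)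
  qed
  have sl: "s \<longlonglongrightarrow> 0"
   unfolding s_def using tendsto_mult_right_zero[OF LIMSEQ_Suc[OF LIMSEQ_Suc[OF lim_1_over_n]], of d] by simp
  obtain r where r: "strict_mono r" "AE x in lborel. x \<in> inset (1 / Suc n) \<longrightarrow> (\<lambda>n. moll (s (r n)) u x) \<longlonglongrightarrow> u x"
   by (rule moll_AE_subseq[OF u _ s0(1) sl, of "1 / Suc n"]) auto
  have sub: "cball x d \<subseteq> \<omega> \<inter> ball x0 q" if "x \<in> A n" for x
  proof -
   have 1: "x \<in> inset (1 / Suc n)" "dist x0 x < q/2" using that by (auto simp: A_def)
   have "cball x d \<subseteq> \<omega>" using inset_cball[OF 1(1)] subset_cball[of d "1 / Suc n" x] by (auto simp: d_def)
   moreover have "cball x d \<subseteq> ball x0 q"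
   proof
    fix y assume "y \<in> cball x d"
    hence "dist x y \<le> q/4" by (simp add: d_def)
    thus "y \<in> ball x0 q" using 1(2) dist_triangle[of x0 y x] q by simp
   qed
   ultimately show ?thesis by blast
  qed
  have bd: "(\<integral>\<^sup>+x. ennreal (indicator (A n) x * (moll (s k) u x) ^ 4) \<partial>lborel) \<le> ?B" for k
  proof -
   have N0: "0 \<le> N" unfolding N_def by (intro mult_nonneg_nonneg add_nonneg_nonneg sum_nonneg) auto
   have C0: "0 \<le> C c" for c unfolding C_def using h by (intro add_nonneg_nonneg mult_nonneg_nonneg sum_nonneg) auto
   let ?I = "\<integral>\<^sup>+x. ennreal (indicator (A n) x * (moll (s k) u x) ^ 4) \<partial>lborel"
   have le: "ennreal \<bar>det2 a b\<bar> * ?I \<le> ennreal (C a * N * (C b * N))"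
    unfolding N_def C_def
    by (rule ladyzhenskaya_moll[OF u v w h det dir s0 sub])
   have "?I = ennreal (1 / \<bar>det2 a b\<bar>) * (ennreal \<bar>det2 a b\<bar> * ?I)"
    using det by (simp add: mult.assoc[symmetric] ennreal_mult[symmetric])
   also have "\<dots> \<le> ennreal (1 / \<bar>det2 a b\<bar>) * ennreal (C a * N * (C b * N))"
    by (rule mult_left_mono[OF le]) simp
   also have "\<dots> = ?B"
    using N0 C0 by (simp add: ennreal_mult[symmetric] power2_eq_square mult_ac)
   finally show ?thesis .
  qed
  show ?thesis
  proof (rule nn_integral_Fatou_le[where f="\<lambda>k x. ennreal (indicator (A n) x * (moll (s (r k)) u x) ^ 4)", OF _ _ always_eventually[OF allI[OF bd]]])
   show "AE x in lborel. (\<lambda>k. ennreal (indicator (A n) x * (moll (s (r k)) u x) ^ 4)) \<longlonglongrightarrow> ennreal (indicator (A n) x * (u x) ^ 4)"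
    using r(2) by eventually_elim (intro tendsto_ennrealI, auto simp: A_def indicator_def intro!: tendsto_intros)
  qed measurable
 qed
 show ?thesis
 proof (rule nn_integral_Fatou_le[where f="\<lambda>n x. ennreal (indicator (A n) x * (u x) ^ 4)", OF _ AE_I2 always_eventually[OF allI[OF An]]])
  show "(\<lambda>n. ennreal (indicator (A n) x * (u x) ^ 4)) \<longlonglongrightarrow> ennreal (indicator (ball x0 (q/2)) x * (u x) ^ 4)" for x
  proof (cases "x \<in> \<omega>")
   case True
   then obtain m where m: "x \<in> inset (1 / Suc m)" using Union_inset by auto
   have "x \<in> inset (1 / Suc n)" if "n \<ge> m" for n
    using m inset_mono[of "1 / Suc n" "1 / Suc m"] that by (auto simp: frac_le)
   thus ?thesis by (intro tendsto_eventually eventually_sequentiallyI[of m]) (auto simp: A_def indicator_def)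
  qed (simp add: uz)
 qed measurable
qed

end

section \<open>The inequality on the whole domain\<close>

locale lipschitz_domain = planar_domain +
 assumes lipschitz: "lipschitz_boundary \<omega>"
begin

text \<open>Compactness of the closure leaves finitely many balls, chosen independently of
  \<open>u\<close> and \<open>v\<close>, and the local constants are added.\<close>

lemma ladyzhenskaya_Borel:
 "\<exists>K\<ge>0. \<forall>u\<in>L20 \<omega>. \<forall>v. (\<forall>i. v i \<in> L20 \<omega> \<and> weak_partial0 \<omega> i u (v i)) \<longrightarrow>
   (\<integral>\<^sup>+x. ennreal ((u x) ^ 4) \<partial>lborel)
    \<le> ennreal (K * (l2norm lborel u * (l2norm lborel u + (\<Sum>i\<in>UNIV. l2norm lborel (v i))))^2)"
proof -
 let ?N = "\<lambda>u v. l2norm lborel u * (l2norm lborel u + (\<Sum>i\<in>(UNIV::2 set). l2norm lborel (v i)))"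
 define P where "P x0 r K \<longleftrightarrow> (\<forall>u\<in>L20 \<omega>. \<forall>v. (\<forall>i. v i \<in> L20 \<omega> \<and> weak_partial0 \<omega> i u (v i)) \<longrightarrow>
   (\<integral>\<^sup>+x. ennreal (indicator (ball x0 r) x * (u x) ^ 4) \<partial>lborel) \<le> ennreal (K * (?N u v)^2))" for x0 r K
 have "\<forall>x0\<in>closure \<omega>. \<exists>r K. r > 0 \<and> K \<ge> 0 \<and> P x0 r K"
 proof
  fix x0 assume "x0 \<in> closure \<omega>"
  from lipschitz_directions[OF open_dom lipschitz this]
  obtain q h a b where *: "q > 0" "h > 0" "det2 a b \<noteq> 0"
   "\<And>y t. y \<in> \<omega> \<Longrightarrow> y \<in> ball x0 q \<Longrightarrow> 0 \<le> t \<Longrightarrow> t \<le> h \<Longrightarrow> y + t *\<^sub>R a \<in> \<omega> \<and> y + t *\<^sub>R b \<in> \<omega>"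
   by blast
  let ?C = "\<lambda>c :: real^2. 1 / h + 2 * (\<Sum>i\<in>UNIV. \<bar>c $ i\<bar>)"
  have C0: "0 \<le> ?C c" for c using *(2) by (intro add_nonneg_nonneg mult_nonneg_nonneg sum_nonneg) auto
  show "\<exists>r K. r > 0 \<and> K \<ge> 0 \<and> P x0 r K"
   unfolding P_def
  proof (intro exI conjI ballI allI impI)
   show "q / 2 > 0" using * by simp
   show "?C a * ?C b / \<bar>det2 a b\<bar> \<ge> 0" by (intro divide_nonneg_nonneg mult_nonneg_nonneg C0) auto
   fix u v assume u: "u \<in> L20 \<omega>" and v: "\<forall>i. v i \<in> L20 \<omega> \<and> weak_partial0 \<omega> i u (v i)"
   show "(\<integral>\<^sup>+x. ennreal (indicator (ball x0 (q/2)) x * (u x) ^ 4) \<partial>lborel) \<le> ennreal (?C a * ?C b / \<bar>det2 a b\<bar> * (?N u v)^2)"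
    by (rule ladyzhenskaya_piece[OF u _ _ *(2,1,3,4)]) (use v in auto)
  qed
 qed
 then obtain r K where rK: "\<And>x0. x0 \<in> closure \<omega> \<Longrightarrow> r x0 > 0" "\<And>x0. x0 \<in> closure \<omega> \<Longrightarrow> K x0 \<ge> 0"
  and P: "\<And>x0. x0 \<in> closure \<omega> \<Longrightarrow> P x0 (r x0) (K x0)"
  by metis
 have c: "compact (closure \<omega>)" using bounded_dom by simp
 have cov: "closure \<omega> \<subseteq> (\<Union>x\<in>closure \<omega>. ball x (r x))"
  using rK(1) by force
 obtain X where X: "X \<subseteq> closure \<omega>" "finite X" "closure \<omega> \<subseteq> (\<Union>x\<in>X. ball x (r x))"
  by (rule compactE_image[OF c open_ball cov])
 show ?thesis
 proof (intro exI conjI ballI allI impI)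
  show "0 \<le> (\<Sum>x\<in>X. K x)" using X rK(2) by (intro sum_nonneg) auto
  fix u v assume u: "u \<in> L20 \<omega>" and v: "\<forall>i. v i \<in> L20 \<omega> \<and> weak_partial0 \<omega> i u (v i)"
  have [measurable]: "u \<in> borel_measurable borel" using u by (simp add: L20_def L2_def)
  have "(\<integral>\<^sup>+x. ennreal ((u x) ^ 4) \<partial>lborel) \<le> (\<integral>\<^sup>+x. (\<Sum>y\<in>X. ennreal (indicator (ball y (r y)) x * (u x) ^ 4)) \<partial>lborel)"
  proof (rule nn_integral_mono)
   fix x
   show "ennreal ((u x) ^ 4) \<le> (\<Sum>y\<in>X. ennreal (indicator (ball y (r y)) x * (u x) ^ 4))"
   proof (cases "x \<in> \<omega>")
    case True
    then obtain y where y: "y \<in> X" "x \<in> ball y (r y)" using X(3) closure_subset by blast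
    hence "ennreal ((u x) ^ 4) = ennreal (indicator (ball y (r y)) x * (u x) ^ 4)" by simp
    also have "\<dots> \<le> (\<Sum>y\<in>X. ennreal (indicator (ball y (r y)) x * (u x) ^ 4))"
     using X(2) y(1) by (intro member_le_sum) auto
    finally show ?thesis .
   next
    case False
    thus ?thesis using u by (simp add: L20_def)
   qed
  qed
  also have "\<dots> = (\<Sum>y\<in>X. \<integral>\<^sup>+x. ennreal (indicator (ball y (r y)) x * (u x) ^ 4) \<partial>lborel)"
   by (rule nn_integral_sum) (intro measurable_compose[OF _ measurable_ennreal] borel_measurable_times
     borel_measurable_indicator borel_measurable_power, simp_all)
  also have "\<dots> \<le> (\<Sum>y\<in>X. ennreal (K y * (?N u v)^2))"
   using X(1) P u v unfolding P_def by (intro sum_mono) blast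
  also have "\<dots> = ennreal ((\<Sum>x\<in>X. K x) * (?N u v)^2)"
   using X(1) rK(2) by (subst sum_ennreal) (auto simp: sum_distrib_right)
  finally show "(\<integral>\<^sup>+x. ennreal ((u x) ^ 4) \<partial>lborel) \<le> ennreal ((\<Sum>x\<in>X. K x) * (?N u v)^2)" .
 qed
qed

lemma H1_representative:
 assumes "u \<in> H1 \<omega>"
 obtains u0 v where "u0 \<in> L20 \<omega>" "AE x in M. u x = u0 x"
  "\<forall>i. v i \<in> L20 \<omega> \<and> weak_partial0 \<omega> i u0 (v i) \<and> (AE x in M. wd i u x = v i x)"
proof -
 obtain u0 where u0: "u0 \<in> L20 \<omega>" "AE x in M. u x = u0 x"
  using L2_representative[OF H1_L2[OF assms]] by metis
 have "\<exists>v. v \<in> L20 \<omega> \<and> weak_partial0 \<omega> i u0 v \<and> (AE x in M. wd i u x = v x)" for i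
 proof -
  obtain v where v: "v \<in> L20 \<omega>" "AE x in M. wd i u x = v x"
   using L2_representative[OF weak_partial_works(1)[OF assms]] by metis
  have "weak_partial0 \<omega> i u0 v"
   using weak_partial0_iff[OF L2_measurable[OF H1_L2[OF assms]] u0 L2_measurable[OF weak_partial_works(1)[OF assms]] v]
    weak_partial_works(2)[OF assms, of i] by blast
  with v show ?thesis by blast
 qed
 then obtain v where "\<forall>i. v i \<in> L20 \<omega> \<and> weak_partial0 \<omega> i u0 (v i) \<and> (AE x in M. wd i u x = v i x)"
  by metis
 with u0 that show thesis by blast
qed

lemma l2norm_L20_eq:
 assumes "u \<in> L2 M" "u0 \<in> L20 \<omega>" "AE x in M. u x = u0 x"
 shows "nm u = l2norm lborel u0"
 by (rule l2norm_dom_eq) (use assms in \<open>auto simp: L20_def L2_def\<close>)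

lemma ladyzhenskaya:
 "\<exists>K\<ge>0. \<forall>u\<in>H1 \<omega>. (\<lambda>x. (u x)^2) \<in> L2 M \<and>
   nm (\<lambda>x. (u x)^2) \<le> K * (nm u *
    (nm u + (\<Sum>i\<in>UNIV. nm (wd i u))))"
proof -
 obtain K where K: "K \<ge> 0" "\<And>u v. u \<in> L20 \<omega> \<Longrightarrow> (\<forall>i. v i \<in> L20 \<omega> \<and> weak_partial0 \<omega> i u (v i)) \<Longrightarrow>
   (\<integral>\<^sup>+x. ennreal ((u x) ^ 4) \<partial>lborel)
    \<le> ennreal (K * (l2norm lborel u * (l2norm lborel u + (\<Sum>i\<in>UNIV. l2norm lborel (v i))))^2)"
  using ladyzhenskaya_Borel by metis
 have "(\<lambda>x. (u x)^2) \<in> L2 M \<and>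
   nm (\<lambda>x. (u x)^2) \<le> sqrt K * (nm u *
    (nm u + (\<Sum>i\<in>UNIV. nm (wd i u))))"
  if u: "u \<in> H1 \<omega>" for u
 proof -
  obtain u0 v where u0: "u0 \<in> L20 \<omega>" "AE x in M. u x = u0 x"
   and v: "\<forall>i. v i \<in> L20 \<omega> \<and> weak_partial0 \<omega> i u0 (v i) \<and> (AE x in M. wd i u x = v i x)"
   by (rule H1_representative[OF u])
  have [measurable]: "u0 \<in> borel_measurable borel" using u0 by (simp add: L20_def L2_def)
  define N where "N = l2norm lborel u0 * (l2norm lborel u0 + (\<Sum>i\<in>UNIV. l2norm lborel (v i)))"
  have N0: "0 \<le> N" unfolding N_def by (intro mult_nonneg_nonneg add_nonneg_nonneg sum_nonneg) auto
  have N: "N = nm u * (nm u + (\<Sum>i\<in>UNIV. nm (wd i u)))"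
  proof -
   have "nm (wd i u) = l2norm lborel (v i)" for i
    by (rule l2norm_L20_eq[OF weak_partial_works(1)[OF u]]) (use v in auto)
   thus ?thesis unfolding N_def using l2norm_L20_eq[OF H1_L2[OF u] u0] by simp
  qed
  have le: "(\<integral>\<^sup>+x. ennreal ((u0 x) ^ 4) \<partial>lborel) \<le> ennreal (K * N^2)"
   unfolding N_def by (rule K(2)[OF u0(1)]) (use v in auto)
  have p4: "((u0 x)^2)^2 = (u0 x) ^ 4" for x by simp
  have int: "integrable lborel (\<lambda>x. ((u0 x)^2)^2)"
   unfolding p4 by (rule integrableI_bounded) (use le in \<open>auto simp: top.not_eq_extremum[symmetric] top_unique\<close>)
  hence s0: "(\<lambda>x. (u0 x)^2) \<in> L20 \<omega>" using u0 by (auto simp: L20_def L2_def)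
  have ae: "AE x in M. (u x)^2 = (u0 x)^2" using u0(2) by eventually_elim simp
  have "AE x in M. (u0 x)^2 = (u x)^2" using u0(2) by eventually_elim simp
  hence s: "(\<lambda>x. (u x)^2) \<in> L2 M"
   by (intro L2_AE_cong[OF L20_imp_L2[OF s0]]) (use L2_measurable[OF H1_L2[OF u]] in auto)
  have "ennreal (LINT x|lborel. ((u0 x)^2)^2) \<le> ennreal (K * N^2)"
   using le nn_integral_eq_integral[OF int] by (simp add: p4)
  hence "(LINT x|lborel. ((u0 x)^2)^2) \<le> K * N^2" using K(1) by (simp add: ennreal_le_iff)
  hence "l2norm lborel (\<lambda>x. (u0 x)^2) \<le> sqrt (K * N^2)"
   unfolding l2norm_def by (rule real_sqrt_le_mono)
  also have "\<dots> = sqrt K * N" using N0 by (simp add: real_sqrt_mult)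
  finally show ?thesis using s l2norm_L20_eq[OF s s0 ae] N by simp
 qed
 thus ?thesis using K(1) by (intro exI[of _ "sqrt K"]) auto
qed

end

section \<open>Rellich's theorem and the Poincare inequality for the Hessian\<close>

text \<open>A countable index lets one diagonal sequence serve all indices at once; it will run over
  the function, the mollification radius and a dense set of points.\<close>

lemma diagonal_convergent_subsequence:
 fixes a :: "'i::countable \<Rightarrow> nat \<Rightarrow> real"
 assumes bd: "\<And>i n. \<bar>a i n\<bar> \<le> B i"
 obtains r :: "nat \<Rightarrow> nat" where "strict_mono r" "\<And>i. convergent (\<lambda>n. a i (r n))"
proof -
 let ?P = "\<lambda>k s. convergent (\<lambda>n. a (from_nat k) (s n))"
 interpret subseqs ?P
 proof
  fix k and s :: "nat \<Rightarrow> nat" assume "strict_mono s"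
  have "bounded (range (\<lambda>n. a (from_nat k) (s n)))"
   using bd[of "from_nat k"] by (auto simp: bounded_iff)
  then obtain l r where "strict_mono (r :: nat \<Rightarrow> nat)" "((\<lambda>n. a (from_nat k) (s n)) \<circ> r) \<longlonglongrightarrow> l"
   using bounded_imp_convergent_subsequence by blast
  thus "\<exists>r'. strict_mono r' \<and> ?P k (s \<circ> r')" by (auto simp: o_def convergent_def)
 qed
 have "convergent (\<lambda>n. a i (diagseq n))" for i
 proof -
  \<comment> \<open>The diagonal sequence follows the extraction for index \<open>to_nat i\<close>
    only from the next position on, hence the shift.\<close>
  have "?P (to_nat i) (diagseq \<circ> ((+) (Suc (to_nat i))))"
  proof (rule diagseq_holds)
   fix r s :: "nat \<Rightarrow> nat" and n assume "strict_mono r" "?P n s"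
   thus "?P n (s \<circ> r)"
    using LIMSEQ_subseq_LIMSEQ[of "\<lambda>k. a (from_nat n) (s k)" _ r] by (auto simp: convergent_def o_def)
  qed
  hence "convergent (\<lambda>n. a i (diagseq (n + Suc (to_nat i))))" by (simp add: o_def add.commute)
  thus ?thesis by (rule convergent_ignore_initial_segment[THEN iffD1])
 qed
 with subseq_diagseq that show thesis by blast
qed

section \<open>Translation estimates\<close>

lemma AE_lborel_translate:
 fixes P :: "real^2 \<Rightarrow> bool"
 assumes "AE x in lborel. P x"
 shows "AE x in lborel. P (x + z)"
proof -
 obtain N where N: "{x. \<not> P x} \<subseteq> N" "N \<in> null_sets lborel"
  using assms by (auto simp: eventually_ae_filter)
 have "{x. x - (- z) \<in> N} \<in> null_sets lborel" by (rule null_sets_translation[OF N(2)])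
 moreover have "{x. \<not> P (x + z)} \<subseteq> {x. x - (- z) \<in> N}" using N(1) by auto
 ultimately show ?thesis by (auto simp: eventually_ae_filter)
qed

lemma nn_integral_lborel_translate:
 fixes f :: "real^2 \<Rightarrow> ennreal"
 assumes "f \<in> borel_measurable borel"
 shows "(\<integral>\<^sup>+x. f (x + z) \<partial>lborel) = (\<integral>\<^sup>+x. f x \<partial>lborel)"
proof -
 have "(\<integral>\<^sup>+x. f x \<partial>lborel) = (\<integral>\<^sup>+x. f x \<partial>distr lborel borel ((+) z))" by (simp add: lborel_distr_plus)
 also have "\<dots> = (\<integral>\<^sup>+x. f (z + x) \<partial>lborel)" using assms by (subst nn_integral_distr) auto
 finally show ?thesis by (simp add: add.commute)
qed

text \<open>The fundamental theorem of calculus and Cauchy-Schwarz on the unit interval.\<close>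

lemma increment_square_le:
 fixes f f' :: "real \<Rightarrow> real"
 assumes c: "continuous_on UNIV f'"
  and d: "\<And>s. 0 \<le> s \<Longrightarrow> s \<le> 1 \<Longrightarrow> (f has_real_derivative f' s) (at s)"
 shows "ennreal ((f 1 - f 0)^2) \<le> (\<integral>\<^sup>+s. ennreal (indicator {0..1} s * (f' s)^2) \<partial>lborel)"
proof -
 have [measurable]: "f' \<in> borel_measurable borel" using c by (rule borel_measurable_continuous_onI)
 have int: "integrable lborel (\<lambda>s. indicator {0..1} s * (f' s)^2)"
  using borel_integrable_atLeastAtMost'[of 0 1 "\<lambda>s. (f' s)^2"] continuous_on_subset[OF c]
  by (auto simp: set_integrable_def intro!: continuous_on_power)
 have sq: "(indicator {0..1} s :: real)^2 = indicator {0..1} s" for s :: real by (simp add: indicator_def)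
 have 1: "(indicator {0..1} :: real \<Rightarrow> real) \<in> L2 lborel"
  by (simp add: L2_def sq integrable_indicator_iff)
 have 2: "(\<lambda>s. indicator {0..1} s * f' s) \<in> L2 lborel"
  using int by (simp add: L2_def power_mult_distrib sq)
 have n1: "l2norm lborel (indicator {0..1} :: real \<Rightarrow> real) = 1"
  by (simp add: l2norm_def sq)
 have "(LINT s|lborel. f' s * indicator {0..1} s) = f 1 - f 0"
 proof (rule integral_FTC_Icc_real)
  show "isCont f' x" for x using c by (simp add: continuous_on_eq_continuous_at)
 qed (use d in auto)
 moreover have "f' s * indicator {0..1} s = indicator {0..1} s * (indicator {0..1} s * f' s)" for s
  by (simp add: indicator_def)
 ultimately have "f 1 - f 0 = (LINT s|lborel. indicator {0..1} s * (indicator {0..1} s * f' s))"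
  by simp
 hence "\<bar>f 1 - f 0\<bar> \<le> l2norm lborel (\<lambda>s. indicator {0..1} s * f' s)"
  using L2_Cauchy_Schwarz[OF 1 2] n1 by simp
 hence "(f 1 - f 0)^2 \<le> (l2norm lborel (\<lambda>s. indicator {0..1} s * f' s))^2"
  by (metis abs_ge_zero power2_abs power_mono)
 also have "\<dots> = (LINT s|lborel. indicator {0..1} s * (f' s)^2)"
  by (simp add: l2norm_power2 power_mult_distrib sq)
 finally have "ennreal ((f 1 - f 0)^2) \<le> ennreal \<dots>" by (rule ennreal_leI)
 also have "\<dots> = (\<integral>\<^sup>+s. ennreal (indicator {0..1} s * (f' s)^2) \<partial>lborel)"
  by (rule nn_integral_eq_integral[symmetric, OF int]) simp
 finally show ?thesis .
qed

context planar_domain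
begin

text \<open>The increment is the integral of the gradient along the segment from \<open>x\<close> to
  \<open>x + z\<close>. It is computed for mollifications, which have derivatives along lines, and
  passed to \<open>u\<close> by Fatou.\<close>

lemma translation_estimate:
 assumes u: "u \<in> L20 \<omega>" and v: "\<And>i. v i \<in> L20 \<omega>" and w: "\<And>i. weak_partial0 \<omega> i u (v i)"
  and z: "norm z < d"
 defines "S \<equiv> norm z * (\<Sum>i\<in>UNIV. l2norm lborel (v i))"
 shows "(\<integral>\<^sup>+x. ennreal ((indicator (inset d) x * (u (x + z) - u x))^2) \<partial>lborel) \<le> ennreal (S^2)"
proof -
 have d: "d > 0" using z norm_ge_zero[of z] by linarith
 \<comment> \<open>What remains of the distance to the complement after moving by \<open>z\<close>;
   mollification radii up to \<open>d'\<close> are admissible along the whole segment.\<close>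
 define d' where "d' = d - norm z"
 have d': "d' > 0" "d' \<le> d" using z by (auto simp: d'_def)
 have u2: "u \<in> L2 lborel" and v2: "v i \<in> L2 lborel" for i using u v by (auto simp: L20_def)
 have ui: "integrable lborel u" and vi: "integrable lborel (v i)" for i
  using L20_integrable[OF bounded_dom open_dom] u v by auto
 note [measurable] = L2_lborel_measurable[OF u2] L2_lborel_measurable[OF v2]
 have S0: "0 \<le> S" unfolding S_def by (intro mult_nonneg_nonneg sum_nonneg) auto
 define h where "h k = d' / (Suc (Suc k))" for k :: nat
 have h0: "h k > 0" "h k \<le> d'" for k
  using d' by (auto simp: h_def divide_le_eq mult_left_le)
 have hl: "h \<longlonglongrightarrow> 0"
  unfolding h_def using tendsto_mult_right_zero[OF LIMSEQ_Suc[OF LIMSEQ_Suc[OF lim_1_over_n]], of d'] by simp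
 obtain r where r: "strict_mono r" "AE x in lborel. x \<in> inset (d'/2) \<longrightarrow> (\<lambda>n. moll (h (r n)) u x) \<longlonglongrightarrow> u x"
  by (rule moll_AE_subseq[OF u _ h0(1) hl, of "d'/2"]) (use d' in auto)
 let ?q = "\<lambda>k x. (indicator (inset d) x * (moll (h k) u (x + z) - moll (h k) u x))^2"
 have bd: "(\<integral>\<^sup>+x. ennreal (?q k x) \<partial>lborel) \<le> ennreal (S^2)" for k
 proof -
  define D where "D y = (\<Sum>i\<in>UNIV. z $ i * moll (h k) (v i) y)" for y
  have Dc: "continuous_on UNIV D" unfolding D_def
   using moll_continuous[OF vi h0(1)] by (intro continuous_intros)
  have [measurable]: "D \<in> borel_measurable borel" using Dc by (rule borel_measurable_continuous_onI)
  have p2: "moll (h k) (v i) \<in> L2 lborel" "l2norm lborel (moll (h k) (v i)) \<le> l2norm lborel (v i)" for i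
   using moll_L2[OF h0(1) v2] by auto
  let ?e = "\<lambda>x s. ennreal (indicator {0..1} s * (D (x + s *\<^sub>R z))^2)"
  have D2: "D \<in> L2 lborel" unfolding D_def[abs_def] by (intro L2_sum L2_scale p2)
  have "l2norm lborel D \<le> (\<Sum>i\<in>UNIV. l2norm lborel (\<lambda>y. z $ i * moll (h k) (v i) y))"
   unfolding D_def by (intro l2norm_sum_le L2_scale p2)
  also have "\<dots> \<le> (\<Sum>i\<in>UNIV. norm z * l2norm lborel (v i))"
   unfolding l2norm_scale using p2 by (intro sum_mono mult_mono) (auto simp: component_le_norm_cart)
  finally have Dn: "l2norm lborel D \<le> S" by (simp add: S_def sum_distrib_left)
  have pt: "ennreal (?q k x)
    \<le> (\<integral>\<^sup>+s. ?e x s \<partial>lborel)" for x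
  proof (cases "x \<in> inset d")
   case True
   have "ennreal ((moll (h k) u (x + 1 *\<^sub>R z) - moll (h k) u (x + 0 *\<^sub>R z))^2)
    \<le> (\<integral>\<^sup>+s. ?e x s \<partial>lborel)"
   proof (rule increment_square_le)
    have "continuous_on UNIV (\<lambda>s. x + s *\<^sub>R z)" by (intro continuous_intros)
    thus "continuous_on UNIV (\<lambda>s. D (x + s *\<^sub>R z))" using continuous_on_compose2[OF Dc] by auto
    fix s :: real assume s: "0 \<le> s" "s \<le> 1"
    have "dist x (x + s *\<^sub>R z) \<le> norm z" using s by (simp add: dist_norm mult_left_le_one_le)
    from inset_shift[OF True this] have "cball (x + s *\<^sub>R z) d' \<subseteq> \<omega>"
     unfolding d'_def by (rule inset_cball)
    hence "cball (x + s *\<^sub>R z) (h k) \<subseteq> \<omega>" using subset_cball[OF h0(2)] by blast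
    from moll_line_deriv[OF open_dom bounded_dom u w h0(1) this]
    show "((\<lambda>s. moll (h k) u (x + s *\<^sub>R z)) has_real_derivative D (x + s *\<^sub>R z)) (at s)"
     unfolding D_def .
   qed
   thus ?thesis using True by simp
  qed simp
  have "(\<integral>\<^sup>+x. ennreal (?q k x) \<partial>lborel)
   \<le> (\<integral>\<^sup>+x. \<integral>\<^sup>+s. ?e x s \<partial>lborel \<partial>lborel)"
   by (intro nn_integral_mono pt)
  also have "\<dots> = (\<integral>\<^sup>+s. \<integral>\<^sup>+x. ?e x s \<partial>lborel \<partial>lborel)"
   by (rule lborel_pair.Fubini') measurable
  also have "\<dots> = (\<integral>\<^sup>+(s::real). ennreal (indicator {0..1} s) * ennreal ((l2norm lborel D)^2) \<partial>lborel)"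
  proof (rule nn_integral_cong)
   fix s :: real
   have "(\<integral>\<^sup>+x. ?e x s \<partial>lborel)
    = ennreal (indicator {0..1} s) * (\<integral>\<^sup>+x. ennreal ((D (x + s *\<^sub>R z))^2) \<partial>lborel)"
    by (subst nn_integral_cmult[symmetric]) (auto simp: ennreal_mult')
   also have "(\<integral>\<^sup>+x. ennreal ((D (x + s *\<^sub>R z))^2) \<partial>lborel) = (\<integral>\<^sup>+x. ennreal ((D x)^2) \<partial>lborel)"
    by (rule nn_integral_lborel_translate) measurable
   also have "\<dots> = ennreal ((l2norm lborel D)^2)"
    unfolding l2norm_power2 by (rule nn_integral_eq_integral[OF L2_square_integrable[OF D2]]) simp
   finally show "(\<integral>\<^sup>+x. ?e x s \<partial>lborel)
    = ennreal (indicator {0..1} s) * ennreal ((l2norm lborel D)^2)" .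
  qed
  also have "\<dots> = ennreal ((l2norm lborel D)^2)"
   by (simp add: nn_integral_multc ennreal_indicator)
  also have "\<dots> \<le> ennreal (S^2)"
   using Dn by (intro ennreal_leI power_mono) auto
  finally show ?thesis .
 qed
 show ?thesis
 proof (rule nn_integral_Fatou_le[where f="\<lambda>k x. ennreal (?q (r k) x)", OF _ _ always_eventually[OF allI[OF bd]]])
  show "AE x in lborel. (\<lambda>k. ennreal (?q (r k) x)) \<longlonglongrightarrow> ennreal ((indicator (inset d) x * (u (x + z) - u x))^2)"
   using r(2) AE_lborel_translate[OF r(2), of z]
  proof eventually_elim
   case (elim x)
   show ?case
   proof (rule tendsto_ennrealI, cases "x \<in> inset d")
    case True
    hence "x \<in> inset (d'/2)" using inset_mono[of "d'/2" d] d' by auto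
    moreover have "x + z \<in> inset d'"
     using inset_shift[OF True, of "x + z" "norm z"] by (simp add: d'_def dist_norm)
    hence "x + z \<in> inset (d'/2)" using inset_mono[of "d'/2" d'] d' by auto
    ultimately show "(\<lambda>k. ?q (r k) x) \<longlonglongrightarrow> (indicator (inset d) x * (u (x + z) - u x))^2"
     using elim by (intro tendsto_intros) auto
   qed simp
  qed
 qed measurable
qed

text \<open>Mollification averages translates by vectors shorter than \<open>h\<close>, so Jensen's
  inequality and the translation estimate bound the error by \<open>h\<close> times the gradient
  norm. Compactness rests on this uniform rate.\<close>

lemma moll_estimate:
 assumes u: "u \<in> L20 \<omega>" and v: "\<And>i. v i \<in> L20 \<omega>" and w: "\<And>i. weak_partial0 \<omega> i u (v i)"
  and h: "0 < h" "h < d"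
 defines "S \<equiv> h * (\<Sum>i\<in>UNIV. l2norm lborel (v i))"
 shows "l2norm lborel (\<lambda>x. indicator (inset d) x * (moll h u x - u x)) \<le> S"
proof -
 have u2: "u \<in> L2 lborel" using u by (auto simp: L20_def)
 have ui: "integrable lborel u" using L20_integrable[OF bounded_dom open_dom] u by auto
 note [measurable] = L2_lborel_measurable[OF u2]
 have S0: "0 \<le> S" unfolding S_def using h by (intro mult_nonneg_nonneg sum_nonneg) auto
 let ?c = "bump_mass h"
 note c = bump_mass_pos[OF h(1)]
 let ?k = "\<lambda>z. bump h 0 z / ?c"
 have k0: "0 \<le> ?k z" for z using c bump_nonneg by simp
 let ?e = "\<lambda>z. ennreal (?k z)" and ?S = "ennreal (S^2)"
 let ?q = "\<lambda>x z. ennreal ((indicator (inset d) x * (u (x + z) - u x))^2)"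
 let ?f = "\<lambda>x. indicator (inset d) x * (moll h u x - u x)"
 have f2: "?f \<in> L2 lborel"
  by (rule L2_bound[OF L2_diff[OF moll_L2(1)[OF h(1) u2] u2]]) (auto simp: indicator_def)
 have pt: "ennreal ((?f x)^2) \<le> (\<integral>\<^sup>+z. ?e z * ?q x z \<partial>lborel)" for x
 proof (cases "x \<in> inset d")
  case True
  have "moll h u x - u x = (LINT y|lborel. u y * (bump h x y / ?c)) - (LINT y|lborel. u x * (bump h x y / ?c))"
   using kernel_integral[OF h(1), of x] unfolding moll_def integral_mult_right_zero by simp
  also have "\<dots> = (LINT y|lborel. (u y - u x) * (bump h x y / ?c))"
   unfolding left_diff_distrib
   using moll_kernel_integrable[OF h(1), of u x] integrable_bump[OF h(1), of x] u2
   by (intro Bochner_Integration.integral_diff[symmetric] integrable_mult_right integrable_divide) auto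
  finally have eq: "moll h u x - u x = (LINT y|lborel. (u y - u x) * (bump h x y / ?c))" .
  have "ennreal ((?f x)^2) \<le> (\<integral>\<^sup>+y. ennreal ((u y - u x)^2 * (bump h x y / ?c)) \<partial>lborel)"
   using True moll_Jensen[OF h(1), of "\<lambda>y. u y - u x" x] by (simp add: eq)
  also have "\<dots> = (\<integral>\<^sup>+y. ennreal ((u (y + x) - u x)^2 * (bump h x (y + x) / ?c)) \<partial>lborel)"
   by (rule nn_integral_lborel_translate[symmetric]) measurable
  also have "\<dots> = (\<integral>\<^sup>+z. ?e z * ?q x z \<partial>lborel)"
  proof (rule nn_integral_cong)
   fix z
   have "bump h x (z + x) = bump h 0 z" by (simp add: bump_def)
   thus "ennreal ((u (z + x) - u x)^2 * (bump h x (z + x) / ?c))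
    = ?e z * ?q x z"
    using True k0[of z] by (simp add: ennreal_mult'[symmetric] mult.commute add.commute)
  qed
  finally show ?thesis .
 qed simp
 have "ennreal ((l2norm lborel ?f)^2) = (\<integral>\<^sup>+x. ennreal ((?f x)^2) \<partial>lborel)"
  unfolding l2norm_power2 by (rule nn_integral_eq_integral[symmetric, OF L2_square_integrable[OF f2]]) simp
 also have "\<dots> \<le> (\<integral>\<^sup>+x. \<integral>\<^sup>+z. ?e z * ?q x z \<partial>lborel \<partial>lborel)"
  by (intro nn_integral_mono pt)
 also have "\<dots> = (\<integral>\<^sup>+z. \<integral>\<^sup>+x. ?e z * ?q x z \<partial>lborel \<partial>lborel)"
  by (rule lborel_pair.Fubini') measurable
 also have "\<dots> \<le> (\<integral>\<^sup>+z. ?e z * ?S \<partial>lborel)"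
 proof (rule nn_integral_mono)
  fix z
  have "(\<integral>\<^sup>+x. ?e z * ?q x z \<partial>lborel)
   = ?e z * (\<integral>\<^sup>+x. ?q x z \<partial>lborel)"
   by (rule nn_integral_cmult) measurable
  also have "\<dots> \<le> ?e z * ?S"
  proof (cases "norm z < h")
   case True
   have "(norm z * (\<Sum>i\<in>UNIV. l2norm lborel (v i)))^2 \<le> S^2"
    unfolding S_def using True by (intro power_mono mult_right_mono mult_nonneg_nonneg sum_nonneg) auto
   hence "ennreal ((norm z * (\<Sum>i\<in>UNIV. l2norm lborel (v i)))^2) \<le> ?S" by (rule ennreal_leI)
   with translation_estimate[OF u v w, of z d] True h
   have "(\<integral>\<^sup>+x. ?q x z \<partial>lborel) \<le> ?S"
    using order_trans by fastforce
   thus ?thesis by (rule mult_left_mono) simp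
  next
   case False
   hence "bump h 0 z = 0" using bump_eq_0[OF h(1), of 0 z] by simp
   thus ?thesis by simp
  qed
  finally show "(\<integral>\<^sup>+x. ?e z * ?q x z \<partial>lborel)
   \<le> ?e z * ?S" .
 qed
 also have "\<dots> = ?S"
  using kernel_mass[OF h(1), of 0] by (subst nn_integral_multc) auto
 finally have "(l2norm lborel ?f)^2 \<le> S^2" by (simp add: ennreal_le_iff)
 thus ?thesis using S0 by (rule power2_le_imp_le)
qed

section \<open>Compactness of mollified sequences\<close>

lemma moll_bound:
 assumes u: "u \<in> L2 lborel" and d: "d > 0"
 shows "\<bar>moll d u x\<bar> \<le> l2norm lborel u / sqrt (bump_mass d)"
proof -
 let ?c = "bump_mass d"
 note c = bump_mass_pos[OF d]
 note [measurable] = L2_lborel_measurable[OF u]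
 have "ennreal ((moll d u x)^2) \<le> (\<integral>\<^sup>+y. ennreal ((u y)^2 * (bump d x y / ?c)) \<partial>lborel)"
  unfolding moll_def by (rule moll_Jensen[OF d]) measurable
 also have "\<dots> \<le> (\<integral>\<^sup>+y. ennreal ((u y)^2 / ?c) \<partial>lborel)"
  using c bump_le_1 bump_nonneg by (intro nn_integral_mono ennreal_leI) (simp add: divide_right_mono mult_left_le)
 also have "\<dots> = ennreal ((l2norm lborel u)^2 / ?c)"
  using c L2_square_integrable[OF u] by (subst nn_integral_eq_integral) (auto simp: l2norm_power2)
 finally have "(moll d u x)^2 \<le> (l2norm lborel u)^2 / ?c" using c by (simp add: ennreal_le_iff)
 hence "(moll d u x)^2 \<le> (l2norm lborel u / sqrt ?c)^2" using c by (simp add: power_divide)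
 hence "\<bar>moll d u x\<bar> \<le> \<bar>l2norm lborel u / sqrt ?c\<bar>" by (simp only: abs_le_square_iff)
 moreover have "0 \<le> l2norm lborel u / sqrt ?c" using c by simp
 ultimately show ?thesis by linarith
qed

text \<open>The constant depends on the radius only, so bounded sets in L2 become equi-Lipschitz.
  The mean value theorem gives the Lipschitz constant of the kernel, and Cauchy-Schwarz on the
  bounded domain replaces the L1 norm of \<open>u\<close> by its L2 norm.\<close>

lemma moll_lipschitz:
 assumes d: "d > 0"
 obtains L where "L \<ge> 0" "\<And>u x y. u \<in> L20 \<omega> \<Longrightarrow> \<bar>moll d u x - moll d u y\<bar> \<le> L * l2norm lborel u * norm (x - y)"
proof -
 let ?c = "bump_mass d"
 note c = bump_mass_pos[OF d]
 have "\<forall>i. \<exists>C. \<forall>z. \<bar>pd i (bump d 0) z\<bar> \<le> C"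
  using partial_bump_bounded[OF d] by meson
 then obtain C where C: "\<And>i z. \<bar>pd i (bump d 0) z\<bar> \<le> C i" by metis
 define B where "B = (\<Sum>i\<in>UNIV. C i)"
 have C0: "0 \<le> C i" for i using C[of i 0] by simp
 have B0: "0 \<le> B" unfolding B_def using C0 by (intro sum_nonneg) auto
 have lip: "\<bar>bump d 0 p - bump d 0 q\<bar> \<le> B * norm (p - q)" for p q
 proof -
  obtain s :: real where "bump d 0 (q + 1 *\<^sub>R (p - q)) - bump d 0 (q + 0 *\<^sub>R (p - q))
    = (1 - 0) * (\<Sum>i\<in>UNIV. (p - q) $ i * pd i (bump d 0) (q + s *\<^sub>R (p - q)))"
   using MVT2[OF zero_less_one line_deriv[OF smooth_differentiable[OF smooth_bump]]] by blast
  hence "bump d 0 p - bump d 0 q = (\<Sum>i\<in>UNIV. (p - q) $ i * pd i (bump d 0) (q + s *\<^sub>R (p - q)))"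
   by simp
  hence "\<bar>bump d 0 p - bump d 0 q\<bar> \<le> (\<Sum>i\<in>UNIV. \<bar>(p - q) $ i * pd i (bump d 0) (q + s *\<^sub>R (p - q))\<bar>)"
   by (simp only: sum_abs)
  also have "\<dots> \<le> (\<Sum>i\<in>UNIV. norm (p - q) * C i)"
   unfolding abs_mult using C by (intro sum_mono mult_mono component_le_norm_cart) auto
  also have "\<dots> = B * norm (p - q)" by (simp add: B_def sum_distrib_right mult.commute)
  finally show ?thesis .
 qed
 define m where "m = l2norm lborel (\<lambda>x::real^2. 1 * indicator \<omega> x)"
 have m0: "0 \<le> m" by (simp add: m_def)
 show thesis
 proof (rule that[of "B / ?c * m"])
  show "0 \<le> B / ?c * m" using B0 c m0 by simp
  fix u x y assume u: "u \<in> L20 \<omega>"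
  have u2: "u \<in> L2 lborel" and uz: "\<And>x. x \<notin> \<omega> \<Longrightarrow> u x = 0" using u by (auto simp: L20_def)
  have ui: "integrable lborel u" using L20_integrable[OF bounded_dom open_dom u] .
  note [measurable] = borel_measurable_integrable[OF ui]
  have a2: "(\<lambda>x. \<bar>u x\<bar>) \<in> L2 lborel" using u2 by (auto simp: L2_def)
  have "moll d u x - moll d u y = (LINT t|lborel. u t * (bump d x t / ?c) - u t * (bump d y t / ?c))"
   unfolding moll_def using moll_kernel_integrable[OF d, of u] u2
   by (intro Bochner_Integration.integral_diff[symmetric]) auto
  hence "\<bar>moll d u x - moll d u y\<bar> \<le> (LINT t|lborel. \<bar>u t * (bump d x t / ?c) - u t * (bump d y t / ?c)\<bar>)"
   by (simp only: integral_abs_bound)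
  also have "\<dots> \<le> (LINT t|lborel. (B / ?c * norm (x - y)) * \<bar>u t\<bar>)"
  proof (rule integral_mono)
   show "integrable lborel (\<lambda>t. \<bar>u t * (bump d x t / ?c) - u t * (bump d y t / ?c)\<bar>)"
    using moll_kernel_integrable[OF d, of u] u2 by (intro integrable_abs Bochner_Integration.integrable_diff) auto
   show "integrable lborel (\<lambda>t. (B / ?c * norm (x - y)) * \<bar>u t\<bar>)" using ui by (intro integrable_mult_right integrable_abs)
   fix t
   have "\<bar>bump d x t - bump d y t\<bar> \<le> B * norm (x - y)"
    using lip[of "t - x" "t - y"] unfolding bump_shift[symmetric] by (simp add: norm_minus_commute)
   hence "\<bar>u t\<bar> * (\<bar>bump d x t - bump d y t\<bar> / ?c) \<le> \<bar>u t\<bar> * (B * norm (x - y) / ?c)"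
    using c by (intro mult_left_mono divide_right_mono) auto
   moreover have "\<bar>u t * (bump d x t / ?c) - u t * (bump d y t / ?c)\<bar> = \<bar>u t\<bar> * (\<bar>bump d x t - bump d y t\<bar> / ?c)"
    using c by (simp add: abs_mult right_diff_distrib[symmetric] diff_divide_distrib[symmetric])
   ultimately show "\<bar>u t * (bump d x t / ?c) - u t * (bump d y t / ?c)\<bar> \<le> (B / ?c * norm (x - y)) * \<bar>u t\<bar>"
    by (simp add: mult_ac)
  qed
  also have "\<dots> = (B / ?c * norm (x - y)) * (LINT t|lborel. \<bar>u t\<bar> * (1 * indicator \<omega> t))"
  proof -
   have "(\<lambda>t. \<bar>u t\<bar>) = (\<lambda>t. \<bar>u t\<bar> * (1 * indicator \<omega> t))" using uz by (auto simp: indicator_def fun_eq_iff)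
   hence "(LINT t|lborel. \<bar>u t\<bar>) = (LINT t|lborel. \<bar>u t\<bar> * (1 * indicator \<omega> t))" by (rule arg_cong)
   thus ?thesis by (simp only: integral_mult_right_zero)
  qed
  also have "\<dots> \<le> (B / ?c * norm (x - y)) * (l2norm lborel u * m)"
  proof (rule mult_left_mono)
   have "\<bar>LINT t|lborel. \<bar>u t\<bar> * (1 * indicator \<omega> t)\<bar> \<le> l2norm lborel (\<lambda>x. \<bar>u x\<bar>) * m"
    unfolding m_def by (rule L2_Cauchy_Schwarz[OF a2 L2_indicator[OF bounded_dom dom_borel]])
   moreover have "l2norm lborel (\<lambda>x. \<bar>u x\<bar>) * m = l2norm lborel u * m" by (simp add: l2norm_def)
   ultimately show "(LINT t|lborel. \<bar>u t\<bar> * (1 * indicator \<omega> t)) \<le> l2norm lborel u * m" by linarith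
   show "0 \<le> B / ?c * norm (x - y)" using B0 c by simp
  qed
  finally show "\<bar>moll d u x - moll d u y\<bar> \<le> B / ?c * m * l2norm lborel u * norm (x - y)"
   by (simp add: mult_ac)
 qed
qed

text \<open>An Arzela-Ascoli argument: a diagonal sequence converges at countably many dense points
  for all radii \<open>1 / Suc k\<close> and all \<open>i\<close>, and the equi-Lipschitz bound
  carries convergence to every point.\<close>

lemma mollified_subsequence:
 fixes u :: "nat \<Rightarrow> nat \<Rightarrow> real^2 \<Rightarrow> real"
 assumes u: "\<And>i n. u i n \<in> L20 \<omega>" and B: "\<And>i n. l2norm lborel (u i n) \<le> B"
 obtains r :: "nat \<Rightarrow> nat" where "strict_mono r"
  "\<And>i k x. convergent (\<lambda>n. moll (1 / Suc k) (u i (r n)) x)"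
proof -
 have B0: "0 \<le> B" using B[of 0 0] l2norm_nonneg order_trans by blast
 have u2: "u i n \<in> L2 lborel" for i n using u by (auto simp: L20_def)
 obtain D :: "(real^2) set" where D: "countable D" "\<And>X. open X \<Longrightarrow> X \<noteq> {} \<Longrightarrow> \<exists>d\<in>D. d \<in> X"
  by (rule countable_dense_setE) blast
 have Dne: "D \<noteq> {}" using D(2)[of UNIV] by auto
 define a where "a p n = moll (1 / Suc (fst (snd p))) (u (fst p) n) (from_nat_into D (snd (snd p)))"
  for p :: "nat \<times> nat \<times> nat" and n
 have bd: "\<bar>a p n\<bar> \<le> B / sqrt (bump_mass (1 / Suc (fst (snd p))))" for p n
 proof -
  have "\<bar>a p n\<bar> \<le> l2norm lborel (u (fst p) n) / sqrt (bump_mass (1 / Suc (fst (snd p))))"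
   unfolding a_def by (rule moll_bound[OF u2]) simp
  also have "\<dots> \<le> B / sqrt (bump_mass (1 / Suc (fst (snd p))))"
   using B bump_mass_pos[of "1 / Suc (fst (snd p))"] by (intro divide_right_mono) auto
  finally show ?thesis .
 qed
 obtain r :: "nat \<Rightarrow> nat" where r: "strict_mono r" "\<And>p. convergent (\<lambda>n. a p (r n))"
  using diagonal_convergent_subsequence[of a "\<lambda>p. B / sqrt (bump_mass (1 / Suc (fst (snd p))))", OF bd] by blast
 have "convergent (\<lambda>n. moll (1 / Suc k) (u i (r n)) x)" for i k x
 proof -
  let ?w = "\<lambda>n. moll (1 / Suc k) (u i (r n))"
  obtain L where L: "L \<ge> 0" "\<And>u x y. u \<in> L20 \<omega> \<Longrightarrow>
    \<bar>moll (1 / Suc k) u x - moll (1 / Suc k) u y\<bar> \<le> L * l2norm lborel u * norm (x - y)"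
   by (rule moll_lipschitz[of "1 / Suc k"]) simp_all
  have "Cauchy (\<lambda>n. ?w n x)"
  proof (rule CauchyI)
   fix e :: real assume e: "e > 0"
   \<comment> \<open>Moving to a dense point within \<open>q\<close> changes every member by less
     than \<open>e / 3\<close>; the \<open>+ 1\<close> covers \<open>L * B = 0\<close>.\<close>
   define q where "q = e / (3 * (L * B + 1))"
   have LB: "0 \<le> L * B" using L(1) B0 by simp
   have q: "q > 0" "L * B * q < e / 3" using e LB by (auto simp: q_def field_simps add_nonneg_pos)
   obtain d where d: "d \<in> D" "d \<in> ball x q" using D(2)[of "ball x q"] q(1) by auto
   then obtain m where m: "from_nat_into D m = d" using from_nat_into_surj[OF D(1)] by blast
   have near: "\<bar>?w n x - ?w n d\<bar> < e / 3" for n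
   proof -
    have "\<bar>?w n x - ?w n d\<bar> \<le> L * l2norm lborel (u i (r n)) * norm (x - d)" by (rule L(2)[OF u])
    also have "\<dots> \<le> L * B * q"
     using d(2) L(1) B B0 by (intro mult_mono) (auto simp: dist_norm less_imp_le)
    also have "\<dots> < e / 3" by (rule q(2))
    finally show ?thesis .
   qed
   have "Cauchy (\<lambda>n. ?w n d)" using r(2)[of "(i, k, m)"] m by (simp add: a_def convergent_Cauchy)
   then obtain N where N: "\<And>p n. p \<ge> N \<Longrightarrow> n \<ge> N \<Longrightarrow> \<bar>?w p d - ?w n d\<bar> < e / 3"
    using CauchyD[of "\<lambda>n. ?w n d" "e/3"] e by auto
   have "\<bar>?w p x - ?w n x\<bar> < e" if "p \<ge> N" "n \<ge> N" for p n
    using near[of p] near[of n] N[OF that] by linarith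
   thus "\<exists>M. \<forall>m\<ge>M. \<forall>n\<ge>M. norm (?w m x - ?w n x) < e" by auto
  qed
  thus ?thesis by (simp add: Cauchy_convergent_iff)
 qed
 with r(1) show thesis by (rule that)
qed

text \<open>The mollifications are uniformly bounded, so pointwise convergence becomes convergence
  in L2 on the bounded domain.\<close>

lemma mollified_Cauchy:
 fixes u :: "nat \<Rightarrow> real^2 \<Rightarrow> real"
 assumes u: "\<And>n. u n \<in> L20 \<omega>" and B: "\<And>n. l2norm lborel (u n) \<le> B" and d: "d > 0"
  and c: "\<And>x. convergent (\<lambda>n. moll d (u n) x)" and e: "e > 0"
 shows "\<exists>N. \<forall>m\<ge>N. \<forall>n\<ge>N. l2norm lborel (\<lambda>x. indicator \<omega> x * (moll d (u m) x - moll d (u n) x)) < e"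
proof -
 have u2: "u n \<in> L2 lborel" for n using u by (auto simp: L20_def)
 note [measurable] = L2_lborel_measurable[OF u2]
 define C where "C = B / sqrt (bump_mass d)"
 define g where "g x = lim (\<lambda>n. moll d (u n) x)" for x
 have gm [measurable]: "g \<in> borel_measurable borel" unfolding g_def by measurable
 have gl: "(\<lambda>n. moll d (u n) x) \<longlonglongrightarrow> g x" for x using c by (simp add: g_def convergent_LIMSEQ_iff)
 let ?q = "\<lambda>n x. indicator \<omega> x * (moll d (u n) x - g x)"
 have bd: "\<bar>moll d (u n) x\<bar> \<le> C" for n x
 proof -
  have "0 \<le> sqrt (bump_mass d)" using bump_mass_pos[OF d] by simp
  with moll_bound[OF u2 d, of n x] divide_right_mono[OF B[of n], of "sqrt (bump_mass d)"]
  show ?thesis unfolding C_def by linarith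
 qed
 have gb: "\<bar>g x\<bar> \<le> C" for x
  by (rule LIMSEQ_le_const2[OF tendsto_rabs[OF gl]]) (use bd in auto)
 have fb: "\<bar>?q n x\<bar> \<le> (2 * C) * indicator \<omega> x" for n x
  using bd[of n x] gb[of x] by (cases "x \<in> \<omega>") auto
 have f2: "(?q n) \<in> L2 lborel" for n
 proof (rule L2_bound[OF L2_indicator[OF bounded_dom dom_borel, of "2 * C"]])
  show "AE x in lborel. \<bar>?q n x\<bar> \<le> \<bar>2 * C * indicator \<omega> x\<bar>"
  proof (rule AE_I2)
   fix x show "\<bar>?q n x\<bar> \<le> \<bar>2 * C * indicator \<omega> x\<bar>"
    using fb[of x n] by (rule order_trans) (rule abs_ge_self)
  qed
 qed measurable
 have "(\<lambda>n. l2norm lborel (?q n)) \<longlonglongrightarrow> 0"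
 proof (rule L2_dominated_convergence[OF _ L2_indicator[OF bounded_dom dom_borel, of "2 * C"]])
  show "AE x in lborel. (\<lambda>n. ?q n x) \<longlonglongrightarrow> 0"
   using gl by (intro AE_I2 tendsto_mult_right_zero) (simp add: LIM_zero_iff)
  show "AE x in lborel. \<bar>?q n x\<bar> \<le> 2 * C * indicator \<omega> x" for n
   using fb by (intro AE_I2)
 qed measurable
 then obtain N where N: "\<And>n. n \<ge> N \<Longrightarrow> l2norm lborel (?q n) < e / 2"
  using LIMSEQ_D[of _ 0 "e/2"] e by fastforce
 have "l2norm lborel (\<lambda>x. indicator \<omega> x * (moll d (u m) x - moll d (u n) x)) < e" if "m \<ge> N" "n \<ge> N" for m n
 proof -
  have "(\<lambda>x. indicator \<omega> x * (moll d (u m) x - moll d (u n) x))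
   = (\<lambda>x. ?q m x - ?q n x)"
   by (simp add: algebra_simps)
  thus ?thesis using l2norm_diff_le[OF f2[of m] f2[of n]] N[OF that(1)] N[OF that(2)] by simp
 qed
 thus ?thesis by blast
qed

text \<open>For a small radius every member is within \<open>e / 4\<close> of its mollification on
  the inset, uniformly in the index, and for that fixed radius the mollifications form a Cauchy
  sequence.\<close>

lemma rellich_interior:
 fixes u :: "nat \<Rightarrow> real^2 \<Rightarrow> real"
 assumes u: "\<And>n. u n \<in> L20 \<omega>" and v: "\<And>n i. v n i \<in> L20 \<omega>" and w: "\<And>n i. weak_partial0 \<omega> i (u n) (v n i)"
  and B: "\<And>n. l2norm lborel (u n) \<le> B" "\<And>n i. l2norm lborel (v n i) \<le> B"
  and c: "\<And>k x. convergent (\<lambda>n. moll (1 / Suc k) (u n) x)" and e: "e > 0" and d: "d > 0"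
 shows "\<exists>N. \<forall>m\<ge>N. \<forall>n\<ge>N. l2norm lborel (\<lambda>x. indicator (inset d) x * (u m x - u n x)) < e"
proof -
 have B0: "0 \<le> B" using B(1)[of 0] l2norm_nonneg order_trans by blast
 have u2: "u n \<in> L2 lborel" for n using u by (auto simp: L20_def)
 note [measurable] = L2_lborel_measurable[OF u2]
 \<comment> \<open>The two partial derivatives contribute \<open>2 * B\<close>, and
   \<open>8 * B + 8\<close> makes \<open>h * (2 * B)\<close> less than \<open>e / 4\<close> while
   staying positive for \<open>B = 0\<close>.\<close>
 obtain k :: nat where k: "1 / Suc k < min d (e / (8 * B + 8))"
  using nat_approx_posE[of "min d (e / (8 * B + 8))"] d e B0 by auto
 define h where "h = 1 / Suc k"
 have h: "h > 0" "h < d" using k by (auto simp: h_def)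
 have "h * (8 * B + 8) < e" using k B0 unfolding h_def[symmetric] by (simp add: pos_less_divide_eq)
 hence hB: "h * (2 * B) < e / 4" using h by (simp add: algebra_simps)
 have m2: "moll h (u n) \<in> L2 lborel" for n using moll_L2(1)[OF h(1) u2] .
 have est: "l2norm lborel (\<lambda>x. indicator (inset d) x * (moll h (u n) x - u n x)) < e / 4" for n
 proof -
  have "l2norm lborel (\<lambda>x. indicator (inset d) x * (moll h (u n) x - u n x)) \<le> h * (\<Sum>i\<in>UNIV. l2norm lborel (v n i))"
   by (rule moll_estimate[OF u v w h])
  also have "\<dots> \<le> h * (2 * B)"
   using h B(2)[of n 1] B(2)[of n 2] by (intro mult_left_mono) (auto simp: sum_2)
  finally show ?thesis using hB by linarith
 qed
 obtain N where N: "\<And>m n. m \<ge> N \<Longrightarrow> n \<ge> N \<Longrightarrow> l2norm lborel (\<lambda>x. indicator \<omega> x * (moll h (u m) x - moll h (u n) x)) < e / 4"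
  using mollified_Cauchy[OF u B(1) h(1) c[of k, folded h_def], where e="e/4"] e by auto
 have "l2norm lborel (\<lambda>x. indicator (inset d) x * (u m x - u n x)) < e" if mn: "m \<ge> N" "n \<ge> N" for m n
 proof -
  have i2: "(\<lambda>x. indicator S x * f x) \<in> L2 lborel" if "f \<in> L2 lborel" "S \<in> sets borel" for f and S :: "(real^2) set"
   by (rule L2_bound[OF that(1)]) (use that in \<open>auto simp: L2_def indicator_def\<close>)
  let ?I = "indicator (inset d) :: real^2 \<Rightarrow> real"
  have 1: "(\<lambda>x. ?I x * (moll h (u n) x - u n x)) \<in> L2 lborel" for n
   by (rule i2[OF L2_diff[OF m2 u2] inset_borel])
  have 2: "(\<lambda>x. ?I x * (moll h (u m) x - moll h (u n) x)) \<in> L2 lborel"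
   by (rule i2[OF L2_diff[OF m2 m2] inset_borel])
  have "l2norm lborel (\<lambda>x. ?I x * (moll h (u m) x - moll h (u n) x))
    \<le> l2norm lborel (\<lambda>x. indicator \<omega> x * (moll h (u m) x - moll h (u n) x))"
  proof (rule l2norm_mono[OF i2[OF L2_diff[OF m2 m2] dom_borel]])
   show "AE x in lborel. \<bar>?I x * (moll h (u m) x - moll h (u n) x)\<bar> \<le> \<bar>indicator \<omega> x * (moll h (u m) x - moll h (u n) x)\<bar>"
    using inset_subset[of d] d by (intro AE_I2) (auto simp: indicator_def)
  qed measurable
  hence 3: "l2norm lborel (\<lambda>x. ?I x * (moll h (u m) x - moll h (u n) x)) < e / 4" using N[OF mn] by linarith
  have eq: "(\<lambda>x. ?I x * (u m x - u n x)) = (\<lambda>x. (?I x * (moll h (u n) x - u n x) - ?I x * (moll h (u m) x - u m x))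
    + ?I x * (moll h (u m) x - moll h (u n) x))"
   by (simp add: algebra_simps)
  have "l2norm lborel (\<lambda>x. ?I x * (u m x - u n x)) \<le>
   l2norm lborel (\<lambda>x. ?I x * (moll h (u n) x - u n x) - ?I x * (moll h (u m) x - u m x)) + e / 4"
   unfolding eq using l2norm_triangle[OF L2_diff[OF 1[of n] 1[of m]] 2] 3 by linarith
  also have "\<dots> \<le> e/4 + e/4 + e/4"
   using l2norm_diff_le[OF 1[of n] 1[of m]] est[of n] est[of m] by linarith
  finally show ?thesis using e by linarith
 qed
 thus ?thesis by blast
qed

lemma inset_complement_small:
 assumes "e > 0"
 obtains d where "d > 0" "nm (\<lambda>x. indicator (- inset d) x) < e"
proof -
 let ?f = "\<lambda>n::nat. \<lambda>x. indicator (- inset (1 / Suc n)) x :: real"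
 have m: "?f n \<in> borel_measurable M" for n
  by (rule lborel_measurable_dom) measurable
 have "(\<lambda>n. nm (?f n)) \<longlonglongrightarrow> 0"
 proof (rule L2_dominated_convergence[OF m L2_const[OF finite_measure_dom, of 1]])
  show "AE x in M. \<bar>?f n x\<bar> \<le> 1" for n by (simp add: indicator_def)
  show "AE x in M. (\<lambda>n. ?f n x) \<longlonglongrightarrow> 0"
  proof (rule AE_I2)
   fix x assume "x \<in> space M"
   hence "x \<in> \<omega>" by simp
   then obtain k where k: "x \<in> inset (1 / Suc k)" using Union_inset by auto
   have "?f n x = 0" if "n \<ge> k" for n
    using k inset_mono[of "1 / Suc n" "1 / Suc k"] that by (auto simp: frac_le)
   thus "(\<lambda>n. ?f n x) \<longlonglongrightarrow> 0" by (intro tendsto_eventually eventually_sequentiallyI[of k])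
  qed
 qed
 then obtain n where "nm (?f n) < e"
  using LIMSEQ_D[of _ 0 e] assms by fastforce
 thus thesis by (intro that[of "1 / Suc n"]) auto
qed

lemma H1_diff_norms:
 assumes "u \<in> H1 \<omega>" "v \<in> H1 \<omega>"
 shows "nm (wd i (\<lambda>x. u x - v x))
  = nm (\<lambda>x. wd i u x - wd i v x)"
 by (rule l2norm_cong_AE[OF _ _ H1_diff(2)[OF assms]])
  (intro L2_measurable weak_partial_works(1) H1_diff(1) L2_diff assms)+

end

context lipschitz_domain
begin

text \<open>Interior compactness leaves the strip outside \<open>inset d\<close>. There
  Cauchy-Schwarz bounds the integral of the squared difference by the norm of the indicator of the
  strip, which is small, times the L2 norm of the square, which the Ladyzhenskaya inequality keeps
  bounded. The index \<open>i\<close> gives several sequences a common subsequence.\<close>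

lemma rellich:
 fixes u :: "nat \<Rightarrow> nat \<Rightarrow> real^2 \<Rightarrow> real"
 assumes u: "\<And>i n. u i n \<in> H1 \<omega>" and B: "\<And>i n. nm (u i n) \<le> B"
  "\<And>i n a. nm (wd a (u i n)) \<le> B"
 obtains r :: "nat \<Rightarrow> nat" where "strict_mono r"
  "\<And>i e. e > 0 \<Longrightarrow> \<exists>N. \<forall>m\<ge>N. \<forall>n\<ge>N. nm (\<lambda>x. u i (r m) x - u i (r n) x) < e"
proof -
 have B0: "0 \<le> B" using B(1)[of 0 0] l2norm_nonneg order_trans by blast
 define P where "P w u0 v \<longleftrightarrow> u0 \<in> L20 \<omega> \<and> (AE x in M. w x = u0 x) \<and>
  (\<forall>a. v a \<in> L20 \<omega> \<and> weak_partial0 \<omega> a u0 (v a) \<and> (AE x in M. wd a w x = v a x))" for w u0 v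
 have "\<exists>u0 v. P (u i n) u0 v" for i n
  unfolding P_def by (rule H1_representative[OF u[of i n]]) blast
 then obtain u0 v where P: "\<And>i n. P (u i n) (u0 i n) (v i n)" by metis
 have u0: "u0 i n \<in> L20 \<omega>" "AE x in M. u i n x = u0 i n x" for i n
  using P[of i n] unfolding P_def by auto
 have v: "v i n a \<in> L20 \<omega>" "weak_partial0 \<omega> a (u0 i n) (v i n a)" "AE x in M. wd a (u i n) x = v i n a x" for i n a
  using P[of i n] unfolding P_def by auto
 have B': "l2norm lborel (u0 i n) \<le> B" "l2norm lborel (v i n a) \<le> B" for i n a
  using B(1)[of i n] l2norm_L20_eq[OF H1_L2[OF u] u0, of i n]
   B(2)[of a i n] l2norm_L20_eq[OF weak_partial_works(1)[OF u] v(1,3), of a i n] by simp_all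
 obtain r :: "nat \<Rightarrow> nat" where r: "strict_mono r" "\<And>i k x. convergent (\<lambda>n. moll (1 / Suc k) (u0 i (r n)) x)"
  using mollified_subsequence[where u=u0, OF u0(1) B'(1)] by blast
 obtain K where K: "K \<ge> 0" "\<And>u. u \<in> H1 \<omega> \<Longrightarrow> (\<lambda>x. (u x)^2) \<in> L2 M"
   "\<And>u. u \<in> H1 \<omega> \<Longrightarrow> nm (\<lambda>x. (u x)^2) \<le> K * (nm u *
    (nm u + (\<Sum>a\<in>UNIV. nm (wd a u))))"
  using ladyzhenskaya by blast
 show thesis
 proof (rule that[OF r(1)])
  fix i and e :: real assume e: "e > 0"
  let ?f = "\<lambda>m n x. u i (r m) x - u i (r n) x"
  \<comment> \<open>Differences of two members have norms at most \<open>2 * B\<close>; the function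
    and its two partial derivatives together give \<open>6 * B\<close>.\<close>
  define C where "C = K * (2 * B * (6 * B))"
  have C0: "0 \<le> C" using K(1) B0 by (simp add: C_def)
  have "e^2 / 4 / (C + 1) > 0" using e C0 by simp
  then obtain d where d: "d > 0" "nm (\<lambda>x. indicator (- inset d) x) < e^2 / 4 / (C + 1)"
   by (rule inset_complement_small)
 let ?J = "\<lambda>x. indicator (- inset d) x :: real"
  have dC: "nm ?J * C < (e/2)^2"
  proof -
   have "nm ?J * C \<le> nm ?J * (C + 1)"
    by (intro mult_left_mono) auto
   also have "\<dots> < (e^2 / 4 / (C + 1)) * (C + 1)" using d(2) C0 by (intro mult_strict_right_mono) auto
   also have "\<dots> = (e/2)^2"
   proof -
    have "C + 1 \<noteq> 0" using C0 by linarith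
    hence "y / (C + 1) * (C + 1) = y" for y by simp
    thus ?thesis by (simp only: power_divide) simp
   qed
   finally show ?thesis .
  qed
  obtain N where N: "\<And>m n. m \<ge> N \<Longrightarrow> n \<ge> N \<Longrightarrow> l2norm lborel (\<lambda>x. indicator (inset d) x * (u0 i (r m) x - u0 i (r n) x)) < e / 2"
   using rellich_interior[where u="\<lambda>n. u0 i (r n)" and v="\<lambda>n. v i (r n)" and e="e/2" and d=d, OF u0(1) v(1) v(2) B' r(2)]
    e d(1) by (metis half_gt_zero)
  have "nm (?f m n) < e" if mn: "m \<ge> N" "n \<ge> N" for m n
  proof -
   let ?g = "?f m n"
   let ?a = "\<lambda>x. indicator (inset d) x * ?g x" and ?b = "\<lambda>x. indicator (- inset d) x * ?g x"
   have g: "?g \<in> H1 \<omega>" using H1_diff(1)[OF u u] .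
   note g2 = H1_L2[OF g]
   have gB: "nm ?g \<le> 2 * B" 
    using l2norm_diff_le[OF H1_L2[OF u[of i "r m"]] H1_L2[OF u[of i "r n"]]] B(1)[of i "r m"] B(1)[of i "r n"] by linarith
   have gdB: "nm (wd a ?g) \<le> 2 * B" for a
    unfolding H1_diff_norms[OF u u]
    using l2norm_diff_le[OF weak_partial_works(1)[OF u[of i "r m"]] weak_partial_works(1)[OF u[of i "r n"]], of a a]
     B(2)[of a i "r m"] B(2)[of a i "r n"] by linarith
   have g4: "nm (\<lambda>x. (?g x)^2) \<le> C"
   proof -
    have "nm (\<lambda>x. (?g x)^2) \<le> K * (nm ?g * (nm ?g + (\<Sum>a\<in>UNIV. nm (wd a ?g))))"
     by (rule K(3)[OF g])
    also have "\<dots> \<le> C" unfolding C_def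
     using K(1) gB gdB[of 1] gdB[of 2] B0
     by (intro mult_left_mono mult_mono) (auto simp: sum_2)
    finally show ?thesis .
   qed
   have Im: "(indicator S :: real^2 \<Rightarrow> real) \<in> borel_measurable M" if "S \<in> sets borel" for S :: "(real^2) set"
    by (rule lborel_measurable_dom) (rule borel_measurable_indicator[OF that])
   have i2: "(\<lambda>x. indicator S x * ?g x) \<in> L2 M" if "S \<in> sets borel" for S :: "(real^2) set"
    by (rule L2_bound[OF g2 borel_measurable_times[OF Im[OF that] L2_measurable[OF g2]]]) (simp add: indicator_def)
   have c2: "?J \<in> L2 M"
    by (rule L2_bound[OF L2_const[OF finite_measure_dom, of 1]], rule Im) (simp_all add: indicator_def)
   have "nm ?a = l2norm lborel (\<lambda>x. indicator (inset d) x * (u0 i (r m) x - u0 i (r n) x))"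
   proof (rule l2norm_dom_eq)
    show "?a \<in> borel_measurable M" using i2 by (intro L2_measurable) auto
    show "(\<lambda>x. indicator (inset d) x * (u0 i (r m) x - u0 i (r n) x)) \<in> borel_measurable borel"
     using u0(1)[of i "r m"] u0(1)[of i "r n"] by (auto simp: L20_def L2_def)
    show "AE x in M. indicator (inset d) x * ?g x = indicator (inset d) x * (u0 i (r m) x - u0 i (r n) x)"
     using u0(2)[of i "r m"] u0(2)[of i "r n"] by eventually_elim simp
   qed (use u0(1) in \<open>auto simp: L20_def\<close>)
   hence 1: "nm ?a < e / 2" using N[OF mn] by simp
   have "(nm ?b)^2 = (LINT x|M. indicator (- inset d) x * (?g x)^2)"
    unfolding l2norm_power2 by (intro Bochner_Integration.integral_cong) (auto simp: indicator_def)
   also have "\<dots> \<le> nm ?J * nm (\<lambda>x. (?g x)^2)"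
    using L2_Cauchy_Schwarz[OF c2 K(2)[OF g]] by linarith
   also have "\<dots> \<le> nm ?J * C"
    by (intro mult_left_mono g4) simp
   also have "\<dots> < (e/2)^2" by (rule dC)
   finally have 2: "nm ?b < e / 2"
    by (rule power2_less_imp_less) (use e in simp)
   have "?g = (\<lambda>x. indicator (inset d) x * ?g x + indicator (- inset d) x * ?g x)"
    by (auto simp: indicator_def fun_eq_iff)
   hence "nm ?g \<le> nm ?a + nm ?b"
    using l2norm_triangle[OF i2[of "inset d"] i2[of "- inset d"]] by simp
   with 1 2 show ?thesis by linarith
  qed
  thus "\<exists>N. \<forall>m\<ge>N. \<forall>n\<ge>N. nm (?f m n) < e" by blast
 qed
qed

end

text \<open>The integral of a translate does not depend on the translation, and its derivative with
  respect to the translation is the integral of the partial derivative.\<close>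

lemma integral_partial_deriv_zero:
 fixes f :: "real^2 \<Rightarrow> real"
 assumes f: "smooth f" and R: "\<And>x. R < norm x \<Longrightarrow> f x = 0"
 shows "(LINT x|lborel. pd i f x) = 0"
proof -
 \<comment> \<open>The radius exceeds the support by 2, so translates with
   \<open>\<bar>t\<bar> < 1\<close> stay inside \<open>K\<close>, and the indicator of
   \<open>K\<close> is an integrable weight for differentiation under the integral.\<close>
 define K where "K = cball (0::real^2) (\<bar>R\<bar> + 2)"
 let ?I = "indicator K :: real^2 \<Rightarrow> real"
 let ?e = "axis i 1 :: real^2"
 have ne: "norm ?e = 1" by simp
 have Ii: "integrable lborel ?I"
  using emeasure_bounded_finite[of K] by (simp add: K_def integrable_indicator_iff)
 have pz: "pd i f x = 0" if "\<bar>R\<bar> < norm x" for x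
 proof -
  have "((\<lambda>_. 0) has_derivative (\<lambda>_. 0)) (at x)" by simp
  moreover have "open (- cball (0::real^2) \<bar>R\<bar>)" by (simp add: open_Compl)
  ultimately have "(f has_derivative (\<lambda>_. 0)) (at x)"
  proof (rule has_derivative_transform_within_open)
   show "x \<in> - cball 0 \<bar>R\<bar>" using that by simp
   fix y assume "y \<in> - cball (0::real^2) \<bar>R\<bar>"
   thus "0 = f y" using R[of y] by simp
  qed
  from partial_deriv_eq[OF this] show ?thesis .
 qed
 have pc: "continuous_on UNIV (pd i f)" by (intro smooth_continuous smooth_partial_deriv f)
 have "bounded (pd i f ` cball 0 \<bar>R\<bar>)"
  by (intro compact_imp_bounded compact_continuous_image compact_cball continuous_on_subset[OF pc]) simp
 then obtain C where C: "\<And>x. x \<in> cball 0 \<bar>R\<bar> \<Longrightarrow> \<bar>pd i f x\<bar> \<le> C"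
  unfolding bounded_iff by (auto simp del: mem_cball mem_cball_0)
 have C': "\<bar>pd i f x\<bar> \<le> \<bar>C\<bar>" for x
 proof (cases "norm x \<le> \<bar>R\<bar>")
  case True thus ?thesis using C[of x] by simp
 next
  case False thus ?thesis using pz[of x] by simp
 qed
 have [measurable]: "f \<in> borel_measurable borel" "pd i f \<in> borel_measurable borel"
  using f by (auto intro: smooth_measurable smooth_partial_deriv)
 have ax: "(\<Sum>g\<in>UNIV. axis i 1 $ g * c g) = c i" for c :: "2 \<Rightarrow> real"
  by (simp add: axis_def if_distrib[of "\<lambda>x. x * _"] cong: if_cong)
 have "((\<lambda>t. LINT x|lborel. ?I x * f (x + t *\<^sub>R ?e)) has_real_derivative (LINT x|lborel. ?I x * pd i f (x + 0 *\<^sub>R ?e))) (at 0)"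
 proof (rule DERIV_integral[OF Ii])
  show "((\<lambda>t. f (x + t *\<^sub>R ?e)) has_real_derivative pd i f (x + t *\<^sub>R ?e)) (at t)" for t x
   using line_deriv[OF smooth_differentiable[OF f], where x=x and a="?e"] unfolding ax .
  show "\<bar>pd i f (x + t *\<^sub>R ?e)\<bar> \<le> \<bar>C\<bar>" for x t by (rule C')
  show "integrable lborel (\<lambda>x. ?I x * f (x + t *\<^sub>R ?e))" for t
  proof -
   have "continuous_on K (\<lambda>x. f (x + t *\<^sub>R ?e))"
    by (intro continuous_on_compose2[OF smooth_continuous[OF f, of UNIV]] continuous_intros) simp
   moreover have "compact K" by (simp add: K_def)
   ultimately show ?thesis using borel_integrable_compact[of K "\<lambda>x. f (x + t *\<^sub>R ?e)"] by simp
  qed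
 qed measurable
 moreover have "(LINT x|lborel. ?I x * f (x + t *\<^sub>R ?e)) = (LINT x|lborel. f x)" if t: "\<bar>t\<bar> < 1" for t
 proof -
  have e: "?I x * f (x + t *\<^sub>R ?e) = f (x + t *\<^sub>R ?e)" for x
  proof (cases "x \<in> K")
   case False
   hence "\<bar>R\<bar> + 2 < norm x" by (simp add: K_def)
   moreover have "norm x \<le> norm (x + t *\<^sub>R ?e) + \<bar>t\<bar>"
    using norm_triangle_ineq4[of "x + t *\<^sub>R ?e" "t *\<^sub>R ?e"] ne by simp
   ultimately have "R < norm (x + t *\<^sub>R ?e)" using t by linarith
   thus ?thesis using R by simp
  qed simp
  have "(LINT x|lborel. f x) = (LINT x|distr lborel borel ((+) (t *\<^sub>R ?e)). f x)" by (simp add: lborel_distr_plus)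
  also have "\<dots> = (LINT x|lborel. f (t *\<^sub>R ?e + x))" by (subst integral_distr) auto
  finally show ?thesis by (simp add: e add.commute)
 qed
 note * = this
 have "((\<lambda>t. LINT x|lborel. ?I x * f (x + t *\<^sub>R ?e)) has_real_derivative 0) (at 0)"
 proof (subst DERIV_cong_ev[OF refl _ refl])
  have "\<forall>\<^sub>F t in nhds (0::real). t \<in> {-1<..<1}" by (rule eventually_nhds_in_open) auto
  thus "\<forall>\<^sub>F t in nhds 0. (LINT x|lborel. ?I x * f (x + t *\<^sub>R ?e)) = (LINT x|lborel. f x)"
   by eventually_elim (rule *, simp add: abs_less_iff)
 qed simp
 ultimately have "(LINT x|lborel. ?I x * pd i f (x + 0 *\<^sub>R ?e)) = 0"
  by (rule DERIV_unique)
 moreover have "?I x * pd i f x = pd i f x" for x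
  using pz[of x] by (cases "x \<in> K") (auto simp: K_def)
 ultimately show ?thesis by simp
qed

section \<open>Vanishing gradients and Hessians\<close>

context planar_domain
begin

text \<open>The product with a test function has bounded support, so its partial derivative has
  integral zero; the product rule splits this integral.\<close>

lemma smooth_has_weak_partial:
 assumes f: "smooth f"
 shows "has_wd i f (pd i f)"
 unfolding has_weak_partial_def
proof
 fix g assume g: "g \<in> test_functions \<omega>"
 note s = test_function_smooth[OF g]
 have z: "g x = 0" "pd i g x = 0" if "x \<notin> \<omega>" for x
 proof -
  have *: "f x = 0" if "f \<in> test_functions \<omega>" for f
   using that \<open>x \<notin> \<omega>\<close> closure_subset[of "{x. f x \<noteq> 0}"] by (auto simp: test_functions_def)
  show "g x = 0" "pd i g x = 0"
   using *[OF g] *[OF test_function_partial[OF g]] by auto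
 qed
 obtain R where R: "\<And>x. x \<in> \<omega> \<Longrightarrow> norm x \<le> R" using bounded_dom by (auto simp: bounded_iff)
 have d: "pd i (\<lambda>x. f x * g x) x = f x * pd i g x + pd i f x * g x" for x
  by (rule partial_deriv_mult) (use smooth_differentiable f s in auto)
 have "(LINT x|lborel. pd i (\<lambda>x. f x * g x) x) = 0"
 proof (rule integral_partial_deriv_zero)
  show "smooth (\<lambda>x. f x * g x)" using f s by (rule smooth_mult)
  show "f x * g x = 0" if "R < norm x" for x using R[of x] z(1)[of x] that by force
 qed
 moreover have "(LINT x|M. f x * pd i g x + pd i f x * g x)
   = (LINT x|lborel. pd i (\<lambda>x. f x * g x) x)"
  unfolding d
 proof (rule integral_dom_eq(1))
  have [measurable]: "f \<in> borel_measurable borel" "g \<in> borel_measurable borel"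
   "pd i f \<in> borel_measurable borel" "pd i g \<in> borel_measurable borel"
   using f s by (auto intro: smooth_measurable smooth_partial_deriv)
  show m: "(\<lambda>x. f x * pd i g x + pd i f x * g x) \<in> borel_measurable borel" by measurable
  show "(\<lambda>x. f x * pd i g x + pd i f x * g x) \<in> borel_measurable M"
   by (rule lborel_measurable_dom[OF m])
 qed (use z in auto)
 moreover have "(LINT x|M. f x * pd i g x + pd i f x * g x)
   = (LINT x|M. f x * pd i g x) + (LINT x|M. pd i f x * g x)"
  using f by (intro Bochner_Integration.integral_add L2_mult_integrable test_function_L2[OF g] smooth_L2 smooth_partial_deriv)
 ultimately show "(LINT x|M. f x * pd i g x) = - (LINT x|M. pd i f x * g x)"
  by linarith
qed

lemma smooth_H1:
 assumes "smooth f"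
 shows "f \<in> H1 \<omega>" "AE x in M. wd i f x = pd i f x"
 using H1_I[OF smooth_L2[OF assms] smooth_L2[OF smooth_partial_deriv[OF assms]] smooth_has_weak_partial[OF assms]]
  weak_partial_AE_eq[OF smooth_L2[OF smooth_partial_deriv[OF assms]] smooth_has_weak_partial[OF assms]] by auto

text \<open>Mollifications have zero derivative along segments in a small ball, so they are constant
  there, and so is their almost everywhere limit.\<close>

lemma locally_constant_if_zero_gradient:
 assumes u: "u \<in> L20 \<omega>" and w: "\<And>i. weak_partial0 \<omega> i u (\<lambda>x. 0)" and x: "x \<in> \<omega>"
 shows "\<exists>r c. r > 0 \<and> (AE y in lborel. y \<in> ball x r \<longrightarrow> u y = c)"
proof -
 obtain R where R: "R > 0" "cball x R \<subseteq> \<omega>" using open_dom x open_contains_cball by blast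
 \<comment> \<open>A quarter of the radius leaves room for kernels of radius up to
   \<open>2 * r\<close> at all points of \<open>ball x (2 * r)\<close>.\<close>
 define r where "r = R / 4"
 have r: "r > 0" using R by (simp add: r_def)
 define d where "d n = r / (Suc n)" for n :: nat
 have d: "d n > 0" "d n \<le> r" for n using r by (auto simp: d_def divide_le_eq mult_left_le)
 have dl: "d \<longlonglongrightarrow> 0"
  unfolding d_def using tendsto_mult_right_zero[OF LIMSEQ_Suc[OF lim_1_over_n], of r] by simp
 have cb: "cball y (2 * r) \<subseteq> \<omega>" if "y \<in> ball x (2 * r)" for y
 proof
  fix z assume "z \<in> cball y (2 * r)"
  hence "dist x z \<le> R" using that dist_triangle[of x z y] by (simp add: r_def)
  thus "z \<in> \<omega>" using R(2) by auto
 qed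
 have const: "moll (d n) u y = moll (d n) u x" if y: "y \<in> ball x r" for y n
 proof -
  have "((\<lambda>t. moll (d n) u (x + t *\<^sub>R (y - x))) has_real_derivative 0) (at t)" if t: "0 \<le> t" "t \<le> 1" for t
  proof -
   have "dist x (x + t *\<^sub>R (y - x)) \<le> dist x y"
    using t by (simp add: dist_norm norm_minus_commute mult_left_le_one_le)
   hence "x + t *\<^sub>R (y - x) \<in> ball x (2 * r)" using y r by simp
   hence "cball (x + t *\<^sub>R (y - x)) (d n) \<subseteq> \<omega>"
    using order_trans[OF subset_cball cb] d(2)[of n] r by simp
   from moll_line_deriv[OF open_dom bounded_dom u w d(1) this]
   show ?thesis by (simp add: moll_def[of _ "\<lambda>x. 0"])
  qed
  hence "moll (d n) u (x + 1 *\<^sub>R (y - x)) = moll (d n) u (x + 0 *\<^sub>R (y - x))"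
   by (intro DERIV_isconst2[of 0 1]) (auto intro!: DERIV_atLeastAtMost_imp_continuous_on)
  thus ?thesis by simp
 qed
 obtain s where s: "strict_mono s" "AE y in lborel. y \<in> inset r \<longrightarrow> (\<lambda>n. moll (d (s n)) u y) \<longlonglongrightarrow> u y"
  by (rule moll_AE_subseq[OF u r d(1) dl])
 have AE: "AE y in lborel. y \<in> ball x r \<longrightarrow> (\<lambda>n. moll (d (s n)) u x) \<longlonglongrightarrow> u y"
  using s(2)
 proof eventually_elim
  fix y assume *: "y \<in> inset r \<longrightarrow> (\<lambda>n. moll (d (s n)) u y) \<longlonglongrightarrow> u y"
  show "y \<in> ball x r \<longrightarrow> (\<lambda>n. moll (d (s n)) u x) \<longlonglongrightarrow> u y"
  proof
   assume y: "y \<in> ball x r"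
   hence "y \<in> ball x (2 * r)" using r by simp
   hence "y \<in> inset r" using cball_inset[OF cb] r by simp
   thus "(\<lambda>n. moll (d (s n)) u x) \<longlonglongrightarrow> u y" using * const[OF y] by simp
  qed
 qed
 have "AE y in lborel. y \<in> ball x r \<longrightarrow> u y = lim (\<lambda>n. moll (d (s n)) u x)"
  using AE by eventually_elim (auto simp: limI)
 with r show ?thesis by blast
qed

text \<open>Local constants agree where balls overlap, since a nonempty open set is not negligible,
  and connectedness makes them all equal. Lindelof's theorem leaves countably many balls, so the
  exceptional sets together are null.\<close>

lemma constant_if_zero_gradient:
 assumes conn: "connected \<omega>" and u: "u \<in> L20 \<omega>" and w: "\<And>i. weak_partial0 \<omega> i u (\<lambda>x. 0)"
 shows "\<exists>c. AE x in lborel. x \<in> \<omega> \<longrightarrow> u x = c"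
proof (cases "\<omega> = {}")
 case False
 have "\<forall>x\<in>\<omega>. \<exists>r c. r > 0 \<and> (AE y in lborel. y \<in> ball x r \<longrightarrow> u y = c)"
  using locally_constant_if_zero_gradient[OF u w] by blast
 hence "\<exists>r. \<forall>x\<in>\<omega>. \<exists>c. r x > 0 \<and> (AE y in lborel. y \<in> ball x (r x) \<longrightarrow> u y = c)" by (rule bchoice)
 then obtain r where "\<forall>x\<in>\<omega>. \<exists>c. r x > 0 \<and> (AE y in lborel. y \<in> ball x (r x) \<longrightarrow> u y = c)" by blast
 hence "\<exists>c. \<forall>x\<in>\<omega>. r x > 0 \<and> (AE y in lborel. y \<in> ball x (r x) \<longrightarrow> u y = c x)" by (rule bchoice)
 then obtain c where rc: "\<And>x. x \<in> \<omega> \<Longrightarrow> r x > 0" "\<And>x. x \<in> \<omega> \<Longrightarrow> AE y in lborel. y \<in> ball x (r x) \<longrightarrow> u y = c x"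
  by blast
 have loc: "c x = c y" if x: "x \<in> \<omega>" and y: "y \<in> \<omega>" "y \<in> ball x (r x)" for x y
 proof (rule ccontr)
  assume ne: "c x \<noteq> c y"
  have "AE z in lborel. z \<notin> ball x (r x) \<inter> ball y (r y)"
   using rc(2)[OF x] rc(2)[OF y(1)] by eventually_elim (use ne in auto)
  hence "ball x (r x) \<inter> ball y (r y) \<in> null_sets lborel" by (subst AE_iff_null_sets) auto
  hence "negligible (ball x (r x) \<inter> ball y (r y))"
   unfolding negligible_iff_null_sets by (rule null_sets_completionI)
  moreover have "y \<in> ball x (r x) \<inter> ball y (r y)" using y rc(1)[OF y(1)] by simp
  ultimately show False using open_not_negligible[of "ball x (r x) \<inter> ball y (r y)"] by blast
 qed
 obtain x0 where x0: "x0 \<in> \<omega>" using False by auto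
 have cc: "c x = c x0" if "x \<in> \<omega>" for x
 proof (rule connected_local_const[OF conn that x0])
  show "\<forall>a\<in>\<omega>. \<forall>\<^sub>F b in at a within \<omega>. c a = c b"
  proof
   fix a assume a: "a \<in> \<omega>"
   show "\<forall>\<^sub>F b in at a within \<omega>. c a = c b"
    unfolding eventually_at using rc(1)[OF a] loc[OF a] by (intro exI[of _ "r a"]) (auto simp: dist_commute)
  qed
 qed
 obtain F' where F': "F' \<subseteq> (\<lambda>x. ball x (r x)) ` \<omega>" "countable F'" "\<Union>F' = (\<Union>x\<in>\<omega>. ball x (r x))"
  using Lindelof[of "(\<lambda>x. ball x (r x)) ` \<omega>"] by auto
 have "AE y in lborel. \<forall>B\<in>F'. y \<in> B \<longrightarrow> u y = c x0"
 proof (rule AE_ball_countable')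
  fix B assume "B \<in> F'"
  then obtain x where "x \<in> \<omega>" "B = ball x (r x)" using F'(1) by auto
  thus "AE y in lborel. y \<in> B \<longrightarrow> u y = c x0" using rc(2)[of x] cc[of x] by simp
 qed (rule F'(2))
 hence "AE y in lborel. y \<in> \<omega> \<longrightarrow> u y = c x0"
 proof eventually_elim
  fix y assume *: "\<forall>B\<in>F'. y \<in> B \<longrightarrow> u y = c x0"
  show "y \<in> \<omega> \<longrightarrow> u y = c x0"
  proof
   assume "y \<in> \<omega>"
   hence "y \<in> \<Union>F'" unfolding F'(3) using rc(1) by force
   thus "u y = c x0" using * by blast
  qed
 qed
 thus ?thesis by blast
qed auto

lemma H1_constant_if_zero_gradient:
 assumes conn: "connected \<omega>" and u: "u \<in> L2 M" and z: "\<And>i. has_wd i u (\<lambda>x. 0)"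
 shows "\<exists>c. AE x in M. u x = c"
proof -
 obtain u0 where u0: "u0 \<in> L20 \<omega>" "AE x in M. u x = u0 x"
  by (rule L2_representative[OF u])
 have "weak_partial0 \<omega> i u0 (\<lambda>x. 0)" for i
  using weak_partial0_iff[OF L2_measurable[OF u] u0, of "\<lambda>x. 0" "\<lambda>x. 0" i] z by (simp add: L20_def L2_zero)
 then obtain c where "AE x in lborel. x \<in> \<omega> \<longrightarrow> u0 x = c" using constant_if_zero_gradient[OF conn u0(1)] by blast
 from AE_dom_iff[OF this] have "AE x in M. u x = c" using u0(2) by eventually_elim simp
 thus ?thesis ..
qed

text \<open>The slopes are constants and form a vector \<open>b\<close>; subtracting
  \<open>x \<bullet> b\<close> leaves a function with zero gradient.\<close>

lemma affine_if_zero_hessian: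
 assumes conn: "connected \<omega>" and u: "u \<in> L2 M" and p: "\<And>i. p i \<in> L2 M"
  and wu: "\<And>i. has_wd i u (p i)" and wp: "\<And>i j. has_wd i (p j) (\<lambda>x. 0)"
 shows "affine_on \<omega> u"
proof -
 have "\<forall>j. \<exists>c. AE x in M. p j x = c"
  using H1_constant_if_zero_gradient[OF conn p wp] by blast
 then obtain c where c: "\<And>j. AE x in M. p j x = c j" by metis
 define b :: "real^2" where "b = (\<chi> j. c j)"
 have l: "(\<lambda>x. x \<bullet> b) \<in> L2 M" by (rule smooth_L2[OF smooth_inner])
 have "has_wd i (\<lambda>x. u x - x \<bullet> b) (\<lambda>x. 0)" for i
 proof -
  have "has_wd i (\<lambda>x. x \<bullet> b) (\<lambda>x. c i)"
   using smooth_has_weak_partial[OF smooth_inner, of i b] by (simp add: partial_deriv_inner b_def)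
  hence w2: "has_wd i (\<lambda>x. \<Sum>k\<in>UNIV. (if k then 1 else -1) * (if k then u else (\<lambda>x. x \<bullet> b)) x)
   (\<lambda>x. \<Sum>k\<in>UNIV. (if k then 1 else -1) * (if k then p i else (\<lambda>x. c i)) x)"
   by (intro has_weak_partial_sum) (auto simp: u l p wu L2_const[OF finite_measure_dom])
  have w3: "has_wd i (\<lambda>x. u x - x \<bullet> b) (\<lambda>x. p i x - c i)"
   using w2 by (simp add: UNIV_bool)
  have pl: "(\<lambda>x. p i x - c i) \<in> L2 M" by (rule L2_diff[OF p L2_const[OF finite_measure_dom]])
  show ?thesis unfolding has_weak_partial_def
  proof
   fix f assume f: "f \<in> test_functions \<omega>"
   have "(LINT x|M. (p i x - c i) * f x) = (LINT x|M. 0 * f x)"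
   proof (rule integral_cong_AE)
    show "(\<lambda>x. (p i x - c i) * f x) \<in> borel_measurable M"
     using L2_measurable[OF pl] L2_measurable[OF test_function_L2(1)[OF f]] by (rule borel_measurable_times)
    show "AE x in M. (p i x - c i) * f x = 0 * f x" using c[of i] by eventually_elim simp
   qed simp
   thus "(LINT x|M. (u x - x \<bullet> b) * pd i f x) = - (LINT x|M. 0 * f x)"
    using w3 f by (simp add: has_weak_partial_def)
  qed
 qed
 then obtain a where "AE x in M. u x - x \<bullet> b = a"
  using H1_constant_if_zero_gradient[OF conn L2_diff[OF u l]] by blast
 hence "AE x in M. u x = a + b \<bullet> x" by eventually_elim (simp add: inner_commute)
 thus ?thesis unfolding affine_on_def by blast
qed

section \<open>Norms and limits in H1 and H2\<close>

lemma H1_scale: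
 assumes "u \<in> H1 \<omega>"
 shows "(\<lambda>x. c * u x) \<in> H1 \<omega>"
  "AE x in M. wd i (\<lambda>x. c * u x) x = c * wd i u x"
 using H1_sum[of "{()}" "\<lambda>_. u", where c = "\<lambda>_. c"] assms by simp_all

lemma H2_scale:
 assumes "u \<in> H2 \<omega>"
 shows "(\<lambda>x. c * u x) \<in> H2 \<omega>"
  "AE x in M. wd i (wd j (\<lambda>x. c * u x)) x = c * wd i (wd j u) x"
 using H2_sum[of "{()}" "\<lambda>_. u", where c = "\<lambda>_. c"] assms by simp_all

lemma norm_H1_le:
 "norm_H1 \<omega> u \<le> nm u + (\<Sum>i\<in>UNIV. nm (wd i u))"
proof -
 have "norm_H1 \<omega> u = sqrt ((nm u)^2 + (\<Sum>i\<in>UNIV. (nm (wd i u))^2))"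
  by (simp add: norm_H1_def l2norm_power2)
 also have "\<dots> \<le> sqrt ((nm u)^2) + sqrt (\<Sum>i\<in>UNIV. (nm (wd i u))^2)"
  by (intro sqrt_add_le_add_sqrt sum_nonneg) auto
 also have "sqrt (\<Sum>i\<in>UNIV. (nm (wd i u))^2) \<le> (\<Sum>i\<in>UNIV. nm (wd i u))"
  by (fold L2_set_def) (rule L2_set_le_sum, simp)
 finally show ?thesis by simp
qed

text \<open>Sums of L2 norms instead of the root of a sum of squares: each summand is estimated and
  sent to zero separately, and \<open>norm_H1\<close> and \<open>norm_H2\<close> are dominated by
  such sums.\<close>

definition grad_norm :: "(real^2 \<Rightarrow> real) \<Rightarrow> real" where
 "grad_norm u = (\<Sum>i\<in>UNIV. nm (wd i u))"

definition hess_norm :: "(real^2 \<Rightarrow> real) \<Rightarrow> real" where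
 "hess_norm u = (\<Sum>i\<in>UNIV. \<Sum>j\<in>UNIV. nm (wd i (wd j u)))"

definition full_norm :: "(real^2 \<Rightarrow> real) \<Rightarrow> real" where
 "full_norm u = nm u + grad_norm u + hess_norm u"

lemma grad_norm_nonneg: "0 \<le> grad_norm u" by (simp add: grad_norm_def sum_nonneg)
lemma hess_norm_nonneg: "0 \<le> hess_norm u" by (simp add: hess_norm_def sum_nonneg)
lemma full_norm_nonneg: "0 \<le> full_norm u" by (simp add: full_norm_def grad_norm_nonneg hess_norm_nonneg)

lemma norm_H2_le: "norm_H2 \<omega> u \<le> full_norm u"
proof -
 let ?n = "nm"
 let ?g = "\<Sum>i\<in>UNIV. (?n (wd i u))^2"
 let ?h = "\<Sum>(i, j)\<in>UNIV \<times> UNIV. (?n (wd i (wd j u)))^2"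
 have nn: "0 \<le> ?g" "0 \<le> ?h" by (auto intro!: sum_nonneg)
 have "norm_H2 \<omega> u = sqrt ((?n u)^2 + ?g + ?h)"
  by (simp add: norm_H2_def l2norm_power2 sum.cartesian_product)
 also have "\<dots> \<le> sqrt ((?n u)^2 + ?g) + sqrt ?h" using nn by (intro sqrt_add_le_add_sqrt) auto
 also have "sqrt ((?n u)^2 + ?g) \<le> sqrt ((?n u)^2) + sqrt ?g" using nn by (intro sqrt_add_le_add_sqrt) auto
 also have "sqrt ?g \<le> grad_norm u"
  unfolding grad_norm_def by (fold L2_set_def) (rule L2_set_le_sum, simp)
 also have "sqrt ?h \<le> (\<Sum>(i, j)\<in>UNIV \<times> UNIV. ?n (wd i (wd j u)))"
  using L2_set_le_sum[of "UNIV \<times> UNIV" "\<lambda>(i, j). ?n (wd i (wd j u))"]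
  by (simp add: L2_set_def case_prod_beta')
 also have "(\<Sum>(i, j)\<in>UNIV \<times> UNIV. ?n (wd i (wd j u))) = hess_norm u"
  by (simp add: hess_norm_def sum.cartesian_product)
 finally show ?thesis by (simp add: full_norm_def)
qed

text \<open>Completeness enters in this form: limits in L2 of the functions and of their derivatives
  fit together because weak derivatives are closed under such limits.\<close>

lemma H1_limit:
 assumes u: "\<And>n. u n \<in> H1 \<omega>" and g: "g \<in> L2 M" and p: "\<And>i. p i \<in> L2 M"
  and lu: "(\<lambda>n. nm (\<lambda>x. u n x - g x)) \<longlonglongrightarrow> 0"
  and lp: "\<And>i. (\<lambda>n. nm (\<lambda>x. wd i (u n) x - p i x)) \<longlonglongrightarrow> 0"
 shows "g \<in> H1 \<omega>" "has_wd i g (p i)" "AE x in M. wd i g x = p i x"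
  "(\<lambda>n. norm_H1 \<omega> (\<lambda>x. u n x - g x)) \<longlonglongrightarrow> 0"
  "(\<lambda>n. nm (wd i (\<lambda>x. u n x - g x))) \<longlonglongrightarrow> 0"
proof -
 let ?d = "\<lambda>n x. u n x - g x"
 have w: "has_wd i g (p i)" for i
  by (rule has_weak_partial_limit[OF H1_L2[OF u] g weak_partial_works(1)[OF u] p weak_partial_works(2)[OF u] lu lp])
 show g1: "g \<in> H1 \<omega>" by (rule H1_I[OF g p w])
 show "has_wd i g (p i)" by (rule w)
 have ae: "AE x in M. wd i g x = p i x" for i by (rule weak_partial_AE_eq[OF p w])
 show "AE x in M. wd i g x = p i x" by (rule ae)
 have e: "nm (wd i (?d n)) = nm (\<lambda>x. wd i (u n) x - p i x)" for n i
 proof (rule l2norm_cong_AE)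
  show "wd i (?d n) \<in> borel_measurable M"
   by (intro L2_measurable weak_partial_works(1) H1_diff(1) u g1)
  show "(\<lambda>x. wd i (u n) x - p i x) \<in> borel_measurable M"
   by (intro L2_measurable L2_diff weak_partial_works(1) u p)
  show "AE x in M. wd i (?d n) x = wd i (u n) x - p i x"
   using H1_diff(2)[OF u[of n] g1, of i] ae[of i] by eventually_elim simp
 qed
 show "(\<lambda>n. nm (wd i (?d n))) \<longlonglongrightarrow> 0" unfolding e by (rule lp)
 have "(\<lambda>n. nm (?d n) + (\<Sum>i\<in>UNIV. nm (\<lambda>x. wd i (u n) x - p i x))) \<longlonglongrightarrow> 0 + (\<Sum>i\<in>(UNIV::2 set). 0)"
  by (intro tendsto_intros lu lp)
 hence l: "(\<lambda>n. nm (?d n) + (\<Sum>i\<in>UNIV. nm (wd i (?d n)))) \<longlonglongrightarrow> 0"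
  by (simp add: e)
 have "0 \<le> norm_H1 \<omega> f" for f unfolding norm_H1_def by (intro real_sqrt_ge_zero add_nonneg_nonneg sum_nonneg) auto
 thus "(\<lambda>n. norm_H1 \<omega> (?d n)) \<longlonglongrightarrow> 0"
  by (intro tendsto_sandwich[OF _ _ tendsto_const l] always_eventually allI norm_H1_le)
qed

lemma H2_limit:
 assumes u: "\<And>n. u n \<in> H2 \<omega>" and g: "g \<in> L2 M" and p: "\<And>i. p i \<in> L2 M"
  and q: "\<And>i j. q i j \<in> L2 M"
  and lu: "(\<lambda>n. nm (\<lambda>x. u n x - g x)) \<longlonglongrightarrow> 0"
  and lp: "\<And>i. (\<lambda>n. nm (\<lambda>x. wd i (u n) x - p i x)) \<longlonglongrightarrow> 0"
  and lq: "\<And>i j. (\<lambda>n. nm (\<lambda>x. wd i (wd j (u n)) x - q i j x)) \<longlonglongrightarrow> 0"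
 shows "g \<in> H2 \<omega>" "has_wd i g (p i)" "AE x in M. wd i g x = p i x"
  "has_wd i (p j) (q i j)"
  "AE x in M. wd i (wd j g) x = q i j x"
  "(\<lambda>n. full_norm (\<lambda>x. u n x - g x)) \<longlonglongrightarrow> 0" "(\<lambda>n. norm_H2 \<omega> (\<lambda>x. u n x - g x)) \<longlonglongrightarrow> 0"
proof -
 let ?d = "\<lambda>n x. u n x - g x"
 note g1 = H1_limit[OF H2_H1(1)[OF u] g p lu lp]
 note p1 = H1_limit[OF H2_H1(2)[OF u] p q lp lq]
 show gH: "g \<in> H2 \<omega>" by (rule H2_I(1)[OF g p1(1) g1(2)])
 show "has_wd i g (p i)" "AE x in M. wd i g x = p i x"
  "has_wd i (p j) (q i j)" by (rule g1 p1)+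
 have ae2: "AE x in M. wd i (wd j g) x = q i j x" for i j
  using H2_I(2)[OF g p1(1) g1(2), of i j] p1(3)[of i j] by eventually_elim simp
 thus "AE x in M. wd i (wd j g) x = q i j x" .
 have e2: "nm (wd i (wd j (?d n)))
   = nm (\<lambda>x. wd i (wd j (u n)) x - q i j x)" for n i j
 proof (rule l2norm_cong_AE)
  show "wd i (wd j (?d n)) \<in> borel_measurable M"
   by (intro L2_measurable weak_partial_works(1) H2_H1(2) H2_diff(1) u gH)
  show "(\<lambda>x. wd i (wd j (u n)) x - q i j x) \<in> borel_measurable M"
   by (intro L2_measurable L2_diff weak_partial_works(1) H2_H1(2) u q)
  show "AE x in M. wd i (wd j (?d n)) x = wd i (wd j (u n)) x - q i j x"
   using H2_diff(2)[OF u[of n] gH, of i j] ae2[of i j] by eventually_elim simp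
 qed
 show l: "(\<lambda>n. full_norm (?d n)) \<longlonglongrightarrow> 0"
  unfolding full_norm_def grad_norm_def hess_norm_def e2 by (intro tendsto_add_zero tendsto_null_sum lu lq g1(5))
 have "0 \<le> norm_H2 \<omega> f" for f unfolding norm_H2_def by (intro real_sqrt_ge_zero add_nonneg_nonneg sum_nonneg) auto
 thus "(\<lambda>n. norm_H2 \<omega> (?d n)) \<longlonglongrightarrow> 0"
  by (intro tendsto_sandwich[OF _ _ tendsto_const l] always_eventually allI norm_H2_le)
qed

lemma full_norm_scale:
 assumes u: "u \<in> H2 \<omega>"
 shows "full_norm (\<lambda>x. c * u x) = \<bar>c\<bar> * full_norm u" "hess_norm (\<lambda>x. c * u x) = \<bar>c\<bar> * hess_norm u"
proof -
 have e1: "nm (wd i (\<lambda>x. c * u x)) = \<bar>c\<bar> * nm (wd i u)" for i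
  unfolding l2norm_scale[symmetric]
  by (rule l2norm_cong_AE[OF _ _ H1_scale(2)[OF H2_H1(1)[OF u]]])
   (intro L2_measurable L2_scale weak_partial_works(1) H1_scale(1) H2_H1(1) u)+
 have e2: "nm (wd i (wd j (\<lambda>x. c * u x))) = \<bar>c\<bar> * nm (wd i (wd j u))" for i j
  unfolding l2norm_scale[symmetric]
  by (rule l2norm_cong_AE[OF _ _ H2_scale(2)[OF u]])
   (intro L2_measurable L2_scale weak_partial_works(1) H2_scale(1) H2_H1(2) u)+
 show "hess_norm (\<lambda>x. c * u x) = \<bar>c\<bar> * hess_norm u"
  by (simp add: hess_norm_def e2 sum_distrib_left)
 thus "full_norm (\<lambda>x. c * u x) = \<bar>c\<bar> * full_norm u"
  by (simp add: full_norm_def grad_norm_def e1 l2norm_scale sum_distrib_left distrib_left)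
qed

end

lemma closed_subspace_of_limit:
 assumes "closed_subspace_of N X V" "u \<in> X" "\<And>n. s n \<in> V" "(\<lambda>n. N (\<lambda>y. s n y - u y)) \<longlonglongrightarrow> 0"
 shows "u \<in> V"
 using assms unfolding closed_subspace_of_def by blast

context lipschitz_domain
begin

text \<open>By contradiction: a normalized sequence with Hessians tending to zero has, by Rellich's
  theorem, a limit in \<open>V\<close> with zero Hessian, which is affine and hence zero. Since the
  Hessians converge as well, the full norms would tend to zero.\<close>

lemma hessian_poincare:
 assumes conn: "connected \<omega>" and V: "closed_subspace_of (norm_H2 \<omega>) (H2 \<omega>) V"
  and ker: "\<forall>v\<in>V. affine_on \<omega> v \<longrightarrow> (AE y in M. v y = 0)"
 shows "\<exists>C\<ge>0. \<forall>u\<in>V. full_norm u \<le> C * hess_norm u"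
proof (rule ccontr)
 assume neg: "\<not> ?thesis"
 have "\<exists>w. w \<in> V \<and> full_norm w = 1 \<and> hess_norm w \<le> 1 / Suc n" for n :: nat
 proof -
  from neg obtain u where u: "u \<in> V" "\<not> full_norm u \<le> real (Suc n) * hess_norm u"
   by (meson of_nat_0_le_iff)
  hence uH: "u \<in> H2 \<omega>" using V by (auto simp: closed_subspace_of_def)
  have pos: "full_norm u > 0" using u(2) mult_nonneg_nonneg[OF of_nat_0_le_iff hess_norm_nonneg, of "Suc n" u] by linarith
  let ?c = "1 / full_norm u"
  have "(\<lambda>x. ?c *\<^sub>R u x) \<in> V" using V u(1) unfolding closed_subspace_of_def by blast
  moreover have "full_norm (\<lambda>x. ?c * u x) = 1" "hess_norm (\<lambda>x. ?c * u x) = hess_norm u / full_norm u"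
   using pos full_norm_scale[OF uH, of ?c] by auto
  moreover have "hess_norm u / full_norm u \<le> 1 / Suc n"
   using u(2) pos by (simp add: field_simps)
  ultimately show ?thesis by (intro exI[of _ "\<lambda>x. ?c * u x"]) simp
 qed
 then obtain w where w: "\<And>n. w n \<in> V" "\<And>n. full_norm (w n) = 1" "\<And>n. hess_norm (w n) \<le> 1 / Suc n" by metis
 have wH: "w n \<in> H2 \<omega>" for n using V w(1) by (auto simp: closed_subspace_of_def)
 \<comment> \<open>Index 0 is the function, 1 the first slope and every other index the second
   slope, so one application of Rellich's theorem yields a common subsequence.\<close>
 define f where "f i n = (if i = 0 then w n else if i = 1 then wd 1 (w n) else wd 2 (w n))" for i n :: nat
 have parts: "nm (w n) \<le> 1" "nm (wd q (w n)) \<le> 1"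
  "nm (wd q (wd j (w n))) \<le> 1 / Suc n" for n q j
 proof -
  have a: "nm (wd q (w n)) \<le> grad_norm (w n)"
   unfolding grad_norm_def by (rule member_le_sum) auto
  have "nm (wd q (wd j (w n))) \<le> (\<Sum>j\<in>UNIV. nm (wd q (wd j (w n))))"
   by (rule member_le_sum) auto
  also have "\<dots> \<le> hess_norm (w n)"
   unfolding hess_norm_def by (rule member_le_sum) (auto intro: sum_nonneg)
  finally show "nm (wd q (wd j (w n))) \<le> 1 / Suc n" using w(3)[of n] by linarith
  show "nm (w n) \<le> 1" "nm (wd q (w n)) \<le> 1"
   using a w(2)[of n] grad_norm_nonneg[of "w n"] hess_norm_nonneg[of "w n"] l2norm_nonneg[of M "w n"]
   unfolding full_norm_def by linarith+
 qed
 have n1: "1 / real (Suc n) \<le> 1" for n by simp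
 have fH: "f i n \<in> H1 \<omega>" and fB: "nm (f i n) \<le> 1" and fB': "nm (wd q (f i n)) \<le> 1" for i n q
  using H2_H1[OF wH[of n]] parts(1)[of n] parts(2)[of _ n] order_trans[OF parts(3)[of _ _ n] n1[of n]] by (auto simp: f_def)
 obtain r where r: "strict_mono (r :: nat \<Rightarrow> nat)"
  "\<And>i e. e > 0 \<Longrightarrow> \<exists>N. \<forall>m\<ge>N. \<forall>n\<ge>N. nm (\<lambda>x. f i (r m) x - f i (r n) x) < e"
  by (rule rellich[of f 1, OF fH fB fB']) blast
 have "\<exists>g. g \<in> L2 M \<and> (\<lambda>n. nm (\<lambda>x. f i (r n) x - g x)) \<longlonglongrightarrow> 0" for i
  by (rule L2_complete[of M "\<lambda>n. f i (r n)", OF finite_measure_dom H1_L2[OF fH] r(2)]) blast+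
 from choice[OF allI[OF this]] obtain g
  where "\<forall>i. g i \<in> L2 M \<and> (\<lambda>n. nm (\<lambda>x. f i (r n) x - g i x)) \<longlonglongrightarrow> 0" ..
 hence g: "\<And>i. g i \<in> L2 M" "\<And>i. (\<lambda>n. nm (\<lambda>x. f i (r n) x - g i x)) \<longlonglongrightarrow> 0" by auto
 define p where "p q = (if q = (1::2) then g 1 else g 2)" for q
 have p2: "p q \<in> L2 M" for q using g by (simp add: p_def)
 have lu: "(\<lambda>n. nm (\<lambda>x. w (r n) x - g 0 x)) \<longlonglongrightarrow> 0" using g(2)[of 0] by (simp add: f_def)
 have lp: "(\<lambda>n. nm (\<lambda>x. wd q (w (r n)) x - p q x)) \<longlonglongrightarrow> 0" for q
  using g(2)[of 1] g(2)[of 2] exhaust_2[of q] by (auto simp: f_def p_def)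
 have lq: "(\<lambda>n. nm (\<lambda>x. wd q (wd j (w (r n))) x - 0)) \<longlonglongrightarrow> 0" for q j
 proof (rule tendsto_sandwich[OF _ _ tendsto_const LIMSEQ_Suc[OF lim_1_over_n]])
  show "\<forall>\<^sub>F n in sequentially. nm (\<lambda>x. wd q (wd j (w (r n))) x - 0) \<le> 1 / real (Suc n)"
  proof (rule always_eventually, rule allI)
   fix n
   have "n \<le> r n" by (rule seq_suble[OF r(1)])
   hence "1 / real (Suc (r n)) \<le> 1 / real (Suc n)" by (intro divide_left_mono) auto
   thus "nm (\<lambda>x. wd q (wd j (w (r n))) x - 0) \<le> 1 / real (Suc n)"
    using parts(3)[of q j "r n"] by simp
  qed
 qed simp
 note L = H2_limit[OF wH g(1) p2 L2_zero lu lp lq]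
 have "g 0 \<in> V"
  by (rule closed_subspace_of_limit[OF V L(1) w(1) L(7)])
 moreover have "affine_on \<omega> (g 0)" by (rule affine_if_zero_hessian[OF conn g(1) p2 L(2) L(4)])
 ultimately have z: "AE y in M. g 0 y = 0" using ker by blast
 note w2 = H1_L2[OF H2_H1(1)[OF wH]]
 have "nm (\<lambda>x. w (r n) x - g 0 x) = nm (\<lambda>x. w (r n) x - 0)" for n
  by (rule l2norm_cong_AE[OF L2_measurable[OF L2_diff[OF w2 g(1)]] L2_measurable[OF L2_diff[OF w2 L2_zero]]])
   (use z in \<open>eventually_elim, simp\<close>)
 hence lu0: "(\<lambda>n. nm (\<lambda>x. w (r n) x - 0)) \<longlonglongrightarrow> 0" using lu by simp
 \<comment> \<open>The zero function may serve as the limit, with the same limits of the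
   derivatives; the norms, all equal to 1, would then tend to 0.\<close>
 show False using H2_limit(6)[OF wH L2_zero p2 L2_zero lu0 lp lq] w(2) by (simp add: LIMSEQ_const_iff)
qed

end

section \<open>The boundary measure\<close>

definition hausdorff1_pre :: "real \<Rightarrow> (real^2) set \<Rightarrow> ennreal" where
 "hausdorff1_pre d A = (INF C\<in>{C :: nat \<Rightarrow> (real^2) set.
   A \<subseteq> (\<Union>n. C n) \<and> (\<forall>n. bounded (C n) \<and> diameter (C n) \<le> d)}. \<Sum>n. ennreal (diameter (C n)))"

lemma hausdorff1_outer_eq: "hausdorff1_outer A = (SUP d\<in>{0<..}. hausdorff1_pre d A)"
 by (simp add: hausdorff1_outer_def hausdorff1_pre_def)

lemma hausdorff1_pre_le:
 assumes "A \<subseteq> (\<Union>n. C n)" "\<And>n. bounded (C n)" "\<And>n. diameter (C n) \<le> d"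
 shows "hausdorff1_pre d A \<le> (\<Sum>n. ennreal (diameter (C n)))"
 unfolding hausdorff1_pre_def by (rule INF_lower) (use assms in auto)

lemma hausdorff1_pre_antimono: "d \<le> d' \<Longrightarrow> hausdorff1_pre d' A \<le> hausdorff1_pre d A"
 unfolding hausdorff1_pre_def by (rule INF_superset_mono) (auto intro: order_trans)

lemma hausdorff1_pre_mono: "A \<subseteq> B \<Longrightarrow> hausdorff1_pre d A \<le> hausdorff1_pre d B"
 unfolding hausdorff1_pre_def by (rule INF_superset_mono) auto

lemma hausdorff1_pre_le_outer: "d > 0 \<Longrightarrow> hausdorff1_pre d A \<le> hausdorff1_outer A"
 unfolding hausdorff1_outer_eq by (rule SUP_upper) simp

lemma hausdorff1_outer_mono: "A \<subseteq> B \<Longrightarrow> hausdorff1_outer A \<le> hausdorff1_outer B"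
 unfolding hausdorff1_outer_eq by (intro SUP_mono) (auto intro: hausdorff1_pre_mono)

lemma hausdorff1_outer_empty: "hausdorff1_outer {} = 0"
proof -
 have "hausdorff1_pre d {} \<le> 0" if "d > 0" for d
  using hausdorff1_pre_le[of "{}" "\<lambda>_. {}" d] that by simp
 thus ?thesis unfolding hausdorff1_outer_eq by (intro antisym SUP_least) auto
qed

lemma hausdorff1_pre_cover:
 assumes "hausdorff1_pre d A < x"
 obtains C where "A \<subseteq> (\<Union>n. C n)" "\<And>n. bounded (C n)" "\<And>n. diameter (C n) \<le> d" "(\<Sum>n. ennreal (diameter (C n))) < x"
 using assms unfolding hausdorff1_pre_def INF_less_iff by blast

text \<open>Near-optimal covers with errors \<open>e * (1/2)^Suc i\<close> are merged into one
  sequence by an enumeration of pairs.\<close>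

lemma hausdorff1_pre_subadditive:
 "hausdorff1_pre d (\<Union>i. A i) \<le> (\<Sum>i. hausdorff1_pre d (A i))"
proof (cases "(\<Sum>i. hausdorff1_pre d (A i)) = \<infinity>")
 case False
 hence fin: "(\<Sum>i. hausdorff1_pre d (A i)) < \<infinity>" by (simp add: less_top)
 have fi: "hausdorff1_pre d (A i) < \<infinity>" for i
  using fin sum_le_suminf[of "\<lambda>i. hausdorff1_pre d (A i)" "{i}"] by (auto intro: le_less_trans)
 show ?thesis
 proof (rule ennreal_le_epsilon)
  fix e :: real assume e: "e > 0"
  have "\<exists>C. A i \<subseteq> (\<Union>n. C n) \<and> (\<forall>n. bounded (C n)) \<and> (\<forall>n. diameter (C n) \<le> d) \<and>
   (\<Sum>n. ennreal (diameter (C n))) \<le> hausdorff1_pre d (A i) + ennreal (e * (1/2)^Suc i)" for i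
  proof -
   have "hausdorff1_pre d (A i) < hausdorff1_pre d (A i) + ennreal (e * (1/2)^Suc i)"
    using fi[of i] e
    by (cases "hausdorff1_pre d (A i)") (auto simp: ennreal_plus[symmetric] ennreal_less_iff simp del: ennreal_plus)
   from hausdorff1_pre_cover[OF this] obtain C where "A i \<subseteq> (\<Union>n. C n)" "\<And>n. bounded (C n)" "\<And>n. diameter (C n) \<le> d"
    "(\<Sum>n. ennreal (diameter (C n))) < hausdorff1_pre d (A i) + ennreal (e * (1/2)^Suc i)" by blast
   thus ?thesis by (intro exI[of _ C]) (auto simp: less_imp_le)
  qed
  hence "\<forall>i. \<exists>C. A i \<subseteq> (\<Union>n. C n) \<and> (\<forall>n. bounded (C n)) \<and> (\<forall>n. diameter (C n) \<le> d) \<and>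
   (\<Sum>n. ennreal (diameter (C n))) \<le> hausdorff1_pre d (A i) + ennreal (e * (1/2)^Suc i)" by blast
  from choice[OF this] obtain C where C: "\<And>i. A i \<subseteq> (\<Union>n. C i n)" "\<And>i n. bounded (C i n)" "\<And>i n. diameter (C i n) \<le> d"
   "\<And>i. (\<Sum>n. ennreal (diameter (C i n))) \<le> hausdorff1_pre d (A i) + ennreal (e * (1/2)^Suc i)" by blast
  define D where "D k = C (fst (prod_decode k)) (snd (prod_decode k))" for k
  have "(\<Union>i. A i) \<subseteq> (\<Union>k. D k)"
  proof
   fix x assume "x \<in> (\<Union>i. A i)"
   then obtain i n where "x \<in> C i n" using C(1) by blast
   hence "x \<in> D (prod_encode (i, n))" by (simp add: D_def)
   thus "x \<in> (\<Union>k. D k)" by blast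
  qed
  hence "hausdorff1_pre d (\<Union>i. A i) \<le> (\<Sum>k. ennreal (diameter (D k)))"
   by (rule hausdorff1_pre_le) (use C in \<open>auto simp: D_def\<close>)
  also have "\<dots> = (\<Sum>i. \<Sum>n. ennreal (diameter (C i n)))"
   unfolding D_def using suminf_ennreal_2dimen[of "\<lambda>i. \<Sum>n. ennreal (diameter (C i n))" "\<lambda>(i, n). ennreal (diameter (C i n))"]
   by (simp add: case_prod_beta')
  also have "\<dots> \<le> (\<Sum>i. hausdorff1_pre d (A i) + ennreal (e * (1/2)^Suc i))"
   by (intro suminf_le C(4)) auto
  also have "\<dots> = (\<Sum>i. hausdorff1_pre d (A i)) + (\<Sum>i. ennreal (e * (1/2)^Suc i))"
   by (rule suminf_add[symmetric]) auto
  also have "(\<Sum>i. ennreal (e * (1/2)^Suc i)) = ennreal e"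
  proof -
   have "(\<lambda>i. e * (1/2)^Suc i) sums (e * 1)" by (intro sums_mult power_half_series)
   thus ?thesis using e by (intro suminf_ennreal_eq[THEN trans]) auto
  qed
  finally show "hausdorff1_pre d (\<Union>i. A i) \<le> (\<Sum>i. hausdorff1_pre d (A i)) + ennreal e" .
 qed
qed simp

lemma hausdorff1_outer_subadditive:
 "hausdorff1_outer (\<Union>i. A i) \<le> (\<Sum>i::nat. hausdorff1_outer (A i))"
 unfolding hausdorff1_outer_eq[of "\<Union>i. A i"]
proof (rule SUP_least)
 fix d :: real assume "d \<in> {0<..}"
 hence "(\<Sum>i. hausdorff1_pre d (A i)) \<le> (\<Sum>i. hausdorff1_outer (A i))"
  by (intro suminf_le hausdorff1_pre_le_outer) auto
 with hausdorff1_pre_subadditive show "hausdorff1_pre d (\<Union>i. A i) \<le> (\<Sum>i. hausdorff1_outer (A i))"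
  by (rule order_trans)
qed

lemma hausdorff1_outer_Un: "hausdorff1_outer (A \<union> B) \<le> hausdorff1_outer A + hausdorff1_outer B"
proof -
 have "A \<union> B = (\<Union>i. binaryset A B i)" by (simp add: UN_binaryset_eq)
 hence "hausdorff1_outer (A \<union> B) \<le> (\<Sum>i. hausdorff1_outer (binaryset A B i))"
  using hausdorff1_outer_subadditive[of "binaryset A B"] by simp
 also have "\<dots> = hausdorff1_outer A + hausdorff1_outer B"
  by (rule suminf_binaryset_eq[where f=hausdorff1_outer, OF hausdorff1_outer_empty])
 finally show ?thesis .
qed

text \<open>A covering set of diameter below the distance cannot meet both \<open>A\<close> and
  \<open>B\<close>, so every fine cover of the union splits into covers of the two sets.\<close>

lemma hausdorff1_outer_separated:
 assumes d: "d > 0" and sep: "\<And>x y. x \<in> A \<Longrightarrow> y \<in> B \<Longrightarrow> d \<le> dist x y"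
 shows "hausdorff1_outer A + hausdorff1_outer B \<le> hausdorff1_outer (A \<union> B)"
proof -
 have small: "hausdorff1_pre h A + hausdorff1_pre h B \<le> hausdorff1_pre h (A \<union> B)" if h: "0 < h" "h < d" for h
  unfolding hausdorff1_pre_def[of h "A \<union> B"]
 proof (rule INF_greatest)
  fix C :: "nat \<Rightarrow> (real^2) set" assume "C \<in> {C. A \<union> B \<subseteq> (\<Union>n. C n) \<and> (\<forall>n. bounded (C n) \<and> diameter (C n) \<le> h)}"
  hence C: "A \<union> B \<subseteq> (\<Union>n. C n)" "\<And>n. bounded (C n)" "\<And>n. diameter (C n) \<le> h" by auto
  have b: "bounded (C n \<inter> S)" "diameter (C n \<inter> S) \<le> diameter (C n)" for n S
   using C(2)[of n] by (auto intro: bounded_subset diameter_subset)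
  have "hausdorff1_pre h A \<le> (\<Sum>n. ennreal (diameter (C n \<inter> A)))"
   by (rule hausdorff1_pre_le) (use C(1) b(1) order_trans[OF b(2) C(3)] in auto)
  moreover have "hausdorff1_pre h B \<le> (\<Sum>n. ennreal (diameter (C n \<inter> B)))"
   by (rule hausdorff1_pre_le) (use C(1) b(1) order_trans[OF b(2) C(3)] in auto)
  ultimately have "hausdorff1_pre h A + hausdorff1_pre h B
    \<le> (\<Sum>n. ennreal (diameter (C n \<inter> A))) + (\<Sum>n. ennreal (diameter (C n \<inter> B)))" by (rule add_mono)
  also have "\<dots> = (\<Sum>n. ennreal (diameter (C n \<inter> A)) + ennreal (diameter (C n \<inter> B)))"
   by (rule suminf_add) auto
  also have "\<dots> \<le> (\<Sum>n. ennreal (diameter (C n)))"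
  proof (intro suminf_le)
   fix n
   have "C n \<inter> A = {} \<or> C n \<inter> B = {}"
   proof (rule ccontr)
    assume "\<not> ?thesis"
    then obtain x y where xy: "x \<in> C n" "x \<in> A" "y \<in> C n" "y \<in> B" by auto
    have "dist x y \<le> diameter (C n)" using C(2) xy by (intro diameter_bounded_bound) auto
    with sep[OF xy(2,4)] C(3)[of n] h show False by linarith
   qed
   thus "ennreal (diameter (C n \<inter> A)) + ennreal (diameter (C n \<inter> B)) \<le> ennreal (diameter (C n))"
    using b(2)[of n A] b(2)[of n B] by (auto intro: ennreal_leI)
  qed auto
  finally show "hausdorff1_pre h A + hausdorff1_pre h B \<le> (\<Sum>n. ennreal (diameter (C n)))" .
 qed
 \<comment> \<open>Independent sizes \<open>h1\<close> and \<open>h2\<close> allow the two suprema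
   to be taken one after the other.\<close>
 have "hausdorff1_pre h1 A + hausdorff1_pre h2 B \<le> hausdorff1_outer (A \<union> B)" if "h1 > 0" "h2 > 0" for h1 h2
 proof -
  define h where "h = min (min h1 h2) (d/2)"
  have h: "0 < h" "h < d" "h \<le> h1" "h \<le> h2" using that d by (auto simp: h_def)
  have "hausdorff1_pre h1 A + hausdorff1_pre h2 B \<le> hausdorff1_pre h A + hausdorff1_pre h B"
   using h by (intro add_mono hausdorff1_pre_antimono)
  also have "\<dots> \<le> hausdorff1_pre h (A \<union> B)" by (rule small[OF h(1,2)])
  also have "\<dots> \<le> hausdorff1_outer (A \<union> B)" by (rule hausdorff1_pre_le_outer[OF h(1)])
  finally show ?thesis .
 qed
 hence "hausdorff1_outer A + hausdorff1_pre h2 B \<le> hausdorff1_outer (A \<union> B)" if "h2 > 0" for h2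
  unfolding hausdorff1_outer_eq[of A] using that
  by (subst ennreal_SUP_add_left[symmetric]) (auto intro!: SUP_least)
 thus ?thesis unfolding hausdorff1_outer_eq[of B]
  by (subst ennreal_SUP_add_right) (auto intro!: SUP_least)
qed

lemma ennreal_suminf_tail_tendsto_0:
 fixes f :: "nat \<Rightarrow> ennreal"
 assumes "(\<Sum>k. f k) < \<infinity>"
 shows "(\<lambda>n. \<Sum>k. f (k + n)) \<longlonglongrightarrow> 0"
proof -
 have "f k < \<infinity>" for k
  using assms sum_le_suminf[of f "{k}"] by (auto intro: le_less_trans)
 hence fg: "f k = ennreal (enn2real (f k))" for k by (simp add: less_top)
 define g where "g k = enn2real (f k)" for k
 have g0: "0 \<le> g k" for k by (simp add: g_def)
 have fg: "f = (\<lambda>k. ennreal (g k))" using fg by (simp add: g_def fun_eq_iff)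
 have sm: "summable g"
  by (rule summable_suminf_not_top[OF g0]) (use assms in \<open>simp add: fg less_top\<close>)
 have "(\<lambda>n. suminf g - (\<Sum>i<n. g i)) \<longlonglongrightarrow> suminf g - suminf g"
  by (intro tendsto_diff tendsto_const summable_LIMSEQ sm)
 hence "(\<lambda>n. \<Sum>k. g (k + n)) \<longlonglongrightarrow> 0"
  using suminf_minus_initial_segment[OF sm] by simp
 hence "(\<lambda>n. ennreal (\<Sum>k. g (k + n))) \<longlonglongrightarrow> ennreal 0" by (rule tendsto_ennrealI)
 moreover have "(\<Sum>k. f (k + n)) = ennreal (\<Sum>k. g (k + n))" for n
  unfolding fg using g0 sm by (intro suminf_ennreal2) (auto simp: summable_iff_shift)
 ultimately show ?thesis by simp
qed

text \<open>Caratheodory's criterion: a metric outer measure is additive on closed sets. The layers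
 between the level sets of the distance to \<open>F\<close> are alternately separated, so their measures sum up.\<close>

lemma hausdorff1_outer_closed:
 assumes F: "closed F"
 shows "hausdorff1_outer (A \<inter> F) + hausdorff1_outer (A - F) \<le> hausdorff1_outer A"
proof (cases "F = {} \<or> hausdorff1_outer A = \<infinity>")
 case True
 thus ?thesis by (auto simp: hausdorff1_outer_empty)
next
 case False
 let ?H = hausdorff1_outer
 have fin: "?H A < \<infinity>" and Fne: "F \<noteq> {}" using False by (auto simp: less_top)
 \<comment> \<open>\<open>B n\<close> keeps the distance \<open>1 / Suc n\<close> from
   \<open>F\<close>, and \<open>R k\<close> is the layer gained from \<open>B k\<close> to
   \<open>B (Suc k)\<close>.\<close>
 define B where "B n = {x \<in> A - F. 1 / Suc n \<le> infdist x F}" for n :: nat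
 define R where "R k = B (Suc k) - B k" for k
 have Bmono: "B n \<subseteq> B m" if "n \<le> m" for n m
 proof -
  have "1 / real (Suc m) \<le> 1 / real (Suc n)" using that by (simp add: frac_le)
  thus ?thesis by (auto simp: B_def)
 qed
 have inR: "1 / real (k + 2) \<le> infdist x F" "infdist x F < 1 / real (k + 1)" if "x \<in> R k" for x k
  using that by (auto simp: R_def B_def)
 have RA: "R k \<subseteq> A" for k by (auto simp: R_def B_def)
 have sum_layers: "(\<Sum>i<m. ?H (R (2 * i + p))) \<le> ?H A" for m p
 proof -
  have "(\<Sum>i<m. ?H (R (2 * i + p))) \<le> ?H (\<Union>i<m. R (2 * i + p))"
  proof (induction m)
   case (Suc m)
   have "?H (\<Union>i<m. R (2 * i + p)) + ?H (R (2 * m + p)) \<le> ?H ((\<Union>i<m. R (2 * i + p)) \<union> R (2 * m + p))"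
   proof (cases "m = 0")
    case True thus ?thesis by (simp add: hausdorff1_outer_empty)
   next
    case False
    \<comment> \<open>Between layers of equal parity lies a whole layer of the other parity; its
      thickness, measured by the distance to \<open>F\<close>, is the separation.\<close>
    let ?a = "1 / real (2 * m + p)" and ?b = "1 / real (2 * m + p + 1)"
    show ?thesis
    proof (rule hausdorff1_outer_separated[of "?a - ?b"])
     show "?a - ?b > 0" using False by (simp add: frac_less2)
     fix x y assume "x \<in> (\<Union>i<m. R (2 * i + p))" and y: "y \<in> R (2 * m + p)"
     then obtain i where i: "i < m" "x \<in> R (2 * i + p)" by auto
     have "2 * i + p + 2 \<le> 2 * m + p" using i(1) by simp
     hence "real (2 * i + p + 2) \<le> real (2 * m + p)" by (rule of_nat_mono)
     hence "?a \<le> 1 / real (2 * i + p + 2)" by (intro divide_left_mono) auto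
     hence "?a \<le> infdist x F" using inR(1)[OF i(2)] by linarith
     moreover have "infdist y F < ?b" using inR(2)[OF y] .
     moreover have "infdist x F \<le> infdist y F + dist x y" by (rule infdist_triangle)
     ultimately show "?a - ?b \<le> dist x y" by linarith
    qed
   qed
   with Suc have "(\<Sum>i<m. ?H (R (2 * i + p))) + ?H (R (2 * m + p)) \<le> ?H ((\<Union>i<m. R (2 * i + p)) \<union> R (2 * m + p))"
    by (meson add_right_mono order_trans)
   thus ?case by (simp add: lessThan_Suc Un_commute add.commute)
  qed (simp add: hausdorff1_outer_empty)
  also have "\<dots> \<le> ?H A" using RA by (intro hausdorff1_outer_mono) auto
  finally show ?thesis .
 qed
 have "(\<Sum>k<n. ?H (R k)) \<le> ?H A + ?H A" for n
 proof -
  have "(\<Sum>k<n. ?H (R k)) \<le> (\<Sum>k<2*n. ?H (R k))" by (intro sum_mono2) auto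
  also have "\<dots> = (\<Sum>i<n. ?H (R (2 * i + 0))) + (\<Sum>i<n. ?H (R (2 * i + 1)))"
   by (induction n) (simp_all add: algebra_simps)
  also have "\<dots> \<le> ?H A + ?H A" by (intro add_mono sum_layers)
  finally show ?thesis .
 qed
 hence "(\<Sum>k. ?H (R k)) \<le> ?H A + ?H A" by (intro suminf_le_const) auto
 also have "\<dots> < \<infinity>" using fin by simp
 finally have tail: "(\<lambda>n. \<Sum>k. ?H (R (k + n))) \<longlonglongrightarrow> 0" by (rule ennreal_suminf_tail_tendsto_0)
 have step: "?H (A \<inter> F) + ?H (A - F) \<le> ?H A + (\<Sum>k. ?H (R (k + n)))" for n
 proof -
  have "A - F \<subseteq> B n \<union> (\<Union>k. R (k + n))"
  proof
   fix x assume x: "x \<in> A - F"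
   hence "infdist x F > 0" using infdist_pos_not_in_closed[OF F Fne] by auto
   then obtain m where "1 / Suc m < infdist x F" using nat_approx_posE by metis
   hence ex: "x \<in> B m" using x by (auto simp: B_def)
   show "x \<in> B n \<union> (\<Union>k. R (k + n))"
   proof (cases "x \<in> B n")
    case False
    define j where "j = (LEAST j. x \<in> B j)"
    have j: "x \<in> B j" "\<And>i. i < j \<Longrightarrow> x \<notin> B i"
     unfolding j_def using ex by (auto intro: LeastI dest: not_less_Least)
    have "n < j" using False j(1) Bmono[of j n] by (meson not_less subsetD)
    then obtain k where k: "j = Suc (k + n)" by (metis add.commute less_imp_Suc_add)
    hence "x \<in> R (k + n)" using j by (simp add: R_def)
    thus ?thesis by blast
   qed simp
  qed
  hence "?H (A - F) \<le> ?H (B n \<union> (\<Union>k. R (k + n)))" by (rule hausdorff1_outer_mono)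
  also have "\<dots> \<le> ?H (B n) + ?H (\<Union>k. R (k + n))" by (rule hausdorff1_outer_Un)
  also have "?H (\<Union>k. R (k + n)) \<le> (\<Sum>k. ?H (R (k + n)))" by (rule hausdorff1_outer_subadditive)
  finally have "?H (A \<inter> F) + ?H (A - F) \<le> ?H (A \<inter> F) + (?H (B n) + (\<Sum>k. ?H (R (k + n))))"
   by (simp add: add_left_mono)
  also have "\<dots> = (?H (A \<inter> F) + ?H (B n)) + (\<Sum>k. ?H (R (k + n)))" by (simp add: add.assoc)
  also have "?H (A \<inter> F) + ?H (B n) \<le> ?H ((A \<inter> F) \<union> B n)"
  proof (rule hausdorff1_outer_separated[of "1 / Suc n"])
   fix x y assume "x \<in> A \<inter> F" "y \<in> B n"
   thus "1 / Suc n \<le> dist x y" using infdist_le[of x F y] by (auto simp: B_def dist_commute)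
  qed simp
  also have "?H ((A \<inter> F) \<union> B n) \<le> ?H A" by (rule hausdorff1_outer_mono) (auto simp: B_def)
  finally show ?thesis by (simp add: add_right_mono)
 qed
 have "(\<lambda>n. ?H A + (\<Sum>k. ?H (R (k + n)))) \<longlonglongrightarrow> ?H A + 0"
  by (intro tendsto_add tendsto_const tail)
 from LIMSEQ_le_const[OF this] step show ?thesis by auto
qed

text \<open>\<open>measure_of\<close> returns the given set function only if it is a measure on the
  sigma-algebra. Caratheodory's theorem provides this for the sets measurable with respect to the
  outer measure, and closed sets, hence all Borel sets, are among them.\<close>

lemma hausdorff1_measure_space: "measure_space UNIV (sets borel) hausdorff1_outer"
proof -
 interpret P: sigma_algebra "UNIV :: (real^2) set" "Pow UNIV" by (rule sigma_algebra_Pow)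
 have oms: "outer_measure_space (Pow UNIV) hausdorff1_outer"
  unfolding outer_measure_space_def positive_def increasing_def countably_subadditive_def
  by (auto simp: hausdorff1_outer_empty intro: hausdorff1_outer_mono hausdorff1_outer_subadditive)
 let ?L = "lambda_system UNIV (Pow UNIV) hausdorff1_outer"
 have ms: "measure_space UNIV ?L hausdorff1_outer" by (rule P.caratheodory_lemma[OF oms])
 then interpret L: sigma_algebra UNIV ?L by (simp add: measure_space_def)
 have "F \<in> ?L" if "closed F" for F
  unfolding P.lambda_system_eq
 proof (intro CollectI conjI ballI)
  fix A
  have "A = (A \<inter> F) \<union> (A - F)" by auto
  hence "hausdorff1_outer A \<le> hausdorff1_outer (A \<inter> F) + hausdorff1_outer (A - F)"
   using hausdorff1_outer_Un by metis
  thus "hausdorff1_outer (A \<inter> F) + hausdorff1_outer (A - F) = hausdorff1_outer A"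
   using hausdorff1_outer_closed[OF that, of A] by (rule antisym[rotated])
 qed simp
 hence "sigma_sets UNIV {F. closed F} \<subseteq> ?L" by (intro L.sigma_sets_subset) auto
 hence sub: "sets borel \<subseteq> ?L" by (simp add: borel_eq_closed)
 have ca: "countably_additive ?L hausdorff1_outer" using ms by (simp add: measure_space_def)
 have "countably_additive (sets borel) hausdorff1_outer"
  unfolding countably_additive_def
 proof (intro allI impI)
  fix A :: "nat \<Rightarrow> (real^2) set"
  assume "range A \<subseteq> sets borel" "disjoint_family A" "(\<Union>i. A i) \<in> sets borel"
  thus "(\<Sum>i. hausdorff1_outer (A i)) = hausdorff1_outer (\<Union>i. A i)"
   using ca sub unfolding countably_additive_def by (meson subset_trans subsetD)
 qed
 moreover have "sigma_algebra UNIV (sets (borel :: (real^2) measure))"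
  using sets.sigma_algebra_axioms[of "borel :: (real^2) measure"] by simp
 moreover have "positive (sets borel) hausdorff1_outer"
  by (simp add: positive_def hausdorff1_outer_empty)
 ultimately show ?thesis by (simp add: measure_space_def)
qed

lemma sets_hausdorff1 [simp, measurable_cong]: "sets hausdorff1 = sets borel"
 unfolding hausdorff1_def using sets.sigma_sets_eq[of borel] by (simp add: sets_measure_of_conv)

lemma space_hausdorff1 [simp]: "space hausdorff1 = UNIV"
 by (simp add: hausdorff1_def)

lemma emeasure_hausdorff1: "A \<in> sets borel \<Longrightarrow> emeasure hausdorff1 A = hausdorff1_outer A"
 unfolding hausdorff1_def using hausdorff1_measure_space
 by (intro emeasure_measure_of_sigma) (auto simp: measure_space_def)

section \<open>Finite length of a Lipschitz boundary\<close>

lemma orthonormal_expansion: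
 fixes e n y :: "real^2"
 assumes e: "norm e = 1" "norm n = 1" "e \<bullet> n = 0"
 shows "y = (y \<bullet> e) *\<^sub>R e + (y \<bullet> n) *\<^sub>R n"
proof -
 have 1: "e$1 * e$1 + e$2 * e$2 = 1" "n$1 * n$1 + n$2 * n$2 = 1" "e$1 * n$1 + e$2 * n$2 = 0"
  using e by (simp_all add: norm_eq_1 inner_vec_def sum_2)
 have a: "n$1 * n$1 = e$2 * e$2"
 proof -
  have "n$1 * n$1 = (e$1 * n$1) * (e$1 * n$1) + (n$1 * n$1) * (e$2 * e$2)" using 1(1) by algebra
  also have "\<dots> = e$2 * e$2" using 1(2,3) by algebra
  finally show ?thesis .
 qed
 have b: "n$2 * n$2 = e$1 * e$1" using 1 a by algebra
 have c: "n$1 * n$2 = - (e$1 * e$2)" using 1 by algebra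
 have "y$1 = (y$1 * e$1 + y$2 * e$2) * e$1 + (y$1 * n$1 + y$2 * n$2) * n$1"
  "y$2 = (y$1 * e$1 + y$2 * e$2) * e$2 + (y$1 * n$1 + y$2 * n$2) * n$2" using 1 a b c by algebra+
 thus ?thesis by (simp add: vec_eq_iff forall_2 inner_vec_def sum_2)
qed

text \<open>Equal subintervals have images of diameter at most \<open>h * C\<close>, and these add
  up to \<open>(b - a) * C\<close> for any number of pieces; sufficiently many pieces make each
  smaller than \<open>d\<close>.\<close>

lemma hausdorff1_Lipschitz_arc:
 assumes f: "C-lipschitz_on {a..b} f" and ab: "a < b"
 shows "hausdorff1_outer (f ` {a..b::real}) \<le> ennreal ((b - a) * C)"
 unfolding hausdorff1_outer_eq
proof (rule SUP_least)
 fix d :: real assume "d \<in> {0<..}"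
 hence d: "d > 0" by simp
 have C0: "0 \<le> C" using f by (rule lipschitz_on_nonneg)
 obtain N0 :: nat where N0: "(b - a) * C / d < real N0" using reals_Archimedean2 by blast
 define N where "N = Suc N0"
 define h where "h = (b - a) / N"
 have h: "h > 0" "h * C \<le> d" and Nh: "real N * h = b - a"
  using ab N0 d by (auto simp: h_def N_def field_simps)
 define D where "D k = (if k < N then f ` ({a..b} \<inter> {a + real k * h..a + real (Suc k) * h}) else {})" for k
 have nb: "norm (y - z) \<le> h * C" if yz: "y \<in> D k" "z \<in> D k" for y z k
 proof -
  let ?J = "{a..b} \<inter> {a + real k * h..a + real (Suc k) * h}"
  have "y \<in> f ` ?J" "z \<in> f ` ?J" using yz by (auto simp: D_def split: if_splits)
  then obtain s t where st': "y = f s" "z = f t" "s \<in> ?J" "t \<in> ?J" by blast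
  hence st: "s \<in> {a..b}" "t \<in> {a..b}" "\<bar>s - t\<bar> \<le> h" by (auto simp del: Int_atLeastAtMost simp add: algebra_simps abs_le_iff)
  have "norm (y - z) \<le> C * \<bar>s - t\<bar>" using lipschitz_onD[OF f st(1,2)] by (simp add: st' dist_norm)
  also have "\<dots> \<le> C * h" using st(3) C0 by (rule mult_left_mono)
  finally show ?thesis by (simp add: mult.commute)
 qed
 have dd: "diameter (D k) \<le> h * C" for k by (rule diameter_le) (use nb h C0 in auto)
 have db: "bounded (D k)" for k unfolding bounded_two_points using nb by (metis dist_norm)
 have cov: "f ` {a..b} \<subseteq> (\<Union>k. D k)"
 proof
  fix y assume "y \<in> f ` {a..b}"
  then obtain t where t: "y = f t" "a \<le> t" "t \<le> b" by auto
  define x where "x = (t - a) / h"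
  have x: "0 \<le> x" "x \<le> N" "t = a + x * h" using t h by (auto simp: x_def pos_divide_le_eq Nh)
  \<comment> \<open>The minimum assigns the right endpoint, whose quotient is \<open>N\<close>, to
    the last piece.\<close>
  define k where "k = min (nat \<lfloor>x\<rfloor>) (N - 1)"
  have k: "k < N" by (simp add: k_def N_def)
  have kx: "real k \<le> x" "x \<le> real (Suc k)"
   using x(1,2) unfolding k_def N_def min_def by (auto split: if_splits) linarith+
  hence "t \<in> {a + real k * h..a + real (Suc k) * h}" using x(3) h by (auto intro!: mult_right_mono)
  hence "y \<in> D k" using t k by (auto simp: D_def)
  thus "y \<in> (\<Union>k. D k)" by blast
 qed
 have "hausdorff1_pre d (f ` {a..b}) \<le> (\<Sum>k. ennreal (diameter (D k)))"
  by (rule hausdorff1_pre_le[OF cov db order_trans[OF dd h(2)]])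
 also have "\<dots> = (\<Sum>k<N. ennreal (diameter (D k)))" by (rule suminf_finite) (auto simp: D_def)
 also have "\<dots> \<le> (\<Sum>k<N. ennreal (h * C))" by (intro sum_mono ennreal_leI dd)
 also have "\<dots> = ennreal (real N * h * C)"
  using h C0 by (simp add: ennreal_of_nat_eq_real_of_nat ennreal_mult mult.assoc)
 finally show "hausdorff1_pre d (f ` {a..b}) \<le> ennreal ((b - a) * C)" by (simp only: Nh)
qed

text \<open>An open set contains none of its frontier, which excludes points above the graph; a
  point below the graph has a neighbourhood that misses \<open>\<omega>\<close>.\<close>

lemma frontier_graph:
 assumes op: "open \<omega>" and g: "\<omega> \<inter> ball x r = {y \<in> ball x r. c (y \<bullet> e) < y \<bullet> n}"
  and c: "continuous_on UNIV c" and y: "y \<in> frontier \<omega>" "y \<in> ball x r"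
 shows "y \<bullet> n = c (y \<bullet> e)"
proof (rule ccontr)
 assume "y \<bullet> n \<noteq> c (y \<bullet> e)"
 then consider "c (y \<bullet> e) < y \<bullet> n" | "y \<bullet> n < c (y \<bullet> e)" by linarith
 thus False
 proof cases
  case 1
  hence "y \<in> \<omega> \<inter> ball x r" using y(2) unfolding g by simp
  thus False using y(1) op by (simp add: frontier_def interior_open)
 next
  case 2
  let ?U = "ball x r \<inter> {y. y \<bullet> n < c (y \<bullet> e)}"
  have "open {y. y \<bullet> n < c (y \<bullet> e)}"
   by (intro open_Collect_less continuous_intros continuous_on_compose2[OF c]) auto
  hence "open ?U" by auto
  moreover have "y \<in> ?U" using y(2) 2 by simp
  moreover have "y \<in> closure \<omega>" using y(1) by (simp add: frontier_def)
  ultimately obtain z where "z \<in> \<omega>" "z \<in> ?U" using open_Int_closure_eq_empty[of ?U \<omega>] by blast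
  moreover from this have "z \<in> \<omega> \<inter> ball x r" by simp
  hence "c (z \<bullet> e) < z \<bullet> n" unfolding g by simp
  ultimately show False by simp
 qed
qed

text \<open>Finitely many balls cover the compact frontier, and in each of them it lies on the
  Lipschitz arc \<open>t *\<^sub>R e + h t *\<^sub>R n\<close> over a bounded interval.\<close>

lemma (in lipschitz_domain) hausdorff1_frontier_finite: "hausdorff1_outer (frontier \<omega>) < \<infinity>"
proof -
 have "\<exists>r>0. hausdorff1_outer (frontier \<omega> \<inter> ball x r) < \<infinity>" if x: "x \<in> frontier \<omega>" for x
 proof -
  obtain r e n h C where r: "r > 0" and e: "norm e = 1" "norm n = 1" "e \<bullet> n = 0"
   and h: "C-lipschitz_on UNIV h" and g: "\<omega> \<inter> ball x r = {y \<in> ball x r. h (y \<bullet> e) < y \<bullet> n}"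
   using lipschitz x unfolding lipschitz_boundary_def by blast
  define R where "R = norm x + r"
  have R: "R > 0" using r by (simp add: R_def add_nonneg_pos)
  have "(1 * norm e + C * norm n)-lipschitz_on {-R..R} (\<lambda>t. t *\<^sub>R e + h t *\<^sub>R n)"
  proof (rule lipschitz_on_add)
   show "(1 * norm e)-lipschitz_on {-R..R} (\<lambda>t. t *\<^sub>R e)"
    by (auto intro!: lipschitz_onI simp: dist_norm scaleR_diff_left[symmetric])
   show "(C * norm n)-lipschitz_on {-R..R} (\<lambda>t. h t *\<^sub>R n)"
    using lipschitz_onD[OF h] lipschitz_on_nonneg[OF h] e
    by (auto intro!: lipschitz_onI simp: dist_norm scaleR_diff_left[symmetric])
  qed
  hence lip: "(1 + C)-lipschitz_on {-R..R} (\<lambda>t. t *\<^sub>R e + h t *\<^sub>R n)" using e by simp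
  have "frontier \<omega> \<inter> ball x r \<subseteq> (\<lambda>t. t *\<^sub>R e + h t *\<^sub>R n) ` {-R..R}"
  proof
   fix y assume y: "y \<in> frontier \<omega> \<inter> ball x r"
   have "\<bar>y \<bullet> e\<bar> \<le> norm y" using Cauchy_Schwarz_ineq2[of y e] e by simp
   also have "\<dots> \<le> R" using y norm_triangle_ineq2[of y x] by (auto simp: R_def dist_norm norm_minus_commute[of x y])
   finally have "y \<bullet> e \<in> {-R..R}" by auto
   moreover have "y = (y \<bullet> e) *\<^sub>R e + h (y \<bullet> e) *\<^sub>R n"
    using orthonormal_expansion[OF e, of y] frontier_graph[OF open_dom g lipschitz_on_continuous_on[OF h], of y] y by simp
   ultimately show "y \<in> (\<lambda>t. t *\<^sub>R e + h t *\<^sub>R n) ` {-R..R}" by blast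
  qed
  hence "hausdorff1_outer (frontier \<omega> \<inter> ball x r) \<le> ennreal ((R - - R) * (1 + C))"
   using R by (intro order_trans[OF hausdorff1_outer_mono hausdorff1_Lipschitz_arc[OF lip]]) auto
  also have "\<dots> < \<infinity>" by simp
  finally show ?thesis using r by blast
 qed
 then obtain r where r: "\<And>x. x \<in> frontier \<omega> \<Longrightarrow> r x > 0" "\<And>x. x \<in> frontier \<omega> \<Longrightarrow> hausdorff1_outer (frontier \<omega> \<inter> ball x (r x)) < \<infinity>"
  by metis
 have c: "compact (frontier \<omega>)" using bounded_dom by (rule compact_frontier_bounded)
 have cov: "frontier \<omega> \<subseteq> (\<Union>x\<in>frontier \<omega>. ball x (r x))" using r(1) by force
 obtain X where X: "X \<subseteq> frontier \<omega>" "finite X" "frontier \<omega> \<subseteq> (\<Union>x\<in>X. ball x (r x))"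
  by (rule compactE_image[OF c open_ball cov])
 have "hausdorff1_outer (\<Union>x\<in>Y. frontier \<omega> \<inter> ball x (r x)) < \<infinity>" if "finite Y" "Y \<subseteq> frontier \<omega>" for Y
  using that
 proof (induction Y)
  case (insert x Y)
  have "hausdorff1_outer (\<Union>x\<in>insert x Y. frontier \<omega> \<inter> ball x (r x))
   \<le> hausdorff1_outer (frontier \<omega> \<inter> ball x (r x)) + hausdorff1_outer (\<Union>x\<in>Y. frontier \<omega> \<inter> ball x (r x))"
   unfolding UN_insert by (rule hausdorff1_outer_Un)
  also have "\<dots> < \<infinity>" using insert r(2)[of x] by auto
  finally show ?case .
 qed (simp add: hausdorff1_outer_empty)
 from this[OF X(2,1)] show ?thesis
  by (rule le_less_trans[rotated]) (use X(3) in \<open>auto intro: hausdorff1_outer_mono\<close>)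
qed

text \<open>Each set of a near-optimal cover is replaced by a ball centred at one of its points in
  \<open>A\<close>. The radius exceeds the diameter by a positive summable amount, so the open balls
  still cover. Centres in \<open>A\<close> make values of a function at the centres comparable with
  its values on \<open>A\<close>.\<close>

lemma hausdorff1_ball_cover:
 assumes A: "A \<noteq> {}" "hausdorff1_outer A < \<infinity>" and d: "d > 0" and e: "e > 0"
 obtains c :: "nat \<Rightarrow> real^2" and r where "\<And>n. c n \<in> A" "\<And>n. 0 < r n" "\<And>n. r n \<le> d" "A \<subseteq> (\<Union>n. ball (c n) (r n))"
  "(\<Sum>n. ennreal (r n)) \<le> hausdorff1_outer A + ennreal e"
proof -
 have "hausdorff1_pre (d/2) A \<le> hausdorff1_outer A" using d by (intro hausdorff1_pre_le_outer) simp
 also have "\<dots> < hausdorff1_outer A + ennreal (e/2)"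
  using A(2) e by (cases "hausdorff1_outer A") (auto simp: ennreal_plus[symmetric] ennreal_less_iff simp del: ennreal_plus)
 finally obtain C where C: "A \<subseteq> (\<Union>n. C n)" "\<And>n. bounded (C n)" "\<And>n. diameter (C n) \<le> d/2"
  "(\<Sum>n. ennreal (diameter (C n))) < hausdorff1_outer A + ennreal (e/2)"
  using hausdorff1_pre_cover by blast
 \<comment> \<open>A covering set that misses \<open>A\<close> receives an arbitrary centre in
   \<open>A\<close>.\<close>
 define c where "c n = (SOME x. x \<in> A \<and> (C n \<inter> A \<noteq> {} \<longrightarrow> x \<in> C n))" for n
 have c: "c n \<in> A" "C n \<inter> A \<noteq> {} \<Longrightarrow> c n \<in> C n" for n
 proof -
  have "\<exists>x. x \<in> A \<and> (C n \<inter> A \<noteq> {} \<longrightarrow> x \<in> C n)" using A(1) by blast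
  from someI_ex[OF this] show "c n \<in> A" "C n \<inter> A \<noteq> {} \<Longrightarrow> c n \<in> C n" unfolding c_def by blast+
 qed
 define m where "m = min d e"
 have m: "0 < m" "m \<le> d" "m \<le> e" using d e by (auto simp: m_def)
 define q where "q n = m/2 * (1/2)^Suc n" for n
 have q: "0 < q n" "q n \<le> d/2" for n
 proof -
  show "0 < q n" using m by (simp add: q_def)
  have "q n \<le> m/2 * 1" unfolding q_def using m by (intro mult_left_mono power_le_one) auto
  thus "q n \<le> d/2" using m by simp
 qed
 have qs: "(\<Sum>n. ennreal (q n)) \<le> ennreal (e/2)"
 proof -
  have "q sums (m/2 * 1)" unfolding q_def[abs_def] by (intro sums_mult power_half_series)
  hence "(\<Sum>n. ennreal (q n)) = ennreal (m/2)" using q by (intro suminf_ennreal_eq) (auto simp: less_imp_le)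
  thus ?thesis using m by (simp add: ennreal_leI)
 qed
 define r where "r n = diameter (C n) + q n" for n
 show ?thesis
 proof (rule that)
  show "c n \<in> A" for n by (rule c(1))
  show "0 < r n" for n unfolding r_def using diameter_ge_0[OF C(2)] q(1) by (rule add_nonneg_pos)
  show "r n \<le> d" for n unfolding r_def using C(3)[of n] q(2)[of n] by linarith
  show "A \<subseteq> (\<Union>n. ball (c n) (r n))"
  proof
   fix x assume x: "x \<in> A"
   then obtain n where n: "x \<in> C n" using C(1) by blast
   hence "c n \<in> C n" using x c(2) by blast
   hence "dist (c n) x \<le> diameter (C n)" using n by (intro diameter_bounded_bound C(2))
   hence "dist (c n) x < r n" using q(1)[of n] by (simp add: r_def)
   thus "x \<in> (\<Union>n. ball (c n) (r n))" by auto
  qed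
  have "(\<Sum>n. ennreal (r n)) = (\<Sum>n. ennreal (diameter (C n)) + ennreal (q n))"
   unfolding r_def using diameter_ge_0[OF C(2)] q(1) by (intro suminf_cong ennreal_plus) (auto simp: less_imp_le)
  also have "\<dots> = (\<Sum>n. ennreal (diameter (C n))) + (\<Sum>n. ennreal (q n))" by (rule suminf_add[symmetric]) auto
  also have "\<dots> \<le> (hausdorff1_outer A + ennreal (e/2)) + ennreal (e/2)"
   using C(4) qs by (intro add_mono) (auto simp: less_imp_le)
  also have "\<dots> = hausdorff1_outer A + ennreal e"
   using e by (simp add: add.assoc ennreal_plus[symmetric] del: ennreal_plus)
  finally show "(\<Sum>n. ennreal (r n)) \<le> hausdorff1_outer A + ennreal e" .
 qed
qed

text \<open>The cover is adapted to the level sets of \<open>F\<close>, so that its weighted size is an upper Riemann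
 sum for the integral of \<open>F\<close>.\<close>

lemma hausdorff1_weighted_cover:
 fixes F :: "real^2 \<Rightarrow> real"
 assumes G: "compact G" "hausdorff1_outer G < \<infinity>" and F: "continuous_on UNIV F" "\<And>x. 0 \<le> F x"
  and d: "d > 0" and l: "l > 0"
 obtains X where "finite X" "\<And>x r. (x, r) \<in> X \<Longrightarrow> x \<in> G \<and> 0 < r \<and> r \<le> d" "G \<subseteq> (\<Union>(x, r)\<in>X. ball x r)"
  "ennreal (\<Sum>(x, r)\<in>X. r * F x) \<le> (\<integral>\<^sup>+y. ennreal (F y) * indicator G y \<partial>hausdorff1) + ennreal l"
proof -
 let ?H = hausdorff1_outer and ?I = "\<integral>\<^sup>+y. ennreal (F y) * indicator G y \<partial>hausdorff1"
 define h where "h = enn2real (?H G)"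
 have h: "?H G = ennreal h" "0 \<le> h" using G(2) by (auto simp: h_def less_top)
 have [measurable]: "F \<in> borel_measurable borel" using F(1) by (rule borel_measurable_continuous_onI)
 have [measurable]: "G \<in> sets borel" using G(1) by (simp add: compact_imp_closed)
 \<comment> \<open>The level height: raising \<open>F\<close> to the next level costs
   \<open>s\<close> times the total length, at most \<open>l / 2\<close>.\<close>
 define s where "s = l / (2 * (h + 1))"
 have s: "s > 0" "s * h \<le> l / 2" using l h(2) by (auto simp: s_def field_simps)
 define lev where "lev y = nat \<lfloor>F y / s\<rfloor>" for y
 define A where "A j = {y \<in> G. lev y = j}" for j
 have [measurable]: "A j \<in> sets borel" for j unfolding A_def lev_def by measurable
 have AH: "?H (A j) \<le> ?H G" for j by (rule hausdorff1_outer_mono) (auto simp: A_def)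
 obtain K where K: "\<And>y. y \<in> G \<Longrightarrow> F y \<le> K"
 proof -
  have "bounded (F ` G)" by (intro compact_imp_bounded compact_continuous_image G(1) continuous_on_subset[OF F(1)]) simp
  then obtain K where "\<forall>y\<in>G. norm (F y) \<le> K" by (auto simp: bounded_iff)
  thus ?thesis using that[of K] by force
 qed
 have lev: "real j * s \<le> F y" "F y \<le> (real j + 1) * s" if "y \<in> A j" for y j
 proof -
  have "0 \<le> F y / s" using F(2) s by simp
  hence "real j \<le> F y / s" "F y / s \<le> real j + 1" using that by (auto simp: A_def lev_def)
  thus "real j * s \<le> F y" "F y \<le> (real j + 1) * s" using s by (auto simp: field_simps)
 qed
 define J where "J = {j. A j \<noteq> {}}"
 have Jb: "(real j + 1) * s \<le> K + s" if j: "j \<in> J" for j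
 proof -
  obtain y where y: "y \<in> A j" using j unfolding J_def by blast
  hence "y \<in> G" by (simp add: A_def)
  thus ?thesis using lev(1)[OF y] K[of y] by (simp add: algebra_simps)
 qed
 have "J \<subseteq> {..nat \<lceil>K / s\<rceil>}"
 proof
  fix j assume "j \<in> J"
  hence "real j * s \<le> K" using Jb[of j] by (simp add: algebra_simps)
  hence "real j \<le> K / s" using s by (simp add: pos_le_divide_eq)
  thus "j \<in> {..nat \<lceil>K / s\<rceil>}" by simp linarith
 qed
 hence J: "finite J" by (rule finite_subset) simp
 define T where "T = \<bar>K\<bar> + s"
 have T: "T > 0" "\<And>j. j \<in> J \<Longrightarrow> (real j + 1) * s \<le> T" using s Jb by (force simp: T_def)+
 \<comment> \<open>Each nonempty level contributes one excess \<open>e\<close>, weighted by at most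
   \<open>T\<close>; together they stay below \<open>l / 2\<close>.\<close>
 define e where "e = l / (2 * (real (card J) + 1) * T)"
 have e: "e > 0" "real (card J) * (T * e) \<le> l / 2"
 proof -
  have p: "2 * (real (card J) + 1) * T > 0" using T(1) by simp
  show "e > 0" unfolding e_def using l p by (rule divide_pos_pos)
  have "e * T = l / (2 * (real (card J) + 1))" using T(1) by (simp add: e_def)
  moreover have "real (card J) * (l / (2 * (real (card J) + 1))) \<le> l / 2"
   using l by (simp add: field_simps)
  ultimately show "real (card J) * (T * e) \<le> l / 2" by (simp add: mult.commute)
 qed
 define Q where "Q j c r \<longleftrightarrow> (\<forall>n. c n \<in> A j) \<and> (\<forall>n. 0 < r n) \<and> (\<forall>n. r n \<le> d) \<and> A j \<subseteq> (\<Union>n::nat. ball (c n) (r n)) \<and>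
  (\<Sum>n. ennreal (r n)) \<le> ?H (A j) + ennreal e" for j c r
 have "\<exists>c r. Q j c r" if "j \<in> J" for j
 proof -
  have "A j \<noteq> {}" "?H (A j) < \<infinity>" using that G(2) AH[of j] by (auto simp: J_def)
  then obtain c r where "\<And>n. c n \<in> A j" "\<And>n. 0 < r n" "\<And>n. r n \<le> d" "A j \<subseteq> (\<Union>n. ball (c n) (r n))"
   "(\<Sum>n. ennreal (r n)) \<le> ?H (A j) + ennreal e"
   using hausdorff1_ball_cover[OF _ _ d e(1), of "A j"] by blast
  hence "Q j c r" unfolding Q_def by blast
  thus ?thesis by blast
 qed
 then obtain c r where "\<And>j. j \<in> J \<Longrightarrow> Q j (c j) (r j)" by metis
 hence cr: "\<And>j n. j \<in> J \<Longrightarrow> c j n \<in> A j" "\<And>j n. j \<in> J \<Longrightarrow> 0 < r j n" "\<And>j n. j \<in> J \<Longrightarrow> r j n \<le> d"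
  "\<And>j. j \<in> J \<Longrightarrow> A j \<subseteq> (\<Union>n::nat. ball (c j n) (r j n))" "\<And>j. j \<in> J \<Longrightarrow> (\<Sum>n. ennreal (r j n)) \<le> ?H (A j) + ennreal e"
  unfolding Q_def by blast+
 let ?c = "\<lambda>p. c (fst p) (snd p)" and ?r = "\<lambda>p. r (fst p) (snd p)"
 have "G \<subseteq> (\<Union>p\<in>J \<times> UNIV. ball (?c p) (?r p))"
 proof
  fix y assume "y \<in> G"
  hence y: "y \<in> A (lev y)" by (simp add: A_def)
  hence "lev y \<in> J" by (auto simp: J_def)
  with y cr(4) obtain n where "y \<in> ball (c (lev y) n) (r (lev y) n)" by blast
  thus "y \<in> (\<Union>p\<in>J \<times> UNIV. ball (?c p) (?r p))"
   using \<open>lev y \<in> J\<close> by (intro UN_I[of "(lev y, n)"]) auto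
 qed
 then obtain Y where Y: "Y \<subseteq> J \<times> UNIV" "finite Y" "G \<subseteq> (\<Union>p\<in>Y. ball (?c p) (?r p))"
  by (rule compactE_image[OF G(1) open_ball])
 obtain N where N: "Y \<subseteq> J \<times> {..<N}"
 proof -
  have "finite (snd ` Y)" using Y(2) by simp
  then obtain N where "snd ` Y \<subseteq> {..<N}" using finite_nat_iff_bounded by blast
  thus ?thesis using Y(1) by (intro that[of N]) force
 qed
 define X where "X = (\<lambda>p. (?c p, ?r p)) ` Y"
 show ?thesis
 proof (rule that[of X])
  show "finite X" using Y(2) by (simp add: X_def)
  show "x \<in> G \<and> 0 < q \<and> q \<le> d" if "(x, q) \<in> X" for x q
   using that Y(1) cr(1-3) unfolding X_def A_def by fastforce
  show "G \<subseteq> (\<Union>(x, r)\<in>X. ball x r)" using Y(3) by (simp add: X_def)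
  have "(\<Sum>(x, r)\<in>X. r * F x) \<le> (\<Sum>p\<in>Y. ?r p * F (?c p))"
  proof -
   \<comment> \<open>Different indices may give the same ball, so the sum over the set
     \<open>X\<close> is at most the sum over the indices.\<close>
   have "sum (\<lambda>(x, r). r * F x) X \<le> sum ((\<lambda>(x, r). r * F x) \<circ> (\<lambda>p. (?c p, ?r p))) Y"
    unfolding X_def
   proof (rule sum_image_le[OF Y(2)])
    fix p assume "p \<in> Y"
    hence "fst p \<in> J" using Y(1) by auto
    thus "0 \<le> (case (?c p, ?r p) of (x, r) \<Rightarrow> r * F x)"
     using cr(2)[of "fst p" "snd p"] F(2) by (simp add: less_imp_le)
   qed
   thus ?thesis by (simp add: o_def)
  qed
  also have "\<dots> \<le> (\<Sum>p\<in>J \<times> {..<N}. ?r p * F (?c p))"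
   using N J cr(2) F(2) by (intro sum_mono2) (auto intro!: mult_nonneg_nonneg simp: less_imp_le)
  also have "\<dots> = (\<Sum>j\<in>J. \<Sum>n<N. r j n * F (c j n))" by (simp add: sum.cartesian_product case_prod_beta')
  also have "\<dots> \<le> (\<Sum>j\<in>J. \<Sum>n<N. r j n * ((real j + 1) * s))"
   using cr(1,2) lev(2) by (intro sum_mono mult_left_mono) (auto simp: less_imp_le)
  also have "\<dots> = (\<Sum>j\<in>J. ((real j + 1) * s) * (\<Sum>n<N. r j n))" by (simp add: sum_distrib_left sum_distrib_right mult.commute)
  finally have "ennreal (\<Sum>(x, r)\<in>X. r * F x) \<le> ennreal (\<Sum>j\<in>J. ((real j + 1) * s) * (\<Sum>n<N. r j n))" by (rule ennreal_leI)
  also have "\<dots> = (\<Sum>j\<in>J. ennreal ((real j + 1) * s) * (\<Sum>n<N. ennreal (r j n)))"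
   using s cr(2) by (subst sum_ennreal[symmetric]) (auto intro!: sum.cong mult_nonneg_nonneg sum_nonneg simp: ennreal_mult less_imp_le sum_ennreal sum_nonneg)
  also have "\<dots> \<le> (\<Sum>j\<in>J. ennreal ((real j + 1) * s) * (?H (A j) + ennreal e))"
   using cr(5) by (intro sum_mono mult_left_mono) (auto intro: order_trans[OF sum_le_suminf])
  also have "\<dots> \<le> (\<Sum>j\<in>J. ennreal (real j * s) * ?H (A j) + (ennreal s * ?H (A j) + ennreal (T * e)))"
  proof (rule sum_mono)
   fix j assume j: "j \<in> J"
   have "ennreal ((real j + 1) * s) * (?H (A j) + ennreal e)
    = ennreal (real j * s + s) * ?H (A j) + ennreal ((real j + 1) * s * e)"
    using s e by (simp add: distrib_left distrib_right ennreal_mult[symmetric])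
   also have "ennreal (real j * s + s) = ennreal (real j * s) + ennreal s" using s by (intro ennreal_plus) auto
   also have "ennreal ((real j + 1) * s * e) \<le> ennreal (T * e)" using T(2)[OF j] e by (intro ennreal_leI mult_right_mono) auto
   finally show "ennreal ((real j + 1) * s) * (?H (A j) + ennreal e)
    \<le> ennreal (real j * s) * ?H (A j) + (ennreal s * ?H (A j) + ennreal (T * e))"
    by (simp add: distrib_right add.assoc)
  qed
  also have "\<dots> = (\<Sum>j\<in>J. ennreal (real j * s) * ?H (A j)) + (ennreal s * (\<Sum>j\<in>J. ?H (A j)) + ennreal (real (card J) * (T * e)))"
   using T(1) e(1) by (simp add: sum.distrib sum_distrib_left ennreal_mult ennreal_of_nat_eq_real_of_nat)
  also have "\<dots> \<le> ?I + (ennreal s * ?H G + ennreal (l/2))"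
  proof (intro add_mono mult_left_mono ennreal_leI e(2))
   have "(\<Sum>j\<in>J. ennreal (real j * s) * ?H (A j)) = (\<integral>\<^sup>+y. (\<Sum>j\<in>J. ennreal (real j * s) * indicator (A j) y) \<partial>hausdorff1)"
    by (subst nn_integral_sum) (simp_all add: nn_integral_cmult_indicator emeasure_hausdorff1)
   also have "\<dots> \<le> ?I"
   proof (rule nn_integral_mono)
    fix y
    have "(\<Sum>j\<in>J. ennreal (real j * s) * indicator (A j) y) = (\<Sum>j\<in>J. if j = lev y then ennreal (real j * s) * indicator G y else 0)"
     by (intro sum.cong) (auto simp: A_def indicator_def)
    also have "\<dots> \<le> ennreal (F y) * indicator G y"
     using J lev(1)[of y "lev y"] by (auto simp: A_def indicator_def intro: ennreal_leI)
    finally show "(\<Sum>j\<in>J. ennreal (real j * s) * indicator (A j) y) \<le> ennreal (F y) * indicator G y" .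
   qed
   finally show "(\<Sum>j\<in>J. ennreal (real j * s) * ?H (A j)) \<le> ?I" .
   have "(\<Sum>j\<in>J. emeasure hausdorff1 (A j)) = emeasure hausdorff1 (\<Union>j\<in>J. A j)"
   proof (rule sum_emeasure[OF _ _ J])
    show "A ` J \<subseteq> sets hausdorff1" by auto
    show "disjoint_family_on A J" by (auto simp: disjoint_family_on_def A_def)
   qed
   also have "\<dots> \<le> emeasure hausdorff1 G" by (intro emeasure_mono) (auto simp: A_def)
   finally show "(\<Sum>j\<in>J. ?H (A j)) \<le> ?H G" by (simp add: emeasure_hausdorff1)
  qed auto
  also have "ennreal s * ?H G + ennreal (l/2) \<le> ennreal l"
  proof -
   have "ennreal s * ?H G + ennreal (l/2) = ennreal (s * h + l/2)"
    using s h l by (simp add: ennreal_mult)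
   also have "\<dots> \<le> ennreal l" using s(2) by (intro ennreal_leI) linarith
   finally show ?thesis .
  qed
  finally show "ennreal (\<Sum>(x, r)\<in>X. r * F x) \<le> ?I + ennreal l"
   by (simp add: add_left_mono)
 qed
qed

section \<open>Zero traces\<close>

text \<open>Used to extend a cut-off function by zero across the boundary. The induction on the
  order works because partial derivatives inherit the local representation.\<close>

lemma smooth_local:
 assumes "\<And>x. \<exists>U g. open U \<and> x \<in> U \<and> smooth g \<and> (\<forall>y\<in>U. f y = g y)"
 shows "smooth f"
proof -
 have "C_k k f" if "\<And>x. \<exists>U g. open U \<and> x \<in> U \<and> smooth g \<and> (\<forall>y\<in>U. f y = g y)" for k f
  using that
 proof (induction k arbitrary: f)
  case 0
  have "isCont f x" for x
  proof -
   obtain U g where g: "open U" "x \<in> U" "smooth g" "\<forall>y\<in>U. f y = g y" using 0 by blast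
   have "continuous_on U f" using smooth_continuous[OF g(3)] g(4) by (simp cong: continuous_on_cong)
   thus ?thesis using g(1,2) by (simp add: continuous_on_eq_continuous_at)
  qed
  thus ?case by (simp add: continuous_at_imp_continuous_on)
 next
  case (Suc k)
  have d: "f differentiable (at x) \<and> pd i f x = pd i g x"
   if g: "open U" "x \<in> U" "smooth g" "\<forall>y\<in>U. f y = g y" for U g x i
  proof -
   have "(g has_derivative frechet_derivative g (at x)) (at x)"
    using smooth_differentiable[OF g(3)] frechet_derivative_works by blast
   hence "(f has_derivative frechet_derivative g (at x)) (at x)"
    by (rule has_derivative_transform_within_open[OF _ g(1,2)]) (use g(4) in simp)
   thus ?thesis using partial_deriv_eq[of f _ x i] by (auto simp: differentiable_def partial_deriv_def)
  qed
  have "C_k k (pd i f)" for i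
  proof (rule Suc.IH)
   fix x
   obtain U g where g: "open U" "x \<in> U" "smooth g" "\<forall>y\<in>U. f y = g y" using Suc.prems by blast
   have "\<forall>y\<in>U. pd i f y = pd i g y" using d g by blast
   thus "\<exists>U g. open U \<and> x \<in> U \<and> smooth g \<and> (\<forall>y\<in>U. pd i f y = g y)"
    using g smooth_partial_deriv by blast
  qed
  moreover have "f differentiable (at x)" for x using Suc.prems[of x] d by blast
  ultimately show ?case by simp
 qed
 thus ?thesis using assms by (simp add: smooth_def)
qed

lemma partial_deriv_cong_open:
 assumes "open U" "x \<in> U" "\<And>y. y \<in> U \<Longrightarrow> f y = g y" "g differentiable (at x)"
 shows "pd i f x = pd i g x"
proof -
 have "(g has_derivative frechet_derivative g (at x)) (at x)" using assms(4) frechet_derivative_works by blast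
 hence "(f has_derivative frechet_derivative g (at x)) (at x)"
  by (rule has_derivative_transform_within_open[OF _ assms(1,2)]) (use assms(3) in simp)
 thus ?thesis using partial_deriv_eq by (simp add: partial_deriv_def)
qed

section \<open>Cut-off functions near finitely many balls\<close>

lemma smooth_flat_term: "smooth f \<Longrightarrow> smooth (\<lambda>x. flat_term p (f x))"
proof -
 assume f: "smooth f"
 define D where "D n = flat_term (((\<lambda>p. [:0, 0, 1:] * (p - pderiv p)) ^^ n) p)" for n
 have "(D n has_real_derivative D (Suc n) t) (at t)" for n t
  unfolding D_def using flat_term_DERIV by simp
 hence "C_k k (\<lambda>x. D 0 (f x))" for k using f by (rule C_k_compose)
 thus ?thesis by (simp add: smooth_def D_def)
qed

lemma partial_deriv_flat_term:
 assumes "smooth f"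
 shows "pd i (\<lambda>x. flat_term p (f x)) x
  = flat_term ([:0, 0, 1:] * (p - pderiv p)) (f x) * pd i f x"
proof -
 have d: "(f has_derivative frechet_derivative f (at x)) (at x)"
  using smooth_differentiable[OF assms] frechet_derivative_works by blast
 have "((\<lambda>x. flat_term p (f x)) has_derivative
   (\<lambda>v. flat_term ([:0, 0, 1:] * (p - pderiv p)) (f x) * frechet_derivative f (at x) v)) (at x)"
  using has_derivative_compose[OF d, of "flat_term p"] flat_term_DERIV[of p "f x"]
  by (simp add: has_field_derivative_def mult_commute_abs)
 from partial_deriv_eq[OF this] show ?thesis by (simp add: partial_deriv_def)
qed

lemma flat_term_nonneg_1: "0 \<le> flat_term 1 t" by (simp add: flat_term_def)
lemma flat_term_le_0: "t \<le> 0 \<Longrightarrow> flat_term p t = 0" by (simp add: flat_term_def)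

lemma flat_term_bounded:
 obtains M where "0 \<le> M" "\<And>t. t \<le> T \<Longrightarrow> \<bar>flat_term p t\<bar> \<le> M"
proof -
 have "continuous_on {0..T} (flat_term p)"
  using flat_term_DERIV by (intro continuous_at_imp_continuous_on ballI DERIV_isCont) blast
 hence "bounded (flat_term p ` {0..T})" by (intro compact_imp_bounded compact_continuous_image) auto
 then obtain M where M: "\<And>t. t \<in> {0..T} \<Longrightarrow> \<bar>flat_term p t\<bar> \<le> M" unfolding bounded_iff by (metis imageI real_norm_def)
 have "\<bar>flat_term p t\<bar> \<le> max M 0" if "t \<le> T" for t
  using M[of t] flat_term_le_0[of t p] that by (cases "t \<le> 0") auto
 thus ?thesis using that[of "max M 0"] by simp
qed

text \<open>The constant 4 places the support in the ball of radius \<open>2 * r\<close> and keeps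
  the value at least \<open>exp (- 1)\<close> on the ball of radius \<open>r\<close>.\<close>

definition scaled_bump :: "real^2 \<Rightarrow> real \<Rightarrow> real^2 \<Rightarrow> real" where
 "scaled_bump x r y = flat_term 1 (4 - (norm (y - x))^2 / r^2)"

lemma smooth_scaled_arg: "smooth (\<lambda>y::real^2. 4 - (norm (y - x))^2 / r^2)"
 using smooth_diff[OF smooth_const[of 4] smooth_mult[OF smooth_const[of "1 / r^2"] smooth_norm_sq[of x]]] by simp

lemma smooth_scaled_bump: "smooth (scaled_bump x r)"
 unfolding scaled_bump_def[abs_def] by (rule smooth_flat_term[OF smooth_scaled_arg])

lemma scaled_bump_nonneg: "0 \<le> scaled_bump x r y"
 by (simp add: scaled_bump_def flat_term_nonneg_1)

lemma scaled_bump_ge: "r > 0 \<Longrightarrow> dist x y < r \<Longrightarrow> 1 \<le> exp 1 * scaled_bump x r y"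
proof -
 assume r: "r > 0" "dist x y < r"
 have "(norm (y - x))^2 / r^2 < 1"
  using r by (simp add: dist_norm norm_minus_commute[of y x] pos_divide_less_eq power_strict_mono)
 hence t: "1 \<le> 4 - (norm (y - x))^2 / r^2" by simp
 thus ?thesis by (simp add: scaled_bump_def flat_term_def mult_exp_exp)
qed

lemma scaled_bump_outside: "r > 0 \<Longrightarrow> 2 * r \<le> dist x y \<Longrightarrow> scaled_bump x r y = 0"
proof -
 assume r: "r > 0" "2 * r \<le> dist x y"
 have "(2 * r)^2 \<le> (norm (y - x))^2" using r by (intro power_mono) (auto simp: dist_norm norm_minus_commute)
 hence "4 - (norm (y - x))^2 / r^2 \<le> 0" using r by (simp add: pos_le_divide_eq power_mult_distrib)
 thus ?thesis unfolding scaled_bump_def by (rule flat_term_le_0)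
qed

lemma partial_deriv_scaled_bump:
 obtains M where "0 \<le> M" "\<And>x r y i. r > 0 \<Longrightarrow> \<bar>pd i (scaled_bump x r) y\<bar> \<le> M / r * indicator (cball x (2 * r)) y"
proof -
 define p :: "real poly" where "p = [:0, 0, 1:] * (1 - pderiv 1)"
 obtain M where M: "0 \<le> M" "\<And>t. t \<le> 4 \<Longrightarrow> \<bar>flat_term p t\<bar> \<le> M" using flat_term_bounded by blast
 have "\<bar>pd i (scaled_bump x r) y\<bar> \<le> 4 * M / r * indicator (cball x (2 * r)) y" if r: "r > 0" for x r y i
 proof -
  let ?t = "4 - (norm (y - x))^2 / r^2"
  have "((\<lambda>y. 4 - (norm (y - x))^2 / r^2) has_derivative (\<lambda>v. - (2 * ((y - x) \<bullet> v) / r^2))) (at y)"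
  proof -
   have "((\<lambda>y. 4 - c * ((y - x) \<bullet> (y - x))) has_derivative (\<lambda>v. - (c * (2 * ((y - x) \<bullet> v))))) (at y)" for c
    by (auto intro!: derivative_eq_intros simp: inner_commute)
   from this[of "inverse (r^2)"] show ?thesis
    unfolding power2_norm_eq_inner divide_inverse by (simp add: mult.commute)
  qed
  from partial_deriv_eq[OF this, of i]
  have d: "pd i (scaled_bump x r) y = flat_term p ?t * (- (2 * ((y - x) $ i) / r^2))"
   unfolding scaled_bump_def[abs_def] partial_deriv_flat_term[OF smooth_scaled_arg] p_def by (simp add: inner_axis)
  show ?thesis
  proof (cases "dist x y \<le> 2 * r")
   case True
   have "\<bar>(y - x) $ i\<bar> \<le> 2 * r" using component_le_norm_cart[of "y - x" i] True by (simp add: dist_norm norm_minus_commute)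
   hence "\<bar>2 * ((y - x) $ i) / r^2\<bar> \<le> 4 / r" using r by (simp add: abs_mult field_simps power2_eq_square)
   hence "\<bar>flat_term p ?t\<bar> * \<bar>2 * ((y - x) $ i) / r^2\<bar> \<le> M * (4 / r)" using M r by (intro mult_mono) auto
   thus ?thesis using True by (simp add: d abs_mult mult.commute)
  next
   case False
   hence "(2 * r)^2 \<le> (norm (y - x))^2" using r by (intro power_mono) (auto simp: dist_norm norm_minus_commute)
   hence "?t \<le> 0" using r by (simp add: pos_le_divide_eq power_mult_distrib)
   thus ?thesis using False by (simp add: d flat_term_le_0)
  qed
 qed
 thus ?thesis using that[of "4 * M"] M(1) by simp
qed

text \<open>The sums count overlapping balls with multiplicity. This matches the weighted size of a
  cover, where overlaps are not controlled.\<close>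

definition cutoff_near :: "real \<Rightarrow> ((real^2) \<times> real) set \<Rightarrow> (real^2 \<Rightarrow> real) \<Rightarrow> bool" where
 "cutoff_near K X h \<longleftrightarrow> smooth h \<and> (\<forall>y\<in>(\<Union>(x, r)\<in>X. ball x r). h y = 0) \<and> (\<forall>y. \<bar>1 - h y\<bar> \<le> (\<Sum>(x, r)\<in>X. indicator (cball x (2 * r)) y)) \<and>
   (\<forall>i y. \<bar>pd i h y\<bar> \<le> (\<Sum>(x, r)\<in>X. K / r * indicator (cball x (2 * r)) y))"

text \<open>The cut-off is a function of the sum \<open>S\<close> of the bumps:
  \<open>exp 1 * flat_term 1 (1 - S y)\<close> is 1 where \<open>S\<close> vanishes and 0 where
  \<open>S\<close> is at least 1. Its gradient is at most a fixed multiple of the sum of the single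
  gradients, so \<open>K\<close> depends neither on the number of balls nor on their
  overlap.\<close>

lemma cutoff_near_balls:
 obtains K where "0 \<le> K" "\<And>X :: ((real^2) \<times> real) set. finite X \<Longrightarrow> (\<And>x r. (x, r) \<in> X \<Longrightarrow> r > 0) \<Longrightarrow>
  \<exists>h. cutoff_near K X h"
proof -
 obtain M where M: "0 \<le> M" "\<And>x r y a. r > 0 \<Longrightarrow> \<bar>pd a (scaled_bump x r) y\<bar> \<le> M / r * indicator (cball x (2 * r)) y"
  using partial_deriv_scaled_bump by blast
 define p :: "real poly" where "p = [:0, 0, 1:] * (1 - pderiv 1)"
 obtain N where N: "0 \<le> N" "\<And>t. t \<le> 1 \<Longrightarrow> \<bar>flat_term p t\<bar> \<le> N" using flat_term_bounded by blast
 define K where "K = exp 1 * N * (exp 1 * M)"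
 show ?thesis
 proof (rule that[of K])
  show "0 \<le> K" using M(1) N(1) by (simp add: K_def)
  fix X :: "((real^2) \<times> real) set" assume X: "finite X" "\<And>x r. (x, r) \<in> X \<Longrightarrow> r > 0"
  define S where "S y = (\<Sum>(x, r)\<in>X. exp 1 * scaled_bump x r y)" for y
  define h where "h y = exp 1 * flat_term 1 (1 - S y)" for y
  have sb: "smooth (\<lambda>y. exp 1 * (case i of (x, r) \<Rightarrow> scaled_bump x r) y)" for i
   by (cases i) (auto intro: smooth_mult smooth_const smooth_scaled_bump)
  have S: "smooth S"
   unfolding S_def[abs_def] case_prod_beta' by (intro smooth_sum smooth_mult smooth_const smooth_scaled_bump)
  have S0: "0 \<le> S y" for y unfolding S_def by (intro sum_nonneg) (auto simp: scaled_bump_nonneg)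
  have s1: "smooth (\<lambda>y. 1 - S y)" by (intro smooth_diff smooth_const S)
  have sm: "smooth h" unfolding h_def[abs_def] by (intro smooth_mult smooth_const smooth_flat_term s1)
  have z: "h y = 0" if "(x, r) \<in> X" "y \<in> ball x r" for x r y
  proof -
   have "1 \<le> exp 1 * scaled_bump x r y" using that X(2) by (intro scaled_bump_ge) auto
   also have "\<dots> \<le> S y" unfolding S_def
    using member_le_sum[OF that(1), of "\<lambda>(x, r). exp 1 * scaled_bump x r y"] X(1) by (auto simp: scaled_bump_nonneg)
   finally show ?thesis by (simp add: h_def flat_term_le_0)
  qed
  have 1: "\<bar>1 - h y\<bar> \<le> (\<Sum>(x, r)\<in>X. indicator (cball x (2 * r)) y)" for y
  proof (cases "\<exists>(x, r)\<in>X. y \<in> cball x (2 * r)")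
   case True
   then obtain x r where xr: "(x, r) \<in> X" "y \<in> cball x (2 * r)" by auto
   have "0 \<le> h y" by (simp add: h_def flat_term_nonneg_1)
   moreover have "h y \<le> 1"
   proof (cases "1 - S y > 0")
    case True
    hence "1 \<le> 1 / (1 - S y)" using S0[of y] by (simp add: pos_le_divide_eq)
    thus ?thesis using True by (simp add: h_def flat_term_def mult_exp_exp)
   qed (simp add: h_def flat_term_le_0)
   ultimately have "\<bar>1 - h y\<bar> \<le> indicator (cball x (2 * r)) y" using xr by simp
   also have "\<dots> \<le> (\<Sum>(x, r)\<in>X. indicator (cball x (2 * r)) y)"
    using member_le_sum[OF xr(1), of "\<lambda>(x, r). indicator (cball x (2 * r)) y :: real"] X(1) by auto
   finally show ?thesis .
  next
   case False
   hence "S y = 0" unfolding S_def using X(2) by (intro sum.neutral) (force intro: scaled_bump_outside)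
   hence "h y = 1" by (simp add: h_def flat_term_def mult_exp_exp)
   thus ?thesis by (simp add: sum_nonneg case_prod_beta')
  qed
  have 2: "\<bar>pd a h y\<bar> \<le> (\<Sum>(x, r)\<in>X. K / r * indicator (cball x (2 * r)) y)" for a y
  proof -
   have dS: "(S has_derivative (\<lambda>v. \<Sum>(x, r)\<in>X. exp 1 * frechet_derivative (scaled_bump x r) (at y) v)) (at y)"
    unfolding S_def[abs_def] case_prod_beta'
    using smooth_differentiable[OF smooth_scaled_bump] frechet_derivative_works
    by (intro has_derivative_sum has_derivative_mult_right) blast
   have "pd a (\<lambda>y. 1 - S y) y = - (\<Sum>(x, r)\<in>X. exp 1 * pd a (scaled_bump x r) y)"
    using partial_deriv_eq[OF has_derivative_diff[OF has_derivative_const dS], of a 1] by (simp add: partial_deriv_def)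
   moreover have "\<bar>\<Sum>(x, r)\<in>X. exp 1 * pd a (scaled_bump x r) y\<bar> \<le> (\<Sum>(x, r)\<in>X. exp 1 * (M / r * indicator (cball x (2 * r)) y))"
    unfolding case_prod_beta'
    by (intro order_trans[OF sum_abs] sum_mono) (simp add: abs_mult del: times_divide_eq_left, metis M(2) X(2) prod.collapse)
   ultimately have le: "\<bar>pd a (\<lambda>y. 1 - S y) y\<bar> \<le> (\<Sum>(x, r)\<in>X. exp 1 * (M / r * indicator (cball x (2 * r)) y))" by simp
   have "h = (\<lambda>y. exp 1 * flat_term 1 (1 - S y))" by (simp add: h_def fun_eq_iff)
   hence "pd a h y = exp 1 * pd a (\<lambda>y. flat_term 1 (1 - S y)) y + pd a (\<lambda>_. exp 1) y * flat_term 1 (1 - S y)"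
    by (simp only:) (intro partial_deriv_mult smooth_differentiable smooth_const smooth_flat_term s1)
   also have "pd a (\<lambda>_. exp 1) y = 0" by (subst partial_deriv_eq) (auto intro: derivative_intros)
   finally have "pd a h y = exp 1 * (flat_term p (1 - S y) * pd a (\<lambda>y. 1 - S y) y)"
    unfolding partial_deriv_flat_term[OF s1] p_def by simp
   hence "\<bar>pd a h y\<bar> = exp 1 * (\<bar>flat_term p (1 - S y)\<bar> * \<bar>pd a (\<lambda>y. 1 - S y) y\<bar>)" by (simp add: abs_mult)
   also have "\<dots> \<le> exp 1 * (N * (\<Sum>(x, r)\<in>X. exp 1 * (M / r * indicator (cball x (2 * r)) y)))"
    using le N S0[of y] by (intro mult_left_mono mult_mono) auto
   also have "\<dots> = (\<Sum>(x, r)\<in>X. K / r * indicator (cball x (2 * r)) y)"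
    by (simp add: sum_distrib_left case_prod_beta' K_def mult_ac)
   finally show ?thesis .
  qed
  show "\<exists>h. cutoff_near K X h"
   using sm z 1 2 unfolding cutoff_near_def by (intro exI[of _ h]) auto
 qed
qed

lemma emeasure_cball_le: "r \<ge> 0 \<Longrightarrow> emeasure lborel (cball (x::real^2) r) \<le> ennreal (4 * r^2)"
proof -
 assume r: "r \<ge> 0"
 let ?c = "(\<chi> i. r) :: real^2"
 have "cball x r \<subseteq> cbox (x - ?c) (x + ?c)"
 proof
  fix y assume "y \<in> cball x r"
  hence "\<bar>(y - x) $ i\<bar> \<le> r" for i using component_le_norm_cart[of "y - x" i] by (simp add: dist_norm norm_minus_commute)
  hence "\<bar>y $ i - x $ i\<bar> \<le> r" for i by simp
  thus "y \<in> cbox (x - ?c) (x + ?c)" by (simp add: mem_box_cart abs_le_iff algebra_simps) 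
 qed
 hence "emeasure lborel (cball x r) \<le> emeasure lborel (cbox (x - ?c) (x + ?c))" by (intro emeasure_mono) auto
 also have "\<dots> = ennreal (measure lborel (cbox (x - ?c) (x + ?c)))"
  using emeasure_lborel_cbox_finite[of "x - ?c" "x + ?c"] by (intro emeasure_eq_ennreal_measure) (metis less_irrefl infinity_ennreal_def)
 also have "measure lborel (cbox (x - ?c) (x + ?c)) = 4 * r^2"
  using r by (subst content_cbox_if_cart) (auto simp: interval_eq_empty_cart UNIV_2 power2_eq_square)
 finally show ?thesis .
qed

section \<open>Integrals of derivatives and the boundary\<close>

context lipschitz_domain
begin

text \<open>A function that vanishes near the frontier and is extended by zero has derivatives of
  integral zero. Cutting \<open>F\<close> off near balls of radius \<open>r\<close> changes the
  derivative by terms of size \<open>\<bar>pd i F\<bar>\<close> and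
  \<open>K * \<bar>F\<bar> / r\<close> on sets of area of order \<open>r^2\<close>. The second kind
  adds up to a Riemann sum of the boundary integral, and the first vanishes with the radii.\<close>

lemma integral_partial_deriv_boundary_le:
 obtains C where "0 \<le> C" "\<And>F i. smooth F \<Longrightarrow>
  ennreal \<bar>LINT x|M. pd i F x\<bar> \<le> ennreal C * (\<integral>\<^sup>+y. ennreal \<bar>F y\<bar> \<partial>boundary_measure \<omega>)"
proof -
 obtain K where K: "0 \<le> K" "\<And>X :: ((real^2) \<times> real) set. finite X \<Longrightarrow> (\<And>x r. (x, r) \<in> X \<Longrightarrow> r > 0) \<Longrightarrow>
  \<exists>e. cutoff_near K X e"
  using cutoff_near_balls by blast
 let ?G = "frontier \<omega>"
 have G: "compact ?G" using bounded_dom by (rule compact_frontier_bounded)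
 have [measurable]: "?G \<in> sets borel" by simp
 \<comment> \<open>A ball of radius \<open>2 * r\<close> has area at most \<open>16 * r^2\<close>;
   the derivative of \<open>F\<close> accounts for the summand 1 and the gradient of the cut-off for
   the multiple of \<open>K\<close>.\<close>
 let ?c = "16 * (2 * K + 1)" and ?I = "\<lambda>F. \<integral>\<^sup>+y. ennreal \<bar>F y\<bar> \<partial>boundary_measure \<omega>"
 let ?C = "ennreal ?c"
 define H where "H = enn2real (hausdorff1_outer ?G)"
 have H: "hausdorff1_outer ?G = ennreal H" "0 \<le> H"
  using hausdorff1_frontier_finite by (auto simp: H_def less_top)
 have main: "ennreal \<bar>LINT x|M. pd i F x\<bar>
   \<le> ?C * ((?I F) + ennreal (l * (H + 1)))"
  if F: "smooth F" and l: "l > 0" for F i l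
 proof -
  have cF: "continuous_on S F" for S using F by (rule smooth_continuous)
  have cF': "continuous_on S (pd i F)" for S by (rule smooth_continuous[OF smooth_partial_deriv[OF F]])
  have [measurable]: "F \<in> borel_measurable borel" using F by (rule smooth_measurable)
  have cl: "compact (closure \<omega>)" using bounded_dom by simp
  have R: "x \<in> \<omega> \<Longrightarrow> x \<in> closure \<omega>" "x \<in> ?G \<Longrightarrow> x \<in> closure \<omega>" for x
   using closure_subset by (auto simp: frontier_def)
  obtain L where L: "0 \<le> L" "\<And>y. y \<in> \<omega> \<Longrightarrow> \<bar>pd i F y\<bar> \<le> L"
  proof -
   have "bounded (pd i F ` closure \<omega>)" by (intro compact_imp_bounded compact_continuous_image cF' cl)
   then obtain L where "\<forall>y\<in>closure \<omega>. \<bar>pd i F y\<bar> \<le> L" by (auto simp: bounded_iff)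
   thus ?thesis using that[of "\<bar>L\<bar>"] R(1) by force
  qed
  \<comment> \<open>The added \<open>l\<close> absorbs both the oscillation of \<open>F\<close> on a
    ball and the contribution of its derivative.\<close>
  let ?g = "\<lambda>x. \<bar>F x\<bar> + l" and ?w = "\<lambda>x r. L + K / r * (\<bar>F x\<bar> + l)"
  obtain d where d: "d > 0" "\<And>x y. x \<in> closure \<omega> \<Longrightarrow> y \<in> closure \<omega> \<Longrightarrow> dist y x < d \<Longrightarrow> \<bar>F y - F x\<bar> < l"
   using compact_uniformly_continuous[OF cF cl] l
   unfolding uniformly_continuous_on_def dist_real_def by metis
  \<comment> \<open>Twice the radius stays within the modulus of continuity for \<open>l\<close>,
    and \<open>h * L \<le> l\<close> makes the derivative term of order \<open>l\<close>.\<close>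
  define h where "h = min (d / 3) (l / (L + 1))"
  have h: "h > 0" "2 * h < d" "h * L \<le> l"
  proof -
   show "h > 0" using d l L(1) by (simp add: h_def)
   show "2 * h < d" using d(1) by (simp add: h_def min_def)
   have "h * L \<le> l / (L + 1) * L" using L(1) by (intro mult_right_mono) (auto simp: h_def)
   also have "\<dots> \<le> l" using L(1) l by (simp add: field_simps)
   finally show "h * L \<le> l" .
  qed
  have cc: "continuous_on UNIV (\<lambda>y. \<bar>F y\<bar> + l)" by (intro continuous_intros cF)
  obtain X where X: "finite X" "\<And>x r. (x, r) \<in> X \<Longrightarrow> x \<in> ?G \<and> 0 < r \<and> r \<le> h" "?G \<subseteq> (\<Union>(x, r)\<in>X. ball x r)"
   "ennreal (\<Sum>(x, r)\<in>X. r * ?g x) \<le> (\<integral>\<^sup>+y. ennreal (\<bar>F y\<bar> + l) * indicator ?G y \<partial>hausdorff1) + ennreal l"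
   using hausdorff1_weighted_cover[OF G hausdorff1_frontier_finite cc _ h(1) l] l by force
  obtain e where e: "smooth e" "\<And>y. y \<in> (\<Union>(x, r)\<in>X. ball x r) \<Longrightarrow> e y = 0"
   "\<And>y. \<bar>1 - e y\<bar> \<le> (\<Sum>(x, r)\<in>X. indicator (cball x (2 * r)) y)"
   "\<And>j y. \<bar>pd j e y\<bar> \<le> (\<Sum>(x, r)\<in>X. K / r * indicator (cball x (2 * r)) y)"
  proof -
   obtain e where "cutoff_near K X e" using K(2)[OF X(1)] X(2) by blast
   thus ?thesis using that unfolding cutoff_near_def by blast
  qed
  let ?u = "\<lambda>y. e y * F y"
  let ?U = "\<Union>(x, r)\<in>X. ball x r"
  have U: "open ?U" by (intro open_UN) auto
  define f where "f y = (if y \<in> \<omega> then e y * F y else 0)" for y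
  have seF: "smooth ?u" by (intro smooth_mult e F)
  \<comment> \<open>Near every point the extended function is either \<open>e * F\<close> or zero:
    the balls of the cover, on which \<open>e\<close> vanishes, bridge the frontier.\<close>
  have trich: "x \<in> \<omega> \<or> x \<in> - closure \<omega> \<or> x \<in> ?U" for x
   using X(3) open_dom by (auto simp: frontier_def interior_open)
  have fU: "f y = 0" if "y \<in> ?U" for y using e(2)[OF that] by (simp add: f_def)
  have fc: "f y = 0" if "y \<in> - closure \<omega>" for y using that closure_subset[of \<omega>] by (auto simp: f_def)
  have sf: "smooth f"
  proof (rule smooth_local)
   fix x
   show "\<exists>U g. open U \<and> x \<in> U \<and> smooth g \<and> (\<forall>y\<in>U. f y = g y)"
    using trich[of x]
   proof (elim disjE)
    assume "x \<in> \<omega>"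
    thus ?thesis using open_dom seF by (intro exI[of _ \<omega>] exI[of _ ?u]) (auto simp: f_def)
   next
    assume "x \<in> - closure \<omega>"
    thus ?thesis using fc by (intro exI[of _ "- closure \<omega>"] exI[of _ "\<lambda>y. 0"]) (auto simp: smooth_const)
   next
    assume "x \<in> ?U"
    thus ?thesis using fU U by (intro exI[of _ ?U] exI[of _ "\<lambda>y. 0"]) (auto simp: smooth_const)
   qed
  qed
  have z0: "pd i (\<lambda>y. 0) x = 0" for x by (subst partial_deriv_eq) (auto intro: derivative_intros)
  have df: "pd i f x = indicator \<omega> x * pd i ?u x" for x
  proof (cases "x \<in> \<omega>")
   case True
   thus ?thesis
    using partial_deriv_cong_open[OF open_dom True, of f ?u i] smooth_differentiable[OF seF] by (simp add: f_def)
  next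
   case False
   have "pd i f x = pd i (\<lambda>y. 0) x"
    using trich[of x] False
   proof (elim disjE)
    assume "x \<in> - closure \<omega>"
    thus ?thesis using fc by (intro partial_deriv_cong_open[of "- closure \<omega>"]) auto
   next
    assume "x \<in> ?U"
    thus ?thesis using fU U by (intro partial_deriv_cong_open[of ?U]) auto
   qed simp
   thus ?thesis using False z0 by simp
  qed
  obtain r where r: "\<And>x. x \<in> \<omega> \<Longrightarrow> norm x \<le> r" using bounded_dom by (auto simp: bounded_iff)
  have "(LINT x|lborel. pd i f x) = 0"
   by (rule integral_partial_deriv_zero[OF sf, of r]) (use r in \<open>force simp: f_def\<close>)
  moreover have "(LINT x|M. pd i ?u x) = (LINT x|lborel. pd i f x)"
  proof (rule integral_dom_eq(1))
   show "pd i f \<in> borel_measurable borel" by (rule smooth_measurable[OF smooth_partial_deriv[OF sf]])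
   show "(\<lambda>x. pd i ?u x) \<in> borel_measurable M"
    by (rule lborel_measurable_dom[OF smooth_measurable[OF smooth_partial_deriv[OF seF]]])
   show "pd i f x = 0" if "x \<notin> \<omega>" for x using that df by simp
   have "AE x in M. x \<in> \<omega>" by (rule AE_I2) simp
   thus "AE x in M. pd i ?u x = pd i f x"
    by eventually_elim (simp add: df)
  qed
  ultimately have I0: "(LINT x|M. pd i ?u x) = 0" by simp
  define B where "B y = (\<Sum>(x, r)\<in>X. indicator (cball x (2 * r)) y * ?w x r)" for y :: "real^2"
  have pw: "\<bar>pd i F y - pd i ?u y\<bar> \<le> B y" if y: "y \<in> \<omega>" for y
  proof -
   have "pd i F y - pd i ?u y = (1 - e y) * pd i F y - pd i e y * F y"
    using partial_deriv_mult[of e y F i] smooth_differentiable[OF e(1)] smooth_differentiable[OF F] by (simp add: algebra_simps)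
   hence "\<bar>pd i F y - pd i ?u y\<bar> \<le> \<bar>1 - e y\<bar> * \<bar>pd i F y\<bar> + \<bar>pd i e y\<bar> * \<bar>F y\<bar>"
    by (simp add: abs_mult[symmetric])
   also have "\<dots> \<le> (\<Sum>(x, r)\<in>X. indicator (cball x (2 * r)) y) * L + (\<Sum>(x, r)\<in>X. K / r * indicator (cball x (2 * r)) y) * \<bar>F y\<bar>"
    using e(3,4) L y by (intro add_mono mult_mono mult_right_mono) (auto intro: order_trans[OF abs_ge_zero])
   also have "\<dots> = (\<Sum>(x, r)\<in>X. indicator (cball x (2 * r)) y * (L + K / r * \<bar>F y\<bar>))"
    by (simp add: sum_distrib_left sum_distrib_right sum.distrib[symmetric] case_prod_beta' algebra_simps)
   also have "\<dots> \<le> B y"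
    unfolding B_def
   proof (intro sum_mono, clarify)
    fix x r assume xr: "(x, r) \<in> X"
    have "\<bar>F y\<bar> \<le> ?g x" if "dist x y \<le> 2 * r"
    proof -
     have "dist y x < d" using that X(2)[OF xr] h(2) by (simp add: dist_commute)
     thus ?thesis using d(2)[of x y] X(2)[OF xr] R y by auto
    qed
    thus "indicator (cball x (2 * r)) y * (L + K / r * \<bar>F y\<bar>) \<le> indicator (cball x (2 * r)) y * ?w x r"
     using X(2)[OF xr] K(1) by (auto simp: indicator_def simp del: times_divide_eq_left intro!: mult_left_mono)
   qed
   finally show ?thesis .
  qed
  have i1: "integrable M (pd i F)"
   and i2: "integrable M (pd i ?u)"
   using F seF by (auto intro!: L2_integrable finite_measure_dom smooth_L2 smooth_partial_deriv)
  have "ennreal \<bar>LINT x|M. pd i F x\<bar>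
   = ennreal \<bar>LINT x|M. (pd i F x - pd i ?u x)\<bar>"
   using I0 i1 i2 by (subst Bochner_Integration.integral_diff) auto
  also have "\<dots> \<le> (\<integral>\<^sup>+x. ennreal \<bar>pd i F x - pd i ?u x\<bar> \<partial>M)"
   using integral_norm_bound_ennreal[OF Bochner_Integration.integrable_diff[OF i1 i2]] by simp
  also have "\<dots> \<le> (\<integral>\<^sup>+y. ennreal (B y) \<partial>M)"
   using pw by (intro nn_integral_mono ennreal_leI) simp
  also have "\<dots> \<le> (\<integral>\<^sup>+y. ennreal (B y) \<partial>lborel)"
  proof -
   have [measurable]: "B \<in> borel_measurable borel" unfolding B_def[abs_def] case_prod_beta'
    by (intro borel_measurable_sum borel_measurable_times borel_measurable_const borel_measurable_indicator) simp
   have [measurable]: "\<omega> \<in> sets borel" using open_dom by simp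
   have "(\<integral>\<^sup>+y. ennreal (B y) \<partial>M) = (\<integral>\<^sup>+y. ennreal (B y) * indicator \<omega> y \<partial>lebesgue)"
    by (subst nn_integral_restrict_space) auto
   also have "\<dots> = (\<integral>\<^sup>+y. ennreal (B y) * indicator \<omega> y \<partial>lborel)"
    by (subst nn_integral_completion) auto
   also have "\<dots> \<le> (\<integral>\<^sup>+y. ennreal (B y) \<partial>lborel)"
    by (intro nn_integral_mono) (auto simp: indicator_def)
   finally show ?thesis .
  qed
  also have "\<dots> = (\<Sum>(x, r)\<in>X. ennreal (?w x r) * emeasure lborel (cball x (2 * r)))"
  proof -
   have nn: "0 \<le> ?w x r" if "(x, r) \<in> X" for x r
    using X(2)[OF that] L(1) K(1) l by (auto intro!: add_nonneg_nonneg mult_nonneg_nonneg)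
   have "ennreal (B y) = (\<Sum>(x, r)\<in>X. ennreal (?w x r) * indicator (cball x (2 * r)) y)" for y
    unfolding B_def using nn
    by (subst sum_ennreal[symmetric]) (auto intro!: sum.cong simp: indicator_def)
   hence "(\<integral>\<^sup>+y. ennreal (B y) \<partial>lborel)
     = (\<Sum>p\<in>X. \<integral>\<^sup>+y. ennreal (?w (fst p) (snd p)) * indicator (cball (fst p) (2 * snd p)) y \<partial>lborel)"
    unfolding case_prod_beta'
    by (subst nn_integral_sum[symmetric]) (auto intro!: borel_measurable_times_ennreal borel_measurable_indicator)
   also have "\<dots> = (\<Sum>(x, r)\<in>X. ennreal (?w x r) * emeasure lborel (cball x (2 * r)))"
    unfolding case_prod_beta' by (intro sum.cong nn_integral_cmult_indicator) auto
   finally show ?thesis .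
  qed
  also have "\<dots> \<le> (\<Sum>(x, r)\<in>X. ennreal (?c * (r * ?g x)))"
  proof (intro sum_mono, clarify)
   fix x r assume xr: "(x, r) \<in> X"
   note r = X(2)[OF xr]
   have "ennreal (?w x r) * emeasure lborel (cball x (2 * r)) \<le> ennreal (?w x r) * ennreal (4 * (2 * r)^2)"
    using r by (intro mult_left_mono emeasure_cball_le) auto
   also have "\<dots> = ennreal (?w x r * (4 * (2 * r)^2))"
    using r L(1) K(1) l by (intro ennreal_mult[symmetric]) (auto intro!: add_nonneg_nonneg mult_nonneg_nonneg)
   also have "?w x r * (4 * (2 * r)^2) = 16 * (r * (r * L)) + 16 * K * (r * ?g x)"
    using r by (simp add: field_simps power2_eq_square)
   also have "\<dots> \<le> 16 * (r * ?g x) + 16 * K * (r * ?g x) + 16 * K * (r * ?g x)"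
   proof -
    have "r * L \<le> h * L" using r L(1) by (intro mult_right_mono) auto
    hence "r * (r * L) \<le> r * ?g x" using r h(3) by (intro mult_left_mono) auto
    moreover have "0 \<le> 16 * K * (r * ?g x)" using r K(1) l by (auto intro!: mult_nonneg_nonneg)
    ultimately show ?thesis by linarith
   qed
   also have "\<dots> = ?c * (r * ?g x)" by (simp add: algebra_simps)
   finally show "ennreal (?w x r) * emeasure lborel (cball x (2 * r)) \<le> ennreal (?c * (r * ?g x))"
    by (simp add: ennreal_leI)
  qed
  also have "\<dots> = ?C * ennreal (\<Sum>(x, r)\<in>X. r * ?g x)"
  proof -
   have "(\<Sum>(x, r)\<in>X. ennreal (?c * (r * ?g x))) = ennreal (\<Sum>(x, r)\<in>X. ?c * (r * ?g x))"
    using X(2) K(1) l by (subst sum_ennreal[symmetric]) (auto intro!: sum.cong mult_nonneg_nonneg simp: less_imp_le)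
   also have "(\<Sum>(x, r)\<in>X. ?c * (r * ?g x)) = ?c * (\<Sum>(x, r)\<in>X. r * ?g x)"
    by (simp add: sum_distrib_left case_prod_beta')
   also have "ennreal \<dots> = ?C * ennreal (\<Sum>(x, r)\<in>X. r * ?g x)"
    using K(1) X(2) l by (intro ennreal_mult) (auto intro!: sum_nonneg mult_nonneg_nonneg simp: less_imp_le)
   finally show ?thesis .
  qed
  also have "\<dots> \<le> ?C * ((\<integral>\<^sup>+y. ennreal (\<bar>F y\<bar> + l) * indicator ?G y \<partial>hausdorff1) + ennreal l)"
   by (intro mult_left_mono X(4)) simp
  also have "(\<integral>\<^sup>+y. ennreal (\<bar>F y\<bar> + l) * indicator ?G y \<partial>hausdorff1)
    = (\<integral>\<^sup>+y. ennreal \<bar>F y\<bar> * indicator ?G y + ennreal l * indicator ?G y \<partial>hausdorff1)"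
   using l by (intro nn_integral_cong) (auto simp: indicator_def)
  also have "\<dots> = (\<integral>\<^sup>+y. ennreal \<bar>F y\<bar> * indicator ?G y \<partial>hausdorff1) + ennreal l * ennreal H"
   by (subst nn_integral_add) (auto simp: nn_integral_cmult_indicator emeasure_hausdorff1 H)
  also have "(\<integral>\<^sup>+y. ennreal \<bar>F y\<bar> * indicator ?G y \<partial>hausdorff1) = (?I F)"
   unfolding boundary_measure_def by (subst nn_integral_restrict_space) auto
  also have "(?I F) + ennreal l * ennreal H + ennreal l
   = (?I F) + ennreal (l * (H + 1))"
   using l H(2) by (simp add: add.assoc ennreal_mult[symmetric] ennreal_plus[symmetric] distrib_left del: ennreal_plus)
  finally show ?thesis .
 qed
 show ?thesis
 proof (rule that[of "?c"])
  show "0 \<le> ?c" using K(1) by simp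
  fix F :: "real^2 \<Rightarrow> real" and i assume F: "smooth F"
  \<comment> \<open>The auxiliary \<open>l\<close> tends to zero, and the finite length
    \<open>H\<close> of the frontier keeps the error of order \<open>l\<close>.\<close>
  have "(\<lambda>n. ennreal (1 / real (Suc n) * (H + 1))) \<longlonglongrightarrow> ennreal (0 * (H + 1))"
   by (intro tendsto_ennrealI tendsto_mult tendsto_const LIMSEQ_Suc[OF lim_1_over_n])
  hence "(\<lambda>n. ?C * (?I F + ennreal (1 / real (Suc n) * (H + 1)))) \<longlonglongrightarrow> ?C * (?I F + 0)"
   by (intro ennreal_tendsto_cmult tendsto_add tendsto_const) simp_all
  moreover have "ennreal \<bar>LINT x|M. pd i F x\<bar> \<le> ?C * (?I F + ennreal (1 / real (Suc n) * (H + 1)))" for n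
   by (rule main[OF F]) simp
  ultimately show "ennreal \<bar>LINT x|M. pd i F x\<bar> \<le> ?C * ?I F"
   by (intro LIMSEQ_le_const[where X = "\<lambda>n. ?C * (?I F + ennreal (1 / real (Suc n) * (H + 1)))"]) auto
 qed
qed

lemma norm_H1_ge: "nm u \<le> norm_H1 \<omega> u" "nm (wd i u) \<le> norm_H1 \<omega> u"
proof -
 have e: "norm_H1 \<omega> u = sqrt ((nm u)^2 + (\<Sum>i\<in>UNIV. (nm (wd i u))^2))"
  by (simp add: norm_H1_def l2norm_power2)
 have nn: "0 \<le> (\<Sum>i\<in>UNIV. (nm (wd i u))^2)" by (intro sum_nonneg) simp
 show "nm u \<le> norm_H1 \<omega> u" unfolding e using nn by (intro real_le_rsqrt) simp
 have "(nm (wd i u))^2 \<le> (\<Sum>i\<in>UNIV. (nm (wd i u))^2)"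
  by (rule member_le_sum) auto
 thus "nm (wd i u) \<le> norm_H1 \<omega> u" unfolding e by (intro real_le_rsqrt) (simp add: add_increasing)
qed

lemma norm_H1_tendsto:
 assumes f: "\<And>n. f n \<in> H1 \<omega>" and v: "\<And>n. v n \<in> H1 \<omega>" and lim: "(\<lambda>n. norm_H1 \<omega> (\<lambda>y. f n y - v n y)) \<longlonglongrightarrow> 0"
 shows "(\<lambda>n. nm (\<lambda>y. f n y - v n y)) \<longlonglongrightarrow> 0"
  "(\<lambda>n. nm (\<lambda>y. wd i (f n) y - wd i (v n) y)) \<longlonglongrightarrow> 0"
 unfolding H1_diff_norms[OF f v, symmetric]
 by (rule tendsto_sandwich[OF _ _ tendsto_const lim], simp_all add: norm_H1_ge)+

lemma L2_limit_trans:
 assumes "\<And>n. a n \<in> L2 M" "\<And>n. b n \<in> L2 M" "g \<in> L2 M"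
  "(\<lambda>n. nm (\<lambda>y. a n y - b n y)) \<longlonglongrightarrow> 0" "(\<lambda>n. nm (\<lambda>y. b n y - g y)) \<longlonglongrightarrow> 0"
 shows "(\<lambda>n. nm (\<lambda>y. a n y - g y)) \<longlonglongrightarrow> 0"
 by (rule tendsto_sandwich[OF _ _ tendsto_const tendsto_add_zero[OF assms(4,5)]])
  (auto intro!: always_eventually l2norm_triangle_diff assms)

section \<open>Calculus with zero traces\<close>

definition zero_trace :: "(real^2 \<Rightarrow> real) \<Rightarrow> bool" where
 "zero_trace u \<longleftrightarrow> has_trace \<omega> u (\<lambda>_. 0)"

lemma zero_trace_H1: "zero_trace u \<Longrightarrow> u \<in> H1 \<omega>"
 by (simp add: zero_trace_def has_trace_def)

lemma zero_trace_approx: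
 assumes "zero_trace u"
 obtains f where "\<And>n. smooth (f n)" "(\<lambda>n. nm (\<lambda>y. f n y - u y)) \<longlonglongrightarrow> 0"
  "\<And>i. (\<lambda>n. nm (\<lambda>y. pd i (f n) y - wd i u y)) \<longlonglongrightarrow> 0"
  "(\<lambda>n. \<integral>\<^sup>+y. ennreal ((f n y)^2) \<partial>boundary_measure \<omega>) \<longlonglongrightarrow> 0"
proof -
 have u: "u \<in> H1 \<omega>" using assms by (rule zero_trace_H1)
 obtain f where f: "\<And>n. smooth (f n)" "(\<lambda>n. norm_H1 \<omega> (\<lambda>y. f n y - u y)) \<longlonglongrightarrow> 0"
  "(\<lambda>n. \<integral>\<^sup>+y. ennreal ((f n y)^2) \<partial>boundary_measure \<omega>) \<longlonglongrightarrow> 0"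
  using assms unfolding zero_trace_def has_trace_def by auto
 note t = norm_H1_tendsto[OF smooth_H1(1)[OF f(1)] u f(2)]
 have e: "nm (\<lambda>y. wd i (f n) y - wd i u y) = nm (\<lambda>y. pd i (f n) y - wd i u y)" for i n
 proof (rule l2norm_cong_AE)
  show "AE y in M. wd i (f n) y - wd i u y = pd i (f n) y - wd i u y"
   using smooth_H1(2)[OF f(1), of i n] by eventually_elim simp
 qed (intro L2_measurable L2_diff weak_partial_works(1) u smooth_H1(1) smooth_L2 smooth_partial_deriv f(1))+
 show ?thesis using that[OF f(1) t(1) t(2)[unfolded e] f(3)] .
qed

text \<open>For a smooth approximation \<open>p n\<close> the two integrals add up to the integral
  of a derivative, which is bounded by the boundary integral of \<open>\<bar>p n * g\<bar>\<close>;
  on a boundary of finite length this tends to zero.\<close>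

lemma zero_trace_by_parts:
 assumes u: "zero_trace u" and g: "smooth g"
 shows "(LINT x|M. wd i u x * g x) = - (LINT x|M. u x * pd i g x)"
proof -
 obtain p where p: "\<And>n. smooth (p n)" "(\<lambda>n. nm (\<lambda>y. p n y - u y)) \<longlonglongrightarrow> 0"
  "\<And>i. (\<lambda>n. nm (\<lambda>y. pd i (p n) y - wd i u y)) \<longlonglongrightarrow> 0"
  "(\<lambda>n. \<integral>\<^sup>+y. ennreal ((p n y)^2) \<partial>boundary_measure \<omega>) \<longlonglongrightarrow> 0"
  using zero_trace_approx[OF u] by blast
 obtain C where C: "0 \<le> C" "\<And>F i. smooth F \<Longrightarrow>
  ennreal \<bar>LINT x|M. pd i F x\<bar> \<le> ennreal C * (\<integral>\<^sup>+y. ennreal \<bar>F y\<bar> \<partial>boundary_measure \<omega>)"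
  by (rule integral_partial_deriv_boundary_le) blast
 let ?G = "frontier \<omega>" and ?b = "boundary_measure \<omega>"
 have spb: "space ?b = ?G" by (simp add: boundary_measure_def space_restrict_space)
 have mb: "f \<in> borel_measurable ?b" if "smooth f" for f
  unfolding boundary_measure_def using smooth_measurable[OF that] by (intro measurable_restrict_space1) simp
 define H where "H = enn2real (hausdorff1_outer ?G)"
 have H: "emeasure ?b ?G = ennreal H" "0 \<le> H"
  using hausdorff1_frontier_finite
  by (auto simp: H_def less_top boundary_measure_def emeasure_restrict_space emeasure_hausdorff1)
 obtain S where S: "0 \<le> S" "\<And>y. y \<in> ?G \<Longrightarrow> \<bar>g y\<bar> \<le> S"
 proof -
  have "bounded (g ` ?G)" using compact_frontier_bounded[OF bounded_dom]
   by (intro compact_imp_bounded compact_continuous_image smooth_continuous g)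
  then obtain S where "\<forall>y\<in>?G. \<bar>g y\<bar> \<le> S" by (auto simp: bounded_iff)
  thus ?thesis using that[of "\<bar>S\<bar>"] by force
 qed
 let ?L = "(LINT x|M. wd i u x * g x) + (LINT x|M. u x * pd i g x)"
 note wu = weak_partial_works(1)[OF zero_trace_H1[OF u]] and u2 = H1_L2[OF zero_trace_H1[OF u]]
 have s: "smooth (\<lambda>x. p n x * g x)" for n by (intro smooth_mult p g)
 have lim: "(\<lambda>n. LINT x|M. pd i (\<lambda>x. p n x * g x) x) \<longlonglongrightarrow> ?L"
 proof -
  have "(LINT x|M. pd i (\<lambda>x. p n x * g x) x) = (LINT x|M. pd i (p n) x * g x) + (LINT x|M. p n x * pd i g x)" for n
  proof -
   have "pd i (\<lambda>x. p n x * g x) x = pd i (p n) x * g x + p n x * pd i g x" for x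
    using partial_deriv_mult[of "p n" x g i] smooth_differentiable p(1) g by auto
   thus ?thesis using p(1) g
    by (simp add: Bochner_Integration.integral_add L2_mult_integrable smooth_L2 smooth_partial_deriv)
  qed
  moreover have "(\<lambda>n. (LINT x|M. pd i (p n) x * g x) + (LINT x|M. p n x * pd i g x)) \<longlonglongrightarrow> ?L"
   by (intro tendsto_add L2_inner_tendsto smooth_L2 smooth_partial_deriv p g wu u2)
  ultimately show ?thesis by simp
 qed
 \<comment> \<open>A weighted arithmetic-geometric inequality passes from the square of
   \<open>p n\<close> on the boundary to its first power; \<open>n\<close> tends to infinity for
   fixed \<open>s\<close>, and \<open>s\<close> tends to zero afterwards.\<close>
 have bd: "ennreal \<bar>?L\<bar> \<le> ennreal (C * S * H) * ennreal s" if s0: "s > 0" for s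
 proof -
  let ?I = "\<lambda>n. \<integral>\<^sup>+y. ennreal ((p n y)^2) \<partial>?b"
  have a: "ennreal \<bar>LINT x|M. pd i (\<lambda>x. p n x * g x) x\<bar> \<le> ennreal C * (ennreal (S * s) * ennreal H + ennreal (S / s) * ?I n)" for n
  proof -
   have "(\<integral>\<^sup>+y. ennreal \<bar>p n y * g y\<bar> \<partial>?b) \<le> (\<integral>\<^sup>+y. ennreal (S * s) + ennreal (S / s) * ennreal ((p n y)^2) \<partial>?b)"
   proof (rule nn_integral_mono)
    fix y assume "y \<in> space ?b"
    hence y: "\<bar>g y\<bar> \<le> S" using S(2) by (simp add: spb)
    have "2 * (\<bar>p n y\<bar> * s) \<le> s^2 + (p n y)^2"
     using sum_squares_bound[of "\<bar>p n y\<bar>" s] by simp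
    moreover have "0 \<le> \<bar>p n y\<bar> * s" using s0 by simp
    ultimately have "\<bar>p n y\<bar> * s \<le> s^2 + (p n y)^2" by linarith
    hence "\<bar>p n y\<bar> \<le> s + (p n y)^2 / s" using s0 by (simp add: field_simps power2_eq_square)
    hence "\<bar>p n y\<bar> * \<bar>g y\<bar> \<le> (s + (p n y)^2 / s) * S" using y s0 by (intro mult_mono) auto
    hence "ennreal \<bar>p n y * g y\<bar> \<le> ennreal (S * s + S / s * (p n y)^2)"
     by (intro ennreal_leI) (simp add: abs_mult algebra_simps)
    also have "\<dots> = ennreal (S * s) + ennreal (S / s) * ennreal ((p n y)^2)"
     using S(1) s0 by (subst ennreal_mult[symmetric]) (auto simp del: times_divide_eq_left)
    finally show "ennreal \<bar>p n y * g y\<bar> \<le> ennreal (S * s) + ennreal (S / s) * ennreal ((p n y)^2)" .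
   qed
   also have "\<dots> = ennreal (S * s) * ennreal H + ennreal (S / s) * ?I n"
    using mb[OF p(1)] by (subst nn_integral_add) (auto simp: nn_integral_cmult H(1)[unfolded spb[symmetric]])
   finally show ?thesis by (intro order_trans[OF C(2)[OF s] mult_left_mono]) auto
  qed
  have b: "(\<lambda>n. ennreal C * (ennreal (S * s) * ennreal H + ennreal (S / s) * ?I n)) \<longlonglongrightarrow> ennreal C * (ennreal (S * s) * ennreal H + ennreal (S / s) * 0)"
   by (intro ennreal_tendsto_cmult tendsto_add tendsto_const p(4)) simp_all
  have c: "(\<lambda>n. ennreal \<bar>LINT x|M. pd i (\<lambda>x. p n x * g x) x\<bar>) \<longlonglongrightarrow> ennreal \<bar>?L\<bar>"
   by (intro tendsto_ennrealI tendsto_rabs lim)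
  have "ennreal \<bar>?L\<bar> \<le> ennreal C * (ennreal (S * s) * ennreal H + ennreal (S / s) * 0)"
   by (rule LIMSEQ_le[OF c b]) (use a in blast)
  also have "\<dots> = ennreal (C * S * H) * ennreal s" using C(1) S(1) H(2) s0 by (simp add: ennreal_mult[symmetric] mult_ac)
  finally show ?thesis .
 qed
 have "\<bar>?L\<bar> \<le> (C * S * H) * s" if "s > 0" for s
  using bd[OF that] C(1) S(1) H(2) that by (simp add: ennreal_mult[symmetric])
 hence "\<bar>?L\<bar> \<le> 0 + e" if "e > 0" for e
 proof -
  have D: "0 \<le> C * S * H" using C(1) S(1) H(2) by simp
  have "\<bar>?L\<bar> \<le> (C * S * H) * (e / (C * S * H + 1))" using that D by (intro \<open>\<And>s. s > 0 \<Longrightarrow> \<bar>?L\<bar> \<le> (C * S * H) * s\<close>) auto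
  also have "\<dots> \<le> e" using that D by (simp add: field_simps)
  finally show ?thesis by simp
 qed
 hence "\<bar>?L\<bar> \<le> 0" by (rule field_le_epsilon)
 thus ?thesis by simp
qed

lemma zero_trace_integral: "zero_trace u \<Longrightarrow> (LINT x|M. wd i u x) = 0"
proof -
 assume u: "zero_trace u"
 have "pd i (\<lambda>x. 1) x = 0" for x by (rule partial_deriv_eq[OF has_derivative_const])
 thus ?thesis using zero_trace_by_parts[OF u smooth_const[of 1], of i] by simp
qed

text \<open>With \<open>u\<close> replaced by smooth approximations, integration by parts moves the
  derivative off \<open>v\<close>, and the mixed second derivatives of the approximations
  commute.\<close>

lemma zero_trace_swap:
 assumes u: "zero_trace u" and v: "zero_trace v"
 shows "(LINT x|M. wd i u x * wd j v x) = (LINT x|M. wd j u x * wd i v x)"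
proof -
 obtain f where f: "\<And>n. smooth (f n)" "(\<lambda>n. nm (\<lambda>y. f n y - u y)) \<longlonglongrightarrow> 0"
  "\<And>i. (\<lambda>n. nm (\<lambda>y. pd i (f n) y - wd i u y)) \<longlonglongrightarrow> 0"
  "(\<lambda>n. \<integral>\<^sup>+y. ennreal ((f n y)^2) \<partial>boundary_measure \<omega>) \<longlonglongrightarrow> 0"
  using zero_trace_approx[OF u] by blast
 have e: "(LINT x|M. pd i (f n) x * wd j v x) = (LINT x|M. pd j (f n) x * wd i v x)" for n
  using zero_trace_by_parts[OF v smooth_partial_deriv[OF f(1)], of j i n] zero_trace_by_parts[OF v smooth_partial_deriv[OF f(1)], of i j n]
   partial_deriv_commute[OF f(1), of i j n] by (simp add: mult.commute)
 have "(\<lambda>n. LINT x|M. pd i (f n) x * wd j v x) \<longlonglongrightarrow> (LINT x|M. wd i u x * wd j v x)" for i j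
  by (intro L2_inner_tendsto smooth_L2 smooth_partial_deriv f weak_partial_works(1) zero_trace_H1 u v)
 from LIMSEQ_unique[OF this[of i j, unfolded e] this[of j i]] show ?thesis .
qed

text \<open>With zero traces the mixed product of \<open>wd 1 (v 2)\<close> and
  \<open>wd 2 (v 1)\<close> has the same integral as the product of the two diagonal derivatives.
  The cross terms of the symmetric gradient thus complete the diagonal terms to the square of the
  divergence.\<close>

lemma korn:
 fixes v :: "2 \<Rightarrow> real^2 \<Rightarrow> real"
 assumes v: "\<And>a. zero_trace (v a)"
 defines "e \<equiv> \<lambda>a j x. (wd a (v j) x + wd j (v a) x) / 2"
 shows "(nm (wd a (v j)))^2 \<le> 4 * (\<Sum>k\<in>UNIV. \<Sum>l\<in>UNIV. (nm (e k l))^2)"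
proof -
 let ?D = "\<lambda>a j. wd a (v j)"
 have D: "?D a j \<in> L2 M" for a j by (intro weak_partial_works(1) zero_trace_H1 v)
 note i = L2_mult_integrable[OF D D]
 define I where "I a j g d = (LINT x|M. ?D a j x * ?D g d x)" for a j g d
 have p: "(nm (e a j))^2 = (I a j a j + I j a j a + 2 * I a j j a) / 4" for a j
 proof -
  have e2: "(e a j x)^2 = (?D a j x * ?D a j x + ?D j a x * ?D j a x + 2 * (?D a j x * ?D j a x)) / 4" for x
   by (simp add: e_def power2_eq_square algebra_simps)
  show ?thesis unfolding l2norm_power2 e2 I_def using i by simp
 qed
 have sw: "I 1 2 2 1 = I 1 1 2 2"
  unfolding I_def using zero_trace_swap[OF v[of 2] v[of 1], of 1 2] by (simp add: mult.commute)
 have cm: "I 2 1 1 2 = I 1 2 2 1" unfolding I_def by (simp add: mult.commute)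
 have nn: "0 \<le> I a j a j" for a j unfolding I_def by simp
 \<comment> \<open>The squared divergence: subtracting it twice from the right-hand side of the
   claim leaves twice the sum of all squared derivatives.\<close>
 have "0 \<le> (LINT x|M. (?D 1 1 x + ?D 2 2 x) * (?D 1 1 x + ?D 2 2 x))" by simp
 also have "\<dots> = (LINT x|M. ?D 1 1 x * ?D 1 1 x + ?D 2 2 x * ?D 2 2 x + 2 * (?D 1 1 x * ?D 2 2 x))"
  by (intro arg_cong[where f = "integral\<^sup>L M"]) (simp add: fun_eq_iff algebra_simps)
 also have "\<dots> = I 1 1 1 1 + I 2 2 2 2 + 2 * I 1 1 2 2" unfolding I_def using i by simp
 finally have s: "0 \<le> I 1 1 1 1 + I 2 2 2 2 + 2 * I 1 1 2 2" .
 have q: "(nm (?D a j))^2 = I a j a j" unfolding l2norm_power2 I_def by (simp add: power2_eq_square)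
 have r: "4 * (\<Sum>k\<in>UNIV. \<Sum>l\<in>UNIV. (nm (e k l))^2) = 4 * I 1 1 1 1 + 4 * I 2 2 2 2 + 2 * I 1 2 1 2 + 2 * I 2 1 2 1 + 4 * I 1 1 2 2"
  unfolding sum_2 p sw cm by (simp add: p sw cm field_simps)
 have "a = 1 \<or> a = 2" "j = 1 \<or> j = 2" using exhaust_2 by auto
 thus ?thesis
  unfolding q r using s nn[of 1 1] nn[of 1 2] nn[of 2 1] nn[of 2 2] by auto
qed

text \<open>The first coordinate is a multiplier with derivative 1: integration by parts turns the
  integral of the square of \<open>u\<close> into \<open>- 2\<close> times that of
  \<open>u x * (x $ 1 * wd 1 u x)\<close>, and the coordinate is bounded by
  \<open>R\<close>.\<close>

lemma zero_trace_poincare: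
 "\<exists>C\<ge>0. \<forall>u. zero_trace u \<longrightarrow> nm u \<le> C * nm (wd 1 u)"
proof -
 obtain R where R: "0 \<le> R" "\<And>x. x \<in> \<omega> \<Longrightarrow> norm x \<le> R"
 proof -
  obtain R where "\<forall>x\<in>\<omega>. norm x \<le> R" using bounded_dom by (auto simp: bounded_iff)
  thus ?thesis using that[of "\<bar>R\<bar>"] by force
 qed
 have "nm u \<le> 2 * R * nm (wd 1 u)" if u: "zero_trace u" for u
 proof -
  let ?w = "wd 1 u"
  note w2 = weak_partial_works(1)[OF zero_trace_H1[OF u]] and u2 = H1_L2[OF zero_trace_H1[OF u]]
  obtain p where p: "\<And>n. smooth (p n)" "(\<lambda>n. nm (\<lambda>y. p n y - u y)) \<longlonglongrightarrow> 0"
   "\<And>i. (\<lambda>n. nm (\<lambda>y. pd i (p n) y - wd i u y)) \<longlonglongrightarrow> 0"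
   "(\<lambda>n. \<integral>\<^sup>+y. ennreal ((p n y)^2) \<partial>boundary_measure \<omega>) \<longlonglongrightarrow> 0"
   using zero_trace_approx[OF u] by blast
  have AR: "AE x in M. \<bar>x $ 1 * f x\<bar> \<le> \<bar>R * f x\<bar>" for f :: "real^2 \<Rightarrow> real"
  proof (rule AE_I2)
   fix x assume "x \<in> space M"
   hence "\<bar>x $ 1\<bar> \<le> R" using R(2)[of x] component_le_norm_cart[of x 1] by (simp add: space_restrict_space)
   thus "\<bar>x $ 1 * f x\<bar> \<le> \<bar>R * f x\<bar>" using R(1) by (simp add: abs_mult mult_right_mono)
  qed
  have xf: "(\<lambda>x. x $ 1 * f x) \<in> L2 M" "nm (\<lambda>x. x $ 1 * f x) \<le> R * nm f" if f: "f \<in> L2 M" for f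
  proof -
   have m: "(\<lambda>x. x $ 1 * f x) \<in> borel_measurable M"
    using lborel_measurable_dom[OF smooth_measurable[OF smooth_coord[of 1]]] L2_measurable[OF f] by (rule borel_measurable_times)
   show "(\<lambda>x. x $ 1 * f x) \<in> L2 M" by (rule L2_bound[OF L2_scale[OF f] m AR])
   show "nm (\<lambda>x. x $ 1 * f x) \<le> R * nm f"
    using l2norm_mono[OF L2_scale[OF f] m AR] R(1) by (simp add: l2norm_scale)
  qed
  \<comment> \<open>One factor \<open>u\<close> is replaced by \<open>p n\<close>, because
    integration by parts takes a smooth second factor.\<close>
  have e: "(LINT x|M. p n x * (x $ 1 * ?w x)) = - ((LINT x|M. p n x * u x) + (LINT x|M. pd 1 (p n) x * (x $ 1 * u x)))" for n
  proof -
   have s: "smooth (\<lambda>x. x $ 1 * p n x)" by (intro smooth_mult smooth_coord p)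
   have "pd 1 (\<lambda>x. x $ 1 * p n x) x = x $ 1 * pd 1 (p n) x + p n x" for x
    using partial_deriv_mult[of "\<lambda>x. x $ 1" x "p n" 1] smooth_differentiable[OF smooth_coord] smooth_differentiable[OF p(1)]
    by (simp add: partial_deriv_coord)
   hence "u x * pd 1 (\<lambda>x. x $ 1 * p n x) x = p n x * u x + pd 1 (p n) x * (x $ 1 * u x)" for x
    by (simp add: algebra_simps)
   hence "(LINT x|M. u x * pd 1 (\<lambda>x. x $ 1 * p n x) x) = (LINT x|M. p n x * u x) + (LINT x|M. pd 1 (p n) x * (x $ 1 * u x))"
    by (simp add: Bochner_Integration.integral_add L2_mult_integrable smooth_L2 smooth_partial_deriv p(1) u2 xf(1))
   moreover have "(LINT x|M. ?w x * (x $ 1 * p n x)) = (LINT x|M. p n x * (x $ 1 * ?w x))" by (simp add: mult_ac)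
   ultimately show ?thesis using zero_trace_by_parts[OF u s, of 1] by simp
  qed
  have "(\<lambda>n. LINT x|M. p n x * (x $ 1 * ?w x)) \<longlonglongrightarrow> (LINT x|M. u x * (x $ 1 * ?w x))"
   by (intro L2_inner_tendsto smooth_L2 p u2 xf(1) w2)
  moreover have "(\<lambda>n. - ((LINT x|M. p n x * u x) + (LINT x|M. pd 1 (p n) x * (x $ 1 * u x))))
   \<longlonglongrightarrow> - ((LINT x|M. u x * u x) + (LINT x|M. ?w x * (x $ 1 * u x)))"
   by (intro tendsto_minus tendsto_add L2_inner_tendsto smooth_L2 smooth_partial_deriv p u2 xf(1) w2)
  ultimately have "(LINT x|M. u x * (x $ 1 * ?w x)) = - ((LINT x|M. u x * u x) + (LINT x|M. ?w x * (x $ 1 * u x)))"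
   unfolding e by (rule LIMSEQ_unique)
  moreover have "(LINT x|M. ?w x * (x $ 1 * u x)) = (LINT x|M. u x * (x $ 1 * ?w x))" by (simp add: mult_ac)
  ultimately have "(nm u)^2 = - 2 * (LINT x|M. u x * (x $ 1 * ?w x))"
   unfolding l2norm_power2 by (simp add: power2_eq_square)
  also have "\<dots> \<le> 2 * (nm u * nm (\<lambda>x. x $ 1 * ?w x))"
   using L2_Cauchy_Schwarz[OF u2 xf(1)[OF w2], of 1] by linarith
  also have "\<dots> \<le> 2 * (nm u * (R * nm ?w))" by (intro mult_left_mono xf(2) w2) auto
  finally have "nm u * nm u \<le> nm u * (2 * R * nm ?w)" by (simp add: power2_eq_square)
  thus ?thesis using R(1) by (cases "nm u = 0") (auto simp: mult_le_cancel_left less_le)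
 qed
 thus ?thesis using R(1) by (intro exI[of _ "2 * R"]) auto
qed

text \<open>A diagonal choice: for each \<open>n\<close> a smooth function within
  \<open>1 / Suc n\<close> of \<open>u n\<close>, whose boundary integral is below
  \<open>1 / Suc n\<close> as well.\<close>

lemma zero_trace_limit:
 assumes u: "\<And>n. zero_trace (u n)" and g: "g \<in> H1 \<omega>" and lim: "(\<lambda>n. norm_H1 \<omega> (\<lambda>y. u n y - g y)) \<longlonglongrightarrow> 0"
 shows "zero_trace g"
proof -
 let ?P = "\<lambda>n f. norm_H1 \<omega> (\<lambda>y. f y - u n y) < 1 / Suc n \<and> (\<integral>\<^sup>+y. ennreal ((f y)^2) \<partial>boundary_measure \<omega>) < ennreal (1 / Suc n)"
 have "\<forall>n. \<exists>f. smooth f \<and> ?P n f"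
 proof
  fix n
  obtain f where f: "\<And>k. smooth (f k)" "(\<lambda>k. norm_H1 \<omega> (\<lambda>y. f k y - u n y)) \<longlonglongrightarrow> 0"
   "(\<lambda>k. \<integral>\<^sup>+y. ennreal ((f k y)^2) \<partial>boundary_measure \<omega>) \<longlonglongrightarrow> 0"
   using u[of n] unfolding zero_trace_def has_trace_def by auto
  have "\<forall>\<^sub>F k in sequentially. ?P n (f k)"
   by (rule eventually_conj[OF order_tendstoD(2)[OF f(2)] order_tendstoD(2)[OF f(3)]]) simp_all
  then obtain k where "?P n (f k)"
   unfolding eventually_sequentially by blast
  with f(1)[of k] show "\<exists>f. smooth f \<and> ?P n f"
   by (intro exI[of _ "f k"] conjI) simp_all
 qed
 from choice[OF this] obtain f where f': "\<forall>n. smooth (f n) \<and> ?P n (f n)" ..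
 note f = conjunct1[OF spec[OF f']] conjunct1[OF conjunct2[OF spec[OF f']]] conjunct2[OF conjunct2[OF spec[OF f']]]
 note uH = zero_trace_H1[OF u]
 note f1 = smooth_H1(1)[OF f(1)]
 have n0: "(\<lambda>n. 1 / real (Suc n)) \<longlonglongrightarrow> 0" by (rule LIMSEQ_Suc[OF lim_1_over_n])
 have "(\<lambda>n. norm_H1 \<omega> (\<lambda>y. f n y - u n y)) \<longlonglongrightarrow> 0"
  by (rule tendsto_sandwich[OF _ _ tendsto_const n0])
   (use f(2) in \<open>auto intro!: always_eventually less_imp_le order_trans[OF l2norm_nonneg norm_H1_ge(1)]\<close>)
 note a = norm_H1_tendsto[OF f1 uH this] and b = norm_H1_tendsto[OF uH g lim]
 have 3: "(\<lambda>n. norm_H1 \<omega> (\<lambda>y. f n y - g y)) \<longlonglongrightarrow> 0"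
  by (rule H1_limit(4)[OF f1 H1_L2[OF g] weak_partial_works(1)[OF g] L2_limit_trans[OF H1_L2[OF f1] H1_L2[OF uH] H1_L2[OF g] a(1) b(1)]
    L2_limit_trans[OF weak_partial_works(1)[OF f1] weak_partial_works(1)[OF uH] weak_partial_works(1)[OF g] a(2) b(2)]])
 have 4: "(\<lambda>n. \<integral>\<^sup>+y. ennreal ((f n y)^2) \<partial>boundary_measure \<omega>) \<longlonglongrightarrow> 0"
 proof (rule tendsto_sandwich[OF _ _ tendsto_const])
  show "(\<lambda>n. ennreal (1 / real (Suc n))) \<longlonglongrightarrow> 0" using tendsto_ennrealI[OF n0] by simp
 qed (use f(3) in \<open>auto simp: less_imp_le\<close>)
 have "(\<lambda>_. 0) \<in> L2 (boundary_measure \<omega>)" by (rule L2_zero)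
 thus ?thesis unfolding zero_trace_def has_trace_def using g f(1) 3 4 by auto
qed

end

section \<open>The plate energy\<close>

lemma section_L2:
 assumes h: "h \<in> L2 (M \<Otimes>\<^sub>M count_space A)" and A: "finite A" "a \<in> A"
 shows "(\<lambda>y. h (y, a)) \<in> L2 M"
proof -
 interpret C: sigma_finite_measure "count_space A" by (rule sigma_finite_measure_count_space_finite[OF A(1)])
 note [measurable] = L2_measurable[OF h]
 have [measurable]: "(\<lambda>y. (y, a)) \<in> measurable M (M \<Otimes>\<^sub>M count_space A)" using A(2) by simp
 have m: "(\<lambda>y. h (y, a)) \<in> borel_measurable M" by measurable
 have "(\<integral>\<^sup>+y. ennreal ((h (y, a))^2) \<partial>M) \<le> (\<integral>\<^sup>+y. \<integral>\<^sup>+b. ennreal ((h (y, b))^2) \<partial>count_space A \<partial>M)"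
 proof (rule nn_integral_mono)
  fix y
  show "ennreal ((h (y, a))^2) \<le> (\<integral>\<^sup>+b. ennreal ((h (y, b))^2) \<partial>count_space A)"
   unfolding nn_integral_count_space_finite[OF A(1)]
   using A member_le_sum[of a A "\<lambda>b. ennreal ((h (y, b))^2)"] by simp
 qed
 also have "\<dots> = (\<integral>\<^sup>+x. ennreal ((h x)^2) \<partial>(M \<Otimes>\<^sub>M count_space A))"
  by (rule C.nn_integral_fst) measurable
 also have "\<dots> < \<infinity>" using L2_square_integrable[OF h] by (simp add: integrable_iff_bounded)
 finally show ?thesis using m by (simp add: L2_def integrable_iff_bounded)
qed

context planar_domain
begin

text \<open>\<open>F\<close> is Lebesgue measurable on the product, which makes only almost all of
  its sections measurable. A Borel representative goes through Tonelli's theorem and Cauchy-Schwarz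
  on fibres of length \<open>2 * \<epsilon>\<close>, and its fibre integrals agree with those of
  \<open>F\<close> for almost every \<open>y\<close>.\<close>

lemma fibre_integral_L2:
 fixes F :: "(real^2) \<times> real \<Rightarrow> real"
 assumes F: "F \<in> L2 (lebesgue_on (\<omega> \<times> {-\<epsilon><..<\<epsilon>}))" and \<epsilon>: "\<epsilon> > 0"
 shows "(\<lambda>y. LINT t|lebesgue_on {-\<epsilon><..<\<epsilon>}. F (y, t)) \<in> L2 M"
proof -
 let ?I = "{-\<epsilon><..<\<epsilon>}"
 let ?W = "\<omega> \<times> ?I"
 have oW: "open ?W" using open_dom by (intro open_Times) auto
 hence [measurable]: "?W \<in> sets borel" by simp
 have lW: "?W \<in> sets lebesgue" using oW by simp
 define F1 where "F1 x = (if x \<in> ?W then F x else 0)" for x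
 have F1m: "F1 \<in> borel_measurable lebesgue"
  unfolding F1_def[abs_def] by (rule borel_measurable_if_I[OF L2_measurable[OF F] lW])
 obtain g where g: "g \<in> borel_measurable lborel" "AE x in lborel. F1 x = g x"
  using completion_ex_borel_measurable_real[OF F1m] by auto
 define g0 where "g0 x = g x * indicator ?W x" for x
 have g0m [measurable]: "g0 \<in> borel_measurable borel"
  unfolding g0_def[abs_def] using g(1) by (intro borel_measurable_times borel_measurable_indicator) auto
 have ae: "AE x in lborel. F1 x = g0 x" using g(2) by eventually_elim (auto simp: g0_def F1_def indicator_def split: if_splits)
 have "integrable (lebesgue_on ?W) (\<lambda>x. (F x)^2)" by (rule L2_square_integrable[OF F])
 hence "integrable lebesgue (\<lambda>x. indicator ?W x * (F x)^2)"
  using lW by (subst (asm) integrable_restrict_space) auto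
 moreover have "indicator ?W x * (F x)^2 = (F1 x)^2" for x by (auto simp: F1_def)
 ultimately have "integrable lebesgue (\<lambda>x. (F1 x)^2)" by simp
 moreover have "AE x in lebesgue. (F1 x)^2 = (g0 x)^2" using AE_completion[OF ae] by eventually_elim simp
 ultimately have "integrable lebesgue (\<lambda>x. (g0 x)^2)"
  using F1m by (subst (asm) integrable_cong_AE) (auto intro!: measurable_completion)
 hence "integrable lborel (\<lambda>x. (g0 x)^2)" by (subst (asm) integrable_completion) auto
 hence fin: "(\<integral>\<^sup>+x. ennreal ((g0 x)^2) \<partial>lborel) < \<infinity>" by (simp add: integrable_iff_bounded)
 have [measurable]: "g0 \<in> borel_measurable (lborel \<Otimes>\<^sub>M lborel)" using g0m by (simp add: lborel_prod)
 define G where "G y = (LINT t|lborel. g0 (y, t))" for y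
 let ?q = "\<lambda>y. \<integral>\<^sup>+t. ennreal ((g0 (y, t))^2) \<partial>lborel" and ?c = "ennreal (2 * \<epsilon>)"
 have Gm [measurable]: "G \<in> borel_measurable borel"
  using lborel.borel_measurable_lebesgue_integral[of "\<lambda>y t. g0 (y, t)" lborel] by (simp add: G_def[abs_def])
 have Gle: "ennreal ((G y)^2) \<le> ?c * ?q y" for y
 proof (cases "?q y = \<infinity>")
  case True
  thus ?thesis using \<epsilon> by (simp add: ennreal_mult_top)
 next
  case False
  have gy: "(\<lambda>t. g0 (y, t)) \<in> L2 lborel"
   using False by (auto simp: L2_def integrable_iff_bounded less_top)
  have iI: "(\<lambda>t. indicator ?I t :: real) \<in> L2 lborel"
  proof -
   have "(indicator ?I t :: real)^2 = indicator ?I t" for t :: real by (simp add: indicator_def)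
   thus ?thesis using \<epsilon> by (simp add: L2_def integrable_indicator_iff)
  qed
  have "g0 (y, t) * indicator ?I t = g0 (y, t)" for t by (auto simp: g0_def indicator_def)
  hence e: "(LINT t|lborel. g0 (y, t) * indicator ?I t) = G y" by (simp only: G_def)
  have "\<bar>G y\<bar> \<le> l2norm lborel (\<lambda>t. g0 (y, t)) * l2norm lborel (\<lambda>t. indicator ?I t)"
   using L2_Cauchy_Schwarz[OF gy iI] unfolding e .
  hence "(G y)^2 \<le> (l2norm lborel (\<lambda>t. g0 (y, t)) * l2norm lborel (\<lambda>t. indicator ?I t))^2"
   by (metis abs_ge_zero power2_abs power_mono)
  also have "\<dots> = (LINT t|lborel. (g0 (y, t))^2) * (LINT t|lborel. (indicator ?I t)^2)"
   by (simp add: power_mult_distrib l2norm_power2)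
  also have "(LINT t|lborel. (indicator ?I t :: real)^2) = 2 * \<epsilon>"
  proof -
   have "(indicator ?I t :: real)^2 = indicator ?I t" for t :: real by (simp add: indicator_def)
   thus ?thesis using \<epsilon> by simp
  qed
  finally have "ennreal ((G y)^2) \<le> ennreal ((2 * \<epsilon>) * (LINT t|lborel. (g0 (y, t))^2))" by (intro ennreal_leI) (simp add: mult.commute)
  also have "\<dots> = ?c * ennreal (LINT t|lborel. (g0 (y, t))^2)" using \<epsilon> by (intro ennreal_mult) auto
  also have "ennreal (LINT t|lborel. (g0 (y, t))^2) = ?q y"
   using L2_square_integrable[OF gy] by (intro nn_integral_eq_integral[symmetric]) auto
  finally show ?thesis .
 qed
 have "(\<integral>\<^sup>+y. ennreal ((G y)^2) \<partial>lborel) \<le> (\<integral>\<^sup>+y. ?c * ?q y \<partial>lborel)"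
  by (intro nn_integral_mono Gle)
 also have "\<dots> = ?c * (\<integral>\<^sup>+y. ?q y \<partial>lborel)"
  by (rule nn_integral_cmult) measurable
 also have "(\<integral>\<^sup>+y. ?q y \<partial>lborel) = (\<integral>\<^sup>+x. ennreal ((g0 x)^2) \<partial>(lborel \<Otimes>\<^sub>M lborel))"
  by (rule lborel.nn_integral_fst) measurable
 also have "\<dots> = (\<integral>\<^sup>+x. ennreal ((g0 x)^2) \<partial>lborel)" by (simp only: lborel_prod)
 also have "?c * \<dots> < \<infinity>" using fin by (simp add: ennreal_mult_less_top)
 finally have "G \<in> L2 lborel" by (simp add: L2_def integrable_iff_bounded)
 moreover have "G y = 0" if "y \<notin> \<omega>" for y using that by (simp add: G_def g0_def)
 ultimately have G2: "G \<in> L2 M" by (intro L20_imp_L2) (simp add: L20_def)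
 let ?h = "\<lambda>y. LINT t|lebesgue_on ?I. F (y, t)"
 have "AE x in lborel \<Otimes>\<^sub>M lborel. F1 x = g0 x" using ae by (simp only: lborel_prod)
 hence "AE y in lborel. AE t in lborel. F1 (y, t) = g0 (y, t)" by (rule lborel_pair.AE_pair)
 hence aeh: "AE y in lborel. (if y \<in> \<omega> then ?h y else 0) = G y"
 proof eventually_elim
  case (elim y)
  show ?case
  proof (cases "y \<in> \<omega>")
   case True
   have gy: "(\<lambda>t. g0 (y, t)) \<in> borel_measurable lebesgue" by (intro measurable_completion) measurable
   have ae': "AE t in lebesgue. g0 (y, t) = F1 (y, t)" using AE_completion[OF elim] by eventually_elim simp
   have Fy: "(\<lambda>t. F1 (y, t)) \<in> borel_measurable lebesgue" by (rule borel_measurable_AE[OF gy ae'])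
   have "?h y = (LINT t|lebesgue. indicator ?I t * F (y, t))"
    by (subst integral_restrict_space) auto
   also have "\<dots> = (LINT t|lebesgue. F1 (y, t))"
    using True by (intro Bochner_Integration.integral_cong) (auto simp: F1_def)
   also have "\<dots> = (LINT t|lebesgue. g0 (y, t))"
    using ae' by (intro integral_cong_AE Fy gy) (auto elim: eventually_mono)
   also have "\<dots> = G y" unfolding G_def by (rule integral_completion) measurable
   finally show ?thesis using True by simp
  qed (simp add: G_def g0_def)
 qed
 have hm: "?h \<in> borel_measurable M"
 proof (rule borel_measurable_if_D)
  have "AE y in lebesgue. G y = (if y \<in> \<omega> then ?h y else 0)" using AE_completion[OF aeh] by eventually_elim simp
  thus "(\<lambda>y. if y \<in> \<omega> then ?h y else 0) \<in> borel_measurable lebesgue"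
   by (rule borel_measurable_AE[rotated]) (intro measurable_completion, simp)
 qed
 have "AE y in lebesgue. y \<in> \<omega> \<longrightarrow> G y = ?h y" using AE_completion[OF aeh] by eventually_elim auto
 hence "AE y in M. G y = ?h y" by (subst AE_restrict_space_iff) auto
 thus ?thesis by (rule L2_AE_cong[OF G2 hm])
qed

lemma resultant_L2:
 assumes e: "e > 0" and f: "f \<in> volume_forces \<omega> e" and g: "g \<in> surface_forces \<omega> e"
 shows "resultant_p e f g i \<in> L2 M" "resultant_q e f g a \<in> L2 M"
proof -
 let ?L = "L2 (lebesgue_on (\<omega> \<times> {-e<..<e}))"
 have f2: "(\<lambda>x. f x $ i) \<in> ?L" for i using f by (simp add: volume_forces_def)
 have f3: "(\<lambda>x. snd x * f x $ i) \<in> ?L" for i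
 proof (rule L2_bound[OF L2_scale[OF f2]])
  have "snd \<in> borel_measurable (lebesgue_on (\<omega> \<times> {-e<..<e}))"
   by (intro measurable_restrict_space1 measurable_completion) (simp add: borel_prod[symmetric])
  thus "(\<lambda>x. snd x * f x $ i) \<in> borel_measurable (lebesgue_on (\<omega> \<times> {-e<..<e}))"
   using L2_measurable[OF f2] by (rule borel_measurable_times)
  show "AE x in lebesgue_on (\<omega> \<times> {-e<..<e}). \<bar>snd x * f x $ i\<bar> \<le> \<bar>e * f x $ i\<bar>"
   using e by (intro AE_I2) (auto simp: abs_mult space_restrict_space intro!: mult_right_mono)
 qed
 have g2: "(\<lambda>y. g (y, s) $ i) \<in> L2 M" if "s \<in> {-e, e}" for s i
 proof -
  have "(\<lambda>x. g x $ i) \<in> L2 (M \<Otimes>\<^sub>M count_space {-e, e})" using g by (simp add: surface_forces_def)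
  from section_L2[OF this _ that] show ?thesis by simp
 qed
 show "resultant_p e f g i \<in> L2 M"
  unfolding resultant_p_def[abs_def] by (intro L2_add fibre_integral_L2 f2 e g2) auto
 show "resultant_q e f g a \<in> L2 M"
  unfolding resultant_q_def[abs_def]
  using fibre_integral_L2[OF f3 e] g2 by (intro L2_add L2_scale L2_diff) auto
qed

end

locale plate = lipschitz_domain +
 fixes \<epsilon> lam \<mu> :: real and f g :: "(real^2) \<times> real \<Rightarrow> real^3"
  and VH :: "(real^2 \<Rightarrow> real^2) set" and V3 :: "(real^2 \<Rightarrow> real) set"
 assumes conn: "connected \<omega>" and eps: "\<epsilon> > 0" and lam: "lam \<ge> 0" and mu: "\<mu> > 0"
  and vol: "f \<in> volume_forces \<omega> \<epsilon>" and surf: "g \<in> surface_forces \<omega> \<epsilon>"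
  and VH: "closed_subspace_of (norm_H1_pair \<omega>) (H1_pair_zero_trace \<omega>) VH"
  and V3: "closed_subspace_of (norm_H2 \<omega>) (H2 \<omega>) V3"
  and ker: "\<forall>v\<in>V3. affine_on \<omega> v \<longrightarrow> (AE y in lebesgue_on \<omega>. v y = 0)"

context lipschitz_domain
begin

lemma L2_product:
 assumes f: "f \<in> borel_measurable M" "(\<lambda>x. (f x)^2) \<in> L2 M" and g: "g \<in> borel_measurable M" "(\<lambda>x. (g x)^2) \<in> L2 M"
 shows "(\<lambda>x. f x * g x) \<in> L2 M" "(nm (\<lambda>x. f x * g x))^2 \<le> nm (\<lambda>x. (f x)^2) * nm (\<lambda>x. (g x)^2)"
proof -
 have e: "(f x * g x)^2 = (f x)^2 * (g x)^2" for x by (rule power_mult_distrib)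
 show "(\<lambda>x. f x * g x) \<in> L2 M"
  using f(1) g(1) L2_mult_integrable[OF f(2) g(2)] by (simp add: L2_def e)
 show "(nm (\<lambda>x. f x * g x))^2 \<le> nm (\<lambda>x. (f x)^2) * nm (\<lambda>x. (g x)^2)"
  unfolding l2norm_power2 e using L2_Cauchy_Schwarz[OF f(2) g(2)] by linarith
qed

end

text \<open>Symmetry of \<open>s\<close> merges the two index permutations in the tensor.\<close>

lemma elasticity_sum:
 fixes s :: "real^2^2"
 assumes "s $ 1 $ 2 = s $ 2 $ 1"
 shows "(\<Sum>i\<in>UNIV. \<Sum>j\<in>UNIV. \<Sum>k\<in>UNIV. \<Sum>l\<in>UNIV. elasticity lam \<mu> i j k l * s $ k $ l * s $ i $ j)
  = 4 * lam * \<mu> / (lam + 2 * \<mu>) * (s $ 1 $ 1 + s $ 2 $ 2)^2 + 4 * \<mu> * (\<Sum>i\<in>UNIV. \<Sum>j\<in>UNIV. (s $ i $ j)^2)"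
proof -
 define a where "a = 4 * lam * \<mu> / (lam + 2 * \<mu>)"
 show ?thesis
  unfolding sum_2 elasticity_def kronecker_def a_def[symmetric]
  using assms by (simp add: power2_eq_square algebra_simps)
qed

lemma double_sum_square_le:
 fixes a :: "2 \<Rightarrow> 2 \<Rightarrow> real"
 shows "(\<Sum>i\<in>UNIV. \<Sum>j\<in>UNIV. a i j)^2 \<le> 4 * (\<Sum>i\<in>UNIV. \<Sum>j\<in>UNIV. (a i j)^2)"
proof -
 have "0 \<le> (x - y)^2 + (x - z)^2 + (x - w)^2 + (y - z)^2 + (y - w)^2 + (z - w)^2" for x y z w :: real
  by simp
 from this[of "a 1 1" "a 1 2" "a 2 1" "a 2 2"] show ?thesis
  unfolding sum_2 by (simp add: power2_eq_square algebra_simps)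
qed

section \<open>The energy in terms of strain and bending\<close>

context plate
begin

definition strain :: "displacement \<Rightarrow> 2 \<Rightarrow> 2 \<Rightarrow> real^2 \<Rightarrow> real" where
 "strain u i j y = strain_E \<omega> u y $ i $ j"

definition bending :: "displacement \<Rightarrow> 2 \<Rightarrow> 2 \<Rightarrow> real^2 \<Rightarrow> real" where
 "bending u i j = wd i (wd j (snd u))"

abbreviation comp :: "displacement \<Rightarrow> 2 \<Rightarrow> real^2 \<Rightarrow> real" where
 "comp u i \<equiv> (\<lambda>y. fst u y $ i)"

abbreviation energy where "energy \<equiv> kirchhoff_love_energy \<omega> \<epsilon> lam \<mu> f g"

abbreviation total_load where "total_load \<equiv> load \<omega> \<epsilon> f g"

abbreviation V where "V \<equiv> VH \<times> V3"

text \<open>The squared elastic norm as a combination of squared L2 norms with nonnegative weights,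
  so that the parallelogram law applies term by term.\<close>

definition elastic where
 "elastic S = 4 * lam * \<mu> / (lam + 2 * \<mu>) * (nm (\<lambda>y. S 1 1 y + S 2 2 y))^2
  + 4 * \<mu> * (\<Sum>i\<in>UNIV. \<Sum>j\<in>UNIV. (nm (S i j))^2)" for S :: "2 \<Rightarrow> 2 \<Rightarrow> real^2 \<Rightarrow> real"

lemma elastic_norm_sq_eq:
 assumes S: "\<And>p j. (\<lambda>y. s y $ p $ j) \<in> L2 M" and sym: "AE y in M. s y $ 1 $ 2 = s y $ 2 $ 1"
 shows "elastic_norm_sq \<omega> lam \<mu> s = elastic (\<lambda>p j y. s y $ p $ j)"
proof -
 let ?a = "4 * lam * \<mu> / (lam + 2 * \<mu>)"
 note [measurable] = L2_measurable[OF S]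
 have i: "integrable M (\<lambda>y. (s y $ p $ j)^2)" for p j by (rule L2_square_integrable[OF S])
 have t: "integrable M (\<lambda>y. (s y $ 1 $ 1 + s y $ 2 $ 2)^2)" by (rule L2_square_integrable[OF L2_add[OF S S]])
 have "elastic_norm_sq \<omega> lam \<mu> s = (LINT y|M. ?a * (s y $ 1 $ 1 + s y $ 2 $ 2)^2 + 4 * \<mu> * (\<Sum>p\<in>UNIV. \<Sum>j\<in>UNIV. (s y $ p $ j)^2))"
  unfolding elastic_norm_sq_def
 proof (rule integral_cong_AE)
  show "AE y in M. (\<Sum>p\<in>UNIV. \<Sum>j\<in>UNIV. \<Sum>k\<in>UNIV. \<Sum>l\<in>UNIV. elasticity lam \<mu> p j k l * s y $ k $ l * s y $ p $ j)
   = ?a * (s y $ 1 $ 1 + s y $ 2 $ 2)^2 + 4 * \<mu> * (\<Sum>p\<in>UNIV. \<Sum>j\<in>UNIV. (s y $ p $ j)^2)"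
   using sym by eventually_elim (rule elasticity_sum)
 qed measurable
 also have "\<dots> = elastic (\<lambda>p j y. s y $ p $ j)"
  unfolding elastic_def l2norm_power2 using i t by simp
 finally show ?thesis .
qed

lemma elastic_ge: "4 * \<mu> * (\<Sum>i\<in>UNIV. \<Sum>j\<in>UNIV. (nm (S i j))^2) \<le> elastic S"
 using lam mu by (simp add: elastic_def)

lemma V_D:
 assumes "u \<in> V"
 shows "zero_trace (comp u i)" "snd u \<in> H2 \<omega>" "snd u \<in> V3" "comp u i \<in> H1 \<omega>"
  "wd i (snd u) \<in> H1 \<omega>"
proof -
 have "fst u \<in> H1_pair_zero_trace \<omega>" using assms VH by (auto simp: closed_subspace_of_def)
 thus "zero_trace (comp u i)" "comp u i \<in> H1 \<omega>" by (auto simp: H1_pair_zero_trace_def zero_trace_def)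
 show "snd u \<in> V3" using assms by auto
 thus s: "snd u \<in> H2 \<omega>" using V3 by (auto simp: closed_subspace_of_def)
 show "wd i (snd u) \<in> H1 \<omega>" by (rule H2_H1(2)[OF s])
qed

lemma strain_eq: "strain u i j y = (wd i (comp u j) y + wd j (comp u i) y) / 2
  + wd i (snd u) y * wd j (snd u) y / 2"
 by (simp add: strain_def strain_E_def field_simps)

text \<open>The Ladyzhenskaya inequality for the slopes, which lie in \<open>H1 \<omega>\<close>.
  The factor \<open>grad_norm\<close> is kept apart from \<open>full_norm\<close> because it is the
  one that compactness makes small for differences.\<close>

lemma slope_product:
 obtains K where "0 \<le> K" "\<And>u v i j. u \<in> V \<Longrightarrow> v \<in> V \<Longrightarrow> (\<lambda>y. wd i (snd u) y * wd j (snd v) y) \<in> L2 M"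
  "\<And>u v i j. u \<in> V \<Longrightarrow> v \<in> V \<Longrightarrow> (nm (\<lambda>y. wd i (snd u) y * wd j (snd v) y))^2
   \<le> (K * (grad_norm (snd u) * full_norm (snd u))) * (K * (grad_norm (snd v) * full_norm (snd v)))"
proof -
 obtain K where K: "0 \<le> K" "\<And>u. u \<in> H1 \<omega> \<Longrightarrow> (\<lambda>x. (u x)^2) \<in> L2 M"
  "\<And>u. u \<in> H1 \<omega> \<Longrightarrow> nm (\<lambda>x. (u x)^2) \<le> K * (nm u * (nm u + grad_norm u))"
  using ladyzhenskaya unfolding grad_norm_def by blast
 have sq: "nm (\<lambda>y. (wd i (snd u) y)^2) \<le> K * (grad_norm (snd u) * full_norm (snd u))" if u: "u \<in> V" for u i
 proof -
  have "nm (wd i (snd u)) \<le> grad_norm (snd u)" unfolding grad_norm_def by (rule member_le_sum) auto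
  moreover have "grad_norm (wd i (snd u)) \<le> hess_norm (snd u)"
   unfolding grad_norm_def hess_norm_def by (intro sum_mono member_le_sum) auto
  ultimately have "nm (wd i (snd u)) \<le> grad_norm (snd u)"
   "nm (wd i (snd u)) + grad_norm (wd i (snd u)) \<le> full_norm (snd u)"
   using l2norm_nonneg[of M "snd u"] unfolding full_norm_def by linarith+
  hence "nm (wd i (snd u)) * (nm (wd i (snd u)) + grad_norm (wd i (snd u)))
   \<le> grad_norm (snd u) * full_norm (snd u)"
   by (intro mult_mono) (auto simp: grad_norm_nonneg)
  thus ?thesis by (intro order_trans[OF K(3)[OF V_D(5)[OF u]] mult_left_mono] K(1))
 qed
 show ?thesis
 proof (rule that[OF K(1)])
  fix u v i j assume u: "u \<in> V" and v: "v \<in> V"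
  show "(\<lambda>y. wd i (snd u) y * wd j (snd v) y) \<in> L2 M"
   by (intro L2_product(1) L2_measurable[OF H1_L2] K(2) V_D(5) u v)
  have "(nm (\<lambda>y. wd i (snd u) y * wd j (snd v) y))^2
   \<le> nm (\<lambda>y. (wd i (snd u) y)^2) * nm (\<lambda>y. (wd j (snd v) y)^2)"
   by (intro L2_product(2) L2_measurable[OF H1_L2] K(2) V_D(5) u v)
  also have "\<dots> \<le> (K * (grad_norm (snd u) * full_norm (snd u))) * (K * (grad_norm (snd v) * full_norm (snd v)))"
   by (intro mult_mono sq u v) (auto intro!: mult_nonneg_nonneg K(1) grad_norm_nonneg full_norm_nonneg)
  finally show "(nm (\<lambda>y. wd i (snd u) y * wd j (snd v) y))^2
   \<le> (K * (grad_norm (snd u) * full_norm (snd u))) * (K * (grad_norm (snd v) * full_norm (snd v)))" .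
 qed
qed

lemma slope_product_L2: "u \<in> V \<Longrightarrow> (\<lambda>y. wd i (snd u) y * wd j (snd u) y) \<in> L2 M"
 by (rule slope_product) blast

lemma slope_L2: "u \<in> V \<Longrightarrow> wd i (snd u) \<in> L2 M"
 by (intro H1_L2 V_D)

lemma sym_grad_L2: "u \<in> V \<Longrightarrow> (\<lambda>y. (wd i (comp u j) y + wd j (comp u i) y) / 2) \<in> L2 M"
proof -
 assume u: "u \<in> V"
 have "(\<lambda>y. 1/2 * (wd i (comp u j) y + wd j (comp u i) y)) \<in> L2 M"
  by (intro L2_scale L2_add weak_partial_works(1) V_D(4) u)
 thus ?thesis by simp
qed

lemma strain_L2: "u \<in> V \<Longrightarrow> strain u i j \<in> L2 M"
proof -
 assume u: "u \<in> V"
 have "(\<lambda>y. (wd i (comp u j) y + wd j (comp u i) y) / 2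
  + 1/2 * (wd i (snd u) y * wd j (snd u) y)) \<in> L2 M"
  by (intro L2_add sym_grad_L2 L2_scale slope_product_L2 u)
 thus ?thesis by (simp add: strain_eq[abs_def])
qed

lemma bending_L2: "u \<in> V \<Longrightarrow> bending u i j \<in> L2 M"
 unfolding bending_def by (intro weak_partial_works(1) V_D)

lemma energy_eq:
 assumes u: "u \<in> V"
 shows "energy u = \<epsilon> / 2 * elastic (strain u) + \<epsilon> ^ 3 / 6 * elastic (bending u) - total_load u"
proof -
 have "elastic_norm_sq \<omega> lam \<mu> (strain_E \<omega> u) = elastic (strain u)"
  using strain_L2[OF u] unfolding strain_def[abs_def]
  by (intro elastic_norm_sq_eq) (auto simp: strain_E_def add.commute mult.commute)
 moreover have "elastic_norm_sq \<omega> lam \<mu> (strain_F \<omega> u) = elastic (bending u)"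
 proof -
  have b: "(\<lambda>i j y. strain_F \<omega> u y $ i $ j) = bending u" by (simp add: fun_eq_iff strain_F_def bending_def)
  have "(\<lambda>y. strain_F \<omega> u y $ i $ j) = bending u i j" for i j by (simp add: fun_eq_iff strain_F_def bending_def)
  moreover have "AE y in M. strain_F \<omega> u y $ 1 $ 2 = strain_F \<omega> u y $ 2 $ 1"
   using weak_partial_commute[OF V_D(2)[OF u], of 1 2] by (simp add: strain_F_def)
  ultimately show ?thesis using elastic_norm_sq_eq[of "strain_F \<omega> u"] bending_L2[OF u] unfolding b by metis
 qed
 ultimately show ?thesis by (simp add: kirchhoff_love_energy_def)
qed

lemma load_eq:
 assumes u: "u \<in> V"
 shows "total_load u = (\<Sum>a\<in>UNIV. LINT y|M. comp u a y * resultant_p \<epsilon> f g (latin a) y)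
  + (LINT y|M. snd u y * resultant_p \<epsilon> f g 3 y)
  - (\<Sum>a\<in>UNIV. LINT y|M. wd a (snd u) y * resultant_q \<epsilon> f g a y)"
proof -
 note r = resultant_L2[OF eps vol surf]
 have c: "component u 1 = comp u 1" "component u 2 = comp u 2" "component u 3 = snd u"
  by (auto simp: component_def fun_eq_iff)
 have i: "integrable M (\<lambda>y. comp u a y * resultant_p \<epsilon> f g i y)" "integrable M (\<lambda>y. snd u y * resultant_p \<epsilon> f g i y)"
  "integrable M (\<lambda>y. wd a (snd u) y * resultant_q \<epsilon> f g a y)" for a i
  using H1_L2[OF V_D(4)[OF u]] H1_L2[OF H2_H1(1)[OF V_D(2)[OF u]]] slope_L2[OF u] by (auto intro!: L2_mult_integrable r)
 show ?thesis
  unfolding load_def using i by (simp add: sum_2 sum_3 c latin_def mult.commute)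
qed

lemma load_bound: "\<exists>P\<ge>0. \<forall>u\<in>V. \<bar>total_load u\<bar> \<le> P * (nm (comp u 1) + nm (comp u 2) + full_norm (snd u))"
proof -
 note r = resultant_L2[OF eps vol surf]
 let ?p = "\<lambda>i. nm (resultant_p \<epsilon> f g i)" and ?q = "\<lambda>k. nm (resultant_q \<epsilon> f g k)"
 define P where "P = ?p 1 + ?p 2 + ?p 3 + ?q 1 + ?q 2"
 have le: "?p 1 \<le> P" "?p 2 \<le> P" "?p 3 \<le> P" "?q 1 \<le> P" "?q 2 \<le> P"
  using l2norm_nonneg[of M "resultant_p \<epsilon> f g 1"] l2norm_nonneg[of M "resultant_p \<epsilon> f g 2"] l2norm_nonneg[of M "resultant_p \<epsilon> f g 3"]
   l2norm_nonneg[of M "resultant_q \<epsilon> f g 1"] l2norm_nonneg[of M "resultant_q \<epsilon> f g 2"] by (auto simp: P_def simp del: l2norm_nonneg)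
 have P0: "0 \<le> P" by (simp add: P_def)
 have "\<bar>total_load u\<bar> \<le> P * (nm (comp u 1) + nm (comp u 2) + full_norm (snd u))" if u: "u \<in> V" for u
 proof -
  have cs: "\<bar>LINT y|M. a y * b y\<bar> \<le> P * nm a" if "a \<in> L2 M" "b \<in> L2 M" "nm b \<le> P" for a b
  proof -
   have "\<bar>LINT y|M. a y * b y\<bar> \<le> nm a * nm b" by (rule L2_Cauchy_Schwarz[OF that(1,2)])
   also have "\<dots> \<le> nm a * P" by (intro mult_left_mono that(3)) simp
   finally show ?thesis by (simp add: mult.commute)
  qed
  note c2 = H1_L2[OF V_D(4)[OF u]] and s2 = H1_L2[OF H2_H1(1)[OF V_D(2)[OF u]]]
  have la: "latin 1 = 1" "latin 2 = 2" by (auto simp: latin_def)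
  have "\<bar>total_load u\<bar> \<le> \<bar>LINT y|M. comp u 1 y * resultant_p \<epsilon> f g 1 y\<bar> + \<bar>LINT y|M. comp u 2 y * resultant_p \<epsilon> f g 2 y\<bar>
   + \<bar>LINT y|M. snd u y * resultant_p \<epsilon> f g 3 y\<bar> + \<bar>LINT y|M. wd 1 (snd u) y * resultant_q \<epsilon> f g 1 y\<bar>
   + \<bar>LINT y|M. wd 2 (snd u) y * resultant_q \<epsilon> f g 2 y\<bar>"
   unfolding load_eq[OF u] sum_2 la by linarith
  also have "\<dots> \<le> P * nm (comp u 1) + P * nm (comp u 2) + P * nm (snd u)
   + P * nm (wd 1 (snd u)) + P * nm (wd 2 (snd u))"
   by (intro add_mono cs le c2 s2 slope_L2 r u)
  also have "\<dots> = P * (nm (comp u 1) + nm (comp u 2) + (nm (snd u) + grad_norm (snd u)))"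
   by (simp add: grad_norm_def sum_2 algebra_simps)
  also have "\<dots> \<le> P * (nm (comp u 1) + nm (comp u 2) + full_norm (snd u))"
   using P0 hess_norm_nonneg[of "snd u"] by (intro mult_left_mono) (auto simp: full_norm_def)
  finally show ?thesis .
 qed
 thus ?thesis using P0 by blast
qed

section \<open>Coercivity\<close>

definition strain_norm where "strain_norm u = (\<Sum>i\<in>UNIV. \<Sum>j\<in>UNIV. nm (strain u i j))"

lemma strain_norm_nonneg: "0 \<le> strain_norm u" by (simp add: strain_norm_def sum_nonneg)

lemma hess_norm_eq: "hess_norm (snd u) = (\<Sum>i\<in>UNIV. \<Sum>j\<in>UNIV. nm (bending u i j))"
 by (simp add: hess_norm_def bending_def)

text \<open>The divergence of a field with zero trace integrates to zero, so the trace of the strain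
 controls the slopes.\<close>

lemma slope_bound: "\<exists>D\<ge>0. \<forall>u\<in>V. (grad_norm (snd u))^2 \<le> D * strain_norm u"
proof -
 let ?s = "sqrt (measure M (space M))"
 have "(grad_norm (snd u))^2 \<le> (4 * ?s) * strain_norm u" if u: "u \<in> V" for u
 proof -
  let ?w = "\<lambda>a. wd a (snd u)" and ?c = "\<lambda>a. wd a (comp u a)"
  have i: "integrable M (?c a)" "integrable M (\<lambda>y. (?w a y)^2)" "integrable M (strain u a a)" for a
   using L2_integrable[OF finite_measure_dom weak_partial_works(1)[OF V_D(4)[OF u]]] L2_square_integrable[OF slope_L2[OF u]]
    L2_integrable[OF finite_measure_dom strain_L2[OF u]] by auto
  have n: "(nm (?w a))^2 = 2 * (LINT y|M. strain u a a y)" for a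
  proof -
   have "strain u a a y = ?c a y + (?w a y)^2 / 2" for y by (simp add: strain_eq power2_eq_square)
   hence "(LINT y|M. strain u a a y) = (LINT y|M. ?c a y) + (LINT y|M. (?w a y)^2) / 2" using i by simp
   thus ?thesis using zero_trace_integral[OF V_D(1)[OF u], of a a] by (simp add: l2norm_power2)
  qed
  have b: "(LINT y|M. strain u a a y) \<le> ?s * nm (strain u a a)" for a
   using L1_le_l2norm[OF finite_measure_dom strain_L2[OF u], of a a] integral_abs_bound[of M "strain u a a"] by linarith
  have "(grad_norm (snd u))^2 \<le> 2 * ((nm (?w 1))^2 + (nm (?w 2))^2)"
   using zero_le_power2[of "nm (?w 1) - nm (?w 2)"] unfolding grad_norm_def sum_2 by (simp add: power2_eq_square algebra_simps)
  also have "\<dots> = 4 * ((LINT y|M. strain u 1 1 y) + (LINT y|M. strain u 2 2 y))" by (simp add: n)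
  also have "\<dots> \<le> 4 * (?s * nm (strain u 1 1) + ?s * nm (strain u 2 2))" by (intro mult_left_mono add_mono b) simp
  also have "\<dots> = (4 * ?s) * (nm (strain u 1 1) + nm (strain u 2 2))" by (simp add: algebra_simps)
  also have "\<dots> \<le> (4 * ?s) * strain_norm u" by (intro mult_left_mono) (auto simp: strain_norm_def sum_2)
  finally show ?thesis .
 qed
 thus ?thesis by (intro exI[of _ "4 * ?s"]) auto
qed

lemma bending_bound: "\<exists>C\<ge>0. \<forall>u\<in>V. full_norm (snd u) \<le> C * hess_norm (snd u)"
 using hessian_poincare[OF conn V3 ker] by auto

lemma slope_product_bound: "\<exists>C\<ge>0. \<forall>u\<in>V. \<forall>i j. nm (\<lambda>y. wd i (snd u) y * wd j (snd u) y)
  \<le> C * (grad_norm (snd u) * hess_norm (snd u))"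
proof -
 obtain K where K: "0 \<le> K" "\<And>u v i j. u \<in> V \<Longrightarrow> v \<in> V \<Longrightarrow> (\<lambda>y. wd i (snd u) y * wd j (snd v) y) \<in> L2 M"
  "\<And>u v i j. u \<in> V \<Longrightarrow> v \<in> V \<Longrightarrow> (nm (\<lambda>y. wd i (snd u) y * wd j (snd v) y))^2
   \<le> (K * (grad_norm (snd u) * full_norm (snd u))) * (K * (grad_norm (snd v) * full_norm (snd v)))"
  by (fact slope_product)
 obtain C where C: "0 \<le> C" "\<And>u. u \<in> V \<Longrightarrow> full_norm (snd u) \<le> C * hess_norm (snd u)" using bending_bound by blast
 have "nm (\<lambda>y. wd i (snd u) y * wd j (snd u) y) \<le> (K * C) * (grad_norm (snd u) * hess_norm (snd u))"
  if u: "u \<in> V" for u i j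
 proof -
  have "nm (\<lambda>y. wd i (snd u) y * wd j (snd u) y) \<le> K * (grad_norm (snd u) * full_norm (snd u))"
  proof (rule power2_le_imp_le)
   show "(nm (\<lambda>y. wd i (snd u) y * wd j (snd u) y))^2 \<le> (K * (grad_norm (snd u) * full_norm (snd u)))^2"
    unfolding power2_eq_square[of "K * (grad_norm (snd u) * full_norm (snd u))"] by (rule K(3)[OF u u])
  qed (intro mult_nonneg_nonneg K(1) grad_norm_nonneg full_norm_nonneg)
  also have "\<dots> \<le> K * (grad_norm (snd u) * (C * hess_norm (snd u)))"
   by (intro mult_left_mono C(2) u grad_norm_nonneg K(1))
  finally show ?thesis by (simp add: mult_ac)
 qed
 thus ?thesis using K(1) C(1) by (intro exI[of _ "K * C"]) auto
qed

text \<open>Passing from squares to norms uses that a sum of squares of nonnegative numbers is at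
  most the square of their sum.\<close>

lemma korn_norm:
 assumes v: "\<And>i. zero_trace (v i)"
 shows "nm (wd i (v j)) \<le> 2 * (\<Sum>k\<in>UNIV. \<Sum>l\<in>UNIV. nm (\<lambda>x. (wd k (v l) x + wd l (v k) x) / 2))"
  (is "_ \<le> 2 * (\<Sum>k\<in>UNIV. \<Sum>l\<in>UNIV. ?e k l)")
proof (rule power2_le_imp_le)
 have "(nm (wd i (v j)))^2 \<le> 4 * (\<Sum>k\<in>UNIV. \<Sum>l\<in>UNIV. (?e k l)^2)" by (rule korn[of v, OF v])
 also have "(\<Sum>k\<in>UNIV. \<Sum>l\<in>UNIV. (?e k l)^2) \<le> (\<Sum>k\<in>UNIV. \<Sum>l\<in>UNIV. ?e k l)^2"
  unfolding sum_2 by (simp add: power2_eq_square algebra_simps add_nonneg_nonneg)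
 finally show "(nm (wd i (v j)))^2 \<le> (2 * (\<Sum>k\<in>UNIV. \<Sum>l\<in>UNIV. ?e k l))^2"
  by (simp add: power_mult_distrib)
 show "0 \<le> 2 * (\<Sum>k\<in>UNIV. \<Sum>l\<in>UNIV. ?e k l)" by (simp add: sum_nonneg)
qed

text \<open>Korn's inequality acts on the symmetric gradient, which is the strain minus half a
  product of slopes; the Poincare inequality passes from gradients to the displacement.\<close>

lemma membrane_bound: "\<exists>D\<ge>0. \<forall>u\<in>V. \<forall>j. nm (comp u j) \<le> D * (strain_norm u + grad_norm (snd u) * hess_norm (snd u))"
proof -
 obtain C where C: "0 \<le> C" "\<And>u i j. u \<in> V \<Longrightarrow> nm (\<lambda>y. wd i (snd u) y * wd j (snd u) y)
  \<le> C * (grad_norm (snd u) * hess_norm (snd u))" using slope_product_bound by blast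
 obtain P where P: "0 \<le> P" "\<And>u. zero_trace u \<Longrightarrow> nm u \<le> P * nm (wd 1 u)"
  using zero_trace_poincare by blast
 \<comment> \<open>The Korn factor 2 meets four entries, each with half of the bound
   \<open>C\<close> on slope products.\<close>
 let ?D = "2 + 4 * C"
 have 1: "nm (wd i (comp u j)) \<le> ?D * (strain_norm u + grad_norm (snd u) * hess_norm (snd u))" if u: "u \<in> V" for u i j
 proof -
  let ?w = "\<lambda>i. wd i (snd u)" and ?GY = "grad_norm (snd u) * hess_norm (snd u)"
  let ?e = "\<lambda>k l x. (wd k (comp u l) x + wd l (comp u k) x) / 2"
  have e: "nm (?e k l) \<le> nm (strain u k l) + C * ?GY / 2" for k l
  proof -
   have "?e k l = (\<lambda>x. strain u k l x - 1/2 * (?w k x * ?w l x))" by (simp add: strain_eq fun_eq_iff)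
   hence "nm (?e k l) \<le> nm (strain u k l) + nm (\<lambda>x. 1/2 * (?w k x * ?w l x))"
    using l2norm_diff_le[OF strain_L2[OF u] L2_scale[OF slope_product_L2[OF u]], of k l "1/2" k l] by simp
   also have "nm (\<lambda>x. 1/2 * (?w k x * ?w l x)) \<le> C * ?GY / 2" unfolding l2norm_scale using C(2)[OF u, of k l] by simp
   finally show ?thesis by simp
  qed
  have "nm (wd i (comp u j)) \<le> 2 * (\<Sum>k\<in>UNIV. \<Sum>l\<in>UNIV. nm (?e k l))"
   by (rule korn_norm) (rule V_D(1)[OF u])
  also have "\<dots> \<le> 2 * (\<Sum>k\<in>UNIV. \<Sum>l\<in>UNIV. nm (strain u k l) + C * ?GY / 2)"
   by (intro mult_left_mono sum_mono e) simp
  also have "\<dots> = 2 * strain_norm u + 4 * C * ?GY" by (simp add: strain_norm_def sum_2)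
  also have "\<dots> \<le> ?D * (strain_norm u + ?GY)"
   using C(1) strain_norm_nonneg[of u] grad_norm_nonneg[of "snd u"] hess_norm_nonneg[of "snd u"] by (simp add: algebra_simps)
  finally show ?thesis .
 qed
 have "nm (comp u j) \<le> P * ?D * (strain_norm u + grad_norm (snd u) * hess_norm (snd u))" if u: "u \<in> V" for u j
 proof -
  have "nm (comp u j) \<le> P * nm (wd 1 (comp u j))" by (rule P(2)[OF V_D(1)[OF u]])
  also have "\<dots> \<le> P * (?D * (strain_norm u + grad_norm (snd u) * hess_norm (snd u)))" by (intro mult_left_mono 1 u P(1))
  finally show ?thesis by (simp add: mult.assoc)
 qed
 thus ?thesis using P(1) C(1) by (intro exI[of _ "P * ?D"]) auto
qed

text \<open>Young's inequality is used with weights in \<open>c\<close>. Of \<open>c * Y^2\<close>,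
  one half absorbs the product of slopes and Hessian and one quarter the linear term in
  \<open>Y\<close>; half of \<open>c * X^2\<close> absorbs the linear term in
  \<open>X\<close>.\<close>

lemma coercive: "\<exists>c>0. \<exists>C. \<forall>u\<in>V. c * ((strain_norm u)^2 + (hess_norm (snd u))^2) \<le> energy u + C"
proof -
 obtain P where P: "0 \<le> P" "\<And>u. u \<in> V \<Longrightarrow> \<bar>total_load u\<bar> \<le> P * (nm (comp u 1) + nm (comp u 2) + full_norm (snd u))"
  using load_bound by blast
 obtain D where D: "0 \<le> D" "\<And>u. u \<in> V \<Longrightarrow> (grad_norm (snd u))^2 \<le> D * strain_norm u" using slope_bound by blast
 obtain B where B: "0 \<le> B" "\<And>u. u \<in> V \<Longrightarrow> full_norm (snd u) \<le> B * hess_norm (snd u)" using bending_bound by blast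
 obtain K where K: "0 \<le> K" "\<And>u j. u \<in> V \<Longrightarrow> nm (comp u j) \<le> K * (strain_norm u + grad_norm (snd u) * hess_norm (snd u))"
  using membrane_bound by blast
 \<comment> \<open>The 4 in \<open>elastic_ge\<close> cancels the 4 lost in squaring a sum of four
   norms.\<close>
 define c where "c = min (\<epsilon> * \<mu> / 2) (\<epsilon> ^ 3 * \<mu> / 6)"
 have c: "c > 0" using eps mu by (simp add: c_def)
 define T where "T = P * (2 * K + B)"
 have T: "0 \<le> T" using P(1) K(1) B(1) by (simp add: T_def)
 \<comment> \<open>Collects the direct term \<open>T * X\<close> and what Young's inequality leaves
   of the squared slope norm, which is linear in the strain.\<close>
 define U where "U = T + T^2 * D / (2 * c)"
 have "c / 4 * ((strain_norm u)^2 + (hess_norm (snd u))^2) \<le> energy u + (U^2 / (2 * c) + T^2 / c)" if u: "u \<in> V" for u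
 proof -
  let ?X = "strain_norm u" and ?Y = "hess_norm (snd u)" and ?G = "grad_norm (snd u)"
  note nn = strain_norm_nonneg[of u] hess_norm_nonneg[of "snd u"] grad_norm_nonneg[of "snd u"]
  have X: "c * ?X^2 \<le> \<epsilon> / 2 * elastic (strain u)"
  proof -
   have "c * ?X^2 \<le> (\<epsilon> * \<mu> / 2) * ?X^2" by (intro mult_right_mono) (auto simp: c_def)
   also have "\<dots> \<le> (\<epsilon> * \<mu> / 2) * (4 * (\<Sum>i\<in>UNIV. \<Sum>j\<in>UNIV. (nm (strain u i j))^2))"
    unfolding strain_norm_def using eps mu by (intro mult_left_mono double_sum_square_le) auto
   also have "\<dots> = \<epsilon> / 2 * (4 * \<mu> * (\<Sum>i\<in>UNIV. \<Sum>j\<in>UNIV. (nm (strain u i j))^2))" by simp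
   also have "\<dots> \<le> \<epsilon> / 2 * elastic (strain u)" using eps by (intro mult_left_mono elastic_ge) auto
   finally show ?thesis .
  qed
  have Y: "c * ?Y^2 \<le> \<epsilon> ^ 3 / 6 * elastic (bending u)"
  proof -
   have "c * ?Y^2 \<le> (\<epsilon> ^ 3 * \<mu> / 6) * ?Y^2" by (intro mult_right_mono) (auto simp: c_def)
   also have "\<dots> \<le> (\<epsilon> ^ 3 * \<mu> / 6) * (4 * (\<Sum>i\<in>UNIV. \<Sum>j\<in>UNIV. (nm (bending u i j))^2))"
    unfolding hess_norm_eq using eps mu by (intro mult_left_mono double_sum_square_le) auto
   also have "\<dots> = \<epsilon> ^ 3 / 6 * (4 * \<mu> * (\<Sum>i\<in>UNIV. \<Sum>j\<in>UNIV. (nm (bending u i j))^2))" by simp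
   also have "\<dots> \<le> \<epsilon> ^ 3 / 6 * elastic (bending u)" using eps by (intro mult_left_mono elastic_ge) auto
   finally show ?thesis .
  qed
  have "\<bar>total_load u\<bar> \<le> P * (K * (?X + ?G * ?Y) + K * (?X + ?G * ?Y) + B * ?Y)"
   using P(1) by (intro order_trans[OF P(2)[OF u]] mult_left_mono add_mono K(2) B(2) u)
  also have "\<dots> \<le> P * ((2 * K + B) * (?X + ?G * ?Y) + (2 * K + B) * ?Y)"
  proof (intro mult_left_mono P(1))
   have "0 \<le> B * (?X + ?G * ?Y)" "0 \<le> 2 * K * ?Y" using B(1) K(1) nn by auto
   thus "K * (?X + ?G * ?Y) + K * (?X + ?G * ?Y) + B * ?Y \<le> (2 * K + B) * (?X + ?G * ?Y) + (2 * K + B) * ?Y"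
    by (simp add: algebra_simps)
  qed
  also have "\<dots> = T * ?X + T * (?G * ?Y) + T * ?Y" by (simp add: T_def algebra_simps)
  also have "T * (?G * ?Y) \<le> c / 2 * ?Y^2 + T^2 / (2 * c) * ?G^2"
  proof -
   have "0 \<le> (c * ?Y - T * ?G)^2 / (2 * c)" using c by simp
   also have "\<dots> = c / 2 * ?Y^2 + T^2 / (2 * c) * ?G^2 - T * (?G * ?Y)" using c by (simp add: field_simps power2_eq_square)
   finally show ?thesis by simp
  qed
  also have "T^2 / (2 * c) * ?G^2 \<le> T^2 / (2 * c) * (D * ?X)" using c by (intro mult_left_mono D(2) u) auto
  finally have L: "\<bar>total_load u\<bar> \<le> U * ?X + c / 2 * ?Y^2 + T * ?Y" by (simp add: U_def algebra_simps)
  have a1: "U * ?X \<le> c / 2 * ?X^2 + U^2 / (2 * c)"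
  proof -
   have "0 \<le> (c * ?X - U)^2 / (2 * c)" using c by simp
   also have "\<dots> = c / 2 * ?X^2 + U^2 / (2 * c) - U * ?X" using c by (simp add: field_simps power2_eq_square)
   finally show ?thesis by simp
  qed
  have a2: "T * ?Y \<le> c / 4 * ?Y^2 + T^2 / c"
  proof -
   have "0 \<le> (c * ?Y - 2 * T)^2 / (4 * c)" using c by simp
   also have "\<dots> = c / 4 * ?Y^2 + T^2 / c - T * ?Y" using c by (simp add: field_simps power2_eq_square)
   finally show ?thesis by simp
  qed
  have a3: "0 \<le> c / 4 * ?X^2" using c by simp
  have "c / 4 * (?X^2 + ?Y^2) = c / 4 * ?X^2 + c / 4 * ?Y^2" by (rule distrib_left)
  thus ?thesis unfolding energy_eq[OF u] using X Y L a1 a2 a3 by linarith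
 qed
 thus ?thesis using c by (intro exI[of _ "c/4"] conjI exI[of _ "U^2 / (2 * c) + T^2 / c"]) auto
qed

end

section \<open>Minimizing sequences\<close>

text \<open>The parallelogram law for the exact midpoint of \<open>a\<close> and \<open>b\<close>.
  The perturbation \<open>k\<close> stands for the part of a midpoint strain that is not affine, and
  costs \<open>2 * R * q + q^2\<close>.\<close>

lemma l2norm_midpoint:
 assumes a: "a \<in> L2 M" and b: "b \<in> L2 M" and k: "k \<in> L2 M" and c: "c \<in> L2 M" "AE x in M. c x = 1/2 * a x + 1/2 * b x - k x"
  and R: "l2norm M a \<le> R" "l2norm M b \<le> R" and q: "l2norm M k \<le> q"
 shows "(l2norm M c)^2 \<le> (l2norm M a)^2 / 2 + (l2norm M b)^2 / 2 - (l2norm M (\<lambda>x. a x - b x))^2 / 4 + (2 * R * q + q^2)"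
proof -
 let ?h = "\<lambda>x. 1/2 * a x + 1/2 * b x"
 have h: "?h \<in> L2 M" by (intro L2_add L2_scale a b)
 have "l2norm M c = l2norm M (\<lambda>x. ?h x - k x)" by (intro l2norm_cong_AE L2_measurable[OF c(1)] L2_measurable[OF L2_diff[OF h k]] c(2))
 also have "\<dots> \<le> l2norm M ?h + q" using l2norm_diff_le[OF h k] q by linarith
 finally have "(l2norm M c)^2 \<le> (l2norm M ?h + q)^2" by (intro power_mono) auto
 also have "\<dots> = (l2norm M ?h)^2 + (2 * l2norm M ?h * q + q^2)" by (simp add: power2_sum algebra_simps)
 also have "l2norm M ?h \<le> R"
  using l2norm_triangle[OF L2_scale[OF a] L2_scale[OF b], of "1/2" "1/2"] R unfolding l2norm_scale by simp
 hence "2 * l2norm M ?h * q \<le> 2 * R * q" using q l2norm_nonneg[of M k] by (intro mult_right_mono) (auto simp del: l2norm_nonneg)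
 hence "(l2norm M ?h)^2 + (2 * l2norm M ?h * q + q^2) \<le> (l2norm M ?h)^2 + (2 * R * q + q^2)" by simp
 also have "(l2norm M ?h)^2 = (l2norm M a)^2 / 2 + (l2norm M b)^2 / 2 - (l2norm M (\<lambda>x. a x - b x))^2 / 4"
 proof -
  note i = L2_square_integrable[OF a] L2_square_integrable[OF b] L2_square_integrable[OF L2_diff[OF a b]]
  have "(?h x)^2 = (a x)^2 / 2 + (b x)^2 / 2 - (a x - b x)^2 / 4" for x by (simp add: power2_eq_square field_simps)
  thus ?thesis unfolding l2norm_power2 using i by simp
 qed
 finally show ?thesis by simp
qed

text \<open>Two indices tending to infinity independently: a Cauchy sequence is one whose distances
  tend to zero along this filter, and limit rules apply to it.\<close>

abbreviation "seq2 \<equiv> (sequentially :: nat filter) \<times>\<^sub>F (sequentially :: nat filter)"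

lemma prod_sequentially_tendsto_zero:
 fixes f :: "nat \<Rightarrow> nat \<Rightarrow> real"
 shows "((\<lambda>p. f (fst p) (snd p)) \<longlongrightarrow> 0) seq2 \<longleftrightarrow> (\<forall>e>0. \<exists>N. \<forall>m\<ge>N. \<forall>n\<ge>N. \<bar>f m n\<bar> < e)"
 by (simp add: tendsto_iff eventually_prod_sequentially dist_real_def) blast

section \<open>Linear combinations and midpoints\<close>

context plate
begin

definition mix :: "real \<Rightarrow> displacement \<Rightarrow> real \<Rightarrow> displacement \<Rightarrow> displacement" where
 "mix a u b v = (\<lambda>y. a *\<^sub>R fst u y + b *\<^sub>R fst v y, \<lambda>y. a * snd u y + b * snd v y)"

abbreviation dif where "dif u v \<equiv> mix 1 u (-1) v"

lemma mix_V: "u \<in> V \<Longrightarrow> v \<in> V \<Longrightarrow> mix a u b v \<in> V"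
 using VH V3 unfolding closed_subspace_of_def mix_def by auto

lemma comp_mix: "comp (mix a u b v) i = (\<lambda>y. a * comp u i y + b * comp v i y)"
 by (simp add: mix_def)

lemma snd_mix: "snd (mix a u b v) = (\<lambda>y. a * snd u y + b * snd v y)"
 by (simp add: mix_def)

lemma mix_AE:
 assumes "u \<in> V" "v \<in> V"
 shows "AE y in M. wd i (comp (mix a u b v) j) y = a * wd i (comp u j) y + b * wd i (comp v j) y"
  "AE y in M. wd i (snd (mix a u b v)) y = a * wd i (snd u) y + b * wd i (snd v) y"
  "AE y in M. bending (mix a u b v) i j y = a * bending u i j y + b * bending v i j y"
 unfolding comp_mix snd_mix bending_def
 by (intro H1_combination(2) H2_combination(2) V_D(4) V_D(2) H2_H1(1) assms)+

text \<open>A polarization identity: half a product of slopes, taken at the midpoint, falls short of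
  its average by one eighth of the product of the slope differences.\<close>

lemma mix_strain:
 assumes u: "u \<in> V" and v: "v \<in> V"
 shows "AE y in M. strain (mix (1/2) u (1/2) v) i j y = 1/2 * strain u i j y + 1/2 * strain v i j y
  - 1/8 * (wd i (snd (dif u v)) y * wd j (snd (dif u v)) y)"
proof -
 show ?thesis
 using mix_AE(1)[OF u v, of i "1/2" "1/2" j] mix_AE(1)[OF u v, of j "1/2" "1/2" i]
  mix_AE(2)[OF u v, of i "1/2" "1/2"] mix_AE(2)[OF u v, of j "1/2" "1/2"]
  mix_AE(2)[OF u v, of i 1 "-1"] mix_AE(2)[OF u v, of j 1 "-1"]
 proof eventually_elim
  case (elim y)
  show ?case unfolding strain_eq elim by (simp add: field_simps)
 qed
qed

text \<open>The difference of two products is written as two products, each with one factor a slope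
  difference, which is the small factor later.\<close>

lemma strain_diff:
 assumes u: "u \<in> V" and v: "v \<in> V"
 shows "AE y in M. strain u i j y - strain v i j y
  = (wd i (comp (dif u v) j) y + wd j (comp (dif u v) i) y) / 2
  + 1/2 * (wd i (snd (dif u v)) y * wd j (snd u) y
    + wd j (snd (dif u v)) y * wd i (snd v) y)"
proof -
 show ?thesis
 using mix_AE(1)[OF u v, of i 1 "-1" j] mix_AE(1)[OF u v, of j 1 "-1" i]
  mix_AE(2)[OF u v, of i 1 "-1"] mix_AE(2)[OF u v, of j 1 "-1"]
 proof eventually_elim
  case (elim y)
  show ?case unfolding strain_eq elim by (simp add: field_simps)
 qed
qed

lemma load_mix:
 assumes u: "u \<in> V" and v: "v \<in> V"
 shows "total_load (mix a u b v) = a * total_load u + b * total_load v"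
proof -
 note r = resultant_L2[OF eps vol surf]
 have lin: "(LINT y|M. w y * h y) = a * (LINT y|M. x y * h y) + b * (LINT y|M. z y * h y)"
  if "x \<in> L2 M" "z \<in> L2 M" "h \<in> L2 M" "w \<in> L2 M" "AE y in M. w y = a * x y + b * z y" for w x z h
 proof -
  have "(LINT y|M. w y * h y) = (LINT y|M. a * (x y * h y) + b * (z y * h y))"
  proof (rule integral_cong_AE)
   show "AE y in M. w y * h y = a * (x y * h y) + b * (z y * h y)" using that(5) by eventually_elim (simp add: algebra_simps)
  qed (use that(1-4)[THEN L2_measurable] in measurable)
  also have "\<dots> = a * (LINT y|M. x y * h y) + b * (LINT y|M. z y * h y)"
   using L2_mult_integrable[OF that(1,3)] L2_mult_integrable[OF that(2,3)] by simp
  finally show ?thesis .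
 qed
 note c2 = H1_L2[OF V_D(4)] and s2 = H1_L2[OF H2_H1(1)[OF V_D(2)]]
 note w = mix_V[OF u v, of a b]
 have 1: "(LINT y|M. comp (mix a u b v) p y * resultant_p \<epsilon> f g i y) = a * (LINT y|M. comp u p y * resultant_p \<epsilon> f g i y) + b * (LINT y|M. comp v p y * resultant_p \<epsilon> f g i y)" for p i
  by (intro lin c2 u v w r) (simp add: mix_def)
 have 2: "(LINT y|M. snd (mix a u b v) y * resultant_p \<epsilon> f g 3 y) = a * (LINT y|M. snd u y * resultant_p \<epsilon> f g 3 y) + b * (LINT y|M. snd v y * resultant_p \<epsilon> f g 3 y)"
  by (intro lin s2 u v w r) (simp add: snd_mix)
 have 3: "(LINT y|M. wd p (snd (mix a u b v)) y * resultant_q \<epsilon> f g p y) = a * (LINT y|M. wd p (snd u) y * resultant_q \<epsilon> f g p y) + b * (LINT y|M. wd p (snd v) y * resultant_q \<epsilon> f g p y)" for p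
  by (intro lin slope_L2 u v w r mix_AE(2))
 show ?thesis unfolding load_eq[OF u] load_eq[OF v] load_eq[OF w] 1 2 3 by (simp add: sum_2 algebra_simps)
qed

text \<open>An asymmetric form of the product bound: only the first displacement, later a
  difference, contributes its slope norm.\<close>

lemma mixed_product:
 obtains K where "0 \<le> K" "\<And>u v i j. u \<in> V \<Longrightarrow> v \<in> V \<Longrightarrow> (\<lambda>y. wd i (snd u) y * wd j (snd v) y) \<in> L2 M"
  "\<And>u v i j. u \<in> V \<Longrightarrow> v \<in> V \<Longrightarrow> nm (\<lambda>y. wd i (snd u) y * wd j (snd v) y)
   \<le> K * (sqrt (grad_norm (snd u) * full_norm (snd u)) * full_norm (snd v))"
proof -
 obtain K where K: "0 \<le> K" "\<And>u v i j. u \<in> V \<Longrightarrow> v \<in> V \<Longrightarrow> (\<lambda>y. wd i (snd u) y * wd j (snd v) y) \<in> L2 M"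
  "\<And>u v i j. u \<in> V \<Longrightarrow> v \<in> V \<Longrightarrow> (nm (\<lambda>y. wd i (snd u) y * wd j (snd v) y))^2
   \<le> (K * (grad_norm (snd u) * full_norm (snd u))) * (K * (grad_norm (snd v) * full_norm (snd v)))"
  by (fact slope_product)
 show ?thesis
 proof (rule that[OF K(1,2)])
  fix u v i j assume u: "u \<in> V" and v: "v \<in> V"
  let ?a = "grad_norm (snd u) * full_norm (snd u)" and ?b = "full_norm (snd v)"
  have a0: "0 \<le> ?a" using grad_norm_nonneg full_norm_nonneg by simp
  have "grad_norm (snd v) \<le> ?b" by (simp add: full_norm_def hess_norm_nonneg)
  hence "(K * ?a) * (K * (grad_norm (snd v) * ?b)) \<le> (K * ?a) * (K * (?b * ?b))"
   using K(1) a0 full_norm_nonneg by (intro mult_left_mono mult_right_mono) auto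
  note order_trans[OF K(3)[OF u v] this]
  also have "\<dots> = (K * (sqrt ?a * ?b))^2" using a0 by (simp add: power_mult_distrib power2_eq_square mult_ac)
  finally show "nm (\<lambda>y. wd i (snd u) y * wd j (snd v) y) \<le> K * (sqrt ?a * ?b)"
   by (rule power2_le_imp_le) (use K(1) a0 full_norm_nonneg in simp)
 qed
qed

text \<open>The parallelogram law for each entry and for the trace, where the gain is dropped.
  Entries of \<open>k\<close> are bounded by \<open>q / 2\<close> so that the trace of
  \<open>k\<close> is bounded by \<open>q\<close>; the error enters once for the trace and, with
  weight \<open>4 * \<mu>\<close>, once for each of the four entries.\<close>

lemma elastic_midpoint:
 assumes S: "\<And>i j. S i j \<in> L2 M" and T: "\<And>i j. T i j \<in> L2 M" and U: "\<And>i j. U i j \<in> L2 M"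
  and k: "\<And>i j. k i j \<in> L2 M" "\<And>i j. nm (k i j) \<le> q / 2"
  and mid: "\<And>i j. AE y in M. U i j y = 1/2 * S i j y + 1/2 * T i j y - k i j y"
  and R: "(\<Sum>i\<in>UNIV. \<Sum>j\<in>UNIV. nm (S i j)) \<le> R" "(\<Sum>i\<in>UNIV. \<Sum>j\<in>UNIV. nm (T i j)) \<le> R"
 shows "elastic U \<le> elastic S / 2 + elastic T / 2
  - \<mu> * (\<Sum>i\<in>UNIV. \<Sum>j\<in>UNIV. (nm (\<lambda>y. S i j y - T i j y))^2)
  + (4 * lam * \<mu> / (lam + 2 * \<mu>) + 16 * \<mu>) * (2 * R * q + q^2)"
proof -
 define A where "A = 4 * lam * \<mu> / (lam + 2 * \<mu>)"
 have A: "0 \<le> A" using lam mu by (simp add: A_def)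
 define r where "r = 2 * R * q + q^2"
 have q: "0 \<le> q" using order_trans[OF l2norm_nonneg k(2)[of 1 1]] by simp
 have n: "nm (W i j) \<le> R" "nm (\<lambda>y. W 1 1 y + W 2 2 y) \<le> R"
  if W: "\<And>i j. W i j \<in> L2 M" "(\<Sum>i\<in>UNIV. \<Sum>j\<in>UNIV. nm (W i j)) \<le> R" for W :: "2 \<Rightarrow> 2 \<Rightarrow> real^2 \<Rightarrow> real" and i j
 proof -
  have "0 \<le> nm (W i j)" for i j by simp
  note nn = this[of 1 1] this[of 1 2] this[of 2 1] this[of 2 2]
  show "nm (W i j) \<le> R" using W(2) nn exhaust_2[of i] exhaust_2[of j] unfolding sum_2 by (elim disjE; simp only:)
  show "nm (\<lambda>y. W 1 1 y + W 2 2 y) \<le> R"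
   using l2norm_triangle[OF W(1)[of 1 1] W(1)[of 2 2]] W(2) nn unfolding sum_2 by linarith
 qed
 have 1: "(nm (U i j))^2 \<le> (nm (S i j))^2 / 2 + (nm (T i j))^2 / 2
   - (nm (\<lambda>y. S i j y - T i j y))^2 / 4 + r" for i j
  unfolding r_def using k(2)[of i j] q by (intro l2norm_midpoint[OF S T k(1) U mid] n S T R) simp
 have "(nm (\<lambda>y. U 1 1 y + U 2 2 y))^2 \<le> (nm (\<lambda>y. S 1 1 y + S 2 2 y))^2 / 2
   + (nm (\<lambda>y. T 1 1 y + T 2 2 y))^2 / 2
   - (nm (\<lambda>y. (S 1 1 y + S 2 2 y) - (T 1 1 y + T 2 2 y)))^2 / 4 + (2 * R * q + q^2)"
 proof (rule l2norm_midpoint)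
  show "AE y in M. U 1 1 y + U 2 2 y = 1/2 * (S 1 1 y + S 2 2 y) + 1/2 * (T 1 1 y + T 2 2 y) - (k 1 1 y + k 2 2 y)"
   using mid[of 1 1] mid[of 2 2] by eventually_elim (simp add: algebra_simps)
  show "nm (\<lambda>y. k 1 1 y + k 2 2 y) \<le> q" using l2norm_triangle[OF k(1)[of 1 1] k(1)[of 2 2]] k(2)[of 1 1] k(2)[of 2 2] by linarith
 qed (intro L2_add S T U k n R)+
 moreover have "0 \<le> (nm (\<lambda>y. (S 1 1 y + S 2 2 y) - (T 1 1 y + T 2 2 y)))^2 / 4" by simp
 ultimately have "(nm (\<lambda>y. U 1 1 y + U 2 2 y))^2 \<le> (nm (\<lambda>y. S 1 1 y + S 2 2 y))^2 / 2
   + (nm (\<lambda>y. T 1 1 y + T 2 2 y))^2 / 2 + r" unfolding r_def by linarith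
 hence "A * (nm (\<lambda>y. U 1 1 y + U 2 2 y))^2 \<le> A * ((nm (\<lambda>y. S 1 1 y + S 2 2 y))^2 / 2
   + (nm (\<lambda>y. T 1 1 y + T 2 2 y))^2 / 2 + r)" using A by (rule mult_left_mono)
 moreover have "4 * \<mu> * (\<Sum>i\<in>UNIV. \<Sum>j\<in>UNIV. (nm (U i j))^2)
  \<le> 4 * \<mu> * (\<Sum>i\<in>UNIV. \<Sum>j\<in>UNIV. (nm (S i j))^2 / 2 + (nm (T i j))^2 / 2
   - (nm (\<lambda>y. S i j y - T i j y))^2 / 4 + r)"
  using mu by (intro mult_left_mono sum_mono 1) auto
 ultimately show ?thesis
  unfolding elastic_def A_def[symmetric] r_def[symmetric] sum_2 by (simp add: algebra_simps add_divide_distrib)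
qed

text \<open>The membrane strain is affine along segments up to a product of slope differences, so the
 energy is uniformly convex up to an error that vanishes for strongly convergent slopes.\<close>

lemma energy_midpoint:
 assumes u: "u \<in> V" and v: "v \<in> V" and R: "strain_norm u \<le> R" "strain_norm v \<le> R"
  and k: "\<And>i j. nm (\<lambda>y. wd i (snd (dif u v)) y * wd j (snd (dif u v)) y) \<le> k"
  and low: "\<And>w. w \<in> V \<Longrightarrow> m \<le> energy w"
 shows "\<epsilon> / 2 * \<mu> * (\<Sum>i\<in>UNIV. \<Sum>j\<in>UNIV. (nm (\<lambda>y. strain u i j y - strain v i j y))^2)
  + \<epsilon> ^ 3 / 6 * \<mu> * (\<Sum>i\<in>UNIV. \<Sum>j\<in>UNIV. (nm (\<lambda>y. bending u i j y - bending v i j y))^2)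
  \<le> (energy u - m) / 2 + (energy v - m) / 2 + \<epsilon> / 2 * ((4 * lam * \<mu> / (lam + 2 * \<mu>) + 16 * \<mu>) * (2 * R * k + k^2))"
proof -
 let ?s = "\<mu> * (\<Sum>i\<in>UNIV. \<Sum>j\<in>UNIV. (nm (\<lambda>y. strain u i j y - strain v i j y))^2)"
 let ?b = "\<mu> * (\<Sum>i\<in>UNIV. \<Sum>j\<in>UNIV. (nm (\<lambda>y. bending u i j y - bending v i j y))^2)"
 let ?c = "(4 * lam * \<mu> / (lam + 2 * \<mu>) + 16 * \<mu>) * (2 * R * k + k^2)"
 let ?m = "mix (1/2) u (1/2) v"
 note mV = mix_V[OF u v, of "1/2" "1/2"]
 have 1: "elastic (strain ?m) \<le> elastic (strain u) / 2 + elastic (strain v) / 2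
  - ?s
  + ?c"
 proof (rule elastic_midpoint[OF _ _ _ _ _ mix_strain[OF u v]])
  fix i j
  have "0 \<le> k" using k[of 1 1] l2norm_nonneg order_trans by blast
  thus "nm (\<lambda>y. 1/8 * (wd i (snd (dif u v)) y * wd j (snd (dif u v)) y)) \<le> k / 2"
   unfolding l2norm_scale using k[of i j] by simp
 qed (intro L2_scale slope_product_L2 mix_V strain_L2 u v mV R[unfolded strain_norm_def])+
 \<comment> \<open>Bending is linear in the displacement, so the perturbation and its error term are
   zero.\<close>
 have 2: "elastic (bending ?m) \<le> elastic (bending u) / 2 + elastic (bending v) / 2
  - ?b"
  using elastic_midpoint[of "bending u" "bending v" "bending ?m" "\<lambda>_ _ _. 0" 0 "hess_norm (snd u) + hess_norm (snd v)",
    OF bending_L2[OF u] bending_L2[OF v] bending_L2[OF mV] L2_zero]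
   mix_AE(3)[OF u v, of "1/2" "1/2"] by (simp add: hess_norm_eq sum_nonneg)
 have "m \<le> energy ?m" by (rule low[OF mV])
 also have "energy ?m = \<epsilon> / 2 * elastic (strain ?m) + \<epsilon> ^ 3 / 6 * elastic (bending ?m) - (total_load u / 2 + total_load v / 2)"
  unfolding energy_eq[OF mV] load_mix[OF u v] by simp
 also have "\<dots> \<le> \<epsilon> / 2 * (elastic (strain u) / 2 + elastic (strain v) / 2
  - ?s
  + ?c)
  + \<epsilon> ^ 3 / 6 * (elastic (bending u) / 2 + elastic (bending v) / 2
  - ?b)
  - (total_load u / 2 + total_load v / 2)"
  using eps by (intro diff_right_mono add_mono mult_left_mono 1 2) auto
 finally show ?thesis unfolding energy_eq[OF u] energy_eq[OF v] by (simp add: algebra_simps add_divide_distrib diff_divide_distrib)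
qed

lemma diff_norms:
 assumes u: "u \<in> V" and v: "v \<in> V"
 shows "nm (comp (dif u v) j) = nm (\<lambda>y. comp u j y - comp v j y)"
  "nm (wd i (comp (dif u v) j)) = nm (\<lambda>y. wd i (comp u j) y - wd i (comp v j) y)"
  "nm (snd (dif u v)) = nm (\<lambda>y. snd u y - snd v y)"
  "nm (wd i (snd (dif u v))) = nm (\<lambda>y. wd i (snd u) y - wd i (snd v) y)"
  "nm (bending (dif u v) i j) = nm (\<lambda>y. bending u i j y - bending v i j y)"
proof -
 note d = mix_V[OF u v, of 1 "-1"]
 show "nm (comp (dif u v) j) = nm (\<lambda>y. comp u j y - comp v j y)" by (simp add: mix_def)
 show "nm (snd (dif u v)) = nm (\<lambda>y. snd u y - snd v y)" by (simp add: mix_def)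
 have w: "wd i (comp u j) \<in> L2 M" if "u \<in> V" for u by (intro weak_partial_works(1) V_D(4) that)
 show "nm (wd i (comp (dif u v) j)) = nm (\<lambda>y. wd i (comp u j) y - wd i (comp v j) y)"
 proof (rule l2norm_cong_AE[OF L2_measurable[OF w[OF d]] L2_measurable[OF L2_diff[OF w[OF u] w[OF v]]]])
  show "AE y in M. wd i (comp (dif u v) j) y = wd i (comp u j) y - wd i (comp v j) y"
   using mix_AE(1)[OF u v, of i 1 "-1" j] by eventually_elim simp
 qed
 show "nm (wd i (snd (dif u v))) = nm (\<lambda>y. wd i (snd u) y - wd i (snd v) y)"
 proof (rule l2norm_cong_AE[OF L2_measurable[OF slope_L2[OF d]] L2_measurable[OF L2_diff[OF slope_L2[OF u] slope_L2[OF v]]]])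
  show "AE y in M. wd i (snd (dif u v)) y = wd i (snd u) y - wd i (snd v) y"
   using mix_AE(2)[OF u v, of i 1 "-1"] by eventually_elim simp
 qed
 show "nm (bending (dif u v) i j) = nm (\<lambda>y. bending u i j y - bending v i j y)"
 proof (rule l2norm_cong_AE[OF L2_measurable[OF bending_L2[OF d]] L2_measurable[OF L2_diff[OF bending_L2[OF u] bending_L2[OF v]]]])
  show "AE y in M. bending (dif u v) i j y = bending u i j y - bending v i j y"
   using mix_AE(3)[OF u v, of 1 "-1" i j] by eventually_elim simp
 qed
qed

lemma hess_norm_diff_le:
 assumes u: "u \<in> V" and v: "v \<in> V"
 shows "hess_norm (snd (dif u v)) \<le> hess_norm (snd u) + hess_norm (snd v)"
 unfolding hess_norm_eq diff_norms(5)[OF u v] sum.distrib[symmetric]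
 by (intro sum_mono l2norm_diff_le bending_L2 u v)

text \<open>The two-sided form serves both directions: from strains to symmetric gradients, and so
  to Korn's inequality, in the Cauchy argument, and from gradients to strains in the continuity of
  the energy.\<close>

lemma strain_diff_bound:
 obtains K where "0 \<le> K"
  "\<And>u v B i j. u \<in> V \<Longrightarrow> v \<in> V \<Longrightarrow> full_norm (snd u) \<le> B \<Longrightarrow> full_norm (snd v) \<le> B \<Longrightarrow>
   \<bar>nm (\<lambda>y. strain u i j y - strain v i j y)
    - nm (\<lambda>y. (wd i (comp (dif u v) j) y + wd j (comp (dif u v) i) y) / 2)\<bar>
   \<le> K * (sqrt (grad_norm (snd (dif u v)) * full_norm (snd (dif u v))) * B)"
proof -
 obtain K where K: "0 \<le> K" "\<And>u v i j. u \<in> V \<Longrightarrow> v \<in> V \<Longrightarrow> (\<lambda>y. wd i (snd u) y * wd j (snd v) y) \<in> L2 M"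
  "\<And>u v i j. u \<in> V \<Longrightarrow> v \<in> V \<Longrightarrow> nm (\<lambda>y. wd i (snd u) y * wd j (snd v) y)
   \<le> K * (sqrt (grad_norm (snd u) * full_norm (snd u)) * full_norm (snd v))"
  by (fact mixed_product)
 show ?thesis
 proof (rule that[OF K(1)])
  fix u v B i j assume u: "u \<in> V" and v: "v \<in> V" and B: "full_norm (snd u) \<le> B" "full_norm (snd v) \<le> B"
  let ?d = "dif u v"
  note d = mix_V[OF u v, of 1 "-1"]
  let ?S = "\<lambda>y. strain u i j y - strain v i j y"
  let ?e = "\<lambda>y. (wd i (comp ?d j) y + wd j (comp ?d i) y) / 2"
  let ?p = "\<lambda>y. wd i (snd ?d) y * wd j (snd u) y" and ?q = "\<lambda>y. wd j (snd ?d) y * wd i (snd v) y"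
  let ?b = "K * (sqrt (grad_norm (snd ?d) * full_norm (snd ?d)) * B)"
  have S2: "?S \<in> L2 M" by (intro L2_diff strain_L2 u v)
  note e2 = sym_grad_L2[OF d, of i j]
  note p2 = K(2)[OF d u, of i j] and q2 = K(2)[OF d v, of j i]
  have r2: "(\<lambda>y. 1/2 * (?p y + ?q y)) \<in> L2 M" by (intro L2_scale L2_add p2 q2)
  have "\<bar>nm ?S - nm ?e\<bar> \<le> nm (\<lambda>y. ?S y - ?e y)" by (rule l2norm_abs_diff_le[OF S2 e2])
  also have "\<dots> = nm (\<lambda>y. 1/2 * (?p y + ?q y))"
  proof (rule l2norm_cong_AE[OF L2_measurable[OF L2_diff[OF S2 e2]] L2_measurable[OF r2]])
   show "AE y in M. ?S y - ?e y = 1/2 * (?p y + ?q y)" using strain_diff[OF u v, of i j] by eventually_elim simp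
  qed
  also have "\<dots> \<le> 1/2 * (nm ?p + nm ?q)"
   unfolding l2norm_scale using l2norm_triangle[OF p2 q2] by simp
  also have "\<dots> \<le> 1/2 * (?b + ?b)"
  proof (intro mult_left_mono add_mono)
   have z: "0 \<le> sqrt (grad_norm (snd ?d) * full_norm (snd ?d))" using grad_norm_nonneg full_norm_nonneg by simp
   show "nm ?p \<le> ?b" by (rule order_trans[OF K(3)[OF d u]]) (intro mult_left_mono B z K(1))
   show "nm ?q \<le> ?b" by (rule order_trans[OF K(3)[OF d v]]) (intro mult_left_mono B z K(1))
  qed simp
  also have "1/2 * (?b + ?b) = ?b" by algebra
  finally show "\<bar>nm ?S - nm ?e\<bar> \<le> ?b" .
 qed
qed

section \<open>Continuity of the energy\<close>

lemma elastic_tendsto: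
 assumes S: "\<And>n i j. S n i j \<in> L2 M" and T: "\<And>i j. T i j \<in> L2 M"
  and lim: "\<And>i j. (\<lambda>n. nm (\<lambda>y. S n i j y - T i j y)) \<longlonglongrightarrow> 0"
 shows "(\<lambda>n. elastic (S n)) \<longlonglongrightarrow> elastic T"
proof -
 have "(\<lambda>n. nm (\<lambda>y. (S n 1 1 y + S n 2 2 y) - (T 1 1 y + T 2 2 y))) \<longlonglongrightarrow> 0"
 proof (rule tendsto_sandwich[OF _ _ tendsto_const])
  show "(\<lambda>n. nm (\<lambda>y. S n 1 1 y - T 1 1 y) + nm (\<lambda>y. S n 2 2 y - T 2 2 y)) \<longlonglongrightarrow> 0"
   using tendsto_add[OF lim lim] by simp
  show "\<forall>\<^sub>F n in sequentially. nm (\<lambda>y. (S n 1 1 y + S n 2 2 y) - (T 1 1 y + T 2 2 y))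
   \<le> nm (\<lambda>y. S n 1 1 y - T 1 1 y) + nm (\<lambda>y. S n 2 2 y - T 2 2 y)"
  proof (intro always_eventually allI)
   fix n
   have "(\<lambda>y. (S n 1 1 y + S n 2 2 y) - (T 1 1 y + T 2 2 y)) = (\<lambda>y. (S n 1 1 y - T 1 1 y) + (S n 2 2 y - T 2 2 y))"
    by (simp add: fun_eq_iff)
   thus "nm (\<lambda>y. (S n 1 1 y + S n 2 2 y) - (T 1 1 y + T 2 2 y))
    \<le> nm (\<lambda>y. S n 1 1 y - T 1 1 y) + nm (\<lambda>y. S n 2 2 y - T 2 2 y)"
    using l2norm_triangle[OF L2_diff[OF S T] L2_diff[OF S T], of n 1 1 1 1 n 2 2 2 2] by simp
  qed
 qed simp
 hence t: "(\<lambda>n. nm (\<lambda>y. S n 1 1 y + S n 2 2 y)) \<longlonglongrightarrow> nm (\<lambda>y. T 1 1 y + T 2 2 y)"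
  by (intro l2norm_tendsto L2_add S T)
 show ?thesis unfolding elastic_def
  by (intro tendsto_add tendsto_mult tendsto_const tendsto_sum tendsto_power[OF t] tendsto_power[OF l2norm_tendsto[OF S T lim]])
qed

text \<open>Strong convergence of all components carries the energy along, including the products of
  slopes, which the bound on strain differences controls.\<close>

lemma energy_tendsto:
 assumes w: "\<And>n. w n \<in> V" and u: "u \<in> V" and B: "\<And>n. full_norm (snd (w n)) \<le> B" "full_norm (snd u) \<le> B"
  and c: "\<And>j. (\<lambda>n. nm (comp (dif (w n) u) j)) \<longlonglongrightarrow> 0"
  and p: "\<And>i j. (\<lambda>n. nm (wd i (comp (dif (w n) u) j))) \<longlonglongrightarrow> 0"
  and h: "(\<lambda>n. full_norm (snd (dif (w n) u))) \<longlonglongrightarrow> 0"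
 shows "(\<lambda>n. energy (w n)) \<longlonglongrightarrow> energy u"
proof -
 let ?d = "\<lambda>n. dif (w n) u"
 note d = mix_V[OF w u, of 1 _ "-1"]
 obtain K where K: "0 \<le> K" "\<And>u v B i j. u \<in> V \<Longrightarrow> v \<in> V \<Longrightarrow> full_norm (snd u) \<le> B \<Longrightarrow> full_norm (snd v) \<le> B \<Longrightarrow>
   \<bar>nm (\<lambda>y. strain u i j y - strain v i j y)
    - nm (\<lambda>y. (wd i (comp (dif u v) j) y + wd j (comp (dif u v) i) y) / 2)\<bar>
   \<le> K * (sqrt (grad_norm (snd (dif u v)) * full_norm (snd (dif u v))) * B)"
  by (fact strain_diff_bound)
 have gh: "grad_norm x \<le> full_norm x" "hess_norm x \<le> full_norm x" for x
  by (simp_all add: full_norm_def grad_norm_nonneg hess_norm_nonneg)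
 have gl: "(\<lambda>n. grad_norm (snd (?d n))) \<longlonglongrightarrow> 0"
  by (rule tendsto_sandwich[OF _ _ tendsto_const h]) (simp_all add: grad_norm_nonneg gh)
 have "(\<lambda>n. nm (\<lambda>y. strain (w n) i j y - strain u i j y)) \<longlonglongrightarrow> 0" for i j
 proof (rule tendsto_sandwich[OF _ _ tendsto_const])
  let ?b = "\<lambda>n. (nm (wd i (comp (?d n) j)) + nm (wd j (comp (?d n) i))) / 2
   + K * (sqrt (grad_norm (snd (?d n)) * full_norm (snd (?d n))) * B)"
  have "?b \<longlonglongrightarrow> (0 + 0) / 2 + K * (sqrt (0 * 0) * B)"
   by (intro tendsto_add tendsto_divide tendsto_mult tendsto_const tendsto_real_sqrt p gl h) simp
  thus "?b \<longlonglongrightarrow> 0" by simp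
  show "\<forall>\<^sub>F n in sequentially. nm (\<lambda>y. strain (w n) i j y - strain u i j y) \<le> ?b n"
  proof (intro always_eventually allI)
   fix n
   have g2: "wd i (comp (?d n) j) \<in> L2 M" for i j by (intro weak_partial_works(1) V_D(4) d)
   have "(\<lambda>y. (wd i (comp (?d n) j) y + wd j (comp (?d n) i) y) / 2)
    = (\<lambda>y. 1/2 * (wd i (comp (?d n) j) y + wd j (comp (?d n) i) y))" by simp
   hence "nm (\<lambda>y. (wd i (comp (?d n) j) y + wd j (comp (?d n) i) y) / 2)
    \<le> (nm (wd i (comp (?d n) j)) + nm (wd j (comp (?d n) i))) / 2"
    using l2norm_triangle[OF g2[of i j] g2[of j i]] by (simp only: l2norm_scale) simp
   thus "nm (\<lambda>y. strain (w n) i j y - strain u i j y) \<le> ?b n"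
    using abs_le_D1[OF K(2)[OF w u B, of n i j]] by linarith
  qed
 qed simp
 hence 1: "(\<lambda>n. elastic (strain (w n))) \<longlonglongrightarrow> elastic (strain u)" by (intro elastic_tendsto strain_L2 w u)
 have "(\<lambda>n. nm (\<lambda>y. bending (w n) i j y - bending u i j y)) \<longlonglongrightarrow> 0" for i j
 proof (rule tendsto_sandwich[OF _ _ tendsto_const h])
  have "nm (bending x i j) \<le> hess_norm (snd x)" for x
  proof -
   have "nm (bending x i j) \<le> (\<Sum>j\<in>UNIV. nm (bending x i j))" by (rule member_le_sum) auto
   also have "\<dots> \<le> hess_norm (snd x)" unfolding hess_norm_eq
    using member_le_sum[of i UNIV "\<lambda>i. \<Sum>j\<in>UNIV. nm (bending x i j)"] by (simp add: sum_nonneg)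
   finally show ?thesis .
  qed
  thus "\<forall>\<^sub>F n in sequentially. nm (\<lambda>y. bending (w n) i j y - bending u i j y) \<le> full_norm (snd (?d n))"
   unfolding diff_norms(5)[OF w u, symmetric] using gh(2) by (intro always_eventually allI) (meson order_trans)
 qed simp
 hence 2: "(\<lambda>n. elastic (bending (w n))) \<longlonglongrightarrow> elastic (bending u)" by (intro elastic_tendsto bending_L2 w u)
 obtain P where P: "0 \<le> P" "\<And>u. u \<in> V \<Longrightarrow> \<bar>total_load u\<bar> \<le> P * (nm (comp u 1) + nm (comp u 2) + full_norm (snd u))"
  using load_bound by blast
 let ?l = "\<lambda>n. P * (nm (comp (?d n) 1) + nm (comp (?d n) 2) + full_norm (snd (?d n)))"
 have "(\<lambda>n. total_load (w n) - total_load u) \<longlonglongrightarrow> 0"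
 proof (rule Lim_null_comparison)
  have "?l \<longlonglongrightarrow> P * (0 + 0 + 0)"
   by (intro tendsto_mult tendsto_add tendsto_const c h)
  thus "?l \<longlonglongrightarrow> 0" by simp
  show "\<forall>\<^sub>F n in sequentially. norm (total_load (w n) - total_load u) \<le> ?l n"
  proof (intro always_eventually allI)
   fix n
   have "total_load (w n) - total_load u = total_load (?d n)" using load_mix[OF w u, of 1 n "-1"] by simp
   thus "norm (total_load (w n) - total_load u) \<le> ?l n"
    using P(2)[OF d, of n] by simp
  qed
 qed
 hence 3: "(\<lambda>n. total_load (w n)) \<longlonglongrightarrow> total_load u" by (rule LIM_zero_cancel)
 show ?thesis unfolding energy_eq[OF w] energy_eq[OF u]
  by (intro tendsto_diff tendsto_add tendsto_mult tendsto_const 1 2 3)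
qed

section \<open>Completeness and existence of a minimizer\<close>

definition L2_lim :: "(nat \<Rightarrow> real^2 \<Rightarrow> real) \<Rightarrow> (real^2 \<Rightarrow> real) \<Rightarrow> bool" where
 "L2_lim h k \<longleftrightarrow> k \<in> L2 M \<and> (\<lambda>n. nm (\<lambda>x. h n x - k x)) \<longlonglongrightarrow> 0"

lemma L2_lim_exists:
 assumes h: "\<And>n::nat. h n \<in> L2 M" and c: "((\<lambda>p. nm (\<lambda>x. h (fst p) x - h (snd p) x)) \<longlongrightarrow> 0) seq2"
 shows "\<exists>k. L2_lim h k"
proof -
 have "\<exists>N. \<forall>m\<ge>N. \<forall>n\<ge>N. nm (\<lambda>x. h m x - h n x) < e" if "e > 0" for e
  using c that prod_sequentially_tendsto_zero[of "\<lambda>m n. nm (\<lambda>x. h m x - h n x)"] by simp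
 from L2_complete[OF finite_measure_dom h this] show ?thesis unfolding L2_lim_def by blast
qed

lemma energy_bounded_below: obtains C where "\<And>u. u \<in> V \<Longrightarrow> - C \<le> energy u"
proof -
 obtain c C where c: "c > 0" "\<And>u. u \<in> V \<Longrightarrow> c * ((strain_norm u)^2 + (hess_norm (snd u))^2) \<le> energy u + C"
  using coercive by blast
 have "- C \<le> energy u" if "u \<in> V" for u
 proof -
  have "0 \<le> c * ((strain_norm u)^2 + (hess_norm (snd u))^2)" using c(1) by simp
  thus ?thesis using c(2)[OF that] by linarith
 qed
 thus ?thesis using that by blast
qed

lemma sublevel_bounded:
 obtains R B where "\<And>u. u \<in> V \<Longrightarrow> energy u \<le> E \<Longrightarrow> strain_norm u \<le> R \<and> hess_norm (snd u) \<le> R \<and> full_norm (snd u) \<le> B"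
proof -
 obtain c C where c: "c > 0" "\<And>u. u \<in> V \<Longrightarrow> c * ((strain_norm u)^2 + (hess_norm (snd u))^2) \<le> energy u + C"
  using coercive by blast
 obtain D where D: "0 \<le> D" "\<And>u. u \<in> V \<Longrightarrow> full_norm (snd u) \<le> D * hess_norm (snd u)" using bending_bound by blast
 define R where "R = sqrt (\<bar>E + C\<bar> / c)"
 have "strain_norm u \<le> R \<and> hess_norm (snd u) \<le> R \<and> full_norm (snd u) \<le> D * R" if u: "u \<in> V" "energy u \<le> E" for u
 proof -
  have "c * ((strain_norm u)^2 + (hess_norm (snd u))^2) \<le> \<bar>E + C\<bar>" using c(2)[OF u(1)] u(2) by linarith
  hence "(strain_norm u)^2 + (hess_norm (snd u))^2 \<le> \<bar>E + C\<bar> / c" using c(1) by (simp add: pos_le_divide_eq mult.commute)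
  hence "(strain_norm u)^2 \<le> \<bar>E + C\<bar> / c" "(hess_norm (snd u))^2 \<le> \<bar>E + C\<bar> / c"
   using zero_le_power2[of "strain_norm u"] zero_le_power2[of "hess_norm (snd u)"] by linarith+
  hence 1: "strain_norm u \<le> R" "hess_norm (snd u) \<le> R" unfolding R_def by (auto intro: real_le_rsqrt)
  have "full_norm (snd u) \<le> D * R" using D(2)[OF u(1)] mult_left_mono[OF 1(2) D(1)] by linarith
  with 1 show ?thesis by simp
 qed
 thus ?thesis using that by blast
qed

text \<open>The derivatives of the slopes are entries of the Hessian, so the slopes are bounded in
  \<open>H1 \<omega>\<close>; Rellich's theorem is applied to both slopes at once.\<close>

lemma slopes_Cauchy_subsequence:
 fixes u :: "nat \<Rightarrow> displacement"
 assumes u: "\<And>n. u n \<in> V" and B: "\<And>n. full_norm (snd (u n)) \<le> B"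
 obtains r :: "nat \<Rightarrow> nat" where "strict_mono r"
  "((\<lambda>p. grad_norm (snd (dif (u (r (fst p))) (u (r (snd p)))))) \<longlongrightarrow> 0) seq2"
proof -
 define F where "F i n = wd (if i = (0::nat) then 1 else 2) (snd (u n))" for i n
 have FB: "nm (F i n) \<le> B" "nm (wd a (F i n)) \<le> B" for i n a
 proof -
  let ?b = "if i = 0 then 1 else 2 :: 2"
  have "nm (F i n) \<le> grad_norm (snd (u n))"
   unfolding F_def grad_norm_def by (rule member_le_sum[where f = "\<lambda>a. nm (wd a (snd (u n)))"]) auto
  also have "\<dots> \<le> full_norm (snd (u n))" by (simp add: full_norm_def hess_norm_nonneg)
  finally show "nm (F i n) \<le> B" using B[of n] by linarith
  have "nm (wd a (F i n)) \<le> (\<Sum>j\<in>UNIV. nm (wd a (wd j (snd (u n)))))"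
   unfolding F_def by (rule member_le_sum[where f = "\<lambda>j. nm (wd a (wd j (snd (u n))))"]) auto
  also have "\<dots> \<le> hess_norm (snd (u n))"
   unfolding hess_norm_def
   by (rule member_le_sum[where f = "\<lambda>a. \<Sum>j\<in>UNIV. nm (wd a (wd j (snd (u n))))"]) (auto simp: sum_nonneg)
  also have "\<dots> \<le> full_norm (snd (u n))" by (simp add: full_norm_def grad_norm_nonneg)
  finally show "nm (wd a (F i n)) \<le> B" using B[of n] by linarith
 qed
 have FH: "F i n \<in> H1 \<omega>" for i n unfolding F_def by (intro V_D u)
 obtain r :: "nat \<Rightarrow> nat" where r: "strict_mono r"
  "\<And>i e. e > 0 \<Longrightarrow> \<exists>N. \<forall>m\<ge>N. \<forall>n\<ge>N. nm (\<lambda>x. F i (r m) x - F i (r n) x) < e"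
  using rellich[of F, OF FH FB] by blast
 have "((\<lambda>p. nm (\<lambda>x. F i (r (fst p)) x - F i (r (snd p)) x)) \<longlongrightarrow> 0) seq2" for i
  using r(2) prod_sequentially_tendsto_zero[of "\<lambda>m n. nm (\<lambda>x. F i (r m) x - F i (r n) x)"] by simp
 from tendsto_add[OF this[of 0] this[of 1]]
 have "((\<lambda>p. grad_norm (snd (dif (u (r (fst p))) (u (r (snd p)))))) \<longlongrightarrow> 0) seq2"
  unfolding grad_norm_def diff_norms(4)[OF u u] by (simp add: sum_2 F_def)
 with r(1) show ?thesis using that by blast
qed

text \<open>By the midpoint inequality a minimizing sequence with convergent slopes is a Cauchy sequence.\<close>

lemma minimizing_sequence_Cauchy:
 fixes w :: "nat \<Rightarrow> displacement"
 assumes w: "\<And>n. w n \<in> V" and R: "\<And>n. strain_norm (w n) \<le> R" "\<And>n. hess_norm (snd (w n)) \<le> R"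
  and low: "\<And>u. u \<in> V \<Longrightarrow> m \<le> energy u" and lim: "(\<lambda>n. energy (w n)) \<longlonglongrightarrow> m"
  and g: "((\<lambda>p. grad_norm (snd (dif (w (fst p)) (w (snd p))))) \<longlongrightarrow> 0) seq2"
 shows "((\<lambda>p. full_norm (snd (dif (w (fst p)) (w (snd p))))) \<longlongrightarrow> 0) seq2"
  "((\<lambda>p. nm (wd i (comp (dif (w (fst p)) (w (snd p))) j))) \<longlongrightarrow> 0) seq2"
  "((\<lambda>p. nm (comp (dif (w (fst p)) (w (snd p))) j)) \<longlongrightarrow> 0) seq2"
proof -
 let ?S = "seq2"
 define d where "d p = dif (w (fst p)) (w (snd p))" for p
 have dV: "d p \<in> V" for p unfolding d_def by (intro mix_V w)
 note g = g[folded d_def]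
 obtain D where D: "0 \<le> D" "\<And>u. u \<in> V \<Longrightarrow> full_norm (snd u) \<le> D * hess_norm (snd u)" using bending_bound by blast
 obtain K where K: "0 \<le> K" "\<And>u v i j. u \<in> V \<Longrightarrow> v \<in> V \<Longrightarrow> (\<lambda>y. wd i (snd u) y * wd j (snd v) y) \<in> L2 M"
  "\<And>u v i j. u \<in> V \<Longrightarrow> v \<in> V \<Longrightarrow> nm (\<lambda>y. wd i (snd u) y * wd j (snd v) y)
   \<le> K * (sqrt (grad_norm (snd u) * full_norm (snd u)) * full_norm (snd v))"
  by (fact mixed_product)
 obtain L where L: "0 \<le> L"
  "\<And>u v B i j. u \<in> V \<Longrightarrow> v \<in> V \<Longrightarrow> full_norm (snd u) \<le> B \<Longrightarrow> full_norm (snd v) \<le> B \<Longrightarrow>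
   \<bar>nm (\<lambda>y. strain u i j y - strain v i j y)
    - nm (\<lambda>y. (wd i (comp (dif u v) j) y + wd j (comp (dif u v) i) y) / 2)\<bar>
   \<le> L * (sqrt (grad_norm (snd (dif u v)) * full_norm (snd (dif u v))) * B)"
  by (fact strain_diff_bound)
 obtain Q where Q: "0 \<le> Q" "\<And>u. zero_trace u \<Longrightarrow> nm u \<le> Q * nm (wd 1 u)"
  using zero_trace_poincare by blast
 \<comment> \<open>Differences have Hessian norms up to \<open>2 * R\<close>, which covers the
   single members too.\<close>
 define B where "B = D * (2 * R)"
 have R0: "0 \<le> R" using R(1)[of 0] strain_norm_nonneg[of "w 0"] by linarith
 have B0: "0 \<le> B" using D(1) R0 by (simp add: B_def)
 have dB: "full_norm (snd (d p)) \<le> B" for p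
 proof -
  have "hess_norm (snd (d p)) \<le> 2 * R" unfolding d_def
   using hess_norm_diff_le[OF w w, of "fst p" "snd p"] R(2)[of "fst p"] R(2)[of "snd p"] by linarith
  thus ?thesis unfolding B_def by (intro order_trans[OF D(2)[OF dV]] mult_left_mono D(1))
 qed
 have wB: "full_norm (snd (w n)) \<le> B" for n
  unfolding B_def using R(2)[of n] R0 by (intro order_trans[OF D(2)[OF w]] mult_left_mono D(1)) auto
 \<comment> \<open>The slope norm of the difference tends to zero while its full norm is only
   bounded by \<open>B\<close>; the root of their product still tends to zero.\<close>
 define s where "s p = sqrt (grad_norm (snd (d p)) * B)" for p
 have s0: "(s \<longlongrightarrow> 0) ?S" unfolding s_def[abs_def] using tendsto_real_sqrt[OF tendsto_mult_left_zero[OF g, of B]] by simp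
 have sge: "sqrt (grad_norm (snd (d p)) * full_norm (snd (d p))) \<le> s p" for p
  unfolding s_def by (intro real_sqrt_le_mono mult_left_mono dB grad_norm_nonneg)
 have snn: "0 \<le> s p" for p unfolding s_def using B0 grad_norm_nonneg by simp
 define q where "q p = K * (s p * B)" for p
 have q: "nm (\<lambda>y. wd i (snd (d p)) y * wd j (snd (d p)) y) \<le> q p" for p i j
  unfolding q_def using full_norm_nonneg snn
  by (intro order_trans[OF K(3)[OF dV dV]] mult_left_mono mult_mono sge dB K(1)) auto
 have q0: "(q \<longlongrightarrow> 0) ?S" unfolding q_def[abs_def]
  using tendsto_mult_right_zero[OF tendsto_mult_left_zero[OF s0, of B], of K] by simp
 \<comment> \<open>The right-hand side of the midpoint inequality. It tends to zero because the
   energies tend to \<open>m\<close> and the slope products to zero.\<close>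
 define r where "r p = (energy (w (fst p)) - m) / 2 + (energy (w (snd p)) - m) / 2
  + \<epsilon> / 2 * ((4 * lam * \<mu> / (lam + 2 * \<mu>) + 16 * \<mu>) * (2 * R * q p + (q p)^2))" for p
 have "(r \<longlongrightarrow> (m - m) / 2 + (m - m) / 2 + \<epsilon> / 2 * ((4 * lam * \<mu> / (lam + 2 * \<mu>) + 16 * \<mu>) * (2 * R * 0 + 0^2))) ?S"
  unfolding r_def[abs_def]
  by (intro tendsto_add tendsto_divide tendsto_diff tendsto_mult tendsto_const tendsto_power q0
    filterlim_compose[OF lim filterlim_fst] filterlim_compose[OF lim filterlim_snd]) simp_all
 hence r0: "(r \<longlongrightarrow> 0) ?S" by simp
 let ?s = "\<lambda>x :: 2 \<Rightarrow> 2 \<Rightarrow> real. \<Sum>i\<in>UNIV. \<Sum>j\<in>UNIV. (x i j)^2"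
 let ?Sg = "\<lambda>p i j. nm (\<lambda>y. strain (w (fst p)) i j y - strain (w (snd p)) i j y)"
 let ?Bd = "\<lambda>p i j. nm (\<lambda>y. bending (w (fst p)) i j y - bending (w (snd p)) i j y)"
 have mid: "\<epsilon> / 2 * \<mu> * ?s (?Sg p) + \<epsilon> ^ 3 / 6 * \<mu> * ?s (?Bd p) \<le> r p" for p
  unfolding r_def by (rule energy_midpoint[OF w w R(1) R(1) q[unfolded d_def] low])
 have sum_ge: "(x i j)^2 \<le> ?s x" for x :: "2 \<Rightarrow> 2 \<Rightarrow> real" and i j
 proof -
  have "(x i j)^2 \<le> (\<Sum>j\<in>UNIV. (x i j)^2)" by (rule member_le_sum) auto
  also have "\<dots> \<le> ?s x"
   by (rule member_le_sum[where f = "\<lambda>i. \<Sum>j\<in>UNIV. (x i j)^2"]) (auto simp: sum_nonneg)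
  finally show ?thesis .
 qed
 \<comment> \<open>A positive multiple of the sum of squares is at most \<open>r\<close>, so every
   single entry is at most the root of \<open>r p / c\<close>.\<close>
 have sq: "((\<lambda>p. x p i j) \<longlongrightarrow> 0) ?S"
  if c: "c > 0" and x: "\<And>p. c * ?s (x p) \<le> r p" and x0: "\<And>p. 0 \<le> x p i j"
  for c and x :: "nat \<times> nat \<Rightarrow> 2 \<Rightarrow> 2 \<Rightarrow> real" and i j
 proof (rule tendsto_sandwich[OF _ _ tendsto_const])
  show "((\<lambda>p. sqrt (r p / c)) \<longlongrightarrow> 0) ?S" using tendsto_real_sqrt[OF tendsto_divide[OF r0 tendsto_const[of c]]] c by simp
  show "\<forall>\<^sub>F p in ?S. x p i j \<le> sqrt (r p / c)"
  proof (intro always_eventually allI real_le_rsqrt)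
   fix p
   have "c * (x p i j)^2 \<le> r p" using c by (intro order_trans[OF mult_left_mono[OF sum_ge] x]) simp
   thus "(x p i j)^2 \<le> r p / c" using c by (simp add: pos_le_divide_eq mult.commute)
  qed
 qed (use x0 in simp)
 have nn: "0 \<le> \<epsilon> / 2 * \<mu> * ?s (?Sg p)" "0 \<le> \<epsilon> ^ 3 / 6 * \<mu> * ?s (?Bd p)" for p
  using eps mu by (auto intro!: mult_nonneg_nonneg sum_nonneg)
 have Sg0: "((\<lambda>p. ?Sg p i j) \<longlongrightarrow> 0) ?S" for i j
 proof (rule sq[of "\<epsilon> / 2 * \<mu>" ?Sg])
  show "\<epsilon> / 2 * \<mu> * ?s (?Sg p) \<le> r p" for p using mid[of p] nn(2)[of p] by linarith
 qed (use eps mu in simp_all)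
 have Bd0: "((\<lambda>p. ?Bd p i j) \<longlongrightarrow> 0) ?S" for i j
 proof (rule sq[of "\<epsilon> ^ 3 / 6 * \<mu>" ?Bd])
  show "\<epsilon> ^ 3 / 6 * \<mu> * ?s (?Bd p) \<le> r p" for p using mid[of p] nn(1)[of p] by linarith
 qed (use eps mu in simp_all)
 have h0: "((\<lambda>p. hess_norm (snd (d p))) \<longlongrightarrow> 0) ?S"
  unfolding hess_norm_eq d_def diff_norms(5)[OF w w] by (intro tendsto_null_sum Bd0)
 have f0: "((\<lambda>p. full_norm (snd (d p))) \<longlongrightarrow> 0) ?S"
  by (rule tendsto_sandwich[OF _ _ tendsto_const tendsto_mult_right_zero[OF h0, of D]]) (simp_all add: full_norm_nonneg D(2) dV)
 thus "((\<lambda>p. full_norm (snd (dif (w (fst p)) (w (snd p))))) \<longlongrightarrow> 0) ?S" by (simp add: d_def)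
 let ?e = "\<lambda>p i j. nm (\<lambda>y. (wd i (comp (d p) j) y + wd j (comp (d p) i) y) / 2)"
 \<comment> \<open>Up to products of slopes the small strain differences are the symmetric
   gradients, to which Korn's inequality applies.\<close>
 have e0: "((\<lambda>p. ?e p i j) \<longlongrightarrow> 0) ?S" for i j
 proof (rule tendsto_sandwich[OF _ _ tendsto_const])
  show "((\<lambda>p. ?Sg p i j + L * (s p * B)) \<longlongrightarrow> 0) ?S"
   using tendsto_add[OF Sg0 tendsto_mult_right_zero[OF tendsto_mult_left_zero[OF s0, of B], of L]] by simp
  show "\<forall>\<^sub>F p in ?S. ?e p i j \<le> ?Sg p i j + L * (s p * B)"
  proof (intro always_eventually allI)
   fix p
   have "\<bar>?Sg p i j - ?e p i j\<bar> \<le> L * (sqrt (grad_norm (snd (d p)) * full_norm (snd (d p))) * B)"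
    unfolding d_def by (rule L(2)[OF w w wB wB])
   also have "\<dots> \<le> L * (s p * B)" by (intro mult_left_mono mult_right_mono sge L(1) B0)
   finally show "?e p i j \<le> ?Sg p i j + L * (s p * B)" by linarith
  qed
 qed simp
 have w0: "((\<lambda>p. nm (wd i (comp (d p) j))) \<longlongrightarrow> 0) ?S" for i j
 proof (rule tendsto_sandwich[OF _ _ tendsto_const])
  show "((\<lambda>p. 2 * (\<Sum>k\<in>UNIV. \<Sum>l\<in>UNIV. ?e p k l)) \<longlongrightarrow> 0) ?S" by (intro tendsto_mult_right_zero tendsto_null_sum e0)
  show "\<forall>\<^sub>F p in ?S. nm (wd i (comp (d p) j)) \<le> 2 * (\<Sum>k\<in>UNIV. \<Sum>l\<in>UNIV. ?e p k l)"
   by (intro always_eventually allI korn_norm V_D(1) dV)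
 qed simp
 show "((\<lambda>p. nm (wd i (comp (dif (w (fst p)) (w (snd p))) j))) \<longlongrightarrow> 0) ?S"
  using w0 by (simp add: d_def)
 have "((\<lambda>p. nm (comp (d p) j)) \<longlongrightarrow> 0) ?S"
  by (rule tendsto_sandwich[OF _ _ tendsto_const tendsto_mult_right_zero[OF w0, of Q 1 j]])
   (auto intro!: always_eventually Q(2) V_D(1) dV)
 thus "((\<lambda>p. nm (comp (dif (w (fst p)) (w (snd p))) j)) \<longlongrightarrow> 0) ?S" by (simp add: d_def)
qed

text \<open>The limits in L2 of all components and derivatives form one displacement. It stays in
  \<open>V\<close> because zero traces and both closed subspaces are stable under convergence in
  their norms.\<close>

lemma V_complete:
 fixes w :: "nat \<Rightarrow> displacement"
 assumes w: "\<And>n. w n \<in> V"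
  and f: "((\<lambda>p. full_norm (snd (dif (w (fst p)) (w (snd p))))) \<longlongrightarrow> 0) seq2"
  and p: "\<And>i j. ((\<lambda>p. nm (wd i (comp (dif (w (fst p)) (w (snd p))) j))) \<longlongrightarrow> 0) seq2"
  and c: "\<And>j. ((\<lambda>p. nm (comp (dif (w (fst p)) (w (snd p))) j)) \<longlongrightarrow> 0) seq2"
 obtains u where "u \<in> V" "\<And>j. (\<lambda>n. nm (comp (dif (w n) u) j)) \<longlonglongrightarrow> 0"
  "\<And>i j. (\<lambda>n. nm (wd i (comp (dif (w n) u) j))) \<longlonglongrightarrow> 0"
  "(\<lambda>n. full_norm (snd (dif (w n) u))) \<longlonglongrightarrow> 0"
proof -
 let ?S = "seq2"
 have le: "nm x \<le> full_norm x" "nm (wd i x) \<le> full_norm x" "nm (wd i (wd j x)) \<le> full_norm x" for x i j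
 proof -
  show "nm x \<le> full_norm x" by (simp add: full_norm_def grad_norm_nonneg hess_norm_nonneg add_nonneg_nonneg)
  have "nm (wd i x) \<le> grad_norm x" unfolding grad_norm_def by (rule member_le_sum) auto
  also have "\<dots> \<le> full_norm x" by (simp add: full_norm_def hess_norm_nonneg)
  finally show "nm (wd i x) \<le> full_norm x" .
  have "nm (wd i (wd j x)) \<le> (\<Sum>j\<in>UNIV. nm (wd i (wd j x)))"
   by (rule member_le_sum) auto
  also have "\<dots> \<le> hess_norm x" unfolding hess_norm_def
   by (rule member_le_sum[where f = "\<lambda>i. \<Sum>j\<in>UNIV. nm (wd i (wd j x))"]) (auto simp: sum_nonneg)
  also have "\<dots> \<le> full_norm x" by (simp add: full_norm_def grad_norm_nonneg)
  finally show "nm (wd i (wd j x)) \<le> full_norm x" .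
 qed
 have f': "((\<lambda>p. nm (T (snd (dif (w (fst p)) (w (snd p)))))) \<longlongrightarrow> 0) ?S" if "\<And>x. nm (T x) \<le> full_norm x" for T
  by (rule tendsto_sandwich[OF _ _ tendsto_const f]) (simp_all add: that)
 have "\<exists>k. L2_lim (\<lambda>n. comp (w n) j) k" for j
  using c unfolding diff_norms(1)[OF w w] by (intro L2_lim_exists H1_L2 V_D(4) w)
 then obtain c' where "\<And>j. L2_lim (\<lambda>n. comp (w n) j) (c' j)" by metis
 hence c': "\<And>j. c' j \<in> L2 M" "\<And>j. (\<lambda>n. nm (\<lambda>x. comp (w n) j x - c' j x)) \<longlonglongrightarrow> 0" by (simp_all add: L2_lim_def)
 have "\<exists>k. L2_lim (\<lambda>n. wd i (comp (w n) j)) k" for i j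
  using p unfolding diff_norms(2)[OF w w] by (intro L2_lim_exists weak_partial_works(1) V_D(4) w)
 then obtain P where "\<And>i j. L2_lim (\<lambda>n. wd i (comp (w n) j)) (P i j)" by metis
 hence P: "\<And>i j. P i j \<in> L2 M" "\<And>i j. (\<lambda>n. nm (\<lambda>x. wd i (comp (w n) j) x - P i j x)) \<longlonglongrightarrow> 0"
  by (simp_all add: L2_lim_def)
 have "\<exists>k. L2_lim (\<lambda>n. snd (w n)) k"
  using f'[of "\<lambda>x. x"] le(1) unfolding diff_norms(3)[OF w w] by (intro L2_lim_exists H1_L2 H2_H1(1) V_D(2) w) simp
 then obtain s where s: "s \<in> L2 M" "(\<lambda>n. nm (\<lambda>x. snd (w n) x - s x)) \<longlonglongrightarrow> 0" by (auto simp: L2_lim_def)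
 have "\<exists>k. L2_lim (\<lambda>n. wd i (snd (w n))) k" for i
  using f'[of "wd i"] le(2) unfolding diff_norms(4)[OF w w] by (intro L2_lim_exists slope_L2 w) simp
 then obtain q where "\<And>i. L2_lim (\<lambda>n. wd i (snd (w n))) (q i)" by metis
 hence q: "\<And>i. q i \<in> L2 M" "\<And>i. (\<lambda>n. nm (\<lambda>x. wd i (snd (w n)) x - q i x)) \<longlonglongrightarrow> 0"
  by (simp_all add: L2_lim_def)
 have "\<exists>k. L2_lim (\<lambda>n. wd i (wd j (snd (w n)))) k" for i j
  using f'[of "\<lambda>x. wd i (wd j x)"] le(3) diff_norms(5)[OF w w, of _ _ i j] bending_L2[OF w]
  unfolding bending_def by (intro L2_lim_exists) simp_all
 then obtain h where "\<And>i j. L2_lim (\<lambda>n. wd i (wd j (snd (w n)))) (h i j)" by metis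
 hence h: "\<And>i j. h i j \<in> L2 M"
  "\<And>i j. (\<lambda>n. nm (\<lambda>x. wd i (wd j (snd (w n))) x - h i j x)) \<longlonglongrightarrow> 0"
  by (simp_all add: L2_lim_def)
 define u where "u = ((\<lambda>y. \<chi> j. c' j y) :: real^2 \<Rightarrow> real^2, s)"
 have cu: "comp u j = c' j" for j by (simp add: u_def)
 note H = H1_limit[of "\<lambda>n. comp (w n) j" "c' j" "\<lambda>i. P i j" for j, OF V_D(4)[OF w] c'(1) P(1) c'(2) P(2)]
 have zt: "zero_trace (c' j)" for j by (rule zero_trace_limit[OF V_D(1)[OF w] H(1) H(4)])
 have X: "fst u \<in> H1_pair_zero_trace \<omega>"
  unfolding H1_pair_zero_trace_def using zt zero_trace_H1[OF zt] by (simp add: cu zero_trace_def)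
 have lim: "(\<lambda>n. norm_H1_pair \<omega> (\<lambda>y. fst (w n) y - fst u y)) \<longlonglongrightarrow> sqrt (\<Sum>i\<in>(UNIV::2 set). 0^2)"
  unfolding norm_H1_pair_def
 proof (intro tendsto_real_sqrt tendsto_sum tendsto_power)
  fix i
  have "(\<lambda>y. (fst (w n) y - fst u y) $ i) = (\<lambda>y. comp (w n) i y - c' i y)" for n by (simp add: u_def)
  thus "(\<lambda>n. norm_H1 \<omega> (\<lambda>y. (fst (w n) y - fst u y) $ i)) \<longlonglongrightarrow> 0" using H(4)[of i] by simp
 qed
 have "fst (w n) \<in> VH" for n using w[of n] by auto
 hence "fst u \<in> VH" using lim by (intro closed_subspace_of_limit[OF VH X]) simp_all
 note S = H2_limit[OF V_D(2)[OF w] s(1) q(1) h(1) s(2) q(2) h(2)]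
 have "snd (w n) \<in> V3" for n using w[of n] by auto
 hence "s \<in> V3" using S(7) by (rule closed_subspace_of_limit[OF V3 S(1)])
 hence uV: "u \<in> V" using \<open>fst u \<in> VH\<close> by (cases u) (auto simp: u_def)
 show ?thesis
 proof (rule that[OF uV])
  show "(\<lambda>n. nm (comp (dif (w n) u) j)) \<longlonglongrightarrow> 0" for j
   using c'(2)[of j] unfolding diff_norms(1)[OF w uV] by (simp add: u_def)
  show "(\<lambda>n. nm (wd i (comp (dif (w n) u) j))) \<longlonglongrightarrow> 0" for i j
   unfolding diff_norms(2)[OF w uV] cu by (rule norm_H1_tendsto(2)[OF V_D(4)[OF w] H(1) H(4)])
  show "(\<lambda>n. full_norm (snd (dif (w n) u))) \<longlonglongrightarrow> 0"
   using S(6) by (simp add: snd_mix u_def)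
 qed
qed

text \<open>The energy converges along the sequence to its value at the limit, which is therefore
  the infimum. This infimum is formed in the reals, where coercivity bounds the energy from below,
  and is compared with the one in \<open>ereal\<close> at the end.\<close>

theorem energy_minimizer: "\<exists>u. is_minimizer energy V u"
proof -
 obtain C where C: "\<And>u. u \<in> V \<Longrightarrow> - C \<le> energy u" using energy_bounded_below by blast
 have ne: "V \<noteq> {}" using VH V3 by (auto simp: closed_subspace_of_def)
 have bdd: "bdd_below (energy ` V)" using C by (intro bdd_belowI2) auto
 define m where "m = (INF u\<in>V. energy u)"
 have low: "m \<le> energy u" if "u \<in> V" for u unfolding m_def by (rule cINF_lower[OF bdd that])
 have "\<exists>u\<in>V. energy u < m + 1 / Suc n" for n
  using cINF_less_iff[OF ne bdd, of "m + 1 / Suc n"] by (simp add: m_def[symmetric])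
 then obtain u where u: "\<And>n. u n \<in> V" "\<And>n. energy (u n) < m + 1 / Suc n" by metis
 have lim: "(\<lambda>n. energy (u n)) \<longlonglongrightarrow> m"
 proof (rule tendsto_sandwich[OF _ _ tendsto_const])
  show "(\<lambda>n. m + 1 / Suc n) \<longlonglongrightarrow> m" using tendsto_add[OF tendsto_const LIMSEQ_Suc[OF lim_1_over_n]] by simp
 qed (use u low in \<open>auto intro!: always_eventually less_imp_le\<close>)
 have E: "energy (u n) \<le> m + 1" for n
 proof -
  have "1 / real (Suc n) \<le> 1" by simp
  thus ?thesis using u(2)[of n] by linarith
 qed
 obtain R B where RB: "\<And>u. u \<in> V \<Longrightarrow> energy u \<le> m + 1 \<Longrightarrow> strain_norm u \<le> R \<and> hess_norm (snd u) \<le> R \<and> full_norm (snd u) \<le> B"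
  using sublevel_bounded by blast
 note b = RB[OF u(1) E]
 from b have bB: "\<And>n. full_norm (snd (u n)) \<le> B" by blast
 obtain r :: "nat \<Rightarrow> nat" where r: "strict_mono r"
  "((\<lambda>p. grad_norm (snd (dif (u (r (fst p))) (u (r (snd p)))))) \<longlongrightarrow> 0) seq2"
  by (fact slopes_Cauchy_subsequence[OF u(1) bB])
 define w where "w n = u (r n)" for n
 have w: "w n \<in> V" for n by (simp add: w_def u(1))
 have wlim: "(\<lambda>n. energy (w n)) \<longlonglongrightarrow> m"
  using LIMSEQ_subseq_LIMSEQ[OF lim r(1)] by (simp add: o_def w_def)
 have wb: "strain_norm (w n) \<le> R" "hess_norm (snd (w n)) \<le> R" "full_norm (snd (w n)) \<le> B" for n using b by (auto simp: w_def)
 note cau = minimizing_sequence_Cauchy[OF w wb(1,2) low wlim r(2)[folded w_def]]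
 obtain v where v: "v \<in> V" "\<And>j. (\<lambda>n. nm (comp (dif (w n) v) j)) \<longlonglongrightarrow> 0"
  "\<And>i j. (\<lambda>n. nm (wd i (comp (dif (w n) v) j))) \<longlonglongrightarrow> 0"
  "(\<lambda>n. full_norm (snd (dif (w n) v))) \<longlonglongrightarrow> 0"
  using V_complete[OF w cau] by blast
 have "full_norm (snd (w n)) \<le> max B (full_norm (snd v))" "full_norm (snd v) \<le> max B (full_norm (snd v))" for n
  using wb(3)[of n] by auto
 from LIMSEQ_unique[OF wlim energy_tendsto[OF w v(1) this v(2-4)]] have "m = energy v" .
 hence "ereal (energy v) \<le> (INF w\<in>V. ereal (energy w))" using low by (auto intro: INF_greatest)
 moreover have "(INF w\<in>V. ereal (energy w)) \<le> ereal (energy v)" using v(1) by (rule INF_lower)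
 ultimately show ?thesis using v(1) by (auto simp: is_minimizer_def)
qed

end

theorem corollary2:
 fixes \<omega> :: "(real^2) set"
  and \<epsilon> lam \<mu> :: real
  and f g :: "(real^2) \<times> real \<Rightarrow> real^3"
  and VH :: "(real^2 \<Rightarrow> real^2) set"
  and V3 :: "(real^2 \<Rightarrow> real) set"
 assumes "open \<omega>" and "bounded \<omega>" and "connected \<omega>" and "lipschitz_boundary \<omega>"
  and "\<epsilon> > 0" and "lam \<ge> 0" and "\<mu> > 0"
  and "f \<in> volume_forces \<omega> \<epsilon>" and "g \<in> surface_forces \<omega> \<epsilon>"
  and "closed_subspace_of (norm_H1_pair \<omega>) (H1_pair_zero_trace \<omega>) VH"
  and "closed_subspace_of (norm_H2 \<omega>) (H2 \<omega>) V3"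
  and "\<forall>v\<in>V3. affine_on \<omega> v \<longrightarrow> (AE y in lebesgue_on \<omega>. v y = 0)"
 shows "\<exists>u. is_minimizer (kirchhoff_love_energy \<omega> \<epsilon> lam \<mu> f g) (VH \<times> V3) u"
proof -
 interpret plate \<omega> \<epsilon> lam \<mu> f g VH V3
  using assms by unfold_locales auto
 show ?thesis by (rule energy_minimizer)
qed

end
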